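(* There is an injective and birational algebra morphism $\mathrm{DS}_q:\mathbb C[H_-\backslash B_-]_q\to A_q$ defined by $$\mathrm{DS}_q(u(\lambda))=\lim_{N\to\infty}\cfrac{y_0^{-1}}{1+\cfrac{(\lambda x_0y_0)^{-1}}{1+\cfrac{(\lambda y_{-1}x_0)^{-1}}{\ddots\;\cfrac{(\lambda y_{-N+1}x_{-N+2})^{-1}}{1+(\lambda x_{-N+1}y_{-N+1})^{-1}}}}}\qquad\text{with the convention }\tfrac ab:=b^{-1}a,$$ $$\mathrm{DS}_q(m(\lambda))=\lim_{N\to\infty}\cfrac{x_1^{-1}}{1+\cfrac{(\lambda x_1y_1)^{-1}}{1+\cfrac{(\lambda y_1x_2)^{-1}}{\ddots\;\cfrac{(\lambda y_{N-1}x_N)^{-1}}{1+(\lambda x_Ny_N)^{-1}}}}}\qquad\text{with the convention }\tfrac ab:=ab^{-1},$$ the limits being taken in the $\lambda^{-1}$-adic topology. Birational means that $\mathrm{DS}_q$ induces an isomorphism between the fraction fields of $\mathbb C[H_-\backslash B_-]_q$ and $A_q$ (both of which exist). Moreover, for all integers $n\ge1$, $$\mathrm{DS}_q\circ H_n=\mathrm{ad}(I_n)\circ\mathrm{DS}_q.$$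
   Context: Ground ring $\mathbb C[q,q^{-1}]$, $q$ formal. $A_q$: algebra generated by $x_i^{\pm1},y_i^{\pm1}$ ($i\in\mathbb Z$) with $x_kx_l=qx_lx_k$, $y_ky_l=qy_ly_k$, $y_kx_l=q^{-1}x_ly_k$ for $k<l$, and $x_ky_l=q^{-1}y_lx_k$ for $k\le l$; graded by $\deg x_i=-\deg y_i=1$; $A_q[0]$ is the degree $0$ part. $T^{1/2}$ is the automorphism $x_i\mapsto y_i$, $y_i\mapsto x_{i+1}$, and $T=(T^{1/2})^2$. For $P\in A_q[0]$, $I(P)$ is its class in $\mathcal F_0=A_q[0]/\mathrm{Im}(T-\mathrm{Id})$, and $\mathrm{ad}(I(P))$ is the (well defined) derivation $x\mapsto\frac1{q-1}\sum_{k\in\mathbb Z}[T^kP,x]$ of $A_q$. $I_n=I(\psi_n)$ ($n\ge1$) are the local integrals of motion with $\psi_n=A_n+T^{1/2}(A_n)$, $$A_n=\sum\frac{[n]}{[\alpha_1]}F_q(\alpha_1,\dots,\alpha_{2N-2})(x_1y_1)^{-\alpha_1}(y_1x_2)^{-\alpha_2}(x_2y_2)^{-\alpha_3}\cdots(y_{N-1}x_N)^{-\alpha_{2N-2}},$$ the sum being over integers $\alpha_1\ge1$, $\alpha_2,\dots,\alpha_{2N-2}\ge0$ with $\sum\alpha_i=n$, for any $N$ with $n\le2(N-1)$. Here $F_q(a_1,\dots,a_M)=\prod_{i=1}^{M-1}\binom{a_i+a_{i+1}-1}{a_{i+1}}_q$, where $\binom ab_q=1$ if $b=0$, $\binom ab_q=0$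 if $b<0$ or $b>\max(0,a)$, and $\binom ab_q=\frac{[a]!}{[b]![a-b]!}$ if $0\le b\le a$, with $[i]=\frac{q^i-1}{q-1}$, $[k]!=\prod_{i=1}^k[i]$. $\mathbb C[H_-\backslash B_-]_q$: algebra with generators $u_i,m_i$ ($i>0$) and relations $$\bigl(\lambda^{-1}u(\lambda)-\mu^{-1}u(\mu)\bigr)\bigl(u(\lambda)-u(\mu)\bigr)=q\bigl(u(\lambda)-u(\mu)\bigr)\bigl(\lambda^{-1}u(\lambda)-\mu^{-1}u(\mu)\bigr),$$ $$\bigl(\lambda^{-1}m(\lambda)-\mu^{-1}m(\mu)\bigr)\bigl(m(\lambda)-m(\mu)\bigr)=q^{-1}\bigl(m(\lambda)-m(\mu)\bigr)\bigl(\lambda^{-1}m(\lambda)-\mu^{-1}m(\mu)\bigr),$$ $$u(\lambda)m(\mu)=q^{-1}m(\mu)u(\lambda),$$ with $u(\lambda)=\sum_{i\ge0}(-1)^iu_{i+1}\lambda^{-i}$, $m(\lambda)=\sum_{i\ge0}(-1)^im_{i+1}\lambda^{-i}$ ($\lambda,\mu$ commuting central formal variables). $(H_n)_{n\ge1}$: the commuting derivations of $\mathbb C[H_-\backslash B_-]_q$ given, with $H_\mu=\sum_{k\ge1}(-1)^kH_k\mu^{-k}$, by $$H_\mu(u(\lambda))=\frac{1}{\lambda^{-1}-\mu^{-1}}\bigl(\lambda^{-1}u(\lambda)-\mu^{-1}u(\mu)\bigr)v(\mu)u(\lambda)-\frac{\mu^{-1}}{\lambda^{-1}-\mu^{-1}}\bigl(u(\lambda)-u(\mu)\bigr)\bigl(1+v(\mu)u(\mu)\bigr),$$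 $$H_\mu(m(\lambda))=\frac{\mu^{-1}}{\lambda^{-1}-\mu^{-1}}\bigl(1+m(\mu)w(\mu)\bigr)\bigl(m(\lambda)-m(\mu)\bigr)-\frac{1}{\lambda^{-1}-\mu^{-1}}m(\lambda)w(\mu)\bigl(\lambda^{-1}m(\lambda)-\mu^{-1}m(\mu)\bigr),$$ where $v(\mu)=-(u(\mu)+\mu m(\mu)^{-1})^{-1}:=-\mu^{-1}m(\mu)(1+\mu^{-1}u(\mu)m(\mu))^{-1}$ and $w(\mu)=-(m(\mu)+\mu u(\mu)^{-1})^{-1}:=-\mu^{-1}u(\mu)(1+\mu^{-1}m(\mu)u(\mu))^{-1}$.
   Formalization: The final identity is proved as [n]·DS_q∘H_n = ad(I_n)∘DS_q, with [n]=(q^n−1)/(q−1); as printed, without [n], it fails for n=2: the coefficients of y_0^{-1}(x_0y_0)^{-2} in the images of u_1 differ by the factor 1+q. *)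

theory Defs
  imports
    "HOL-Library.Poly_Mapping"
    "HOL-Library.Groups_Big_Fun"
    "HOL-Computational_Algebra.Formal_Power_Series"
    "HOL-Algebra.Algebraic_Closure_Type"
begin

section \<open>The ground ring and exact division\<close>

text \<open>The Laurent polynomial ring is the group ring of the additive group of integers.\<close>

type_synonym laurent = "int \<Rightarrow>\<^sub>0 complex"

definition qvar :: laurent where
  "qvar = Poly_Mapping.single 1 1"

definition qvar_inv :: laurent where
  "qvar_inv = Poly_Mapping.single (-1) 1"

text \<open>Only used for a divisor that is central and not a zero divisor, and for a divisible
  dividend: this is the quotient of \<open>a\<close> by \<open>c\<close>.\<close>

definition exact_quot :: "'a::ring_1 \<Rightarrow> 'a \<Rightarrow> 'a" where
  "exact_quot a c = (THE b. c * b = a)"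

definition unit_inv :: "'a::ring_1 \<Rightarrow> 'a" where
  "unit_inv a = (THE b. a * b = 1 \<and> b * a = 1)"

section \<open>Algebras presented by generators and relations\<close>

datatype 'g word = Word (letters: "'g list")

instantiation word :: (type) monoid_add
begin

definition zero_word :: "'a word" where
  "zero_word = Word []"

definition plus_word :: "'a word \<Rightarrow> 'a word \<Rightarrow> 'a word" where
  "plus_word v w = Word (letters v @ letters w)"

instance
  by standard (simp_all add: zero_word_def plus_word_def)

end

text \<open>The monoid algebra of the free monoid, that is, noncommutative polynomials.\<close>

type_synonym 'g free_algebra = "'g word \<Rightarrow>\<^sub>0 laurent"

definition free_gen :: "'g \<Rightarrow> 'g free_algebra" where
  "free_gen g = Poly_Mapping.single (Word [g]) 1"

definition free_scalar :: "laurent \<Rightarrow> 'g free_algebra" where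
  "free_scalar c = Poly_Mapping.single 0 c"

text \<open>The two-sided ideal generated by a set.\<close>

definition two_sided_ideal :: "'a::ring_1 set \<Rightarrow> 'a set" where
  "two_sided_ideal S = genideal ring_of_type_algebra S"

lemma ring_ring_of_type: "Ring.ring (ring_of_type_algebra :: 'a::ring_1 ring)"
proof -
  have "\<exists>y. x + y = 0" for x :: 'a
    using add.right_inverse by blast
  thus ?thesis
    unfolding ring_of_type_algebra_def using add.right_inverse
    by unfold_locales (auto simp: algebra_simps Units_def)
qed

lemma a_inv_ring_of_type [simp]: "\<ominus>\<^bsub>ring_of_type_algebra\<^esub> (x::'a::ring_1) = - x"
proof -
  interpret R: ring "ring_of_type_algebra :: 'a ring" by (rule ring_ring_of_type)
  show ?thesis
    by (rule R.minus_equality) (simp_all add: ring_of_type_algebra_def)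
qed

lemma ideal_two_sided_ideal: "ideal (two_sided_ideal S) (ring_of_type_algebra :: 'a::ring_1 ring)"
  unfolding two_sided_ideal_def
  by (rule ring.genideal_ideal[OF ring_ring_of_type]) (simp add: ring_of_type_algebra_def)

lemma two_sided_ideal_0: "0 \<in> two_sided_ideal S"
  and two_sided_ideal_add: "a \<in> two_sided_ideal S \<Longrightarrow> b \<in> two_sided_ideal S \<Longrightarrow> a + b \<in> two_sided_ideal S"
  and two_sided_ideal_lmult: "a \<in> two_sided_ideal S \<Longrightarrow> c * a \<in> two_sided_ideal S"
  and two_sided_ideal_rmult: "a \<in> two_sided_ideal S \<Longrightarrow> a * c \<in> two_sided_ideal S"
  and two_sided_ideal_uminus: "a \<in> two_sided_ideal S \<Longrightarrow> - a \<in> two_sided_ideal S"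
  for a b c :: "'a::ring_1"
proof -
  interpret ideal "two_sided_ideal S" "ring_of_type_algebra :: 'a ring"
    by (rule ideal_two_sided_ideal)
  show "0 \<in> two_sided_ideal S"
    using additive_subgroup.zero_closed[OF is_additive_subgroup]
    by (simp add: ring_of_type_algebra_def)
  show "a \<in> two_sided_ideal S \<Longrightarrow> b \<in> two_sided_ideal S \<Longrightarrow> a + b \<in> two_sided_ideal S"
    using additive_subgroup.a_closed[OF is_additive_subgroup, of a b] by (simp add: ring_of_type_algebra_def)
  show l: "a \<in> two_sided_ideal S \<Longrightarrow> c * a \<in> two_sided_ideal S" for a c
    using I_l_closed[of a c] by (simp add: ring_of_type_algebra_def)
  show "a \<in> two_sided_ideal S \<Longrightarrow> a * c \<in> two_sided_ideal S"
    using I_r_closed[of a c] by (simp add: ring_of_type_algebra_def)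
  show "a \<in> two_sided_ideal S \<Longrightarrow> - a \<in> two_sided_ideal S"
    using l[of a "- 1"] by simp
qed

lemma two_sided_ideal_induct:
  fixes S :: "'a::ring_1 set" and J :: "'a set"
  assumes "S \<subseteq> J" "0 \<in> J"
    and "\<And>a b. a \<in> J \<Longrightarrow> b \<in> J \<Longrightarrow> a + b \<in> J"
    and "\<And>a c. a \<in> J \<Longrightarrow> c * a \<in> J" and "\<And>a c. a \<in> J \<Longrightarrow> a * c \<in> J"
  shows "two_sided_ideal S \<subseteq> J"
proof -
  interpret R: ring "ring_of_type_algebra :: 'a ring" by (rule ring_ring_of_type)
  have m: "- a \<in> J" if "a \<in> J" for a
    using assms(4)[OF that, of "- 1"] by simp
  have "ideal J (ring_of_type_algebra :: 'a ring)"
  proof (rule idealI[OF ring_ring_of_type])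
    show "subgroup J (add_monoid (ring_of_type_algebra :: 'a ring))"
    proof (rule group.subgroupI)
      show "group (add_monoid (ring_of_type_algebra :: 'a ring))"
        by (rule R.add.group_axioms)
      show "inv\<^bsub>add_monoid (ring_of_type_algebra :: 'a ring)\<^esub> a \<in> J" if "a \<in> J" for a
        using m[OF that] a_inv_ring_of_type[of a] by (simp add: a_inv_def)
    qed (use assms in \<open>auto simp: ring_of_type_algebra_def\<close>)
  qed (use assms in \<open>auto simp: ring_of_type_algebra_def\<close>)
  thus ?thesis
    unfolding two_sided_ideal_def genideal_def using assms(1) by blast
qed

text \<open>The class assumption is needed because \<^class>\<open>ring_1\<close> excludes the zero ring.\<close>

class presentation =
  fixes relators :: "'a free_algebra set"
  assumes relators_proper: "1 \<notin> two_sided_ideal relators"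

quotient_type (overloaded) 'g presented = "'g::presentation free_algebra" /
  "\<lambda>a b. a - b \<in> two_sided_ideal relators"
proof (rule equivpI)
  show "reflp (\<lambda>a b. a - b \<in> two_sided_ideal (relators :: 'g free_algebra set))"
    by (simp add: reflp_def two_sided_ideal_0)
  show "symp (\<lambda>a b. a - b \<in> two_sided_ideal (relators :: 'g free_algebra set))"
    using two_sided_ideal_uminus by (fastforce simp: symp_def)
  show "transp (\<lambda>a b. a - b \<in> two_sided_ideal (relators :: 'g free_algebra set))"
  proof (rule transpI)
    fix a b c :: "'g free_algebra"
    assume "a - b \<in> two_sided_ideal relators" "b - c \<in> two_sided_ideal relators"
    from two_sided_ideal_add[OF this] show "a - c \<in> two_sided_ideal relators" by simp
  qed
qed

instantiation presented :: (presentation) ring_1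
begin

lift_definition zero_presented :: "'a presented" is 0 .

lift_definition one_presented :: "'a presented" is 1 .

lift_definition plus_presented :: "'a presented \<Rightarrow> 'a presented \<Rightarrow> 'a presented" is "(+)"
  using two_sided_ideal_add by (fastforce simp: algebra_simps)

lift_definition uminus_presented :: "'a presented \<Rightarrow> 'a presented" is uminus
  using two_sided_ideal_uminus by fastforce

lift_definition minus_presented :: "'a presented \<Rightarrow> 'a presented \<Rightarrow> 'a presented" is "(-)"
proof -
  fix a b c d :: "'a free_algebra"
  assume "a - b \<in> two_sided_ideal relators" "c - d \<in> two_sided_ideal relators"
  from two_sided_ideal_add[OF this(1) two_sided_ideal_uminus[OF this(2)]]
  show "a - c - (b - d) \<in> two_sided_ideal relators" by (simp add: algebra_simps)
qed

lift_definition times_presented :: "'a presented \<Rightarrow> 'a presented \<Rightarrow> 'a presented" is "(*)"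
proof -
  fix a b c d :: "'a free_algebra"
  assume "a - b \<in> two_sided_ideal relators" "c - d \<in> two_sided_ideal relators"
  from two_sided_ideal_add[OF two_sided_ideal_rmult[OF this(1), of c]
      two_sided_ideal_lmult[OF this(2), of b]]
  show "a * c - b * d \<in> two_sided_ideal relators" by (simp add: algebra_simps)
qed

instance
proof
  fix a b c :: "'a presented"
  show "a + b + c = a + (b + c)"
    by transfer (simp add: two_sided_ideal_0 add.assoc)
  show "a + b = b + a"
    by transfer (simp add: two_sided_ideal_0 add.commute)
  show "0 + a = a"
    by transfer (simp add: two_sided_ideal_0)
  show "- a + a = 0"
    by transfer (simp add: two_sided_ideal_0)
  show "a - b = a + - b"
    by transfer (simp add: two_sided_ideal_0)
  show "a * b * c = a * (b * c)"
    by transfer (simp add: two_sided_ideal_0 mult.assoc)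
  show "1 * a = a"
    by transfer (simp add: two_sided_ideal_0)
  show "a * 1 = a"
    by transfer (simp add: two_sided_ideal_0)
  show "(a + b) * c = a * c + b * c"
    by transfer (simp add: two_sided_ideal_0 distrib_right)
  show "a * (b + c) = a * b + a * c"
    by transfer (simp add: two_sided_ideal_0 distrib_left)
  show "(0::'a presented) \<noteq> 1"
  proof transfer
    show "0 - 1 \<notin> two_sided_ideal (relators :: 'a free_algebra set)"
      using relators_proper two_sided_ideal_uminus[of "0 - 1"] by fastforce
  qed
qed

end

lift_definition gen :: "'g::presentation \<Rightarrow> 'g presented" is free_gen .

lift_definition scalar :: "laurent \<Rightarrow> 'g::presentation presented" is free_scalar .

definition alg_hom :: "('g::presentation presented \<Rightarrow> 'h::presentation presented) \<Rightarrow> bool" where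
  "alg_hom f \<longleftrightarrow>
     (\<forall>a b. f (a + b) = f a + f b) \<and> (\<forall>a b. f (a * b) = f a * f b) \<and>
     f 1 = 1 \<and> (\<forall>c. f (scalar c) = scalar c)"

definition derivation :: "('g::presentation presented \<Rightarrow> 'g presented) \<Rightarrow> bool" where
  "derivation D \<longleftrightarrow>
     (\<forall>a b. D (a + b) = D a + D b) \<and> (\<forall>a b. D (a * b) = D a * b + a * D b) \<and>
     (\<forall>c. D (scalar c) = 0)"

text \<open>The specialisation of all generators and of \<open>q\<close> to \<open>1\<close>. It serves only to show that the
  presented algebras below are not zero.\<close>

definition coeff_sum :: "('k::monoid_add \<Rightarrow>\<^sub>0 'c::comm_ring_1) \<Rightarrow> 'c" where
  "coeff_sum f = (\<Sum>k\<in>Poly_Mapping.keys f. Poly_Mapping.lookup f k)"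

lemma coeff_sum_superset:
  "finite K \<Longrightarrow> Poly_Mapping.keys f \<subseteq> K \<Longrightarrow> coeff_sum f = (\<Sum>k\<in>K. Poly_Mapping.lookup f k)"
  unfolding coeff_sum_def
  by (rule sum.mono_neutral_left) (auto simp: in_keys_iff)

lemma coeff_sum_0 [simp]: "coeff_sum 0 = 0"
  by (simp add: coeff_sum_def)

lemma coeff_sum_single [simp]: "coeff_sum (Poly_Mapping.single k c) = c"
  by (cases "c = 0") (simp_all add: coeff_sum_def)

lemma coeff_sum_1 [simp]: "coeff_sum 1 = 1"
  by (simp flip: single_one)

lemma coeff_sum_add [simp]: "coeff_sum (f + g) = coeff_sum f + coeff_sum g"
proof -
  let ?K = "Poly_Mapping.keys f \<union> Poly_Mapping.keys g"
  have "coeff_sum (f + g) = (\<Sum>k\<in>?K. Poly_Mapping.lookup (f + g) k)"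
    using Poly_Mapping.keys_add[of f g] by (intro coeff_sum_superset) auto
  also have "\<dots> = (\<Sum>k\<in>?K. Poly_Mapping.lookup f k) + (\<Sum>k\<in>?K. Poly_Mapping.lookup g k)"
    by (simp add: lookup_add sum.distrib)
  also have "\<dots> = coeff_sum f + coeff_sum g"
    by (simp flip: coeff_sum_superset)
  finally show ?thesis .
qed

lemma coeff_sum_uminus [simp]: "coeff_sum (- f) = - coeff_sum f"
  using coeff_sum_add[of f "- f"] by (simp add: eq_neg_iff_add_eq_0 add.commute)

lemma coeff_sum_diff [simp]: "coeff_sum (f - g) = coeff_sum f - coeff_sum g"
  using coeff_sum_add[of f "- g"] by simp

lemma coeff_sum_sum [simp]: "coeff_sum (sum h I) = (\<Sum>i\<in>I. coeff_sum (h i))"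
  by (induction I rule: infinite_finite_induct) simp_all

lemma poly_mapping_add_induct [case_names zero single add]:
  fixes f :: "'k \<Rightarrow>\<^sub>0 'c::ab_group_add"
  assumes "P 0" "\<And>k c. P (Poly_Mapping.single k c)" "\<And>f g. P f \<Longrightarrow> P g \<Longrightarrow> P (f + g)"
  shows "P f"
proof (induction f rule: Poly_Mapping.update_induct)
  case const
  show ?case by (rule assms(1))
next
  case (update f a b)
  have "Poly_Mapping.update a b f = f + Poly_Mapping.single a b"
    using update(1) by (intro poly_mapping_eqI) (auto simp: lookup_update lookup_add lookup_single in_keys_iff)
  thus ?case using update(3) assms(2,3) by simp
qed

lemma coeff_sum_mult [simp]:
  fixes f g :: "'k::monoid_add \<Rightarrow>\<^sub>0 'c::comm_ring_1"
  shows "coeff_sum (f * g) = coeff_sum f * coeff_sum g"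
proof -
  have 1: "coeff_sum (Poly_Mapping.single k c * g) = c * coeff_sum g" for k :: 'k and c :: 'c and g
    by (induction g rule: poly_mapping_add_induct) (simp_all add: mult_single distrib_left)
  show ?thesis
    by (induction f rule: poly_mapping_add_induct) (simp_all add: 1 distrib_right)
qed

definition augmentation :: "'g free_algebra \<Rightarrow> complex" where
  "augmentation f = coeff_sum (coeff_sum f)"

lemma augmentation_simps [simp]:
  "augmentation 0 = 0" "augmentation 1 = 1" "augmentation (f + g) = augmentation f + augmentation g"
  "augmentation (f - g) = augmentation f - augmentation g" "augmentation (- f) = - augmentation f"
  "augmentation (f * g) = augmentation f * augmentation g"
  "augmentation (sum h I) = (\<Sum>i\<in>I. augmentation (h i))"
  "augmentation (free_gen x) = 1"
  "augmentation (free_scalar qvar) = 1" "augmentation (free_scalar qvar_inv) = 1"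
  by (simp_all add: augmentation_def free_gen_def free_scalar_def qvar_def qvar_inv_def)

lemma proper_if_augmentation:
  assumes "\<And>r. r \<in> S \<Longrightarrow> augmentation r = 0"
  shows "1 \<notin> two_sided_ideal S"
proof -
  have "two_sided_ideal S \<subseteq> {r. augmentation r = 0}"
    by (rule two_sided_ideal_induct) (use assms in auto)
  thus ?thesis by auto
qed

section \<open>The algebra $A_q$\<close>

datatype aq_gen = GX int | GX_inv int | GY int | GY_inv int

instantiation aq_gen :: presentation
begin

definition relators_aq_gen :: "aq_gen free_algebra set" where
  "relators_aq_gen =
     (let x = (\<lambda>i. free_gen (GX i)); y = (\<lambda>i. free_gen (GY i));
          x' = (\<lambda>i. free_gen (GX_inv i)); y' = (\<lambda>i. free_gen (GY_inv i));
          q = free_scalar qvar; q' = free_scalar qvar_inv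
      in {x i * x' i - 1 | i. True} \<union> {x' i * x i - 1 | i. True} \<union>
         {y i * y' i - 1 | i. True} \<union> {y' i * y i - 1 | i. True} \<union>
         {x k * x l - q * (x l * x k) | k l. k < l} \<union>
         {y k * y l - q * (y l * y k) | k l. k < l} \<union>
         {y k * x l - q' * (x l * y k) | k l. k < l} \<union>
         {x k * y l - q' * (y l * x k) | k l. k \<le> l})"

instance
  by standard (rule proper_if_augmentation, auto simp: relators_aq_gen_def Let_def)

end

type_synonym aq = "aq_gen presented"

abbreviation xA :: "int \<Rightarrow> aq" where "xA i \<equiv> gen (GX i)"
abbreviation yA :: "int \<Rightarrow> aq" where "yA i \<equiv> gen (GY i)"

fun gen_degree :: "aq_gen \<Rightarrow> int" where
  "gen_degree (GX i) = 1"
| "gen_degree (GX_inv i) = -1"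
| "gen_degree (GY i) = -1"
| "gen_degree (GY_inv i) = 1"

text \<open>The relators are homogeneous, so the degree \<open>0\<close> part of the quotient is the image of the
  degree \<open>0\<close> part of the free algebra.\<close>

definition aq_degree_0 :: "aq set" where
  "aq_degree_0 = abs_presented `
     {f. \<forall>w\<in>Poly_Mapping.keys f. sum_list (map gen_degree (letters w)) = 0}"

definition T_half :: "aq \<Rightarrow> aq" where
  "T_half = (THE f. alg_hom f \<and> (\<forall>i. f (xA i) = yA i) \<and> (\<forall>i. f (yA i) = xA (i + 1)))"

definition T :: "aq \<Rightarrow> aq" where
  "T = T_half \<circ> T_half"

definition T_pow :: "int \<Rightarrow> aq \<Rightarrow> aq" where
  "T_pow k = (if 0 \<le> k then T ^^ nat k else inv_into UNIV T ^^ nat (- k))"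

text \<open>The class of an element of the degree \<open>0\<close> part modulo the image of \<open>T - Id\<close>.\<close>

definition I_class :: "aq \<Rightarrow> aq set" where
  "I_class P = {P + (T R - R) | R. R \<in> aq_degree_0}"

text \<open>The value does not depend on the representative of the class, and only finitely many
  commutators are nonzero, so that \<^const>\<open>Sum_any\<close> is their sum.\<close>

definition ad :: "aq set \<Rightarrow> aq \<Rightarrow> aq" where
  "ad C z = (THE w. \<forall>P\<in>C.
     w = exact_quot (Sum_any (\<lambda>k. T_pow k P * z - z * T_pow k P)) (scalar (qvar - 1)))"

section \<open>The local integrals of motion\<close>

definition qint :: "nat \<Rightarrow> laurent" where
  "qint i = exact_quot (qvar ^ i - 1) (qvar - 1)"

definition qfact :: "nat \<Rightarrow> laurent" where
  "qfact k = (\<Prod>i=1..k. qint i)"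

definition qbinom :: "int \<Rightarrow> int \<Rightarrow> laurent" where
  "qbinom a b =
     (if b = 0 then 1 else if b < 0 \<or> b > max 0 a then 0
      else exact_quot (qfact (nat a)) (qfact (nat b) * qfact (nat (a - b))))"

definition Fq :: "nat list \<Rightarrow> laurent" where
  "Fq \<alpha> = (\<Prod>i<length \<alpha> - 1. qbinom (int (\<alpha> ! i) + int (\<alpha> ! Suc i) - 1) (int (\<alpha> ! Suc i)))"

text \<open>The products $\dots, z_{-1} = x_0 y_0, z_0 = y_0 x_1, z_1 = x_1 y_1, z_2 = y_1 x_2, \dots$
  of neighbours.\<close>

definition zA :: "int \<Rightarrow> aq" where
  "zA i = (if odd i then xA ((i + 1) div 2) * yA ((i + 1) div 2) else yA (i div 2) * xA (i div 2 + 1))"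

text \<open>The list entry \<open>\<alpha> ! i\<close> is $\alpha_{i+1}$.\<close>

definition A_sum :: "nat \<Rightarrow> nat \<Rightarrow> aq" where
  "A_sum N n = (\<Sum>\<alpha> | length \<alpha> = 2 * N - 2 \<and> 1 \<le> \<alpha> ! 0 \<and> sum_list \<alpha> = n.
     scalar (exact_quot (qint n * Fq \<alpha>) (qint (\<alpha> ! 0))) *
     (\<Prod>i\<leftarrow>[0..<2 * N - 2]. unit_inv (zA (int i + 1)) ^ (\<alpha> ! i)))"

definition psi :: "nat \<Rightarrow> nat \<Rightarrow> aq" where
  "psi N n = A_sum N n + T_half (A_sum N n)"

section \<open>Generating series\<close>

text \<open>A series in $\lambda^{-1}$ is a formal power series with \<^const>\<open>fps_X\<close> in the role of
  $\lambda^{-1}$. In a series in $\lambda^{-1}$ and $\mu^{-1}$, the outer variable is $\lambda^{-1}$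
  and the inner one is $\mu^{-1}$.\<close>

definition alt_series :: "(nat \<Rightarrow> 'a::ring_1) \<Rightarrow> 'a fps" where
  "alt_series c = Abs_fps (\<lambda>i. (-1) ^ i * c i)"

definition at_lambda :: "'a::ring_1 fps \<Rightarrow> 'a fps fps" where
  "at_lambda A = Abs_fps (\<lambda>i. fps_const (A $ i))"

definition at_mu :: "'a::ring_1 fps \<Rightarrow> 'a fps fps" where
  "at_mu A = fps_const A"

definition lambda_inv :: "'a::ring_1 fps fps" where
  "lambda_inv = fps_X"

definition mu_inv :: "'a::ring_1 fps fps" where
  "mu_inv = fps_const fps_X"

definition coeffwise :: "('a \<Rightarrow> 'b) \<Rightarrow> 'a fps \<Rightarrow> 'b fps" where
  "coeffwise f A = Abs_fps (\<lambda>i. f (A $ i))"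

section \<open>The algebra $\mathbb{C}[H_- \backslash B_-]_q$\<close>

text \<open>Indices are shifted to start at \<open>0\<close>: the generators \<open>U i\<close> and \<open>M i\<close> are $u_{i+1}$ and
  $m_{i+1}$.\<close>

datatype hb_gen = U nat | M nat

text \<open>The difference of the two sides of
  $(\lambda^{-1}a(\lambda)-\mu^{-1}a(\mu))(a(\lambda)-a(\mu)) =
   c\,(a(\lambda)-a(\mu))(\lambda^{-1}a(\lambda)-\mu^{-1}a(\mu))$.\<close>

definition exchange_relator :: "'a::ring_1 \<Rightarrow> 'a fps \<Rightarrow> 'a fps fps" where
  "exchange_relator c a =
     (let d = at_lambda a - at_mu a;
          d' = lambda_inv * at_lambda a - mu_inv * at_mu a
      in d' * d - fps_const (fps_const c) * (d * d'))"

lemma augmentation_fps_mult: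
  "augmentation ((A * B) $ i $ j) = (\<Sum>k=0..i. \<Sum>l=0..j. augmentation (A $ k $ l) * augmentation (B $ (i - k) $ (j - l)))"
  by (simp add: fps_mult_nth fps_sum_nth)

lemma augmentation_fps_mult_commute:
  "augmentation ((A * B) $ i $ j) = augmentation ((B * A) $ i $ j)"
proof -
  let ?a = "\<lambda>A. Abs_fps (\<lambda>k. Abs_fps (\<lambda>l. augmentation (A $ k $ l)))"
  have h: "augmentation ((A * B) $ i $ j) = (?a A * ?a B) $ i $ j" for A B
    by (simp add: augmentation_fps_mult) (simp add: fps_mult_nth fps_sum_nth)
  show ?thesis by (simp only: h mult.commute)
qed

lemma augmentation_fps_const_mult:
  "augmentation ((fps_const (fps_const c) * A) $ i $ j) = augmentation c * augmentation (A $ i $ j)"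
  by simp

instantiation hb_gen :: presentation
begin

definition relators_hb_gen :: "hb_gen free_algebra set" where
  "relators_hb_gen =
     (let u = alt_series (\<lambda>i. free_gen (U i)); m = alt_series (\<lambda>i. free_gen (M i));
          q = free_scalar qvar; q' = free_scalar qvar_inv
      in {R $ i $ j | R i j.
            R \<in> {exchange_relator q u, exchange_relator q' m,
                 at_lambda u * at_mu m - fps_const (fps_const q') * (at_mu m * at_lambda u)}})"

instance
proof
  have 1: "augmentation (exchange_relator c a $ i $ j) = 0" if "augmentation c = 1"
    for c :: "hb_gen free_algebra" and a i j
    unfolding exchange_relator_def Let_def fps_sub_nth augmentation_simps
      augmentation_fps_const_mult that
    by (subst augmentation_fps_mult_commute) simp
  have 2: "augmentation ((A * B - fps_const (fps_const c) * (B * A)) $ i $ j) = 0"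
    if "augmentation c = 1"
    for c :: "hb_gen free_algebra" and A B i j
    unfolding fps_sub_nth augmentation_simps augmentation_fps_const_mult that
    by (subst augmentation_fps_mult_commute) simp
  show "1 \<notin> two_sided_ideal (relators :: hb_gen free_algebra set)"
    by (rule proper_if_augmentation)
      (auto simp: relators_hb_gen_def Let_def 1 simp del: fps_sub_nth intro!: 2)
qed

end

type_synonym hb = "hb_gen presented"

definition u_series :: "hb fps" where
  "u_series = alt_series (\<lambda>i. gen (U i))"

definition m_series :: "hb fps" where
  "m_series = alt_series (\<lambda>i. gen (M i))"

section \<open>The derivations $H_n$\<close>

definition v_series :: "hb fps" where
  "v_series = - (fps_X * m_series * unit_inv (1 + fps_X * u_series * m_series))"

definition w_series :: "hb fps" where
  "w_series = - (fps_X * u_series * unit_inv (1 + fps_X * m_series * u_series))"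

definition H_mu_u :: "hb fps fps" where
  "H_mu_u =
     (let ul = at_lambda u_series; um = at_mu u_series; v = at_mu v_series
      in exact_quot (lambda_inv * ul - mu_inv * um) (lambda_inv - mu_inv) * v * ul
         - mu_inv * exact_quot (ul - um) (lambda_inv - mu_inv) * (1 + v * um))"

definition H_mu_m :: "hb fps fps" where
  "H_mu_m =
     (let ml = at_lambda m_series; mm = at_mu m_series; w = at_mu w_series
      in mu_inv * (1 + mm * w) * exact_quot (ml - mm) (lambda_inv - mu_inv)
         - ml * w * exact_quot (lambda_inv * ml - mu_inv * mm) (lambda_inv - mu_inv))"

text \<open>The coefficient of $\mu^{-n}$ in a series in $\lambda^{-1}$ and $\mu^{-1}$.\<close>

definition mu_coeff :: "nat \<Rightarrow> 'a::ring_1 fps fps \<Rightarrow> 'a fps" where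
  "mu_coeff n A = Abs_fps (\<lambda>i. A $ i $ n)"

definition H :: "nat \<Rightarrow> hb \<Rightarrow> hb" where
  "H n = (THE D. derivation D \<and>
     (-1) ^ n * coeffwise D u_series = mu_coeff n H_mu_u \<and>
     (-1) ^ n * coeffwise D m_series = mu_coeff n H_mu_m)"

section \<open>Continued fractions\<close>

text \<open>The two readings $b^{-1}a$ and $ab^{-1}$ of $\frac ab$.\<close>

definition left_frac :: "'a::ring_1 \<Rightarrow> 'a \<Rightarrow> 'a" where
  "left_frac a b = unit_inv b * a"

definition right_frac :: "'a::ring_1 \<Rightarrow> 'a \<Rightarrow> 'a" where
  "right_frac a b = a * unit_inv b"

text \<open>The expression $1 + \frac{a_1}{1 + \frac{a_2}{\ddots\, 1 + a_k}}$.\<close>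

definition cont_frac :: "('a::ring_1 \<Rightarrow> 'a \<Rightarrow> 'a) \<Rightarrow> 'a list \<Rightarrow> 'a" where
  "cont_frac quot xs = foldr (\<lambda>a b. 1 + quot a b) xs 1"

text \<open>The series $(\lambda a)^{-1} = a^{-1}\lambda^{-1}$.\<close>

definition lambda_times_inv :: "'a::ring_1 \<Rightarrow> 'a fps" where
  "lambda_times_inv a = fps_const (unit_inv a) * fps_X"

definition DS_u_approx :: "nat \<Rightarrow> aq fps" where
  "DS_u_approx N = left_frac (fps_const (unit_inv (yA 0)))
     (cont_frac left_frac (map (\<lambda>i. lambda_times_inv (zA (- int i))) [1..<2 * N]))"

definition DS_m_approx :: "nat \<Rightarrow> aq fps" where
  "DS_m_approx N = right_frac (fps_const (unit_inv (xA 1)))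
     (cont_frac right_frac (map (\<lambda>i. lambda_times_inv (zA (int i))) [1..<2 * N]))"

section \<open>Fraction fields\<close>

definition skew_field :: "('k, 'm) ring_scheme \<Rightarrow> bool" where
  "skew_field K \<longleftrightarrow> Ring.ring K \<and> \<one>\<^bsub>K\<^esub> \<noteq> \<zero>\<^bsub>K\<^esub> \<and> Units K = carrier K - {\<zero>\<^bsub>K\<^esub>}"

definition is_fraction_field :: "('k, 'm) ring_scheme \<Rightarrow> ('a::ring_1 \<Rightarrow> 'k) \<Rightarrow> bool" where
  "is_fraction_field K \<iota> \<longleftrightarrow>
     skew_field K \<and> \<iota> \<in> ring_hom ring_of_type_algebra K \<and> inj \<iota> \<and>
     (\<forall>k\<in>carrier K. \<exists>a b. b \<noteq> 0 \<and> k = \<iota> a \<otimes>\<^bsub>K\<^esub> inv\<^bsub>K\<^esub> (\<iota> b)) \<and>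
     (\<forall>k\<in>carrier K. \<exists>a b. b \<noteq> 0 \<and> k = inv\<^bsub>K\<^esub> (\<iota> b) \<otimes>\<^bsub>K\<^esub> \<iota> a)"

text \<open>A fraction field can be carried by classes of pairs, whence the carrier types. It is unique up
  to unique isomorphism, so its choice is irrelevant.\<close>

definition birational :: "('a::ring_1 \<Rightarrow> 'b::ring_1) \<Rightarrow> bool" where
  "birational f \<longleftrightarrow>
     (\<exists>(K :: ('a \<times> 'a) set ring) \<iota> (L :: ('b \<times> 'b) set ring) \<kappa>.
        is_fraction_field K \<iota> \<and> is_fraction_field L \<kappa> \<and>
        (\<exists>\<Phi>\<in>ring_iso K L. \<forall>a. \<Phi> (\<iota> a) = \<kappa> (f a)))"

end

theory Submission
  imports Defs
begin

text \<open>Write $t_{2i-1} = x_i$, $t_{2i} = y_i$ and $m_i = (t_i + \lambda^{-1} m_{i+1})^{-1}$, so that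
  $\mathrm{DS}_q(m(\lambda)) = m_1$; the image of $u(\lambda)$ is the mirror image $u_0$ with
  $u_i = (t_i + \lambda^{-1} u_{i-1})^{-1}$. The exchange relation is stable under
  $a \mapsto (t + \lambda^{-1} a)^{-1}$, hence holds for all finite continued fractions and for their limits,
  and $\mathrm{DS}_q$ exists. Ordered monomials in the generators span the source, and their images have
  distinct leading exponents in the quantum torus $A_q$, hence $\mathrm{DS}_q$ is injective. Both algebras
  have polynomial growth, hence are Ore domains, and the generators $t_i$ are rational in the coefficients
  of $m_1$ and $u_0$, which gives birationality.

  For the Hamiltonians, the density $A_n$ and its shifts are coefficients of quantum logarithms of
  $-\lambda^{-1} m_{j+1} t_j^{-1}$. By the $q$-binomial theorem their sum telescopes, which computes the
  action of $\sum_n (-\mu)^{-n}\, \mathrm{ad}(I_n)/[n]$ on $t_i$ as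
  $\mu^{-1} (t_i K_i m_{i+1} - u_{i-1} K_i t_i)$ with
  $K_i = (t_i + \mu^{-1} m_{i+1} + \mu^{-1} u_{i-1})^{-1}$. A derivation with these values transforms $m_i$
  and $u_i$ by the formulas that define $H_\mu$, since the difference of the two sides for $m_i$ is
  divisible by the difference for $m_{i+1}$ times $\lambda^{-1}$.\<close>

section \<open>Units and exact quotients\<close>

text \<open>Three obstacles shape the proof. The parameter q is formal and the ground ring is not a
  field; therefore A_q is embedded into the complex group algebra of an ordered Heisenberg-type
  group in which q is a central group element. Leading terms then decide zero divisors and
  independence, and growth is a matter of complex dimensions. The numbers [m] are not invertible, so
  quantum logarithms are truncated at order n and multiplied by [n]!; they are compared only in the
  coefficient of \<lambda>^-n, and the factor is cancelled at the end. Finally,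
  \<open>T_half\<close>, \<open>ad\<close>, \<open>H\<close> and all quotients are definite
  descriptions, so their values must be produced before anything is proved about them. For H_n the
  relators of the source are not checked: the derivation ad(I_n)/[n] of A_q is seen to preserve the
  image of the injective map \<open>DS\<close>, and its pullback has the defining values. The work
  for m and u is shared through the mirror i -> 1 - i, which exchanges the two series and reverses
  the signs of the commutation exponents and of the flow.\<close>

lemma unit_inv_eqI:
  assumes "a * b = 1" "b * a = 1"
  shows "unit_inv a = b"
  unfolding unit_inv_def
proof (rule the_equality)
  show "a * b = 1 \<and> b * a = 1" using assms by simp
next
  fix c assume c: "a * c = 1 \<and> c * a = 1"
  have "c = (b * a) * c" using assms by simp
  also have "\<dots> = b" using c by (simp add: mult.assoc)
  finally show "c = b" .
qed

text \<open>\<open>unit_inv\<close> is a description and says nothing without a two-sided inverse;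
  this predicate is the side condition under which it may be rewritten.\<close>

definition is_unit_elt :: "'a::ring_1 \<Rightarrow> bool" where
  "is_unit_elt a \<longleftrightarrow> (\<exists>b. a * b = 1 \<and> b * a = 1)"

lemma is_unit_eltI: "a * b = 1 \<Longrightarrow> b * a = 1 \<Longrightarrow> is_unit_elt a"
  by (auto simp: is_unit_elt_def)

lemma unit_inv_right: "is_unit_elt a \<Longrightarrow> a * unit_inv a = 1"
  and unit_inv_left: "is_unit_elt a \<Longrightarrow> unit_inv a * a = 1"
  using unit_inv_eqI by (fastforce simp: is_unit_elt_def)+

lemma unit_inv_right': "is_unit_elt a \<Longrightarrow> a * (unit_inv a * x) = x"
  and unit_inv_left': "is_unit_elt a \<Longrightarrow> unit_inv a * (a * x) = x"
  by (simp_all add: unit_inv_right unit_inv_left flip: mult.assoc)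

lemma is_unit_unit_inv: "is_unit_elt a \<Longrightarrow> is_unit_elt (unit_inv a)"
  by (rule is_unit_eltI[OF unit_inv_left unit_inv_right])

lemma unit_inv_unit_inv: "is_unit_elt a \<Longrightarrow> unit_inv (unit_inv a) = a"
  by (rule unit_inv_eqI[OF unit_inv_left unit_inv_right])

lemma is_unit_1: "is_unit_elt 1"
  by (rule is_unit_eltI[of _ 1]) simp_all

lemma unit_inv_1: "unit_inv 1 = 1"
  by (rule unit_inv_eqI) simp_all

lemma is_unit_mult: "is_unit_elt a \<Longrightarrow> is_unit_elt b \<Longrightarrow> is_unit_elt (a * b)"
  by (rule is_unit_eltI[of _ "unit_inv b * unit_inv a"])
     (simp_all add: mult.assoc unit_inv_right unit_inv_right' unit_inv_left unit_inv_left')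

lemma unit_inv_mult: "is_unit_elt a \<Longrightarrow> is_unit_elt b \<Longrightarrow> unit_inv (a * b) = unit_inv b * unit_inv a"
  by (rule unit_inv_eqI)
     (simp_all add: mult.assoc unit_inv_right unit_inv_right' unit_inv_left unit_inv_left')

lemma unit_cancel_left: "is_unit_elt a \<Longrightarrow> a * x = a * y \<Longrightarrow> x = y"
  by (metis unit_inv_left')

lemma unit_cancel_right: "is_unit_elt a \<Longrightarrow> x * a = y * a \<Longrightarrow> x = y"
  by (metis mult.assoc mult_1_right unit_inv_right)

lemma exact_quot_eqI:
  assumes "c * b = a" "\<And>x y. c * x = c * y \<Longrightarrow> x = y"
  shows "exact_quot a c = b"
  unfolding exact_quot_def using assms by (intro the_equality) auto

lemma exact_quot_eqI':
  fixes c :: "'a::ring_1_no_zero_divisors"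
  assumes "c * b = a" "c \<noteq> 0"
  shows "exact_quot a c = b"
  by (rule exact_quot_eqI) (use assms in auto)

lemma is_unit_fps:
  fixes f :: "'a::ring_1 fps"
  assumes "is_unit_elt (f $ 0)"
  shows "is_unit_elt f"
proof -
  let ?x = "unit_inv (f $ 0)"
  show ?thesis
    by (rule is_unit_eltI[of _ "fps_right_inverse f ?x"])
       (use assms in \<open>auto intro!: fps_right_inverse fps_left_inverse'[of ?x] simp: unit_inv_right unit_inv_left\<close>)
qed

lemma is_unit_fps_1: "(f :: 'a::ring_1 fps) $ 0 = 1 \<Longrightarrow> is_unit_elt f"
  by (rule is_unit_fps) (simp add: is_unit_1)

lemma is_unit_fps_const: "is_unit_elt c \<Longrightarrow> is_unit_elt (fps_const c)"
  by (rule is_unit_fps) simp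

lemma unit_inv_fps_const:
  "is_unit_elt (c :: 'a::ring_1) \<Longrightarrow> unit_inv (fps_const c) = fps_const (unit_inv c)"
  by (rule unit_inv_eqI) (simp_all add: unit_inv_right unit_inv_left)

section \<open>Algebras presented by generators and relations\<close>

lemma scalar_add: "scalar (a + b) = scalar a + (scalar b :: 'g::presentation presented)"
  by transfer (simp add: free_scalar_def single_add mult_single two_sided_ideal_0 single_one)

lemma scalar_mult: "scalar (a * b) = scalar a * (scalar b :: 'g::presentation presented)"
  by transfer (simp add: free_scalar_def single_add mult_single two_sided_ideal_0 single_one)

lemma scalar_0 [simp]: "scalar 0 = (0 :: 'g::presentation presented)"
  by transfer (simp add: free_scalar_def single_add mult_single two_sided_ideal_0 single_one)

lemma scalar_1 [simp]: "scalar 1 = (1 :: 'g::presentation presented)"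
  by transfer (simp add: free_scalar_def single_add mult_single two_sided_ideal_0 single_one)

lemma free_word:
  "Poly_Mapping.single w c = free_scalar c * prod_list (map free_gen (letters w))"
proof -
  have "prod_list (map free_gen xs) = Poly_Mapping.single (Word xs) (1::laurent)" for xs :: "'a list"
    by (induction xs) (auto simp: free_gen_def mult_single plus_word_def simp flip: single_one zero_word_def)
  thus ?thesis by (simp add: free_scalar_def mult_single zero_word_def plus_word_def)
qed

lemma free_induct [case_names scalar gen add mult]:
  fixes f :: "'g free_algebra"
  assumes "\<And>c. P (free_scalar c)" "\<And>g. P (free_gen g)" "\<And>a b. P a \<Longrightarrow> P b \<Longrightarrow> P (a + b)"
    "\<And>a b. P a \<Longrightarrow> P b \<Longrightarrow> P (a * b)"
  shows "P f"
proof (induction f rule: poly_mapping_add_induct)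
  case zero
  show ?case using assms(1)[of 0] by (simp add: free_scalar_def)
next
  case (single w c)
  have "P (prod_list (map free_gen xs))" for xs :: "'g list"
    by (induction xs) (use assms(1)[of 1] assms in \<open>auto simp: free_scalar_def\<close>)
  thus ?case by (simp add: free_word assms)
qed (use assms in auto)

lemma presented_induct [case_names scalar gen add mult]:
  fixes a :: "'g::presentation presented"
  assumes "\<And>c. P (scalar c)" "\<And>g. P (gen g)" "\<And>a b. P a \<Longrightarrow> P b \<Longrightarrow> P (a + b)"
    "\<And>a b. P a \<Longrightarrow> P b \<Longrightarrow> P (a * b)"
  shows "P a"
proof (induction a rule: presented.abs_induct)
  fix f :: "'g free_algebra"
  show "P (abs_presented f)"
    by (induction f rule: free_induct)
      (use assms in \<open>auto simp flip: scalar.abs_eq gen.abs_eq plus_presented.abs_eq times_presented.abs_eq\<close>)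
qed

lemma scalar_central: "scalar c * a = a * scalar c" for a :: "'g::presentation presented"
proof (induction a rule: presented_induct)
  case (scalar d)
  show ?case by (simp add: mult.commute flip: scalar_mult)
next
  case (gen g)
  show ?case
    by transfer (simp add: free_scalar_def free_gen_def mult_single two_sided_ideal_0)
next
  case (mult a b)
  thus ?case by (metis mult.assoc)
qed (simp add: distrib_left distrib_right)

lemma scalar_left_commute: "a * (scalar c * b) = scalar c * (a * b)" for a :: "'g::presentation presented"
  by (metis mult.assoc scalar_central)

lemma relator_eq_0:
  fixes f :: "'g::presentation free_algebra"
  shows "f \<in> relators \<Longrightarrow> abs_presented f = 0"
proof -
  assume "f \<in> relators"
  hence "f \<in> two_sided_ideal relators"
    unfolding two_sided_ideal_def
    using ring.genideal_self[OF ring_ring_of_type, of relators] by (auto simp: ring_of_type_algebra_def)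
  thus ?thesis unfolding zero_presented_def by (simp add: presented.abs_eq_iff)
qed

text \<open>The structure map of an algebra over the Laurent ring. Instances are the presented
  algebras, the group algebra \<open>qtorus\<close> and power series over any instance, so that
  evaluation of noncommutative polynomials and q-commutation are treated once.\<close>

locale central_scalars =
  fixes sc :: "laurent \<Rightarrow> 'r::ring_1"
  assumes sc_add: "sc (a + b) = sc a + sc b" and sc_mult: "sc (a * b) = sc a * sc b"
    and sc_1 [simp]: "sc 1 = 1" and sc_central: "sc c * x = x * sc c"
begin

lemma sc_0 [simp]: "sc 0 = 0"
  using sc_add[of 0 0] by simp

lemma sc_diff: "sc (a - b) = sc a - sc b"
  using sc_add[of "a - b" b] by (metis add_diff_cancel_right' diff_add_cancel)

lemma sc_left_commute: "x * (sc c * y) = sc c * (x * y)"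
  by (metis mult.assoc sc_central)

definition free_eval :: "('g \<Rightarrow> 'r) \<Rightarrow> 'g free_algebra \<Rightarrow> 'r" where
  "free_eval g f =
     (\<Sum>w\<in>Poly_Mapping.keys f. sc (Poly_Mapping.lookup f w) * prod_list (map g (letters w)))"

lemma free_eval_superset:
  "finite K \<Longrightarrow> Poly_Mapping.keys f \<subseteq> K \<Longrightarrow>
     free_eval g f = (\<Sum>w\<in>K. sc (Poly_Mapping.lookup f w) * prod_list (map g (letters w)))"
  unfolding free_eval_def by (rule sum.mono_neutral_left) (auto simp: in_keys_iff)

lemma free_eval_single:
  "free_eval g (Poly_Mapping.single w c) = sc c * prod_list (map g (letters w))"
  by (subst free_eval_superset[of "{w}"]) auto

lemma free_eval_0 [simp]: "free_eval g 0 = 0"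
  by (simp add: free_eval_def)

lemma free_eval_add: "free_eval g (a + b) = free_eval g a + free_eval g b"
proof -
  let ?K = "Poly_Mapping.keys a \<union> Poly_Mapping.keys b"
  have "free_eval g (a + b) = (\<Sum>w\<in>?K. sc (Poly_Mapping.lookup (a + b) w) * prod_list (map g (letters w)))"
    using Poly_Mapping.keys_add[of a b] by (intro free_eval_superset) auto
  also have "\<dots> = free_eval g a + free_eval g b"
    by (subst (1 2) free_eval_superset[of ?K]) (auto simp: lookup_add sc_add distrib_right sum.distrib)
  finally show ?thesis .
qed

lemma free_eval_mult: "free_eval g (a * b) = free_eval g a * free_eval g b"
proof -
  have 1: "free_eval g (Poly_Mapping.single w c * b) = free_eval g (Poly_Mapping.single w c) * free_eval g b" for w c b
  proof (induction b rule: poly_mapping_add_induct)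
    case (single v d)
    have "letters (w + v) = letters w @ letters v" by (simp add: plus_word_def)
    moreover have "x * (sc d * y) = sc d * (x * y)" for x y
      by (rule sc_left_commute)
    ultimately show ?case
      by (simp only: mult_single free_eval_single sc_mult mult.assoc map_append prod_list.append)
  qed (simp_all add: distrib_left free_eval_add)
  show ?thesis
    by (induction a rule: poly_mapping_add_induct) (simp_all add: 1 distrib_right free_eval_add)
qed

lemma free_eval_gen [simp]: "free_eval g (free_gen x) = g x"
  by (simp add: free_gen_def free_eval_single)

lemma free_eval_scalar [simp]: "free_eval g (free_scalar c) = sc c"
  by (simp add: free_scalar_def free_eval_single zero_word_def)

lemma free_eval_1 [simp]: "free_eval g 1 = 1"
  using free_eval_scalar[of g 1] by (simp add: free_scalar_def single_one)

lemma free_eval_uminus: "free_eval g (- a) = - free_eval g a"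
  using free_eval_add[of g a "- a"] by (simp add: eq_neg_iff_add_eq_0 add.commute)

lemma free_eval_diff: "free_eval g (a - b) = free_eval g a - free_eval g b"
  using free_eval_add[of g a "- b"] by (simp add: free_eval_uminus)

text \<open>The representative is arbitrary. The value depends only on the class as soon as all
  relators evaluate to zero, because the polynomials with value zero form a two-sided ideal.\<close>

definition presented_lift :: "('g::presentation \<Rightarrow> 'r) \<Rightarrow> 'g presented \<Rightarrow> 'r" where
  "presented_lift g a = free_eval g (rep_presented a)"

context
  fixes g :: "'g::presentation \<Rightarrow> 'r"
  assumes relators: "\<And>r. r \<in> relators \<Longrightarrow> free_eval g r = 0"
begin

lemma presented_lift_abs: "presented_lift g (abs_presented f) = free_eval g f"
proof -
  have "two_sided_ideal relators \<subseteq> {f. free_eval g f = 0}"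
    by (rule two_sided_ideal_induct) (use relators in \<open>auto simp: free_eval_add free_eval_mult\<close>)
  moreover have "rep_presented (abs_presented f) - f \<in> two_sided_ideal relators"
    by (simp only: presented.abs_eq_iff[symmetric] Quotient3_abs_rep[OF Quotient3_presented])
  ultimately have "free_eval g (rep_presented (abs_presented f) - f) = 0" by blast
  thus ?thesis by (simp add: presented_lift_def free_eval_diff)
qed

lemma presented_lift_hom:
  "presented_lift g (a + b) = presented_lift g a + presented_lift g b"
  "presented_lift g (a * b) = presented_lift g a * presented_lift g b"
  "presented_lift g 1 = 1"
  "presented_lift g (scalar c) = sc c"
  "presented_lift g (gen x) = g x"
proof -
  show "presented_lift g (a + b) = presented_lift g a + presented_lift g b"
    by (induction a rule: presented.abs_induct, induction b rule: presented.abs_induct)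
       (simp add: plus_presented.abs_eq presented_lift_abs free_eval_add)
  show "presented_lift g (a * b) = presented_lift g a * presented_lift g b"
    by (induction a rule: presented.abs_induct, induction b rule: presented.abs_induct)
       (simp add: times_presented.abs_eq presented_lift_abs free_eval_mult)
  show "presented_lift g 1 = 1" by (simp add: one_presented_def presented_lift_abs)
  show "presented_lift g (scalar c) = sc c" by (simp add: scalar.abs_eq presented_lift_abs)
  show "presented_lift g (gen x) = g x" by (simp add: gen.abs_eq presented_lift_abs)
qed

end

end

interpretation scalar: central_scalars "scalar :: laurent \<Rightarrow> 'g::presentation presented"
  by unfold_locales (rule scalar_add scalar_mult scalar_1 scalar_central)+

lemma coeffwise_nth [simp]: "coeffwise h A $ n = h (A $ n)"
  by (simp add: coeffwise_def)

text \<open>A unital ring homomorphism. \<open>alg_hom\<close> makes sense only between presented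
  algebras, whereas maps into \<open>qtorus\<close> and coefficientwise maps of power series occur
  as well.\<close>

definition additive_mult :: "('a::ring_1 \<Rightarrow> 'b::ring_1) \<Rightarrow> bool" where
  "additive_mult f \<longleftrightarrow> (\<forall>a b. f (a + b) = f a + f b) \<and> (\<forall>a b. f (a * b) = f a * f b) \<and> f 1 = 1"

lemma alg_hom_additive_mult: "alg_hom f \<Longrightarrow> additive_mult f"
  by (auto simp: alg_hom_def additive_mult_def)

context
  fixes f :: "'a::ring_1 \<Rightarrow> 'b::ring_1"
  assumes f: "additive_mult f"
begin

lemma am_add: "f (a + b) = f a + f b"
  and am_mult: "f (a * b) = f a * f b"
  and am_1: "f 1 = 1"
  using f by (auto simp: additive_mult_def)

lemma am_0: "f 0 = 0"
  using am_add[of 0 0] by simp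

lemma am_uminus: "f (- a) = - f a"
  using am_add[of a "- a"] by (simp add: am_0 eq_neg_iff_add_eq_0 add.commute)

lemma am_diff: "f (a - b) = f a - f b"
  using am_add[of a "- b"] by (simp add: am_uminus)

lemma am_sum: "f (sum h A) = (\<Sum>x\<in>A. f (h x))"
  by (induction A rule: infinite_finite_induct) (auto simp: am_add am_0)

lemma am_power: "f (a ^ n) = f a ^ n"
  by (induction n) (auto simp: am_mult am_1)

lemma am_unit: "is_unit_elt a \<Longrightarrow> is_unit_elt (f a)"
  by (rule is_unit_eltI[of _ "f (unit_inv a)"])
     (simp_all add: unit_inv_left unit_inv_right am_1 flip: am_mult)

lemma am_unit_inv: "is_unit_elt a \<Longrightarrow> f (unit_inv a) = unit_inv (f a)"
  by (rule unit_inv_eqI[symmetric])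
     (simp_all add: unit_inv_left unit_inv_right am_1 flip: am_mult)

lemma am_inj: "(\<And>a. f a = 0 \<Longrightarrow> a = 0) \<Longrightarrow> inj f"
  by (rule injI) (metis am_diff right_minus_eq)

lemma additive_mult_coeffwise: "additive_mult (coeffwise f)"
  unfolding additive_mult_def
  by (auto simp: fps_eq_iff coeffwise_nth am_add am_mult am_1 am_0 am_sum fps_mult_nth)

end

lemma coeffwise_fps_const: "f 0 = 0 \<Longrightarrow> coeffwise f (fps_const c) = fps_const (f c)"
  by (auto simp: fps_eq_iff coeffwise_def)

lemma coeffwise_fps_X: "f 0 = 0 \<Longrightarrow> f 1 = 1 \<Longrightarrow> coeffwise f fps_X = fps_X"
  by (auto simp: fps_eq_iff coeffwise_def fps_X_def)

section \<open>The quantum torus as a group algebra\<close>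

text \<open>The generators of $A_q$ form one sequence $t_i$, with $t_{2i-1} = x_i$ and $t_{2i} = y_i$. In the
  lexicographic order on exponents the positions $0, 1, 2, 3, \dots$ belong to
  $t_1, t_0, t_2, t_{-1}, \dots$, so that both continued fractions move to ever less significant
  positions.\<close>

definition idx :: "nat \<Rightarrow> int" where
  "idx n = (if even n then int (n div 2) + 1 else - int (n div 2))"

definition pos :: "int \<Rightarrow> nat" where
  "pos i = (if 1 \<le> i then nat (2 * (i - 1)) else nat (1 - 2 * i))"

lemma idx_pos [simp]: "idx (pos i) = i"
  by (auto simp: idx_def pos_def even_nat_iff nat_div_distrib)

lemma pos_idx [simp]: "pos (idx n) = n"
  by (auto simp: idx_def pos_def elim!: evenE oddE)

lemma pos_eq_iff [simp]: "pos i = pos j \<longleftrightarrow> i = j"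
  by (metis idx_pos)

text \<open>The commutation relations of $A_q$ are $t_a t_b = q^{\epsilon(a,b)} t_b t_a$.\<close>

definition eps :: "int \<Rightarrow> int \<Rightarrow> int" where
  "eps a b = (if a = b then 0 else (if a < b then 1 else - 1) * (if even (a - b) then 1 else - 1))"

lemma eps_antisym: "eps b a = - eps a b"
  by (auto simp: eps_def)

lemma eps_same [simp]: "eps a a = 0"
  by (simp add: eps_def)

text \<open>The power of q that arises when the factors of t^e and t^f are merged into the order of
  positions: only a factor of t^e at a later position m has to pass a factor of t^f at n.
  Bilinearity makes this a 2-cocycle, whence associativity of the product below.\<close>

definition ecoc :: "(nat \<Rightarrow>\<^sub>0 int) \<Rightarrow> (nat \<Rightarrow>\<^sub>0 int) \<Rightarrow> int" where
  "ecoc e f = (\<Sum>m\<in>Poly_Mapping.keys e. \<Sum>n\<in>Poly_Mapping.keys f.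
     Poly_Mapping.lookup e m * Poly_Mapping.lookup f n * (if n < m then eps (idx m) (idx n) else 0))"

lemma ecoc_superset:
  assumes "finite K" "finite L" "Poly_Mapping.keys e \<subseteq> K" "Poly_Mapping.keys f \<subseteq> L"
  shows "ecoc e f = (\<Sum>m\<in>K. \<Sum>n\<in>L.
     Poly_Mapping.lookup e m * Poly_Mapping.lookup f n * (if n < m then eps (idx m) (idx n) else 0))"
proof -
  have "ecoc e f = (\<Sum>m\<in>Poly_Mapping.keys e. \<Sum>n\<in>L.
     Poly_Mapping.lookup e m * Poly_Mapping.lookup f n * (if n < m then eps (idx m) (idx n) else 0))"
    unfolding ecoc_def
    by (intro sum.cong refl sum.mono_neutral_left) (use assms in \<open>auto simp: in_keys_iff\<close>)
  also have "\<dots> = (\<Sum>m\<in>K. \<Sum>n\<in>L.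
     Poly_Mapping.lookup e m * Poly_Mapping.lookup f n * (if n < m then eps (idx m) (idx n) else 0))"
    by (intro sum.mono_neutral_left) (use assms in \<open>auto simp: in_keys_iff\<close>)
  finally show ?thesis .
qed

lemma ecoc_add_left: "ecoc (e + e') f = ecoc e f + ecoc e' f"
  by (subst (1 2 3) ecoc_superset[of "Poly_Mapping.keys e \<union> Poly_Mapping.keys e'" "Poly_Mapping.keys f"])
     (use Poly_Mapping.keys_add[of e e'] in \<open>auto simp: lookup_add distrib_right sum.distrib\<close>)

lemma ecoc_add_right: "ecoc e (f + f') = ecoc e f + ecoc e f'"
  by (subst (1 2 3) ecoc_superset[of "Poly_Mapping.keys e" "Poly_Mapping.keys f \<union> Poly_Mapping.keys f'"])
     (use Poly_Mapping.keys_add[of f f'] in \<open>auto simp: lookup_add distrib_right distrib_left sum.distrib\<close>)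

lemma ecoc_0 [simp]: "ecoc 0 f = 0" "ecoc e 0 = 0"
  by (simp_all add: ecoc_def)

lemma ecoc_single:
  "ecoc (Poly_Mapping.single m a) (Poly_Mapping.single n b) = a * b * (if n < m then eps (idx m) (idx n) else 0)"
  by (subst ecoc_superset[of "{m}" "{n}"]) auto

text \<open>The basis element $q^c t^e$ of the quantum torus, with the factors of $t^e$ in the order of their
  positions. Leading terms refer to the order that compares \<open>e\<close> before \<open>c\<close>; the quantum torus has no zero
  divisors because they are multiplicative.\<close>

datatype heis = Heis (hc: int) (he: "nat \<Rightarrow>\<^sub>0 int")

instantiation heis :: monoid_add
begin

definition zero_heis :: heis where "zero_heis = Heis 0 0"

definition plus_heis :: "heis \<Rightarrow> heis \<Rightarrow> heis" where
  "plus_heis a b = Heis (hc a + hc b + ecoc (he a) (he b)) (he a + he b)"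

instance
  by standard (auto simp: zero_heis_def plus_heis_def ecoc_add_left ecoc_add_right add.assoc)

end

lemma he_add [simp]: "he (a + b) = he a + he b"
  by (simp add: plus_heis_def)

instantiation heis :: linorder
begin

definition less_heis :: "heis \<Rightarrow> heis \<Rightarrow> bool" where
  "less_heis a b \<longleftrightarrow> he a < he b \<or> he a = he b \<and> hc a < hc b"

definition less_eq_heis :: "heis \<Rightarrow> heis \<Rightarrow> bool" where
  "less_eq_heis a b \<longleftrightarrow> he a < he b \<or> he a = he b \<and> hc a \<le> hc b"

instance
  by standard (auto simp: less_heis_def less_eq_heis_def heis.expand)

end

lemma heis_add_strict_right_mono: "a < b \<Longrightarrow> a + c < b + c"
  and heis_add_strict_left_mono: "a < b \<Longrightarrow> c + a < c + b" for a b c :: heis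
  by (auto simp: less_heis_def plus_heis_def)

lemma heis_add_mono:
  fixes a b :: heis
  assumes "a \<le> a'" "b \<le> b'"
  shows "a + b \<le> a' + b'"
proof -
  have "a + b \<le> a' + b"
    using assms(1) heis_add_strict_right_mono[of a a' b] by (auto simp: order_le_less)
  also have "\<dots> \<le> a' + b'"
    using assms(2) heis_add_strict_left_mono[of b b' a'] by (auto simp: order_le_less)
  finally show ?thesis .
qed

lemma heis_add_strict_mono1:
  fixes a b :: heis
  assumes "a < a'" "b \<le> b'"
  shows "a + b < a' + b'"
  using heis_add_strict_right_mono[OF assms(1), of b] heis_add_mono[OF order.refl assms(2), of a']
  by (rule less_le_trans)

lemma heis_add_strict_mono2:
  fixes a b :: heis
  assumes "a \<le> a'" "b < b'"
  shows "a + b < a' + b'"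
  using heis_add_strict_left_mono[OF assms(2), of a] heis_add_mono[OF assms(1) order.refl, of b']
  by (rule less_le_trans)

section \<open>Leading terms in the group algebra\<close>

type_synonym qtorus = "heis \<Rightarrow>\<^sub>0 complex"

definition lead :: "qtorus \<Rightarrow> heis" where
  "lead f = Max (Poly_Mapping.keys f)"

lemma lead_in_keys: "f \<noteq> 0 \<Longrightarrow> lead f \<in> Poly_Mapping.keys f"
  unfolding lead_def by (intro Max_in) auto

lemma lead_ge: "k \<in> Poly_Mapping.keys f \<Longrightarrow> k \<le> lead f"
  unfolding lead_def by (intro Max_ge) auto

lemma lead_eqI: "a \<in> Poly_Mapping.keys f \<Longrightarrow> (\<And>k. k \<in> Poly_Mapping.keys f \<Longrightarrow> k \<le> a) \<Longrightarrow> lead f = a"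
  unfolding lead_def by (intro Max_eqI) auto

lemma lead_single: "c \<noteq> 0 \<Longrightarrow> lead (Poly_Mapping.single k c) = k"
  by (rule lead_eqI) auto

text \<open>The coefficients at the upper bounds a and b are split off; strict monotonicity of
  addition in both arguments keeps all other products below a + b.\<close>

lemma lookup_top:
  fixes f g :: qtorus
  assumes "\<And>k. k \<in> Poly_Mapping.keys f \<Longrightarrow> k \<le> a" "\<And>k. k \<in> Poly_Mapping.keys g \<Longrightarrow> k \<le> b"
  shows "Poly_Mapping.lookup (f * g) (a + b) = Poly_Mapping.lookup f a * Poly_Mapping.lookup g b"
proof -
  define c where "c = Poly_Mapping.lookup f a"
  define d where "d = Poly_Mapping.lookup g b"
  define f' where "f' = f - Poly_Mapping.single a c"
  define g' where "g' = g - Poly_Mapping.single b d"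
  have f': "k < a" if "k \<in> Poly_Mapping.keys f'" for k
  proof -
    have "k \<noteq> a" "k \<in> Poly_Mapping.keys f"
      using that by (auto simp: f'_def in_keys_iff lookup_minus lookup_single c_def when_def split: if_splits)
    thus ?thesis using assms(1) by force
  qed
  have g': "k < b" if "k \<in> Poly_Mapping.keys g'" for k
  proof -
    have "k \<noteq> b" "k \<in> Poly_Mapping.keys g"
      using that by (auto simp: g'_def in_keys_iff lookup_minus lookup_single d_def when_def split: if_splits)
    thus ?thesis using assms(2) by force
  qed
  have 1: "Poly_Mapping.lookup (f' * g) (a + b) = 0"
  proof -
    have "a + b \<notin> Poly_Mapping.keys (f' * g)"
      using keys_mult[of f' g] f' assms(2) heis_add_strict_mono1 by fastforce
    thus ?thesis by (simp add: in_keys_iff)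
  qed
  have 2: "Poly_Mapping.lookup (Poly_Mapping.single a c * g') (a + b) = 0"
  proof -
    have "a + b \<notin> Poly_Mapping.keys (Poly_Mapping.single a c * g')"
      using keys_mult[of "Poly_Mapping.single a c" g'] g' heis_add_strict_mono2[of a a]
      by (fastforce split: if_splits)
    thus ?thesis by (simp add: in_keys_iff)
  qed
  have "f * g = Poly_Mapping.single a c * Poly_Mapping.single b d + Poly_Mapping.single a c * g' + f' * g"
    by (simp add: f'_def g'_def algebra_simps)
  thus ?thesis by (simp add: lookup_add 1 2 mult_single) (simp add: c_def d_def)
qed

lemma qtorus_mult_nonzero:
  fixes f g :: qtorus
  assumes "f \<noteq> 0" "g \<noteq> 0"
  shows "f * g \<noteq> 0" and "lead (f * g) = lead f + lead g"
proof -
  have l: "Poly_Mapping.lookup (f * g) (lead f + lead g) \<noteq> 0"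
    using lookup_top[of f "lead f" g "lead g"] lead_ge lead_in_keys assms by (auto simp: in_keys_iff)
  thus "f * g \<noteq> 0" by auto
  show "lead (f * g) = lead f + lead g"
  proof (rule lead_eqI)
    show "lead f + lead g \<in> Poly_Mapping.keys (f * g)" using l by (simp add: in_keys_iff)
    show "k \<le> lead f + lead g" if "k \<in> Poly_Mapping.keys (f * g)" for k
      using keys_mult[of f g] that lead_ge heis_add_mono by blast
  qed
qed

lemma lead_add_less:
  assumes "f \<noteq> 0" "\<And>k. k \<in> Poly_Mapping.keys g \<Longrightarrow> k < lead f"
  shows "f + g \<noteq> 0" and "lead (f + g) = lead f"
proof -
  have "Poly_Mapping.lookup g (lead f) = 0" using assms(2) by (meson in_keys_iff less_irrefl)
  hence l: "Poly_Mapping.lookup (f + g) (lead f) \<noteq> 0"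
    using lead_in_keys[OF assms(1)] by (simp add: lookup_add in_keys_iff)
  thus "f + g \<noteq> 0" by auto
  show "lead (f + g) = lead f"
  proof (rule lead_eqI)
    show "lead f \<in> Poly_Mapping.keys (f + g)" using l by (simp add: in_keys_iff)
    show "k \<le> lead f" if "k \<in> Poly_Mapping.keys (f + g)" for k
      using Poly_Mapping.keys_add[of f g] that lead_ge[of _ f] assms(2) by force
  qed
qed

lemma keys_sum_less:
  assumes "\<And>x k. x \<in> A \<Longrightarrow> k \<in> Poly_Mapping.keys (F x) \<Longrightarrow> k < (b::'k::order)"
  shows "k \<in> Poly_Mapping.keys (sum F A) \<Longrightarrow> k < b"
  using assms
proof (induction A arbitrary: k rule: infinite_finite_induct)
  case (insert x A)
  thus ?case using Poly_Mapping.keys_add[of "F x" "sum F A"] by fastforce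
qed auto

text \<open>The largest of the leading terms cannot be cancelled by the other summands.\<close>

lemma sum_distinct_leads_nonzero:
  assumes "finite A" "A \<noteq> {}" "\<And>x. x \<in> A \<Longrightarrow> F x \<noteq> 0" "inj_on (\<lambda>x. lead (F x)) A"
  shows "sum F A \<noteq> 0"
proof -
  let ?l = "\<lambda>x. lead (F x)"
  have "Max (?l ` A) \<in> ?l ` A" using assms(1,2) by (intro Max_in) auto
  then obtain x where x: "x \<in> A" "?l x = Max (?l ` A)" by auto
  have "k < lead (F x)" if "k \<in> Poly_Mapping.keys (sum F (A - {x}))" for k
  proof (rule keys_sum_less[OF _ that])
    fix y k assume y: "y \<in> A - {x}" "k \<in> Poly_Mapping.keys (F y)"
    have "?l y \<noteq> ?l x" using assms(4) x(1) y(1) by (auto dest: inj_onD)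
    moreover have "?l y \<le> ?l x" unfolding x(2) using assms(1) y(1) by auto
    ultimately show "k < lead (F x)" using lead_ge[OF y(2)] by simp
  qed
  from lead_add_less(1)[OF assms(3)[OF x(1)] this]
  show ?thesis using assms(1) x(1) by (simp add: sum.remove)
qed

text \<open>The variable q becomes the central group element \<open>Heis 1 0\<close>, so that the
  torus is an algebra over the complex numbers alone.\<close>

definition qt_scalar :: "laurent \<Rightarrow> qtorus" where
  "qt_scalar c = (\<Sum>k\<in>Poly_Mapping.keys c. Poly_Mapping.single (Heis k 0) (Poly_Mapping.lookup c k))"

lemma qt_scalar_superset:
  "finite K \<Longrightarrow> Poly_Mapping.keys c \<subseteq> K \<Longrightarrow>
     qt_scalar c = (\<Sum>k\<in>K. Poly_Mapping.single (Heis k 0) (Poly_Mapping.lookup c k))"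
  unfolding qt_scalar_def by (rule sum.mono_neutral_left) (auto simp: in_keys_iff)

lemma qt_scalar_single: "qt_scalar (Poly_Mapping.single k c) = Poly_Mapping.single (Heis k 0) c"
  by (subst qt_scalar_superset[of "{k}"]) auto

lemma qt_scalar_0 [simp]: "qt_scalar 0 = 0"
  by (simp add: qt_scalar_def)

lemma qt_scalar_add: "qt_scalar (a + b) = qt_scalar a + qt_scalar b"
proof -
  let ?K = "Poly_Mapping.keys a \<union> Poly_Mapping.keys b"
  show ?thesis
    by (subst (1 2 3) qt_scalar_superset[of ?K])
       (use Poly_Mapping.keys_add[of a b] in \<open>auto simp: lookup_add single_add sum.distrib\<close>)
qed

lemma qt_scalar_mult: "qt_scalar (a * b) = qt_scalar a * qt_scalar b"
proof -
  have 1: "qt_scalar (Poly_Mapping.single k c * b) = qt_scalar (Poly_Mapping.single k c) * qt_scalar b" for k c b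
    by (induction b rule: poly_mapping_add_induct)
       (simp_all add: mult_single qt_scalar_single qt_scalar_add plus_heis_def distrib_left)
  show ?thesis
    by (induction a rule: poly_mapping_add_induct) (simp_all add: 1 qt_scalar_add distrib_right)
qed

lemma qt_scalar_central: "qt_scalar c * x = x * qt_scalar c"
proof -
  have 1: "qt_scalar (Poly_Mapping.single k c) * x = x * qt_scalar (Poly_Mapping.single k c)" for k c
    by (induction x rule: poly_mapping_add_induct)
       (simp_all add: mult_single qt_scalar_single plus_heis_def distrib_left distrib_right add.commute mult.commute)
  show ?thesis
    by (induction c rule: poly_mapping_add_induct) (simp_all add: 1 qt_scalar_add distrib_right distrib_left)
qed

lemma qt_scalar_1 [simp]: "qt_scalar 1 = 1"
  using qt_scalar_single[of 0 1] by (simp flip: zero_heis_def)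

interpretation qts: central_scalars qt_scalar
  by unfold_locales (fact qt_scalar_add qt_scalar_mult qt_scalar_1 qt_scalar_central)+

lemma he_keys_qt_scalar:
  assumes "k \<in> Poly_Mapping.keys (qt_scalar c)"
  shows "he k = 0"
proof -
  have "k \<in> (\<Union>j\<in>Poly_Mapping.keys c. Poly_Mapping.keys (Poly_Mapping.single (Heis j 0) (Poly_Mapping.lookup c j)))"
    by (rule subsetD[OF Poly_Mapping.keys_sum assms[unfolded qt_scalar_def]])
  thus ?thesis by (auto split: if_splits)
qed

lemma qt_scalar_eq_0_iff [simp]: "qt_scalar c = 0 \<longleftrightarrow> c = 0"
proof
  assume 0: "qt_scalar c = 0"
  show "c = 0"
  proof (rule ccontr)
    assume "c \<noteq> 0"
    have "(\<Sum>k\<in>Poly_Mapping.keys c. Poly_Mapping.single (Heis k 0) (Poly_Mapping.lookup c k)) \<noteq> 0"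
    proof (rule sum_distinct_leads_nonzero)
      show "inj_on (\<lambda>k. lead (Poly_Mapping.single (Heis k 0) (Poly_Mapping.lookup c k))) (Poly_Mapping.keys c)"
        by (rule inj_onI) (simp add: lead_single in_keys_iff)
      show "Poly_Mapping.single (Heis k 0) (Poly_Mapping.lookup c k) \<noteq> 0" if "k \<in> Poly_Mapping.keys c" for k
        using that by (metis in_keys_iff lookup_single_eq lookup_zero)
    qed (use \<open>c \<noteq> 0\<close> in simp_all)
    thus False using 0 by (simp add: qt_scalar_def)
  qed
qed simp

lemma he_lead_qt_scalar: "c \<noteq> 0 \<Longrightarrow> he (lead (qt_scalar c)) = 0"
  by (rule he_keys_qt_scalar[OF lead_in_keys]) simp

section \<open>The algebra $A_q$ as a quantum torus\<close>

definition qpow :: "int \<Rightarrow> laurent" where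
  "qpow k = Poly_Mapping.single k 1"

lemma qpow_add: "qpow (a + b) = qpow a * qpow b"
  by (simp add: qpow_def mult_single)

lemma qpow_0 [simp]: "qpow 0 = 1"
  by (simp add: qpow_def)

lemma qpow_uminus [simp]: "qpow a * qpow (- a) = 1" "qpow (- a) * qpow a = 1"
  by (simp_all flip: qpow_add)

lemma qvar_eq_qpow: "qvar = qpow 1" "qvar_inv = qpow (- 1)"
  by (simp_all add: qvar_def qvar_inv_def qpow_def)

section \<open>Calculus of q-commuting elements\<close>

context central_scalars
begin

lemma sc_qpow_cancel [simp]:
  "sc (qpow a) * (sc (qpow (- a)) * x) = x" "sc (qpow (- a)) * (sc (qpow a) * x) = x"
  by (simp_all flip: sc_mult mult.assoc)

lemma sc_qpow_cancel_right [simp]: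
  "sc (qpow a) * sc (qpow (- a)) = 1" "sc (qpow (- a)) * sc (qpow a) = 1"
  by (simp_all flip: sc_mult)

lemma qcomm_swap:
  assumes "x * y = sc (qpow c) * (y * x)"
  shows "y * x = sc (qpow (- c)) * (x * y)"
  by (simp add: assms)

lemma qcomm_unit_inv:
  assumes "is_unit_elt y" "x * y = sc (qpow c) * (y * x)"
  shows "x * unit_inv y = sc (qpow (- c)) * (unit_inv y * x)"
proof (rule unit_cancel_right[OF assms(1)])
  have "sc (qpow (- c)) * (unit_inv y * x) * y = unit_inv y * y * x"
    by (simp add: mult.assoc assms(2) sc_left_commute[of "unit_inv y"])
  thus "x * unit_inv y * y = sc (qpow (- c)) * (unit_inv y * x) * y"
    using assms(1) by (simp add: mult.assoc unit_inv_left)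
qed

lemma qcomm_unit_inv':
  assumes "is_unit_elt y" "y * x = sc (qpow c) * (x * y)"
  shows "unit_inv y * x = sc (qpow (- c)) * (x * unit_inv y)"
  using qcomm_swap[OF qcomm_unit_inv[OF assms(1) qcomm_swap[OF assms(2)]]] by simp

lemma qcomm_mult:
  assumes "x * y = sc (qpow c) * (y * x)" "x * z = sc (qpow d) * (z * x)"
  shows "x * (y * z) = sc (qpow (c + d)) * ((y * z) * x)"
proof -
  have "x * (y * z) = sc (qpow c) * (y * (x * z))"
    by (metis assms(1) mult.assoc)
  also have "\<dots> = sc (qpow c) * (y * (sc (qpow d) * (z * x)))"
    by (simp only: assms(2))
  also have "\<dots> = sc (qpow (c + d)) * ((y * z) * x)"
    by (simp only: qpow_add sc_mult mult.assoc sc_left_commute[of y])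
  finally show ?thesis .
qed

lemma qcomm_mult':
  assumes "y * x = sc (qpow c) * (x * y)" "z * x = sc (qpow d) * (x * z)"
  shows "(y * z) * x = sc (qpow (c + d)) * (x * (y * z))"
  using qcomm_swap[OF qcomm_mult[OF qcomm_swap[OF assms(1)] qcomm_swap[OF assms(2)]]] by (simp add: add.commute)

definition aq_assign :: "(int \<Rightarrow> 'r) \<Rightarrow> aq_gen \<Rightarrow> 'r" where
  "aq_assign \<tau> g = (case g of GX i \<Rightarrow> \<tau> (2 * i - 1) | GX_inv i \<Rightarrow> unit_inv (\<tau> (2 * i - 1))
     | GY i \<Rightarrow> \<tau> (2 * i) | GY_inv i \<Rightarrow> unit_inv (\<tau> (2 * i)))"

lemma aq_relators:
  assumes "\<And>i. is_unit_elt (\<tau> i)"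
    and "\<And>a b. a < b \<Longrightarrow> \<tau> a * \<tau> b = sc (qpow (eps a b)) * (\<tau> b * \<tau> a)"
    and "r \<in> relators"
  shows "free_eval (aq_assign \<tau>) r = 0"
  using assms(3) unfolding relators_aq_gen_def Let_def
  by (auto simp: free_eval_diff free_eval_mult aq_assign_def assms(1,2) unit_inv_left unit_inv_right
      qvar_eq_qpow eps_def)

end

lemma abs_presented_hom:
  fixes a b :: "'g::presentation free_algebra"
  shows "abs_presented (a + b) = abs_presented a + abs_presented b"
    "abs_presented (a - b) = abs_presented a - abs_presented b"
    "abs_presented (a * b) = abs_presented a * abs_presented b"
    "abs_presented (1 :: 'g free_algebra) = 1"
    "abs_presented (0 :: 'g free_algebra) = 0"
    "abs_presented (free_gen g) = gen (g :: 'g)"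
    "abs_presented (free_scalar c :: 'g free_algebra) = scalar c"
  by (simp_all add: plus_presented.abs_eq minus_presented.abs_eq times_presented.abs_eq
      one_presented_def zero_presented_def gen.abs_eq scalar.abs_eq)

lemma aq_inverse_relations:
  "xA i * gen (GX_inv i) = 1" "gen (GX_inv i) * xA i = 1"
  "yA i * gen (GY_inv i) = 1" "gen (GY_inv i) * yA i = 1"
proof -
  have "abs_presented (free_gen (GX i) * free_gen (GX_inv i) - 1) = 0"
    "abs_presented (free_gen (GX_inv i) * free_gen (GX i) - 1) = 0"
    "abs_presented (free_gen (GY i) * free_gen (GY_inv i) - 1) = 0"
    "abs_presented (free_gen (GY_inv i) * free_gen (GY i) - 1) = 0"
    by (rule relator_eq_0; auto simp: relators_aq_gen_def Let_def)+
  thus "xA i * gen (GX_inv i) = 1" "gen (GX_inv i) * xA i = 1"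
    "yA i * gen (GY_inv i) = 1" "gen (GY_inv i) * yA i = 1"
    by (simp_all add: abs_presented_hom)
qed

lemma aq_exchange_relations:
  "k < l \<Longrightarrow> xA k * xA l = scalar (qpow 1) * (xA l * xA k)"
  "k < l \<Longrightarrow> yA k * yA l = scalar (qpow 1) * (yA l * yA k)"
  "k < l \<Longrightarrow> yA k * xA l = scalar (qpow (- 1)) * (xA l * yA k)"
  "k \<le> l \<Longrightarrow> xA k * yA l = scalar (qpow (- 1)) * (yA l * xA k)"
proof -
  have 1: "abs_presented (free_gen (GX k) * free_gen (GX l) - free_scalar qvar * (free_gen (GX l) * free_gen (GX k))) = 0"
    if "k < l" for k l using that by (intro relator_eq_0) (auto simp: relators_aq_gen_def Let_def)
  have 2: "abs_presented (free_gen (GY k) * free_gen (GY l) - free_scalar qvar * (free_gen (GY l) * free_gen (GY k))) = 0"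
    if "k < l" for k l using that by (intro relator_eq_0) (auto simp: relators_aq_gen_def Let_def)
  have 3: "abs_presented (free_gen (GY k) * free_gen (GX l) - free_scalar qvar_inv * (free_gen (GX l) * free_gen (GY k))) = 0"
    if "k < l" for k l using that by (intro relator_eq_0) (auto simp: relators_aq_gen_def Let_def)
  have 4: "abs_presented (free_gen (GX k) * free_gen (GY l) - free_scalar qvar_inv * (free_gen (GY l) * free_gen (GX k))) = 0"
    if "k \<le> l" for k l using that by (intro relator_eq_0) (auto simp: relators_aq_gen_def Let_def)
  show "k < l \<Longrightarrow> xA k * xA l = scalar (qpow 1) * (xA l * xA k)"
    using 1 by (simp add: abs_presented_hom qvar_eq_qpow)
  show "k < l \<Longrightarrow> yA k * yA l = scalar (qpow 1) * (yA l * yA k)"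
    using 2 by (simp add: abs_presented_hom qvar_eq_qpow)
  show "k < l \<Longrightarrow> yA k * xA l = scalar (qpow (- 1)) * (xA l * yA k)"
    using 3 by (simp add: abs_presented_hom qvar_eq_qpow)
  show "k \<le> l \<Longrightarrow> xA k * yA l = scalar (qpow (- 1)) * (yA l * xA k)"
    using 4 by (simp add: abs_presented_hom qvar_eq_qpow)
qed

definition tA :: "int \<Rightarrow> aq" where
  "tA i = (if odd i then xA ((i + 1) div 2) else yA (i div 2))"

lemma tA_odd: "tA (2 * k - 1) = xA k" and tA_even: "tA (2 * k) = yA k"
  by (auto simp: tA_def)

lemma is_unit_tA: "is_unit_elt (tA i)"
  unfolding tA_def by (auto intro: is_unit_eltI aq_inverse_relations)

lemma unit_inv_tA: "unit_inv (xA k) = gen (GX_inv k)" "unit_inv (yA k) = gen (GY_inv k)"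
  using aq_inverse_relations by (auto intro: unit_inv_eqI)

lemma tA_comm_less: "a < b \<Longrightarrow> tA a * tA b = scalar (qpow (eps a b)) * (tA b * tA a)"
proof -
  assume ab: "a < b"
  consider k l where "a = 2 * k - 1" "b = 2 * l - 1" | k l where "a = 2 * k" "b = 2 * l"
    | k l where "a = 2 * k - 1" "b = 2 * l" | k l where "a = 2 * k" "b = 2 * l - 1"
  proof -
    have "\<exists>k. a = 2 * k \<or> a = 2 * k - 1" "\<exists>k. b = 2 * k \<or> b = 2 * k - 1" by presburger+
    thus thesis using that by auto
  qed
  thus ?thesis
    by cases (use ab in \<open>auto simp: tA_odd tA_even aq_exchange_relations eps_def\<close>)
qed

lemma tA_comm: "tA a * tA b = scalar (qpow (eps a b)) * (tA b * tA a)"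
proof -
  consider "a < b" | "a = b" | "b < a" by linarith
  thus ?thesis
  proof cases
    case 3
    show ?thesis using scalar.qcomm_swap[OF tA_comm_less[OF 3]] by (simp add: eps_antisym[of b a])
  qed (use tA_comm_less in auto)
qed

lemma aq_induct [case_names scalar tA tA_inv add mult]:
  assumes "\<And>c. P (scalar c)" "\<And>i. P (tA i)" "\<And>i. P (unit_inv (tA i))"
    "\<And>a b. P a \<Longrightarrow> P b \<Longrightarrow> P (a + b)" "\<And>a b. P a \<Longrightarrow> P b \<Longrightarrow> P (a * b)"
  shows "P a"
proof (induction a rule: presented_induct)
  case (gen g)
  have "P (xA k)" "P (yA k)" "P (gen (GX_inv k))" "P (gen (GY_inv k))" for k
    using assms(2,3)[of "2 * k"] assms(2,3)[of "2 * k - 1"]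
    by (simp_all only: tA_odd tA_even unit_inv_tA)
  thus ?case by (cases g) auto
qed (use assms in auto)

lemma aq_hom_eqI:
  assumes "additive_mult f" "additive_mult g" "\<And>c. f (scalar c) = g (scalar c)" "\<And>i. f (tA i) = g (tA i)"
  shows "f = g"
proof
  fix a show "f a = g a"
    by (induction a rule: aq_induct)
       (use assms in \<open>simp_all add: am_add am_mult am_unit_inv is_unit_tA\<close>)
qed

context central_scalars
begin

context
  fixes \<tau> :: "int \<Rightarrow> 'r"
  assumes unit: "\<And>i. is_unit_elt (\<tau> i)"
    and comm: "\<And>a b. a < b \<Longrightarrow> \<tau> a * \<tau> b = sc (qpow (eps a b)) * (\<tau> b * \<tau> a)"
begin

lemma aq_lift_hom: "additive_mult (presented_lift (aq_assign \<tau>))"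
  and aq_lift_scalar: "presented_lift (aq_assign \<tau>) (scalar c) = sc c"
  and aq_lift_tA: "presented_lift (aq_assign \<tau>) (tA i) = \<tau> i"
proof -
  note * = presented_lift_hom[of "aq_assign \<tau>", OF aq_relators[OF unit comm]]
  show "additive_mult (presented_lift (aq_assign \<tau>))"
    by (simp add: additive_mult_def *)
  show "presented_lift (aq_assign \<tau>) (scalar c) = sc c" by (simp add: *)
  show "presented_lift (aq_assign \<tau>) (tA i) = \<tau> i"
    by (cases "even i") (auto simp: tA_def * aq_assign_def algebra_simps elim!: evenE oddE)
qed

end

end

definition tq :: "int \<Rightarrow> int \<Rightarrow> qtorus" where
  "tq i z = Poly_Mapping.single (Heis 0 (Poly_Mapping.single (pos i) z)) 1"

lemma tq_mult: "tq i z * tq i w = tq i (z + w)"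
  by (simp add: tq_def mult_single plus_heis_def ecoc_single single_add)

lemma tq_0: "tq i 0 = 1"
  by (simp add: tq_def flip: zero_heis_def)

lemma is_unit_tq: "is_unit_elt (tq i z)"
  by (rule is_unit_eltI[of _ "tq i (- z)"]) (simp_all add: tq_mult tq_0)

lemma unit_inv_tq: "unit_inv (tq i z) = tq i (- z)"
  by (rule unit_inv_eqI) (simp_all add: tq_mult tq_0)

lemma tq_comm: "tq a 1 * tq b 1 = qt_scalar (qpow (eps a b)) * (tq b 1 * tq a 1)"
proof -
  have "pos a < pos b \<or> a = b \<or> pos b < pos a" by (metis linorder_neqE_nat pos_eq_iff)
  thus ?thesis
    using eps_antisym[of a b]
    by (auto simp: tq_def mult_single plus_heis_def ecoc_single qpow_def qt_scalar_single add.commute)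
qed

definition to_qt :: "aq \<Rightarrow> qtorus" where
  "to_qt = qts.presented_lift (qts.aq_assign (\<lambda>i. tq i 1))"

lemma to_qt_hom: "additive_mult to_qt"
  and to_qt_scalar: "to_qt (scalar c) = qt_scalar c"
  and to_qt_tA: "to_qt (tA i) = tq i 1"
  unfolding to_qt_def
  by (rule qts.aq_lift_hom qts.aq_lift_scalar qts.aq_lift_tA; rule is_unit_tq tq_comm)+

section \<open>Ordered monomials and faithfulness of the map into the group algebra\<close>

definition zpow :: "'a::ring_1 \<Rightarrow> int \<Rightarrow> 'a" where
  "zpow a z = (if 0 \<le> z then a ^ nat z else unit_inv a ^ nat (- z))"

lemma zpow_0 [simp]: "zpow a 0 = 1"
  by (simp add: zpow_def)

lemma zpow_step:
  assumes "is_unit_elt a"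
  shows "a * zpow a z = zpow a (z + 1)" "unit_inv a * zpow a z = zpow a (z - 1)"
proof -
  consider "z \<ge> 0" | "z = - 1" | "z < - 1" by linarith
  thus "a * zpow a z = zpow a (z + 1)"
  proof cases
    case 3
    hence "z = - int (nat (- z - 2)) - 2" by simp
    then obtain n where "z = - int n - 2" by blast
    hence "nat (- z) = Suc (Suc n)" "nat (- (z + 1)) = Suc n" "\<not> 0 \<le> z" "\<not> 0 \<le> z + 1" by auto
    thus ?thesis using assms
      by (simp add: zpow_def unit_inv_right')
  qed (use assms in \<open>auto simp: zpow_def nat_add_distrib unit_inv_right\<close>)
  consider "z > 0" | "z \<le> 0" by linarith
  thus "unit_inv a * zpow a z = zpow a (z - 1)"
  proof cases
    case 1
    then obtain n where "z = int (Suc n)" by (metis zero_less_imp_eq_int gr0_conv_Suc)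
    hence "nat z = Suc n" "nat (z - 1) = n" "0 \<le> z" "0 \<le> z - 1" by auto
    thus ?thesis using assms by (simp add: zpow_def unit_inv_left')
  next
    case 2
    then obtain n where "z = - int n" by (metis nonpos_int_cases)
    thus ?thesis using assms by (auto simp: zpow_def nat_add_distrib)
  qed
qed

interpretation lmod: Modules.module "\<lambda>(c::laurent) (x::'g::presentation presented). scalar c * x"
  by unfold_locales (simp_all add: distrib_left distrib_right scalar_add scalar_mult mult.assoc)

text \<open>The factors stand in the order of positions, as in the basis of \<open>qtorus\<close>,
  so that \<open>to_qt\<close> sends the monomial to a single basis element.\<close>

definition tmon :: "(nat \<Rightarrow> int) \<Rightarrow> nat \<Rightarrow> aq" where
  "tmon e N = (\<Prod>n\<leftarrow>[0..<N]. zpow (tA (idx n)) (e n))"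

lemma tmon_Suc: "tmon e (Suc N) = tmon e N * zpow (tA (idx N)) (e N)"
  by (simp add: tmon_def)

lemma tmon_extend:
  assumes "N \<le> L" "\<And>n. N \<le> n \<Longrightarrow> e n = 0"
  shows "tmon e L = tmon e N"
  using assms(1) by (induction L rule: dec_induct) (auto simp: tmon_def assms(2))

lemma tmon_cong: "(\<And>n. n < N \<Longrightarrow> e n = e' n) \<Longrightarrow> tmon e N = tmon e' N"
  unfolding tmon_def by (intro arg_cong[where f = prod_list] map_cong) auto

lemma qcomm_zpow:
  assumes "x * a = scalar (qpow c) * (a * x)" "is_unit_elt a"
  shows "\<exists>d. x * zpow a z = scalar (qpow d) * (zpow a z * x)"
proof -
  have *: "\<exists>d. x * b ^ n = scalar (qpow d) * (b ^ n * x)" if b: "x * b = scalar (qpow c) * (b * x)" for b c n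
  proof (induction n)
    case 0
    show ?case by (intro exI[of _ 0]) simp
  next
    case (Suc n)
    thus ?case using scalar.qcomm_mult[OF b] by auto
  qed
  show ?thesis
    using *[OF assms(1)] *[OF scalar.qcomm_unit_inv[OF assms(2,1)]] by (simp add: zpow_def)
qed

text \<open>The factor x q-commutes with all powers of all generators; it is carried past the
  positions before j and merged with the power at j.\<close>

lemma tA_mult_tmon:
  assumes "j < N" "z = 1 \<and> x = tA (idx j) \<or> z = - 1 \<and> x = unit_inv (tA (idx j))"
  shows "\<exists>d. x * tmon e N = scalar (qpow d) * tmon (e(j := e j + z)) N"
proof -
  have step: "x * zpow (tA (idx j)) w = zpow (tA (idx j)) (w + z)" for w
    using zpow_step[OF is_unit_tA, of "idx j" w] assms(2) by auto
  have comm: "\<exists>d. x * zpow (tA (idx n)) w = scalar (qpow d) * (zpow (tA (idx n)) w * x)" for n w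
    using assms(2) qcomm_zpow[OF tA_comm is_unit_tA]
      qcomm_zpow[OF scalar.qcomm_unit_inv'[OF is_unit_tA tA_comm] is_unit_tA] by blast
  have below: "\<exists>d. x * tmon e L = scalar (qpow d) * (tmon e L * x)" for L
  proof (induction L)
    case 0
    show ?case by (intro exI[of _ 0]) (simp add: tmon_def)
  next
    case (Suc L)
    then obtain d where "x * tmon e L = scalar (qpow d) * (tmon e L * x)" by blast
    moreover obtain d' where "x * zpow (tA (idx L)) (e L) = scalar (qpow d') * (zpow (tA (idx L)) (e L) * x)"
      using comm by blast
    ultimately show ?case using scalar.qcomm_mult by (fastforce simp: tmon_def)
  qed
  show ?thesis
    using assms(1)
  proof (induction N)
    case (Suc N)
    show ?case
    proof (cases "j = N")
      case True
      obtain d where d: "x * tmon e N = scalar (qpow d) * (tmon e N * x)" using below by blast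
      have "x * tmon e (Suc N) = (x * tmon e N) * zpow (tA (idx N)) (e N)"
        by (simp add: tmon_def mult.assoc)
      also have "\<dots> = scalar (qpow d) * (tmon e N * zpow (tA (idx N)) (e N + z))"
        using step[of "e N"] True by (simp add: d mult.assoc)
      also have "tmon e N = tmon (e(j := e j + z)) N"
        by (rule tmon_cong) (use True in auto)
      finally show ?thesis using True by (auto simp: tmon_def)
    next
      case False
      then obtain d where d: "x * tmon e N = scalar (qpow d) * tmon (e(j := e j + z)) N"
        using Suc.IH Suc.prems by (metis less_SucE)
      have "x * tmon e (Suc N) = (x * tmon e N) * zpow (tA (idx N)) (e N)"
        by (simp add: tmon_Suc mult.assoc)
      also have "\<dots> = scalar (qpow d) * tmon (e(j := e j + z)) (Suc N)"
        unfolding d tmon_Suc mult.assoc using False by simp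
      finally show ?thesis by blast
    qed
  qed simp
qed

definition tmonomials :: "aq set" where
  "tmonomials = {tmon (Poly_Mapping.lookup e) N | e N. \<forall>n\<ge>N. Poly_Mapping.lookup e n = 0}"

text \<open>The span contains 1 and is stable under left multiplication by scalars, generators and
  their inverses, hence by every element.\<close>

lemma tmonomials_span: "a \<in> lmod.span tmonomials"
proof -
  have "\<forall>s\<in>lmod.span tmonomials. x * s \<in> lmod.span tmonomials" for x
  proof (induction x rule: aq_induct)
    case (scalar c)
    show ?case using lmod.span_scale by blast
  next
    have *: "\<forall>s\<in>lmod.span tmonomials. x * s \<in> lmod.span tmonomials"
      if x: "z = 1 \<and> x = tA i \<or> z = - 1 \<and> x = unit_inv (tA i)" for z :: int and x i
    proof
      fix s assume "s \<in> lmod.span tmonomials"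
      thus "x * s \<in> lmod.span tmonomials"
      proof (induction s rule: lmod.span_induct_alt)
        case (step c a s)
        then obtain e N where a: "a = tmon (Poly_Mapping.lookup e) N" "\<forall>n\<ge>N. Poly_Mapping.lookup e n = 0"
          by (auto simp: tmonomials_def)
        \<comment> \<open>The position of t_i may lie beyond N, so the monomial is first padded with
          zero exponents.\<close>
        define L where "L = max N (Suc (pos i))"
        have "a = tmon (Poly_Mapping.lookup e) L"
          unfolding a(1) L_def by (rule tmon_extend[symmetric]) (use a(2) in auto)
        moreover have "pos i < L" by (simp add: L_def)
        ultimately obtain d where d: "x * a = scalar (qpow d) * tmon ((Poly_Mapping.lookup e)(pos i := Poly_Mapping.lookup e (pos i) + z)) L"
          using tA_mult_tmon[of "pos i" L z x "Poly_Mapping.lookup e"] x by (metis idx_pos)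
        have l: "(Poly_Mapping.lookup e)(pos i := Poly_Mapping.lookup e (pos i) + z) =
            Poly_Mapping.lookup (e + Poly_Mapping.single (pos i) z)"
          by (auto simp: lookup_add lookup_single)
        have "tmon ((Poly_Mapping.lookup e)(pos i := Poly_Mapping.lookup e (pos i) + z)) L \<in> tmonomials"
          unfolding tmonomials_def l mem_Collect_eq
          by (intro exI[of _ "e + Poly_Mapping.single (pos i) z"] exI[of _ L])
             (use a(2) in \<open>auto simp: lookup_add lookup_single L_def when_def\<close>)
        hence "x * a \<in> lmod.span tmonomials"
          unfolding d by (intro lmod.span_scale lmod.span_base)
        thus ?case using step(2)
          by (simp add: distrib_left scalar_left_commute lmod.span_add lmod.span_scale)
      qed (simp add: lmod.span_zero)
    qed
    fix i
    show "\<forall>s\<in>lmod.span tmonomials. tA i * s \<in> lmod.span tmonomials"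
      "\<forall>s\<in>lmod.span tmonomials. unit_inv (tA i) * s \<in> lmod.span tmonomials"
      using *[of 1 "tA i" i] *[of "- 1" "unit_inv (tA i)" i] by simp_all
  next
    case (add a b)
    thus ?case by (simp add: distrib_right lmod.span_add)
  next
    case (mult a b)
    thus ?case by (simp add: mult.assoc)
  qed
  moreover have "1 \<in> tmonomials"
    unfolding tmonomials_def by (rule CollectI, rule exI[of _ 0], rule exI[of _ 0]) (simp add: tmon_def)
  hence "1 \<in> lmod.span tmonomials" by (rule lmod.span_base)
  ultimately have "a * 1 \<in> lmod.span tmonomials" by blast
  thus ?thesis by simp
qed

lemma to_qt_zpow: "to_qt (zpow (tA i) z) = tq i z"
proof -
  have "tq i z ^ n = tq i (int n * z)" for z n
    by (induction n) (auto simp: tq_0 tq_mult algebra_simps)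
  thus ?thesis
    by (simp add: zpow_def am_power[OF to_qt_hom] am_unit_inv[OF to_qt_hom] is_unit_tA to_qt_tA unit_inv_tq)
qed

lemma to_qt_tmon:
  "\<exists>c E. to_qt (tmon e N) = Poly_Mapping.single (Heis c E) 1 \<and>
     (\<forall>n. Poly_Mapping.lookup E n = (if n < N then e n else 0))"
proof (induction N)
  case 0
  show ?case by (intro exI[of _ 0]) (simp add: tmon_def am_1[OF to_qt_hom] flip: zero_heis_def)
next
  case (Suc N)
  then obtain c E where E: "to_qt (tmon e N) = Poly_Mapping.single (Heis c E) 1"
    "\<And>n. Poly_Mapping.lookup E n = (if n < N then e n else 0)" by auto
  have "to_qt (tmon e (Suc N)) = Poly_Mapping.single (Heis c E) 1 * tq (idx N) (e N)"
    by (simp add: tmon_def am_mult[OF to_qt_hom] to_qt_zpow flip: E(1))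
  thus ?case
    by (intro exI[of _ "E + Poly_Mapping.single N (e N)"] exI)
       (auto simp: tq_def mult_single plus_heis_def lookup_add lookup_single E(2) when_def)
qed

lemma lookup_he_lead_tmon:
  "Poly_Mapping.lookup (he (lead (to_qt (tmon e N)))) n = (if n < N then e n else 0)"
  using to_qt_tmon[of e N] by (auto simp: lead_single)

lemma to_qt_tmon_nonzero: "to_qt (tmon e N) \<noteq> 0"
  using to_qt_tmon[of e N] by (metis lookup_single_eq lookup_zero zero_neq_one)

text \<open>Scalar coefficients shift only the component \<open>hc\<close> of a leading term.
  Distinct \<open>he\<close> therefore stay distinct in every linear combination, and no
  cancellation is possible.\<close>

lemma lin_indep_by_leads:
  fixes \<phi> :: "'g::presentation presented \<Rightarrow> qtorus"
  assumes "additive_mult \<phi>" "\<And>c. \<phi> (scalar c) = qt_scalar c"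
    and "\<And>b. b \<in> B \<Longrightarrow> \<phi> b \<noteq> 0" "inj_on (\<lambda>b. he (lead (\<phi> b))) B"
    and "a \<in> lmod.span B" "\<phi> a = 0"
  shows "a = 0"
proof -
  obtain F r where F: "finite F" "F \<subseteq> B" "a = (\<Sum>b\<in>F. scalar (r b) * b)"
    using assms(5) unfolding lmod.span_explicit by blast
  define G where "G = {b \<in> F. r b \<noteq> 0}"
  have G: "a = (\<Sum>b\<in>G. scalar (r b) * b)"
    unfolding F(3) by (rule sum.mono_neutral_right) (use F(1) in \<open>auto simp: G_def\<close>)
  have nz: "\<phi> (scalar (r b) * b) \<noteq> 0" "he (lead (\<phi> (scalar (r b) * b))) = he (lead (\<phi> b))" if "b \<in> G" for b
    using that F(2) assms(3)[of b] qtorus_mult_nonzero[of "qt_scalar (r b)" "\<phi> b"]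
    by (auto simp: G_def am_mult[OF assms(1)] assms(2) he_lead_qt_scalar)
  have "G = {}"
  proof (rule ccontr)
    assume "G \<noteq> {}"
    have "(\<Sum>b\<in>G. \<phi> (scalar (r b) * b)) \<noteq> 0"
    proof (rule sum_distinct_leads_nonzero)
      show "inj_on (\<lambda>b. lead (\<phi> (scalar (r b) * b))) G"
      proof (rule inj_onI)
        fix x y assume "x \<in> G" "y \<in> G" "lead (\<phi> (scalar (r x) * x)) = lead (\<phi> (scalar (r y) * y))"
        thus "x = y" using inj_onD[OF assms(4), of x y] nz(2)[of x] nz(2)[of y] F(2) by (auto simp: G_def)
      qed
    qed (use F(1) \<open>G \<noteq> {}\<close> nz in \<open>auto simp: G_def\<close>)
    thus False using assms(6) unfolding G by (simp add: am_sum[OF assms(1)])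
  qed
  thus ?thesis by (simp add: G)
qed

lemma inj_to_qt: "inj to_qt"
proof (rule am_inj[OF to_qt_hom], rule lin_indep_by_leads[OF to_qt_hom to_qt_scalar _ _ tmonomials_span])
  show "to_qt b \<noteq> 0" if "b \<in> tmonomials" for b
    using that to_qt_tmon_nonzero by (auto simp: tmonomials_def)
  show "inj_on (\<lambda>b. he (lead (to_qt b))) tmonomials"
  proof (rule inj_onI)
    fix a b assume "a \<in> tmonomials" "b \<in> tmonomials" and eq: "he (lead (to_qt a)) = he (lead (to_qt b))"
    then obtain e N f L where
      a: "a = tmon (Poly_Mapping.lookup e) N" "\<forall>n\<ge>N. Poly_Mapping.lookup e n = 0" and
      b: "b = tmon (Poly_Mapping.lookup f) L" "\<forall>n\<ge>L. Poly_Mapping.lookup f n = 0"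
      by (auto simp: tmonomials_def)
    have "e = he (lead (to_qt a))" "f = he (lead (to_qt b))"
      by (rule poly_mapping_eqI; use a b in \<open>simp add: lookup_he_lead_tmon\<close>)+
    hence "e = f" using eq by simp
    have "a = tmon (Poly_Mapping.lookup e) (max N L)" "b = tmon (Poly_Mapping.lookup f) (max N L)"
      unfolding a(1) b(1) by (rule tmon_extend[symmetric]; use a b in simp)+
    thus "a = b" using \<open>e = f\<close> by simp
  qed
qed

lemma to_qt_eq_0_iff [simp]: "to_qt a = 0 \<longleftrightarrow> a = 0"
  using inj_to_qt am_0[OF to_qt_hom] by (metis injD)

lemma aq_no_zero_divisors: "a * b = 0 \<Longrightarrow> a = 0 \<or> b = 0" for a b :: aq
  using qtorus_mult_nonzero(1)[of "to_qt a" "to_qt b"] am_mult[OF to_qt_hom, of a b]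
  by (metis to_qt_eq_0_iff)

text \<open>Divisions in A_q by [n]!, [n] and q - 1 are carried out with this cancellation.\<close>

lemma aq_scalar_cancel:
  assumes "scalar c * a = scalar c * (b :: aq)" "c \<noteq> 0"
  shows "a = b"
proof -
  have "scalar c * (a - b) = 0" using assms by (simp add: right_diff_distrib)
  moreover have "scalar c \<noteq> (0 :: aq)"
    using assms(2) by (metis qt_scalar_eq_0_iff to_qt_eq_0_iff to_qt_scalar)
  ultimately show ?thesis using aq_no_zero_divisors by fastforce
qed

section \<open>Series in two variables\<close>

lemma additive_mult_at_lambda: "additive_mult (at_lambda :: 'a::ring_1 fps \<Rightarrow> _)"
proof -
  have sum: "fps_const (sum f S) = (\<Sum>x\<in>S. fps_const (f x))" for f :: "nat \<Rightarrow> 'a" and S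
    by (induction S rule: infinite_finite_induct) (auto simp flip: fps_const_add)
  show ?thesis
    unfolding additive_mult_def
    by (auto simp: at_lambda_def fps_eq_iff fps_mult_nth sum fps_sum_nth simp flip: fps_const_add)
qed

lemma additive_mult_at_mu: "additive_mult (at_mu :: 'a::ring_1 fps \<Rightarrow> _)"
  unfolding additive_mult_def at_mu_def by simp

lemma at_lambda_const: "at_lambda (fps_const c) = fps_const (fps_const c)"
  by (auto simp: at_lambda_def fps_eq_iff)

lemma at_lambda_X: "at_lambda fps_X = (lambda_inv :: 'a::ring_1 fps fps)"
  by (auto simp: at_lambda_def lambda_inv_def fps_eq_iff fps_X_def)

lemma at_mu_const: "at_mu (fps_const c) = fps_const (fps_const c)"
  by (simp add: at_mu_def)

lemma at_mu_X: "at_mu fps_X = (mu_inv :: 'a::ring_1 fps fps)"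
  by (simp add: at_mu_def mu_inv_def)

lemma fps_X_central: "fps_X * A = A * (fps_X :: 'a::ring_1 fps)"
  by (rule fps_mult_fps_X_commute)

lemma fps_X_left_commute: "A * (fps_X * B) = fps_X * (A * (B :: 'a::ring_1 fps))"
  by (simp only: mult.assoc[symmetric] fps_X_central[of A])

lemma fps_const_central:
  assumes "\<And>x. c * x = x * (c::'a::ring_1)"
  shows "fps_const c * A = A * fps_const c"
  by (simp add: fps_eq_iff assms)

lemma lambda_inv_central: "lambda_inv * A = A * (lambda_inv :: 'a::ring_1 fps fps)"
  unfolding lambda_inv_def by (rule fps_X_central)

lemma mu_inv_central: "mu_inv * A = A * (mu_inv :: 'a::ring_1 fps fps)"
  unfolding mu_inv_def by (intro fps_const_central fps_X_central)

lemma lambda_inv_nth: "(lambda_inv * A) $ i = (if i = 0 then 0 else A $ (i - 1))"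
  for A :: "'a::ring_1 fps fps"
  by (simp add: lambda_inv_def)

lemma mu_inv_nth: "(mu_inv * A) $ i $ j = (if j = 0 then 0 else A $ i $ (j - 1))"
  for A :: "'a::ring_1 fps fps"
  by (simp add: mu_inv_def)

lemma at_lambda_nth: "at_lambda A $ i $ j = (if j = 0 then A $ i else 0)"
  by (simp add: at_lambda_def)

lemma at_mu_nth: "at_mu A $ i $ j = (if i = 0 then A $ j else 0)"
  by (simp add: at_mu_def)

text \<open>For the difference C, comparison of coefficients gives a zero first row and C_(i+1,j) =
  C_(i,j+1), so the rows vanish one after the other. Thus quotients by \<lambda>^-1 - \<mu>^-1 are
  unique over any coefficient ring.\<close>

lemma lambda_minus_mu_cancel:
  fixes A B :: "'a::ring_1 fps fps"
  assumes "(lambda_inv - mu_inv) * A = (lambda_inv - mu_inv) * B"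
  shows "A = B"
proof -
  define C where "C = A - B"
  have "(lambda_inv - mu_inv) * C = 0" using assms by (simp add: C_def right_diff_distrib)
  hence eq: "lambda_inv * C = mu_inv * C" by (simp add: left_diff_distrib)
  have "C $ i $ j = 0" for i j
  proof (induction i arbitrary: j)
    case 0
    show ?case using arg_cong[OF eq, of "\<lambda>A. A $ 0 $ Suc j"]
      by (simp add: lambda_inv_nth mu_inv_nth del: fps_mult_nth_0)
  next
    case (Suc i)
    show ?case
      using arg_cong[OF eq, of "\<lambda>A. A $ Suc i $ Suc j"] Suc[of "Suc j"]
      by (simp add: lambda_inv_nth mu_inv_nth)
  qed
  hence "C = 0" by (simp add: fps_eq_iff)
  thus ?thesis by (simp add: C_def)
qed

text \<open>Coefficientwise this is the quotient of \<lambda>^-n - \<mu>^-n by \<lambda>^-1 -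
  \<mu>^-1, the sum of all \<lambda>^-i \<mu>^-j with i + j = n - 1.\<close>

definition divided_diff :: "'a::ring_1 fps \<Rightarrow> 'a fps fps" where
  "divided_diff A = Abs_fps (\<lambda>i. Abs_fps (\<lambda>j. A $ (i + j + 1)))"

lemma divided_diff: "(lambda_inv - mu_inv) * divided_diff A = at_lambda A - at_mu A"
  by (auto simp: fps_eq_iff left_diff_distrib lambda_inv_nth mu_inv_nth at_lambda_nth at_mu_nth
      divided_diff_def)

lemma exact_quot_lambda_minus_mu:
  "(lambda_inv - mu_inv) * B = A \<Longrightarrow> exact_quot A (lambda_inv - mu_inv) = B"
  by (rule exact_quot_eqI) (auto intro: lambda_minus_mu_cancel)

section \<open>The exchange relation under inversion\<close>

text \<open>With \<open>x = a * \<beta>\<close> and \<open>y = \<alpha> * b\<close>, the hypothesis becomes \<open>C * y = E\<close> for elements \<open>C\<close>, \<open>E\<close> that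
  commute with \<open>x\<close>. Hence \<open>x\<close> and \<open>y\<close> commute, and the claim follows.\<close>

lemma exchange_inverse:
  fixes a b \<alpha> \<beta> p s c :: "'a::ring_1"
  assumes central: "\<And>x. p * x = x * p" "\<And>x. s * x = x * s" "\<And>x. c * x = x * c"
    and inv: "a * \<alpha> = 1" "\<alpha> * a = 1" "b * \<beta> = 1" "\<beta> * b = 1"
    and ex: "(\<alpha> - \<beta>) * (s * \<alpha> - p * \<beta>) = c * ((s * \<alpha> - p * \<beta>) * (\<alpha> - \<beta>))"
    and cancel: "\<And>z. ((s - c * p) * (a * \<beta>) - (1 - c) * s) * z = 0 \<Longrightarrow> z = 0"
  shows "(p * a - s * b) * (a - b) = c * ((a - b) * (p * a - s * b))"
proof -
  have inv': "a * (\<alpha> * z) = z" "\<alpha> * (a * z) = z" "b * (\<beta> * z) = z" "\<beta> * (b * z) = z" for z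
    by (simp_all add: inv flip: mult.assoc)
  have left: "x * (p * z) = p * (x * z)" "x * (s * z) = s * (x * z)" "x * (c * z) = c * (x * z)" for x z
    by (metis central mult.assoc)+
  define x where "x = a * \<beta>"
  define y where "y = \<alpha> * b"
  define C where "C = (s - c * p) * x - (1 - c) * s"
  define E where "E = (1 - c) * p * x - (p - c * s)"
  have pc: "s * p = p * s" "c * p = p * c" "c * s = s * c" by (rule central)+
  note cs = pc left(1)[of s] left(1,2)[of c]
  \<comment> \<open>Multiplication by a on the left and b on the right turns every product in the
    hypothesis into a word in x and y.\<close>
  have ex': "a * ((\<alpha> - \<beta>) * (s * \<alpha> - p * \<beta>)) * b = a * (c * ((s * \<alpha> - p * \<beta>) * (\<alpha> - \<beta>))) * b"
    by (simp add: ex)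
  have 1: "a * ((\<alpha> - \<beta>) * (s * \<alpha> - p * \<beta>)) * b = s * y - p - s * (x * y) + p * x"
    unfolding x_def y_def by (simp add: algebra_simps inv inv' cs left[of a] left[of \<alpha>] left[of \<beta>])
  have 2: "a * (c * ((s * \<alpha> - p * \<beta>) * (\<alpha> - \<beta>))) * b = c * (s * y - s - p * (x * y) + p * x)"
    unfolding x_def y_def by (simp add: algebra_simps inv inv' cs left[of a] left[of \<alpha>] left[of \<beta>])
  have key: "s * y - p - s * (x * y) + p * x = c * (s * y - s - p * (x * y) + p * x)"
    using ex' by (simp only: 1 2)
  have Cy: "C * y = E"
  proof -
    have "C * y - E = (c * (s * y - s - p * (x * y) + p * x)) - (s * y - p - s * (x * y) + p * x)"
      by (simp add: C_def E_def algebra_simps cs)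
    thus ?thesis using key by simp
  qed
  have Cx: "C * x = x * C" and Ex: "E * x = x * E"
    by (simp_all add: C_def E_def algebra_simps cs left[of x] central[of x, symmetric])
  have "C * (x * y - y * x) = 0"
  proof -
    have "C * (x * y) = x * (C * y)" by (metis Cx mult.assoc)
    also have "\<dots> = C * (y * x)" by (simp add: Cy Ex flip: mult.assoc)
    finally show ?thesis by (simp add: right_diff_distrib)
  qed
  hence "x * y - y * x = 0"
    unfolding C_def x_def by (rule cancel)
  hence xy: "x * y = y * x" by simp
  \<comment> \<open>The claim, multiplied by \<alpha> and \<beta>, is the same polynomial with
    \<open>y * x\<close> in place of \<open>x * y\<close>; this is where commutation enters.\<close>
  have "\<alpha> * ((p * a - s * b) * (a - b)) * \<beta> = p * x - p - s * (y * x) + s * y"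
    unfolding x_def y_def by (simp add: algebra_simps inv inv' cs left[of a] left[of \<alpha>] left[of b])
  also have "\<dots> = c * (p * x - s - p * (y * x) + s * y)"
    using key unfolding xy by (simp add: algebra_simps cs)
  also have "\<dots> = \<alpha> * (c * ((a - b) * (p * a - s * b))) * \<beta>"
    unfolding x_def y_def by (simp add: algebra_simps inv inv' cs left[of a] left[of \<alpha>] left[of b])
  finally have "a * (\<alpha> * ((p * a - s * b) * (a - b)) * \<beta>) * b = a * (\<alpha> * (c * ((a - b) * (p * a - s * b))) * \<beta>) * b"
    by simp
  thus ?thesis by (simp only: mult.assoc inv inv' mult_1_right)
qed

section \<open>Continued fractions in a quantum torus\<close>

text \<open>The family \<open>\<tau> i = tA i\<close> with \<open>\<kappa> = 1\<close> gives the series $m$; the mirrored family \<open>\<tau> i = tA (1 - i)\<close>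
  with \<open>\<kappa> = - 1\<close> gives the series $u$, so that each statement is proved for both at once.\<close>

locale qcommuting = central_scalars sc for sc :: "laurent \<Rightarrow> 'r::ring_1" +
  fixes \<tau> :: "int \<Rightarrow> 'r" and \<kappa> :: int
  assumes unit: "is_unit_elt (\<tau> i)"
    and comm: "a < b \<Longrightarrow> \<tau> a * \<tau> b = sc (qpow (\<kappa> * eps a b)) * (\<tau> b * \<tau> a)"
begin

lemma comm_all: "\<tau> a * \<tau> b = sc (qpow (\<kappa> * eps a b)) * (\<tau> b * \<tau> a)"
proof -
  consider "a < b" | "a = b" | "b < a" by linarith
  thus ?thesis
  proof cases
    case 3
    show ?thesis using qcomm_swap[OF comm[OF 3]] by (simp add: eps_antisym[of b a])
  qed (use comm in auto)
qed

fun capp :: "nat \<Rightarrow> int \<Rightarrow> 'r fps" where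
  "capp 0 i = fps_const (unit_inv (\<tau> i))"
| "capp (Suc k) i = unit_inv (fps_const (\<tau> i) + fps_X * capp k (i + 1))"

text \<open>The denominator of \<open>capp k i\<close> in both clauses, so that \<open>capp\<close>
  is the inverse of \<open>cden\<close> at depth 0 too.\<close>

definition cden :: "nat \<Rightarrow> int \<Rightarrow> 'r fps" where
  "cden k i = (case k of 0 \<Rightarrow> fps_const (\<tau> i) | Suc k \<Rightarrow> fps_const (\<tau> i) + fps_X * capp k (i + 1))"

lemma is_unit_cden: "is_unit_elt (cden k i)"
  by (rule is_unit_fps) (auto simp: cden_def unit split: nat.splits)

lemma capp_eq: "capp k i = unit_inv (cden k i)"
  by (cases k) (auto simp: cden_def unit unit_inv_fps_const)

lemma capp_0_nth: "capp k i $ 0 = unit_inv (\<tau> i)"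
proof -
  have "(cden k i * capp k i) $ 0 = 1" "(capp k i * cden k i) $ 0 = 1"
    by (simp_all add: capp_eq unit_inv_left unit_inv_right is_unit_cden)
  thus ?thesis
    by (intro unit_inv_eqI[symmetric]) (auto simp: cden_def split: nat.splits)
qed

end

lemma fps_agree_mult:
  assumes "\<And>m. m < n \<Longrightarrow> A $ m = A' $ m" "\<And>m. m < n \<Longrightarrow> B $ m = (B' :: 'a::ring_1 fps) $ m" "m < n"
  shows "(A * B) $ m = (A' * B') $ m"
  unfolding fps_mult_nth using assms by (intro sum.cong) auto

lemma fps_agree_unit_inv:
  fixes A B :: "'a::ring_1 fps"
  assumes "is_unit_elt A" "is_unit_elt B" "\<And>m. m < n \<Longrightarrow> A $ m = B $ m" "m < n"
  shows "unit_inv A $ m = unit_inv B $ m"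
proof -
  have "unit_inv A $ m = (unit_inv A * (B * unit_inv B)) $ m"
    using assms by (simp add: unit_inv_right)
  also have "\<dots> = (unit_inv A * (A * unit_inv B)) $ m"
    by (rule fps_agree_mult[of n]) (use assms in \<open>auto intro!: fps_agree_mult[of n]\<close>)
  also have "\<dots> = unit_inv B $ m"
    using assms by (simp add: unit_inv_left')
  finally show ?thesis .
qed

context qcommuting
begin

text \<open>Each level carries a factor \<lambda>^-1, so a change at depth k + 1 affects only
  coefficients beyond k.\<close>

lemma capp_Suc_agree: "m \<le> k \<Longrightarrow> capp (Suc k) i $ m = capp k i $ m"
proof (induction k arbitrary: i m)
  case 0
  show ?case using 0 by (simp only: capp_0_nth le_zero_eq)
next
  case (Suc k)
  show ?case
    unfolding capp_eq
  proof (rule fps_agree_unit_inv[of _ _ "Suc (Suc k)"])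
    show "cden (Suc (Suc k)) i $ j = cden (Suc k) i $ j" if "j < Suc (Suc k)" for j
      using that Suc.IH[of "j - 1" "i + 1"] by (auto simp: cden_def)
  qed (use Suc.prems is_unit_cden in auto)
qed

lemma capp_agree: "m \<le> k \<Longrightarrow> capp k i $ m = capp m i $ m"
  by (induction k rule: dec_induct) (auto simp: capp_Suc_agree simp del: capp.simps)

text \<open>Coefficient n no longer changes from depth n on, so the diagonal is the
  \<lambda>^-1-adic limit.\<close>

definition cser :: "int \<Rightarrow> 'r fps" where
  "cser i = Abs_fps (\<lambda>n. capp n i $ n)"

lemma cser_capp: "m \<le> k \<Longrightarrow> capp k i $ m = cser i $ m"
  using capp_agree[of m k i] by (simp add: cser_def del: capp.simps)

lemma cser_mult: "cser i * (fps_const (\<tau> i) + fps_X * cser (i + 1)) = 1"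
  and mult_cser: "(fps_const (\<tau> i) + fps_X * cser (i + 1)) * cser i = 1"
proof -
  have *: "cser i $ m = capp (Suc n) i $ m"
    "(fps_const (\<tau> i) + fps_X * cser (i + 1)) $ m = cden (Suc n) i $ m" if "m \<le> n" for m n
    using that by (auto simp: cser_capp cden_def simp del: capp.simps)
  have "(cser i * (fps_const (\<tau> i) + fps_X * cser (i + 1))) $ n = (capp (Suc n) i * cden (Suc n) i) $ n" for n
    by (rule fps_agree_mult[OF *(1)[of _ n] *(2)[of _ n] lessI]) simp_all
  moreover have "((fps_const (\<tau> i) + fps_X * cser (i + 1)) * cser i) $ n = (cden (Suc n) i * capp (Suc n) i) $ n" for n
    by (rule fps_agree_mult[OF *(2)[of _ n] *(1)[of _ n] lessI]) simp_all
  ultimately show "cser i * (fps_const (\<tau> i) + fps_X * cser (i + 1)) = 1"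
    "(fps_const (\<tau> i) + fps_X * cser (i + 1)) * cser i = 1"
    by (simp_all add: fps_eq_iff capp_eq unit_inv_left unit_inv_right is_unit_cden del: capp.simps)
qed

end

lemma (in central_scalars) central_scalars_fps: "central_scalars (\<lambda>c. fps_const (sc c))"
proof
  show "fps_const (sc c) * x = x * fps_const (sc c)" for c and x :: "'r fps"
    by (rule fps_const_central) (rule sc_central)
qed (simp_all add: sc_add sc_mult)

context qcommuting
begin

interpretation F: central_scalars "\<lambda>c. fps_const (sc c)"
  by (rule central_scalars_fps)

lemma eps_Suc: "j < i \<Longrightarrow> eps j (i + 1) = - eps j i"
  by (auto simp: eps_def)

text \<open>Inversion changes the sign of the exponent, and so does the step from i to i + 1. Hence
  both summands of the denominator q-commute with z by the same power of q.\<close>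

lemma capp_comm_elt:
  assumes "\<And>i. i0 \<le> i \<Longrightarrow> z * \<tau> i = sc (qpow (e i)) * (\<tau> i * z)"
    and "\<And>i. i0 \<le> i \<Longrightarrow> e (i + 1) = - e i" and "i0 \<le> i"
  shows "fps_const z * capp k i = fps_const (sc (qpow (- e i))) * (capp k i * fps_const z)"
  using assms(3)
proof (induction k arbitrary: i)
  case 0
  have "z * unit_inv (\<tau> i) = sc (qpow (- e i)) * (unit_inv (\<tau> i) * z)"
    by (rule qcomm_unit_inv[OF unit assms(1)[OF 0]])
  thus ?case by simp
next
  case (Suc k)
  have "fps_const z * cden (Suc k) i = fps_const (sc (qpow (e i))) * (cden (Suc k) i * fps_const z)"
  proof -
    have "fps_const z * (fps_X * capp k (i + 1)) = fps_X * (fps_const z * capp k (i + 1))"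
      by (metis fps_X_central mult.assoc)
    also have "\<dots> = fps_const (sc (qpow (e i))) * (fps_X * capp k (i + 1) * fps_const z)"
      using Suc.IH[of "i + 1"] Suc.prems assms(2)[of i]
      by simp (metis fps_X_central mult.assoc)
    finally show ?thesis
      using assms(1)[OF Suc.prems] by (simp add: cden_def distrib_left distrib_right mult.assoc)
  qed
  from F.qcomm_unit_inv[OF is_unit_cden this] show ?case by (simp only: capp_eq)
qed

lemma cser_comm_elt:
  assumes "\<And>i. i0 \<le> i \<Longrightarrow> z * \<tau> i = sc (qpow (e i)) * (\<tau> i * z)"
    and "\<And>i. i0 \<le> i \<Longrightarrow> e (i + 1) = - e i" and "i0 \<le> i"
  shows "z * cser i $ n = sc (qpow (- e i)) * (cser i $ n * z)"
  using arg_cong[OF capp_comm_elt[OF assms, of n], of "\<lambda>A. A $ n"]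
  by (simp add: cser_capp del: capp.simps)

lemma capp_comm:
  assumes "j < i"
  shows "fps_const (\<tau> j) * capp k i = fps_const (sc (qpow (- \<kappa> * eps j i))) * (capp k i * fps_const (\<tau> j))"
  using capp_comm_elt[of "j + 1" "\<tau> j" "\<lambda>i. \<kappa> * eps j i" i k] comm_all[of j] assms
  by (simp add: eps_Suc)

lemma cser_comm:
  assumes "j < i"
  shows "fps_const (\<tau> j) * cser i = fps_const (sc (qpow (- \<kappa> * eps j i))) * (cser i * fps_const (\<tau> j))"
proof (rule fps_ext)
  fix n
  show "(fps_const (\<tau> j) * cser i) $ n = (fps_const (sc (qpow (- \<kappa> * eps j i))) * (cser i * fps_const (\<tau> j))) $ n"
    using arg_cong[OF capp_comm[OF assms, of n], of "\<lambda>A. A $ n"] by (simp add: cser_capp del: capp.simps)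
qed

lemma exchange_capp: "exchange_relator (sc (qpow (- \<kappa>))) (capp k i) = 0"
proof (induction k arbitrary: i)
  case 0
  have *: "at_lambda (capp 0 i) = at_mu (capp 0 i)" by (simp add: at_lambda_const at_mu_const)
  show ?case by (simp add: exchange_relator_def * del: capp.simps)
next
  case (Suc k)
  let ?l = "at_lambda :: 'r fps \<Rightarrow> _" and ?m = "at_mu :: 'r fps \<Rightarrow> _"
  define p where "p = (lambda_inv :: 'r fps fps)"
  define s where "s = (mu_inv :: 'r fps fps)"
  define c where "c = fps_const (fps_const (sc (qpow (- \<kappa>))))"
  define t where "t = fps_const (fps_const (\<tau> i))"
  define a where "a = ?l (capp (Suc k) i)"
  define b where "b = ?m (capp (Suc k) i)"
  define \<alpha> where "\<alpha> = ?l (cden (Suc k) i)"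
  define \<beta> where "\<beta> = ?m (cden (Suc k) i)"
  define a' where "a' = ?l (capp k (i + 1))"
  define b' where "b' = ?m (capp k (i + 1))"
  define D where "D = divided_diff (fps_X * capp k (i + 1))"
  have central: "p * x = x * p" "s * x = x * s" "c * x = x * c" for x
    unfolding p_def s_def c_def
    by (rule lambda_inv_central mu_inv_central fps_const_central sc_central)+
  have left: "x * (p * z) = p * (x * z)" "x * (s * z) = s * (x * z)" "x * (c * z) = c * (x * z)" for x z
    by (metis central mult.assoc)+
  have pc: "s * p = p * s" "c * p = p * c" "c * s = s * c" by (rule central)+
  note cs = pc left(1)[of s] left(1,2)[of c]
  have \<alpha>: "\<alpha> = t + p * a'" and \<beta>: "\<beta> = t + s * b'"
    by (simp_all add: \<alpha>_def \<beta>_def t_def p_def s_def a'_def b'_def cden_def am_add am_mult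
        additive_mult_at_lambda additive_mult_at_mu at_lambda_const at_lambda_X at_mu_const at_mu_X)
  have ab: "a * \<alpha> = 1" "\<alpha> * a = 1" "b * \<beta> = 1" "\<beta> * b = 1"
    unfolding a_def b_def \<alpha>_def \<beta>_def capp_eq
    by (simp_all add: unit_inv_left unit_inv_right is_unit_cden
        am_1[OF additive_mult_at_lambda] am_1[OF additive_mult_at_mu]
        flip: am_mult[OF additive_mult_at_lambda] am_mult[OF additive_mult_at_mu])
  have \<delta>: "\<alpha> - \<beta> = (p - s) * D"
    unfolding \<alpha> \<beta> p_def s_def D_def divided_diff a'_def b'_def
    by (simp add: am_mult additive_mult_at_lambda additive_mult_at_mu at_lambda_X at_mu_X)
  have t': "t * a' = fps_const (fps_const (sc (qpow \<kappa>))) * (a' * t)"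
    "t * b' = fps_const (fps_const (sc (qpow \<kappa>))) * (b' * t)"
    using arg_cong[OF capp_comm[of i "i + 1" k], of ?l] arg_cong[OF capp_comm[of i "i + 1" k], of ?m]
    by (simp_all add: t_def a'_def b'_def am_mult additive_mult_at_lambda additive_mult_at_mu
        at_lambda_const at_mu_const eps_def)
  have ct: "c * (t * a') = a' * t" "c * (t * b') = b' * t"
    unfolding t' c_def by (simp_all flip: mult.assoc)
  have \<delta>t: "(\<alpha> - \<beta>) * t = c * (t * (\<alpha> - \<beta>))"
    unfolding \<alpha> \<beta> by (simp add: algebra_simps cs left[of t] left(1,2)[of a'] left(1,2)[of b'] central(1,2)[of t, symmetric] ct)
  have IH: "(p * a' - s * b') * (a' - b') = c * ((a' - b') * (p * a' - s * b'))"
    using Suc.IH[of "i + 1"]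
    by (simp add: exchange_relator_def Let_def p_def s_def c_def a'_def b'_def)
  have ex: "(\<alpha> - \<beta>) * (s * \<alpha> - p * \<beta>) = c * ((s * \<alpha> - p * \<beta>) * (\<alpha> - \<beta>))"
  proof -
    \<comment> \<open>This factor splits into a multiple of a' - b', which the induction hypothesis
      handles because \<alpha> - \<beta> = p a' - s b', and a multiple of t, which q-commutes with
      \<alpha> - \<beta>.\<close>
    have e: "s * \<alpha> - p * \<beta> = p * s * (a' - b') - (p - s) * t"
      unfolding \<alpha> \<beta> by (simp add: algebra_simps cs)
    have d: "\<alpha> - \<beta> = p * a' - s * b'" unfolding \<alpha> \<beta> by simp
    have "(\<alpha> - \<beta>) * (p * s * (a' - b')) = c * (p * s * (a' - b') * (\<alpha> - \<beta>))"
    proof -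
      have "(\<alpha> - \<beta>) * (p * s * (a' - b')) = p * (s * ((\<alpha> - \<beta>) * (a' - b')))"
        by (simp only: mult.assoc left[of "\<alpha> - \<beta>"])
      also have "\<dots> = c * (p * s * (a' - b') * (\<alpha> - \<beta>))"
        unfolding d IH by (simp only: mult.assoc cs)
      finally show ?thesis .
    qed
    moreover have "(\<alpha> - \<beta>) * ((p - s) * t) = c * ((p - s) * t * (\<alpha> - \<beta>))"
    proof -
      have "(\<alpha> - \<beta>) * ((p - s) * t) = (p - s) * ((\<alpha> - \<beta>) * t)"
        by (simp add: left_diff_distrib right_diff_distrib left(1,2)[of \<alpha>] left(1,2)[of \<beta>])
      also have "\<dots> = c * ((p - s) * t * (\<alpha> - \<beta>))"
        unfolding \<delta>t by (simp only: mult.assoc left_diff_distrib right_diff_distrib cs)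
      finally show ?thesis .
    qed
    ultimately show ?thesis
      unfolding e right_diff_distrib[of "\<alpha> - \<beta>" "p * s * (a' - b')" "(p - s) * t"]
        left_diff_distrib[of "p * s * (a' - b')" "(p - s) * t" "\<alpha> - \<beta>"]
        right_diff_distrib[of c "p * s * (a' - b') * (\<alpha> - \<beta>)"]
      by simp
  qed
  have "(p * a - s * b) * (a - b) = c * ((a - b) * (p * a - s * b))"
  proof (rule exchange_inverse[OF central ab ex])
    \<comment> \<open>Since \<alpha> - \<beta> is divisible by p - s, the element is p - s times a
      series with constant coefficient -q^(-\<kappa>). The first factor cancels and the second is
      invertible.\<close>
    fix z assume z: "((s - c * p) * (a * \<beta>) - (1 - c) * s) * z = 0"
    have a\<beta>: "a * \<beta> = 1 - (p - s) * (a * D)"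
    proof -
      have "a * \<beta> = a * (\<alpha> - (\<alpha> - \<beta>))" by simp
      thus ?thesis unfolding \<delta> by (simp add: algebra_simps ab left[of a])
    qed
    have "(s - c * p) * (a * \<beta>) - (1 - c) * s = (p - s) * (- c - (s - c * p) * (a * D))"
      unfolding a\<beta> by (simp add: algebra_simps cs)
    hence "(p - s) * ((- c - (s - c * p) * (a * D)) * z) = (p - s) * 0"
      using z by (simp add: mult.assoc)
    hence "(- c - (s - c * p) * (a * D)) * z = 0"
      unfolding p_def s_def by (rule lambda_minus_mu_cancel)
    moreover have "is_unit_elt (- c - (s - c * p) * (a * D))"
    proof (intro is_unit_fps)
      have "(- c - (s - c * p) * (a * D)) $ 0 $ 0 = - sc (qpow (- \<kappa>))"
        by (simp add: c_def s_def p_def lambda_inv_def mu_inv_def)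
      moreover have "is_unit_elt (- sc (qpow (- \<kappa>)))"
        by (rule is_unit_eltI[of _ "- sc (qpow \<kappa>)"]) simp_all
      ultimately show "is_unit_elt ((- c - (s - c * p) * (a * D)) $ 0 $ 0)" by simp
    qed
    ultimately show "z = 0" by (metis mult_zero_right unit_cancel_left)
  qed
  thus ?case
    by (simp add: exchange_relator_def Let_def p_def s_def c_def a_def b_def del: capp.simps)
qed

end

lemma fps2_agree_mult:
  fixes A B :: "'a::ring_1 fps fps"
  assumes "\<And>i j. i < n \<Longrightarrow> j < n \<Longrightarrow> A $ i $ j = A' $ i $ j"
    "\<And>i j. i < n \<Longrightarrow> j < n \<Longrightarrow> B $ i $ j = B' $ i $ j" "i < n" "j < n"
  shows "(A * B) $ i $ j = (A' * B') $ i $ j"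
  unfolding fps_mult_nth fps_sum_nth using assms by (intro sum.cong) auto

lemma exchange_relator_agree:
  assumes "\<And>m. m < n \<Longrightarrow> A $ m = B $ m" "i < n" "j < n"
  shows "exchange_relator c A $ i $ j = exchange_relator c B $ i $ j"
  unfolding exchange_relator_def Let_def fps_sub_nth
  by (intro arg_cong2[where f = minus] fps2_agree_mult[of n])
     (use assms in \<open>auto simp: at_lambda_nth at_mu_nth lambda_inv_nth mu_inv_nth intro!: fps2_agree_mult[of n]\<close>)

lemma (in qcommuting) exchange_cser: "exchange_relator (sc (qpow (- \<kappa>))) (cser i) = 0"
proof -
  have "exchange_relator (sc (qpow (- \<kappa>))) (cser i) $ m $ n = 0" for m n
    using exchange_relator_agree[of "Suc (m + n)" "cser i" "capp (m + n) i" m n]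
    by (simp add: cser_capp exchange_capp del: capp.simps)
  thus ?thesis by (simp add: fps_eq_iff)
qed

section \<open>Derivations and continued fractions\<close>

text \<open>The polynomial identity behind \<open>riccati_defect_step\<close>: \<alpha> and \<beta>
  stand for the denominators of the continued fraction at \<lambda> and \<mu>, and the first bracket
  is the value of the derivation on t. Only p and s are central.\<close>

lemma riccati_identity:
  fixes \<alpha> \<beta> t K p s :: "'a::ring_1"
  assumes p: "\<And>x. p * x = x * p" and s: "\<And>x. s * x = x * s"
  shows "- ((p - s) * (t * K * \<beta> - t * K * t - t + \<beta> * K * t)) - (s * (\<alpha> * K * \<beta>) - s * (\<alpha> * K * \<alpha>) + (1 - \<beta> * K) * (p * \<beta> - s * \<alpha>))
    = (1 - (\<beta> - t) * K) * (s * (\<alpha> - t) - p * (\<beta> - t)) + s * ((\<alpha> - t) * K * (\<alpha> - \<beta>))"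
proof -
  have left: "x * (p * z) = p * (x * z)" "x * (s * z) = s * (x * z)" for x z
    by (metis p s mult.assoc)+
  show ?thesis
    by (simp add: algebra_simps left[of t] left[of K] left[of \<alpha>] left[of \<beta>])
qed

text \<open>With f the embedding of constants, the values may be power series in \<mu>^-1, so that
  all Hamiltonians are treated at once.\<close>

definition derivation_along :: "('a::ring_1 \<Rightarrow> 'b::ring_1) \<Rightarrow> ('a \<Rightarrow> 'b) \<Rightarrow> bool" where
  "derivation_along f D \<longleftrightarrow> (\<forall>a b. D (a + b) = D a + D b) \<and> (\<forall>a b. D (a * b) = D a * f b + f a * D b)"

lemma derivation_along_0: "derivation_along f D \<Longrightarrow> D 0 = 0"
  by (metis add_cancel_right_left derivation_along_def)

lemma derivation_along_sum:
  assumes "derivation_along f D"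
  shows "D (sum h S) = (\<Sum>x\<in>S. D (h x))"
  by (induction S rule: infinite_finite_induct)
     (use assms derivation_along_0[OF assms] in \<open>auto simp: derivation_along_def\<close>)

lemma derivation_along_1: "derivation_along f D \<Longrightarrow> f 1 = 1 \<Longrightarrow> D 1 = 0"
  unfolding derivation_along_def by (metis add_cancel_right_left mult_1 mult_1_right)

lemma derivation_along_coeffwise:
  fixes D :: "'a::ring_1 \<Rightarrow> 'a fps"
  assumes "derivation_along fps_const D"
  shows "derivation_along at_lambda (coeffwise D)"
  using assms
  by (auto simp: derivation_along_def fps_eq_iff[where ?'a = "'a fps"] fps_mult_nth at_lambda_def
      derivation_along_sum[OF assms] sum.distrib)

text \<open>A and B are the continued fractions running to the right and to the left, D collects all
  currents. The second instance exchanges A and B, mirrors the index and negates D.\<close>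

locale riccati =
  fixes \<tau> :: "int \<Rightarrow> 'r::ring_1" and A B :: "int \<Rightarrow> 'r fps" and D :: "'r \<Rightarrow> 'r fps"
    and K :: "int \<Rightarrow> 'r fps"
  assumes A: "(fps_const (\<tau> i) + fps_X * A (i + 1)) * A i = 1" "A i * (fps_const (\<tau> i) + fps_X * A (i + 1)) = 1"
    and B: "(fps_const (\<tau> i) + fps_X * B (i - 1)) * B i = 1" "B i * (fps_const (\<tau> i) + fps_X * B (i - 1)) = 1"
    and K: "(fps_const (\<tau> i) + fps_X * A (i + 1) + fps_X * B (i - 1)) * K i = 1"
      "K i * (fps_const (\<tau> i) + fps_X * A (i + 1) + fps_X * B (i - 1)) = 1"
    and D: "derivation_along fps_const D"
    and D_tau: "D (\<tau> i) = fps_X * (fps_const (\<tau> i) * K i * A (i + 1) - B (i - 1) * K i * fps_const (\<tau> i))"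
begin

definition w :: "int \<Rightarrow> 'r fps" where
  "w i = - (fps_X * B (i - 1) * unit_inv (1 + fps_X * A i * B (i - 1)))"

text \<open>Factoring 1 + \<lambda>^-1 A_i B_(i-1) as A_i times the sum of the denominator of A_i
  and \<lambda>^-1 B_(i-1) expresses w_i through K_i. By the companion lemma w_(i+1) involves the
  same K_i, so one recursion step needs a single resolvent.\<close>

lemma w_eq: "w i = - (1 - (fps_const (\<tau> i) + fps_X * A (i + 1)) * K i) * (fps_const (\<tau> i) + fps_X * A (i + 1))"
proof -
  define \<beta> where "\<beta> = fps_const (\<tau> i) + fps_X * A (i + 1)"
  have \<beta>: "\<beta> * A i = 1" "A i * \<beta> = 1" using A by (simp_all add: \<beta>_def)
  have K': "(\<beta> + fps_X * B (i - 1)) * K i = 1" "K i * (\<beta> + fps_X * B (i - 1)) = 1"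
    using K by (simp_all add: \<beta>_def)
  have eq: "1 + fps_X * A i * B (i - 1) = A i * (\<beta> + fps_X * B (i - 1))"
    by (simp add: distrib_left \<beta> fps_X_left_commute mult.assoc)
  have "unit_inv (1 + fps_X * A i * B (i - 1)) = K i * \<beta>"
    unfolding eq
  proof (rule unit_inv_eqI)
    have "A i * (\<beta> + fps_X * B (i - 1)) * (K i * \<beta>) = A i * ((\<beta> + fps_X * B (i - 1)) * K i) * \<beta>"
      by (simp only: mult.assoc)
    thus "A i * (\<beta> + fps_X * B (i - 1)) * (K i * \<beta>) = 1" by (simp add: K' \<beta>)
    have "K i * \<beta> * (A i * (\<beta> + fps_X * B (i - 1))) = K i * (\<beta> * A i) * (\<beta> + fps_X * B (i - 1))"
      by (simp only: mult.assoc)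
    thus "K i * \<beta> * (A i * (\<beta> + fps_X * B (i - 1))) = 1" by (simp add: K' \<beta>)
  qed
  moreover have "fps_X * B (i - 1) * K i = 1 - \<beta> * K i"
    using K'(1) by (simp add: distrib_right algebra_simps)
  ultimately show ?thesis
    by (simp add: w_def left_diff_distrib flip: \<beta>_def mult.assoc)
qed

lemma w_Suc: "w (i + 1) = - (fps_X * K i)"
proof -
  define \<gamma> where "\<gamma> = fps_const (\<tau> i) + fps_X * B (i - 1)"
  have \<gamma>: "\<gamma> * B i = 1" "B i * \<gamma> = 1" using B by (simp_all add: \<gamma>_def)
  have K': "(\<gamma> + fps_X * A (i + 1)) * K i = 1" "K i * (\<gamma> + fps_X * A (i + 1)) = 1"
    using K[of i] by (simp_all add: \<gamma>_def add_ac)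
  have eq: "1 + fps_X * A (i + 1) * B i = (\<gamma> + fps_X * A (i + 1)) * B i"
    by (simp add: distrib_right \<gamma>)
  have "unit_inv (1 + fps_X * A (i + 1) * B i) = \<gamma> * K i"
    unfolding eq
  proof (rule unit_inv_eqI)
    have "(\<gamma> + fps_X * A (i + 1)) * B i * (\<gamma> * K i) = (\<gamma> + fps_X * A (i + 1)) * (B i * \<gamma>) * K i"
      by (simp only: mult.assoc)
    thus "(\<gamma> + fps_X * A (i + 1)) * B i * (\<gamma> * K i) = 1" by (simp add: K' \<gamma>)
    have "\<gamma> * K i * ((\<gamma> + fps_X * A (i + 1)) * B i) = \<gamma> * (K i * (\<gamma> + fps_X * A (i + 1))) * B i"
      by (simp only: mult.assoc)
    thus "\<gamma> * K i * ((\<gamma> + fps_X * A (i + 1)) * B i) = 1" by (simp add: K' \<gamma>)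
  qed
  thus ?thesis by (simp add: w_def mult.assoc) (simp add: \<gamma> flip: mult.assoc)
qed

text \<open>The defining formula of H_\<mu> on m with the denominator \<lambda>^-1 - \<mu>^-1
  cleared; i = 1 is the case of the theorem.\<close>

definition riccati_rhs :: "int \<Rightarrow> 'r fps fps" where
  "riccati_rhs i = (let a = at_lambda (A i); b = at_mu (A i); w = at_mu (w i) in
     mu_inv * (1 + b * w) * (a - b) - a * w * (lambda_inv * a - mu_inv * b))"

definition riccati_defect :: "int \<Rightarrow> 'r fps fps" where
  "riccati_defect i = (lambda_inv - mu_inv) * coeffwise D (A i) - riccati_rhs i"

text \<open>The defect is $\lambda^{-1}$ times an expression in the next defect, so that all defects vanish in the
  $\lambda^{-1}$-adic topology.\<close>

lemma riccati_defect_step: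
  "riccati_defect i = lambda_inv * - (at_lambda (A i) * riccati_defect (i + 1) * at_lambda (A i))"
proof -
  let ?l = "at_lambda :: 'r fps \<Rightarrow> _" and ?m = "at_mu :: 'r fps \<Rightarrow> _"
  note hl = am_add[OF additive_mult_at_lambda] am_mult[OF additive_mult_at_lambda] am_1[OF additive_mult_at_lambda]
    am_diff[OF additive_mult_at_lambda] am_uminus[OF additive_mult_at_lambda]
  note hm = am_add[OF additive_mult_at_mu] am_mult[OF additive_mult_at_mu] am_1[OF additive_mult_at_mu]
    am_diff[OF additive_mult_at_mu] am_uminus[OF additive_mult_at_mu]
  define p where "p = (lambda_inv :: 'r fps fps)"
  define s where "s = (mu_inv :: 'r fps fps)"
  define t where "t = fps_const (fps_const (\<tau> i))"
  define a where "a = ?l (A i)"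
  define b where "b = ?m (A i)"
  define a' where "a' = ?l (A (i + 1))"
  define b' where "b' = ?m (A (i + 1))"
  define u where "u = ?m (B (i - 1))"
  define k where "k = ?m (K i)"
  define \<alpha> where "\<alpha> = t + p * a'"
  define \<beta> where "\<beta> = t + s * b'"
  define Da where "Da = coeffwise D (A i)"
  define Da' where "Da' = coeffwise D (A (i + 1))"
  have p: "p * x = x * p" and s: "s * x = x * s" for x
    unfolding p_def s_def by (rule lambda_inv_central mu_inv_central)+
  have left: "x * (p * z) = p * (x * z)" "x * (s * z) = s * (x * z)" for x z
    by (metis p s mult.assoc)+
  have c: "?l (fps_const (\<tau> i)) = t" "?m (fps_const (\<tau> i)) = t" "?l fps_X = p" "?m fps_X = s"
    by (simp_all add: t_def p_def s_def at_lambda_const at_lambda_X at_mu_const at_mu_X)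
  have a: "\<alpha> * a = 1" "a * \<alpha> = 1"
    using arg_cong[OF A(1)[of i], of ?l] arg_cong[OF A(2)[of i], of ?l]
    by (simp_all add: hl c a_def \<alpha>_def a'_def)
  have b: "\<beta> * b = 1" "b * \<beta> = 1"
    using arg_cong[OF A(1)[of i], of ?m] arg_cong[OF A(2)[of i], of ?m]
    by (simp_all add: hm c b_def \<beta>_def b'_def)
  have a2: "\<alpha> * (a * z) = z" "a * (\<alpha> * z) = z" for z by (simp_all add: a flip: mult.assoc)
  have b2: "\<beta> * (b * z) = z" "b * (\<beta> * z) = z" for z by (simp_all add: b flip: mult.assoc)
  have k: "(\<beta> + s * u) * k = 1" "k * (\<beta> + s * u) = 1"
    using arg_cong[OF K(1)[of i], of ?m] arg_cong[OF K(2)[of i], of ?m]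
    by (simp_all add: hm c k_def \<beta>_def b'_def u_def)
  have w: "?m (w i) = - (1 - \<beta> * k) * \<beta>"
    by (simp add: w_eq hm c k_def \<beta>_def b'_def)
  have w': "?m (w (i + 1)) = - (s * k)"
    by (simp add: w_Suc hm c k_def)
  have bw: "1 + b * ?m (w i) = k * \<beta>"
    unfolding w by (simp add: algebra_simps b b2)
  define R where "R = (s * (k * \<beta> * (a - b)) + a * (1 - \<beta> * k) * (\<beta> * (p * a - s * b)))"
  define R' where "R' = (s * ((1 - s * (b' * k)) * (a' - b')) + s * (a' * k * (p * a' - s * b')))"
  have rhs: "riccati_rhs i = R"
    unfolding riccati_rhs_def Let_def a_def[symmetric] b_def[symmetric] p_def[symmetric] s_def[symmetric] bw R_def
    unfolding w by (simp add: algebra_simps)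
  have rhs': "riccati_rhs (i + 1) = R'"
    unfolding riccati_rhs_def Let_def a'_def[symmetric] b'_def[symmetric] p_def[symmetric] s_def[symmetric] R'_def w'
    by (simp add: algebra_simps left[of a'] left[of b'])
  have D': "derivation_along ?l (coeffwise D)" by (rule derivation_along_coeffwise[OF D])
  define Dt where "Dt = t * k * \<beta> - t * k * t - t + \<beta> * k * t"
  \<comment> \<open>The resolvent equation replaces s u k by 1 - \<beta> k, so that the left-running
    fraction u disappears from the computation.\<close>
  have Dt: "coeffwise D (fps_const (\<tau> i)) = Dt"
  proof -
    have "coeffwise D (fps_const (\<tau> i)) = ?m (D (\<tau> i))"
      using derivation_along_0[OF D] by (simp add: coeffwise_fps_const at_mu_def)
    also have "\<dots> = s * (t * k * b' - u * k * t)"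
      by (simp add: D_tau hm c k_def b'_def u_def)
    also have "\<dots> = t * k * (s * b') - (s * u * k) * t"
      by (simp add: algebra_simps left[of t] left[of k] left[of u])
    also have "s * u * k = 1 - \<beta> * k" using k(1) by (simp add: algebra_simps)
    also have "s * b' = \<beta> - t" by (simp add: \<beta>_def)
    finally show ?thesis by (simp add: Dt_def algebra_simps)
  qed
  have DX: "coeffwise D (fps_X * A (i + 1)) = p * Da'"
    by (auto simp: fps_eq_iff[where ?'a = "'r fps"] p_def lambda_inv_nth Da'_def derivation_along_0[OF D])
  have Da: "Da = - (a * (Dt + p * Da') * a)"
  proof -
    have "coeffwise D (A i * (fps_const (\<tau> i) + fps_X * A (i + 1))) = Da * \<alpha> + a * (Dt + p * Da')"
      using D' Dt DX by (simp add: derivation_along_def Da_def a_def \<alpha>_def hl c a'_def)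
    moreover have "coeffwise D (A i * (fps_const (\<tau> i) + fps_X * A (i + 1))) = 0"
      unfolding A(2) by (rule derivation_along_1[OF D']) (simp add: hl)
    ultimately have "Da * \<alpha> = - (a * (Dt + p * Da'))" by (simp add: eq_neg_iff_add_eq_0)
    hence "Da * \<alpha> * a = - (a * (Dt + p * Da')) * a" by simp
    thus ?thesis by (simp add: mult.assoc a)
  qed
  have \<alpha>R: "\<alpha> * R * \<alpha> = s * (\<alpha> * k * \<beta>) - s * (\<alpha> * k * \<alpha>) + (1 - \<beta> * k) * (p * \<beta> - s * \<alpha>)"
    unfolding R_def
    by (simp add: algebra_simps a a2 b b2 left[of a] left[of b] left[of \<alpha>] left[of \<beta>] left[of k])
  have pR': "p * R' = (1 - (\<beta> - t) * k) * (s * (\<alpha> - t) - p * (\<beta> - t)) + s * ((\<alpha> - t) * k * (\<alpha> - \<beta>))"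
    unfolding R'_def \<alpha>_def \<beta>_def
    by (simp add: algebra_simps left[of t] left[of k] left[of a'] left[of b'] left(1)[of s] p[of s, symmetric])
  have id: "- ((p - s) * Dt) - \<alpha> * R * \<alpha> = p * R'"
    unfolding \<alpha>R pR' Dt_def by (rule riccati_identity[OF p s])
  \<comment> \<open>Multiplication by \<alpha> on both sides removes all inverses and leaves
    polynomials in t, \<alpha>, \<beta> and k, to which \<open>riccati_identity\<close>
    applies.\<close>
  have "(p - s) * Da - R = a * (\<alpha> * ((p - s) * Da - R) * \<alpha>) * a"
    by (simp add: mult.assoc a a2)
  also have "\<alpha> * ((p - s) * Da - R) * \<alpha> = - (p - s) * Dt - (p - s) * (p * Da') - \<alpha> * R * \<alpha>"
    unfolding Da by (simp add: algebra_simps a a2 left[of \<alpha>] left[of a])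
  also have "\<dots> = p * R' - (p - s) * (p * Da')"
    using id by (simp add: algebra_simps)
  also have "\<dots> = - (p * ((p - s) * Da' - R'))"
    by (simp add: algebra_simps left(1)[of s] p[of s, symmetric])
  finally show ?thesis
    unfolding riccati_defect_def rhs rhs' a_def[symmetric] p_def[symmetric] s_def[symmetric]
      Da_def[symmetric] Da'_def[symmetric]
    by (simp add: mult.assoc left[of a])
qed

lemma riccati_defect_0: "riccati_defect i = 0"
proof -
  have "riccati_defect i $ n = 0" for n
  proof (induction n arbitrary: i rule: less_induct)
    case (less n)
    have 0: "(at_lambda (A i) * riccati_defect (i + 1) * at_lambda (A i)) $ m = 0" if "m < n" for m
    proof -
      have "(at_lambda (A i) * riccati_defect (i + 1)) $ j = 0" if "j \<le> m" for j
        unfolding fps_mult_nth using \<open>m < n\<close> that by (intro sum.neutral) (auto simp: less)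
      thus ?thesis unfolding fps_mult_nth[of "_ * _"] by (intro sum.neutral) auto
    qed
    show ?case
      by (subst riccati_defect_step) (use 0[of "n - 1"] in \<open>simp add: lambda_inv_nth\<close>)
  qed
  thus ?thesis by (simp add: fps_eq_iff)
qed

lemma riccati: "(lambda_inv - mu_inv) * coeffwise D (A i) = riccati_rhs i"
  using riccati_defect_0 by (simp add: riccati_defect_def)

end

section \<open>The morphism $\mathrm{DS}_q$\<close>

context qcommuting
begin

interpretation F: central_scalars "\<lambda>c. fps_const (sc c)"
  by (rule central_scalars_fps)

text \<open>The powers of q from \<tau> i and \<open>capp k i\<close> cancel. For i = j + 1 the
  product is the inverse of the tail of the fraction in the statement, so \<tau> j may be moved
  through it.\<close>

lemma comm_ratio_capp:
  assumes "j < i"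
  shows "fps_const (\<tau> j) * (fps_const (\<tau> i) * capp k i) = fps_const (\<tau> i) * capp k i * fps_const (\<tau> j)"
    and "fps_const (\<tau> j) * (capp k i * fps_const (\<tau> i)) = capp k i * fps_const (\<tau> i) * fps_const (\<tau> j)"
proof -
  have 1: "fps_const (\<tau> j) * fps_const (\<tau> i) = fps_const (sc (qpow (\<kappa> * eps j i))) * (fps_const (\<tau> i) * fps_const (\<tau> j))"
    using comm_all[of j i] by simp
  show "fps_const (\<tau> j) * (fps_const (\<tau> i) * capp k i) = fps_const (\<tau> i) * capp k i * fps_const (\<tau> j)"
    using F.qcomm_mult[OF 1 capp_comm[OF assms, of k]] by simp
  show "fps_const (\<tau> j) * (capp k i * fps_const (\<tau> i)) = capp k i * fps_const (\<tau> i) * fps_const (\<tau> j)"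
    using F.qcomm_mult[OF capp_comm[OF assms, of k] 1] by simp
qed

lemma comm_unit_inv:
  assumes "is_unit_elt y" "x * y = y * (x :: 'a::ring_1)"
  shows "x * unit_inv y = unit_inv y * x"
  by (metis assms mult.assoc unit_inv_left' unit_inv_right mult_1_right)

lemma cont_frac_Suc:
  "cont_frac f (map g [1..<Suc (Suc k)]) = 1 + f (g 1) (cont_frac f (map (\<lambda>j. g (Suc j)) [1..<Suc k]))"
proof -
  have "[1..<Suc (Suc k)] = 1 # map Suc [1..<Suc k]"
    by (simp add: upt_conv_Cons map_Suc_upt del: upt_Suc)
  thus ?thesis by (simp add: cont_frac_def comp_def del: upt_Suc)
qed

text \<open>\<open>capp\<close> has \<tau> i on the diagonal, whereas \<open>C\<close> has 1 there
  and (\<lambda> z_i)^-1 as numerators. One level of \<open>C\<close> is the denominator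
  \<open>cden\<close> times the inverse of \<tau> i; pulling this factor out requires that it
  commute with the inverse of the next tail.\<close>

lemma cont_frac_right:
  assumes z: "\<And>i. unit_inv (z i) = unit_inv (\<tau> (i + 1)) * unit_inv (\<tau> i)"
  defines "C \<equiv> \<lambda>k i. cont_frac right_frac (map (\<lambda>j. lambda_times_inv (z (i + int j - 1))) [1..<Suc k])"
  shows "is_unit_elt (C k i) \<and> right_frac (fps_const (unit_inv (\<tau> i))) (C k i) = capp k i"
proof (induction k arbitrary: i)
  case 0
  show ?case by (simp add: C_def cont_frac_def is_unit_1 unit_inv_1 right_frac_def)
next
  case (Suc k)
  define D where "D = C k (i + 1)"
  have D: "is_unit_elt D" "fps_const (unit_inv (\<tau> (i + 1))) * unit_inv D = capp k (i + 1)"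
    using Suc[of "i + 1"] by (simp_all add: D_def right_frac_def)
  have invD: "unit_inv D = fps_const (\<tau> (i + 1)) * capp k (i + 1)"
    unfolding D(2)[symmetric] using unit[of "i + 1"] by (simp add: unit_inv_right flip: mult.assoc)
  have "fps_const (\<tau> i) * unit_inv D = unit_inv D * fps_const (\<tau> i)"
    unfolding invD by (rule comm_ratio_capp) simp
  hence c: "unit_inv D * fps_const (unit_inv (\<tau> i)) = fps_const (unit_inv (\<tau> i)) * unit_inv D"
    using comm_unit_inv[OF is_unit_fps_const[OF unit], of "unit_inv D" i]
    by (simp add: unit_inv_fps_const unit)
  have "C (Suc k) i = 1 + lambda_times_inv (z i) * unit_inv D"
    unfolding C_def cont_frac_Suc by (simp add: right_frac_def D_def C_def algebra_simps)
  also have "lambda_times_inv (z i) * unit_inv D =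
      fps_X * (fps_const (unit_inv (\<tau> (i + 1))) * (fps_const (unit_inv (\<tau> i)) * unit_inv D))"
    unfolding lambda_times_inv_def z by (metis fps_X_central fps_const_mult mult.assoc)
  also have "\<dots> = fps_X * capp k (i + 1) * fps_const (unit_inv (\<tau> i))"
    unfolding c[symmetric] D(2)[symmetric] by (simp only: mult.assoc)
  also have "1 + \<dots> = cden (Suc k) i * fps_const (unit_inv (\<tau> i))"
    by (simp add: cden_def distrib_right unit unit_inv_right)
  finally have C: "C (Suc k) i = cden (Suc k) i * fps_const (unit_inv (\<tau> i))" .
  have u: "is_unit_elt (fps_const (unit_inv (\<tau> i)))"
    by (intro is_unit_fps_const is_unit_unit_inv unit)
  show ?case
    unfolding right_frac_def C capp_eq
    by (simp add: unit_inv_mult[OF is_unit_cden u] unit_inv_right'[OF u] is_unit_mult[OF is_unit_cden u])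
qed

lemma cont_frac_left:
  assumes z: "\<And>i. unit_inv (z i) = unit_inv (\<tau> i) * unit_inv (\<tau> (i + 1))"
  defines "C \<equiv> \<lambda>k i. cont_frac left_frac (map (\<lambda>j. lambda_times_inv (z (i + int j - 1))) [1..<Suc k])"
  shows "is_unit_elt (C k i) \<and> left_frac (fps_const (unit_inv (\<tau> i))) (C k i) = capp k i"
proof (induction k arbitrary: i)
  case 0
  show ?case by (simp add: C_def cont_frac_def is_unit_1 unit_inv_1 left_frac_def)
next
  case (Suc k)
  define D where "D = C k (i + 1)"
  have D: "is_unit_elt D" "unit_inv D * fps_const (unit_inv (\<tau> (i + 1))) = capp k (i + 1)"
    using Suc[of "i + 1"] by (simp_all add: D_def left_frac_def)
  have invD: "unit_inv D = capp k (i + 1) * fps_const (\<tau> (i + 1))"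
    unfolding D(2)[symmetric] using unit[of "i + 1"] by (simp add: unit_inv_left mult.assoc)
  have "fps_const (\<tau> i) * unit_inv D = unit_inv D * fps_const (\<tau> i)"
    unfolding invD by (rule comm_ratio_capp) simp
  hence c: "unit_inv D * fps_const (unit_inv (\<tau> i)) = fps_const (unit_inv (\<tau> i)) * unit_inv D"
    using comm_unit_inv[OF is_unit_fps_const[OF unit], of "unit_inv D" i]
    by (simp add: unit_inv_fps_const unit)
  have "C (Suc k) i = 1 + unit_inv D * lambda_times_inv (z i)"
    unfolding C_def cont_frac_Suc by (simp add: left_frac_def D_def C_def algebra_simps)
  also have "unit_inv D * lambda_times_inv (z i) =
      fps_X * ((unit_inv D * fps_const (unit_inv (\<tau> i))) * fps_const (unit_inv (\<tau> (i + 1))))"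
    unfolding lambda_times_inv_def z by (metis fps_X_central fps_const_mult mult.assoc)
  also have "\<dots> = fps_const (unit_inv (\<tau> i)) * (fps_X * capp k (i + 1))"
    unfolding c D(2)[symmetric] by (metis fps_X_central mult.assoc)
  also have "1 + \<dots> = fps_const (unit_inv (\<tau> i)) * cden (Suc k) i"
    by (simp add: cden_def distrib_left unit unit_inv_left)
  finally have C: "C (Suc k) i = fps_const (unit_inv (\<tau> i)) * cden (Suc k) i" .
  have u: "is_unit_elt (fps_const (unit_inv (\<tau> i)))"
    by (intro is_unit_fps_const is_unit_unit_inv unit)
  show ?case
    unfolding left_frac_def C capp_eq
    by (simp add: unit_inv_mult[OF u is_unit_cden] mult.assoc unit_inv_left[OF u] is_unit_mult[OF u is_unit_cden])
qed

end

section \<open>The two continued fractions in A_q and the homomorphism they define\<close>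

interpretation mf: qcommuting scalar tA 1
  by unfold_locales (simp_all add: is_unit_tA tA_comm_less)

interpretation uf: qcommuting scalar "\<lambda>i. tA (1 - i)" "- 1"
proof
  fix a b :: int assume "a < b"
  have "eps (1 - a) (1 - b) = - eps a b" by (auto simp: eps_def)
  thus "tA (1 - a) * tA (1 - b) = scalar (qpow (- 1 * eps a b)) * (tA (1 - b) * tA (1 - a))"
    using tA_comm[of "1 - a" "1 - b"] by simp
qed (rule is_unit_tA)

lemma zA_eq: "zA i = tA i * tA (i + 1)"
proof (cases "even i")
  case True
  then obtain k where "i = 2 * k" by blast
  thus ?thesis using tA_odd[of "k + 1"] by (simp add: zA_def tA_even add.commute)
next
  case False
  then obtain k where "i = 2 * k - 1" by (metis oddE add_diff_cancel_right' even_add even_plus_one_iff odd_one dvd_def)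
  thus ?thesis by (simp add: zA_def tA_even tA_odd)
qed

lemma unit_inv_zA: "unit_inv (zA i) = unit_inv (tA (i + 1)) * unit_inv (tA i)"
  unfolding zA_eq by (rule unit_inv_mult) (rule is_unit_tA)+

lemma DS_m_approx_eq: "1 \<le> N \<Longrightarrow> DS_m_approx N = mf.capp (2 * N - 1) 1"
proof -
  assume "1 \<le> N"
  hence "[1..<2 * N] = [1..<Suc (2 * N - 1)]" by simp
  thus ?thesis
    using mf.cont_frac_right[OF unit_inv_zA, where k = "2 * N - 1" and i = 1] tA_odd[of 1]
    unfolding DS_m_approx_def by (simp del: upt_Suc mf.capp.simps)
qed

lemma DS_u_approx_eq: "1 \<le> N \<Longrightarrow> DS_u_approx N = uf.capp (2 * N - 1) 1"
proof -
  assume "1 \<le> N"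
  hence *: "[1..<2 * N] = [1..<Suc (2 * N - 1)]" by simp
  have "unit_inv (zA (- i)) = unit_inv (tA (1 - i)) * unit_inv (tA (1 - (i + 1)))" for i
    by (simp add: unit_inv_zA)
  from uf.cont_frac_left[of "\<lambda>i. zA (- i)", OF this, where k = "2 * N - 1" and i = 1] show ?thesis
    using tA_even[of 0] * unfolding DS_u_approx_def by (simp del: upt_Suc uf.capp.simps)
qed

lemma fps_tendsto_if_agree:
  fixes f :: "nat \<Rightarrow> 'a::ring_1 fps"
  assumes "\<And>N m. m < N \<Longrightarrow> f N $ m = g $ m"
  shows "f \<longlonglongrightarrow> g"
proof (rule tendsto_fpsI)
  show "\<forall>\<^sub>F N in sequentially. f N $ m = g $ m" for m
    using eventually_gt_at_top[of m] by eventually_elim (rule assms)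
qed

text \<open>The signs undo those of \<open>alt_series\<close>, so that the generating series are
  sent to the continued fractions themselves.\<close>

definition ds_assign :: "hb_gen \<Rightarrow> aq" where
  "ds_assign g = (case g of U i \<Rightarrow> (- 1) ^ i * uf.cser 1 $ i | M i \<Rightarrow> (- 1) ^ i * mf.cser 1 $ i)"

definition DS :: "hb \<Rightarrow> aq" where
  "DS = scalar.presented_lift ds_assign"

lemma coeffwise_at_lambda: "f 0 = 0 \<Longrightarrow> coeffwise (coeffwise f) (at_lambda A) = at_lambda (coeffwise f A)"
  and coeffwise_at_mu: "f 0 = 0 \<Longrightarrow> coeffwise (coeffwise f) (at_mu A) = at_mu (coeffwise f A)"
  by (auto simp: fps_eq_iff at_lambda_nth at_mu_nth coeffwise_def)

lemma coeffwise_lambda_inv: "f 0 = 0 \<Longrightarrow> f 1 = 1 \<Longrightarrow> coeffwise (coeffwise f) lambda_inv = lambda_inv"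
  and coeffwise_mu_inv: "f 0 = 0 \<Longrightarrow> f 1 = 1 \<Longrightarrow> coeffwise (coeffwise f) mu_inv = mu_inv"
  by (auto simp: fps_eq_iff lambda_inv_def mu_inv_def coeffwise_def fps_X_def)

lemma coeffwise_exchange_relator:
  assumes "additive_mult f"
  shows "coeffwise (coeffwise f) (exchange_relator c A) = exchange_relator (f c) (coeffwise f A)"
proof -
  have "additive_mult (coeffwise (coeffwise f))"
    by (intro additive_mult_coeffwise assms)
  note h = am_mult[OF this] am_diff[OF this]
  have f: "f 0 = 0" "f 1 = 1" using am_0 am_1 assms by blast+
  have c: "coeffwise (coeffwise f) (fps_const (fps_const c)) = fps_const (fps_const (f c))"
    by (auto simp: fps_eq_iff coeffwise_def f)
  show ?thesis
    unfolding exchange_relator_def Let_def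
    by (simp add: h c f coeffwise_at_lambda coeffwise_at_mu coeffwise_lambda_inv coeffwise_mu_inv)
qed

lemma (in central_scalars) additive_mult_free_eval: "additive_mult (free_eval g)"
  by (simp add: additive_mult_def free_eval_add free_eval_mult)

text \<open>The exponents between t_i with i \<le> 0 and t_j with j \<ge> 1 alternate in both
  indices, so \<open>cser_comm_elt\<close> applies to either series. What remains is the exponent of
  the leading pair t_0, t_1, which is -1.\<close>

lemma uf_mf_comm: "uf.cser 1 $ i * mf.cser 1 $ j = scalar (qpow (- 1)) * (mf.cser 1 $ j * uf.cser 1 $ i)"
proof -
  have "mf.cser 1 $ j * tA (1 - k) = scalar (qpow (eps (1 - k) 1)) * (tA (1 - k) * mf.cser 1 $ j)" if "1 \<le> k" for k
  proof (rule scalar.qcomm_swap[where c = "- eps (1 - k) 1", simplified])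
    show "tA (1 - k) * mf.cser 1 $ j = scalar (qpow (- eps (1 - k) 1)) * (mf.cser 1 $ j * tA (1 - k))"
      using arg_cong[OF mf.cser_comm[of "1 - k" 1], of "\<lambda>A. A $ j"] that by simp
  qed
  moreover have "eps (1 - (k + 1)) 1 = - eps (1 - k) 1" if "1 \<le> k" for k :: int
    using that by (auto simp: eps_def)
  ultimately have "mf.cser 1 $ j * uf.cser 1 $ i = scalar (qpow (- eps (1 - 1) 1)) * (uf.cser 1 $ i * mf.cser 1 $ j)"
    by (rule uf.cser_comm_elt) auto
  hence "mf.cser 1 $ j * uf.cser 1 $ i = scalar (qpow 1) * (uf.cser 1 $ i * mf.cser 1 $ j)"
    by (simp add: eps_def)
  thus ?thesis by (rule scalar.qcomm_swap)
qed

lemma alt_signs: "(- 1) ^ i * ((- 1) ^ i * x) = (x :: 'a::ring_1)"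
  by (simp add: minus_one_power_iff)

lemma minus_one_power_left_commute: "z * ((- 1) ^ n * w) = (- 1) ^ n * (z * w)" for z :: "'a::ring_1"
  by (cases "even n") simp_all

lemma minus_one_power_hom: "additive_mult f \<Longrightarrow> f ((- 1) ^ i * x) = (- 1) ^ i * f x"
  by (simp add: am_mult am_power am_uminus am_1)

lemma ds_relators:
  assumes "r \<in> relators"
  shows "scalar.free_eval ds_assign r = (0 :: aq)"
proof -
  let ?f = "scalar.free_eval ds_assign :: hb_gen free_algebra \<Rightarrow> aq"
  have f: "additive_mult ?f" by (rule scalar.additive_mult_free_eval)
  let ?u = "alt_series (\<lambda>i. free_gen (U i))" and ?m = "alt_series (\<lambda>i. free_gen (M i))"
  have u: "coeffwise ?f ?u = uf.cser 1" and m: "coeffwise ?f ?m = mf.cser 1"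
    by (simp_all add: fps_eq_iff alt_series_def minus_one_power_hom[OF f] ds_assign_def alt_signs)
  obtain R i j where r: "r = R $ i $ j"
    and R: "R = exchange_relator (free_scalar qvar) ?u \<or> R = exchange_relator (free_scalar qvar_inv) ?m \<or>
      R = at_lambda ?u * at_mu ?m - fps_const (fps_const (free_scalar qvar_inv)) * (at_mu ?m * at_lambda ?u)"
    using assms unfolding relators_hb_gen_def Let_def by auto
  have "coeffwise (coeffwise ?f) R = 0"
    using R
  proof (elim disjE)
    assume "R = exchange_relator (free_scalar qvar) ?u"
    thus ?thesis using uf.exchange_cser[of 1]
      by (simp only: coeffwise_exchange_relator[OF f] u scalar.free_eval_scalar qvar_eq_qpow minus_minus)
  next
    assume "R = exchange_relator (free_scalar qvar_inv) ?m"
    thus ?thesis using mf.exchange_cser[of 1]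
      by (simp only: coeffwise_exchange_relator[OF f] m scalar.free_eval_scalar qvar_eq_qpow)
  next
    assume R: "R = at_lambda ?u * at_mu ?m - fps_const (fps_const (free_scalar qvar_inv)) * (at_mu ?m * at_lambda ?u)"
    have "additive_mult (coeffwise (coeffwise ?f))"
      by (intro additive_mult_coeffwise f)
    note h = am_mult[OF this] am_diff[OF this]
    have c: "coeffwise (coeffwise ?f) (fps_const (fps_const c)) = fps_const (fps_const (?f c))" for c
      by (auto simp: fps_eq_iff coeffwise_def)
    have "at_lambda (uf.cser 1) * at_mu (mf.cser 1) =
        fps_const (fps_const (scalar (qpow (- 1)))) * (at_mu (mf.cser 1) * at_lambda (uf.cser 1))"
    proof (intro fps_ext)
      fix m n
      show "(at_lambda (uf.cser 1) * at_mu (mf.cser 1)) $ m $ n =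
        (fps_const (fps_const (scalar (qpow (- 1)))) * (at_mu (mf.cser 1) * at_lambda (uf.cser 1))) $ m $ n"
        by (simp add: at_mu_def at_lambda_def uf_mf_comm)
    qed
    thus ?thesis unfolding R
      by (simp add: h c u m coeffwise_at_lambda coeffwise_at_mu qvar_eq_qpow)
  qed
  hence "coeffwise (coeffwise ?f) R $ i $ j = 0" by simp
  thus ?thesis by (simp add: r)
qed

lemma alg_hom_DS: "alg_hom DS"
  and DS_gen: "DS (gen g) = ds_assign g"
  using scalar.presented_lift_hom[of ds_assign, OF ds_relators]
  by (simp_all add: alg_hom_def DS_def)

lemmas DS_hom = alg_hom_additive_mult[OF alg_hom_DS]

lemma DS_scalar: "DS (scalar c) = scalar c"
  using alg_hom_DS by (simp add: alg_hom_def)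

lemma DS_u_series: "coeffwise DS u_series = uf.cser 1"
  and DS_m_series: "coeffwise DS m_series = mf.cser 1"
  by (simp_all add: fps_eq_iff u_series_def m_series_def alt_series_def minus_one_power_hom[OF DS_hom]
      DS_gen ds_assign_def alt_signs)

lemma DS_u_limit: "DS_u_approx \<longlonglongrightarrow> coeffwise DS u_series"
  unfolding DS_u_series
  by (rule fps_tendsto_if_agree) (simp add: DS_u_approx_eq uf.cser_capp)

lemma DS_m_limit: "DS_m_approx \<longlonglongrightarrow> coeffwise DS m_series"
  unfolding DS_m_series
  by (rule fps_tendsto_if_agree) (simp add: DS_m_approx_eq mf.cser_capp)

section \<open>A spanning set of $\mathbb{C}[H_- \backslash B_-]_q$\<close>

lemma at_mult_nth:
  "(at_lambda A * at_mu B) $ i $ j = A $ i * (B :: 'a::ring_1 fps) $ j"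
  "(at_mu A * at_lambda B) $ i $ j = A $ j * B $ i"
  "(at_lambda A * at_lambda B) $ i $ Suc j = 0"
  "(at_mu A * at_mu B) $ Suc i $ j = 0"
  by (simp_all add: at_mu_def flip: am_mult[OF additive_mult_at_lambda]) (simp_all add: at_lambda_def)

text \<open>In the coefficient of \<lambda>^-(i+1) \<mu>^-(j+1) the products of two series in the
  same variable do not contribute.\<close>

lemma exchange_relator_coeff:
  fixes A :: "'a::ring_1 fps"
  assumes "exchange_relator c A = 0"
  shows "A $ i * A $ Suc j + A $ j * A $ Suc i = c * (A $ Suc i * A $ j + A $ Suc j * A $ i)"
proof -
  let ?l = "at_lambda A" and ?m = "at_mu A"
  have "exchange_relator c A = lambda_inv * (?l * ?l) - lambda_inv * (?l * ?m) - mu_inv * (?m * ?l) + mu_inv * (?m * ?m)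
    - fps_const (fps_const c) * (lambda_inv * (?l * ?l) - mu_inv * (?l * ?m) - lambda_inv * (?m * ?l) + mu_inv * (?m * ?m))"
  proof -
    have c: "x * (lambda_inv * y) = lambda_inv * (x * y)" "x * (mu_inv * y) = mu_inv * (x * y)" for x y :: "'a fps fps"
      by (metis lambda_inv_central mu_inv_central mult.assoc)+
    show ?thesis
      unfolding exchange_relator_def Let_def
      by (simp add: algebra_simps c[of ?l] c[of ?m])
  qed
  from arg_cong[OF this, of "\<lambda>A. A $ Suc i $ Suc j"] assms
  have "0 = - (A $ i * A $ Suc j) - A $ j * A $ Suc i - c * (- (A $ Suc i * A $ j) - A $ Suc j * A $ i)"
    by (simp add: lambda_inv_nth mu_inv_nth at_mult_nth)
  thus ?thesis by (simp add: algebra_simps)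
qed

lemma additive_mult_abs_presented: "additive_mult (abs_presented :: 'g::presentation free_algebra \<Rightarrow> _)"
  by (simp add: additive_mult_def abs_presented_hom)

lemma hb_relations:
  "exchange_relator (scalar (qpow 1)) u_series = 0"
  "exchange_relator (scalar (qpow (- 1))) m_series = 0"
  "u_series $ i * m_series $ j = scalar (qpow (- 1)) * (m_series $ j * u_series $ i)"
proof -
  let ?f = "abs_presented :: hb_gen free_algebra \<Rightarrow> hb"
  let ?u = "alt_series (\<lambda>i. free_gen (U i))" and ?m = "alt_series (\<lambda>i. free_gen (M i))"
  note f = additive_mult_abs_presented
  have u: "coeffwise ?f ?u = u_series" and m: "coeffwise ?f ?m = m_series"
    by (simp_all add: fps_eq_iff alt_series_def u_series_def m_series_def abs_presented_hom am_power[OF f] am_uminus[OF f])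
  have rel: "?f (R $ i $ j) = 0"
    if "R \<in> {exchange_relator (free_scalar qvar) ?u, exchange_relator (free_scalar qvar_inv) ?m,
      at_lambda ?u * at_mu ?m - fps_const (fps_const (free_scalar qvar_inv)) * (at_mu ?m * at_lambda ?u)}" for R i j
    by (rule relator_eq_0) (use that in \<open>force simp: relators_hb_gen_def Let_def\<close>)
  have "coeffwise (coeffwise ?f) (exchange_relator (free_scalar qvar) ?u) = 0"
    "coeffwise (coeffwise ?f) (exchange_relator (free_scalar qvar_inv) ?m) = 0"
    unfolding fps_eq_iff coeffwise_nth using rel by simp_all
  thus "exchange_relator (scalar (qpow 1)) u_series = 0" "exchange_relator (scalar (qpow (- 1))) m_series = 0"
    by (simp_all add: coeffwise_exchange_relator[OF f] u m abs_presented_hom qvar_eq_qpow)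
  have "(at_lambda ?u * at_mu ?m - fps_const (fps_const (free_scalar qvar_inv)) * (at_mu ?m * at_lambda ?u)) $ i $ j =
      ?u $ i * ?m $ j - free_scalar qvar_inv * (?m $ j * ?u $ i)"
    by (simp add: at_mult_nth)
  hence "?f (?u $ i * ?m $ j - free_scalar qvar_inv * (?m $ j * ?u $ i)) = 0"
    using rel[of "at_lambda ?u * at_mu ?m - fps_const (fps_const (free_scalar qvar_inv)) * (at_mu ?m * at_lambda ?u)" i j]
    by simp
  hence "?f (?u $ i) * ?f (?m $ j) = scalar (qpow (- 1)) * (?f (?m $ j) * ?f (?u $ i))"
    by (simp add: abs_presented_hom qvar_eq_qpow)
  thus "u_series $ i * m_series $ j = scalar (qpow (- 1)) * (m_series $ j * u_series $ i)"
    unfolding u[symmetric] m[symmetric] coeffwise_nth .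
qed

section \<open>Straightening of words by the exchange relation\<close>

definition word_val :: "'a::ring_1 fps \<Rightarrow> nat list \<Rightarrow> 'a" where
  "word_val A xs = (\<Prod>i\<leftarrow>xs. A $ i)"

lemma word_val_simps [simp]:
  "word_val A [] = 1" "word_val A (x # xs) = A $ x * word_val A xs"
  "word_val A (xs @ ys) = word_val A xs * word_val A ys"
  by (simp_all add: word_val_def)

lemma unsorted_adjacent:
  "\<not> sorted (xs :: nat list) \<Longrightarrow> \<exists>ys b a zs. xs = ys @ b # a # zs \<and> a < b"
proof -
  assume "\<not> sorted xs"
  then obtain i where i: "Suc i < length xs" "xs ! Suc i < xs ! i"
    by (auto simp: sorted_iff_nth_Suc not_le)
  hence "xs = take i xs @ xs ! i # xs ! Suc i # drop (Suc (Suc i)) xs"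
    by (metis Cons_nth_drop_Suc Suc_lessD id_take_nth_drop)
  thus ?thesis using i(2) by blast
qed

text \<open>For adjacent indices every term of the exchange relation occurs twice; 2 is invertible
  among the complex scalars.\<close>

lemma presented_double_cancel:
  assumes "x + x = y + (y :: 'g::presentation presented)"
  shows "x = y"
proof -
  have h: "scalar (Poly_Mapping.single 0 (1/2)) * (z + z) = z" for z :: "'g presented"
    by (simp add: distrib_left single_one flip: distrib_right scalar_add single_add)
  show ?thesis by (metis h assms)
qed

text \<open>Solved for A_b A_a with a < b, the relation yields three products that begin with a
  letter below b, unless b = a + 1. Length-lexicographic induction therefore terminates in sorted
  words.\<close>

lemma word_straighten:
  fixes A :: "'g::presentation presented fps"
  assumes "exchange_relator (scalar (qpow k)) A = 0"
  shows "word_val A xs \<in> lmod.span (word_val A ` {ys. sorted ys})"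
proof (induction xs rule: wf_induct[OF wf_lenlex[OF wf_less_than]])
  case (1 xs)
  let ?S = "lmod.span (word_val A ` {ys. sorted ys})"
  show ?case
  proof (cases "sorted xs")
    case False
    then obtain ys b a zs where xs: "xs = ys @ b # a # zs" "a < b" using unsorted_adjacent by blast
    have IH: "word_val A (ys @ b' # a' # zs) \<in> ?S" if "b' < b" for b' a'
    proof -
      have "(ys @ b' # a' # zs, xs) \<in> lenlex less_than"
        using that by (auto simp: xs lenlex_def lex_append_leftI)
      thus ?thesis using 1 by blast
    qed
    obtain j where j: "b = Suc j" using xs(2) by (cases b) auto
    note rel = exchange_relator_coeff[OF assms, of a j]
    have swap: "A $ b * A $ a = scalar (qpow (- k)) * (A $ a * A $ b + A $ j * A $ Suc a) - A $ Suc a * A $ j"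
      unfolding j rel by (simp add: distrib_left)
    show ?thesis
    proof (cases "a = j")
      \<comment> \<open>Here Suc a = b, so A_b A_a also occurs as A_(a+1) A_j, and the relation says
        twice that A_a and A_b q-commute.\<close>
      case True
      have "A $ a * A $ b + A $ a * A $ b = scalar (qpow k) * (A $ b * A $ a) + scalar (qpow k) * (A $ b * A $ a)"
        using rel True j by (simp add: distrib_left)
      hence "A $ a * A $ b = scalar (qpow k) * (A $ b * A $ a)" by (rule presented_double_cancel)
      hence "A $ b * A $ a = scalar (qpow (- k)) * (A $ a * A $ b)" by simp
      hence "word_val A xs = scalar (qpow (- k)) * word_val A (ys @ a # b # zs)"
        by (simp add: xs mult.assoc[symmetric] scalar_central[of _ "word_val A ys"])
      thus ?thesis using lmod.span_scale[OF IH[OF xs(2), of b]] by simp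
    next
      case False
      hence *: "a < b" "j < b" "Suc a < b" using j xs(2) by auto
      have "word_val A xs = word_val A ys * (A $ b * A $ a) * word_val A zs"
        by (simp add: xs mult.assoc)
      also have "\<dots> = scalar (qpow (- k)) * (word_val A (ys @ a # b # zs) + word_val A (ys @ j # Suc a # zs))
          - word_val A (ys @ Suc a # j # zs)"
        unfolding swap
        by (simp add: algebra_simps scalar_left_commute[of "word_val A ys"])
      finally show ?thesis
        using IH[OF *(1)] IH[OF *(2)] IH[OF *(3)]
        by (simp add: lmod.span_diff lmod.span_add lmod.span_scale)
    qed
  qed (auto intro: lmod.span_base)
qed

lemma span_mult:
  fixes x y :: "'g::presentation presented"
  assumes "x \<in> lmod.span S" "y \<in> lmod.span R" "\<And>a b. a \<in> S \<Longrightarrow> b \<in> R \<Longrightarrow> a * b \<in> Q"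
  shows "x * y \<in> lmod.span Q"
  using assms(1)
proof (induction x rule: lmod.span_induct_alt)
  case (step c a x)
  have "a * y \<in> lmod.span Q"
    using assms(2)
  proof (induction y rule: lmod.span_induct_alt)
    case (step d b y)
    have "a * (scalar d * b + y) = scalar d * (a * b) + a * y"
      by (simp add: distrib_left scalar_left_commute)
    thus ?case using step assms(3)[OF \<open>a \<in> S\<close> step(1)]
      by (simp add: lmod.span_add lmod.span_scale lmod.span_base)
  qed (simp add: lmod.span_zero)
  thus ?case using step by (simp add: distrib_right mult.assoc lmod.span_add lmod.span_scale)
qed (simp add: lmod.span_zero)

definition pbw :: "hb set" where
  "pbw = {word_val u_series us * word_val m_series ms | us ms. sorted us \<and> sorted ms}"

lemma m_word_comm:
  "\<exists>d. m_series $ j * word_val u_series us = scalar (qpow d) * (word_val u_series us * m_series $ j)"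
proof (induction us)
  case Nil
  show ?case by (intro exI[of _ 0]) simp
next
  case (Cons i us)
  then obtain d where "m_series $ j * word_val u_series us = scalar (qpow d) * (word_val u_series us * m_series $ j)"
    by blast
  thus ?case using scalar.qcomm_mult[OF scalar.qcomm_swap[OF hb_relations(3)]] by fastforce
qed

lemma gen_u: "gen (U i) = (- 1) ^ i * u_series $ i" and gen_m: "gen (M i) = (- 1) ^ i * m_series $ i"
  by (simp_all add: u_series_def m_series_def alt_series_def alt_signs)

lemma pbw_span: "a \<in> lmod.span pbw"
proof -
  have words: "word_val u_series us * word_val m_series ms \<in> lmod.span pbw" for us ms
    by (rule span_mult[OF word_straighten[OF hb_relations(1)] word_straighten[OF hb_relations(2)]])
       (auto simp: pbw_def)
  have sign: "(- 1) ^ i * x \<in> lmod.span pbw" if "x \<in> lmod.span pbw" for x i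
    using that by (simp add: minus_one_power_iff lmod.span_neg)
  have "\<forall>s\<in>lmod.span pbw. x * s \<in> lmod.span pbw" for x
  proof (induction x rule: presented_induct)
    case (scalar c)
    show ?case using lmod.span_scale by blast
  next
    case (gen g)
    show ?case
    proof
      fix s assume "s \<in> lmod.span pbw"
      thus "gen g * s \<in> lmod.span pbw"
      proof (induction s rule: lmod.span_induct_alt)
        case (step c a s)
        then obtain us ms where a: "a = word_val u_series us * word_val m_series ms"
          by (auto simp: pbw_def)
        have "gen g * a \<in> lmod.span pbw"
        proof (cases g)
          case (U i)
          have "gen g * a = (- 1) ^ i * (word_val u_series (i # us) * word_val m_series ms)"
            by (simp add: U a gen_u mult.assoc)
          thus ?thesis using sign[OF words[of "i # us" ms]] by simp
        next
          case (M i)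
          obtain d where d: "m_series $ i * word_val u_series us = scalar (qpow d) * (word_val u_series us * m_series $ i)"
            using m_word_comm by blast
          have "gen g * a = (- 1) ^ i * ((m_series $ i * word_val u_series us) * word_val m_series ms)"
            by (simp add: M a gen_m mult.assoc)
          also have "\<dots> = (- 1) ^ i * (scalar (qpow d) * (word_val u_series us * word_val m_series (i # ms)))"
            unfolding d by (simp add: mult.assoc)
          finally show ?thesis using sign[OF lmod.span_scale[OF words[of us "i # ms"]]] by simp
        qed
        thus ?case using step(2)
          by (simp add: distrib_left scalar_left_commute lmod.span_add lmod.span_scale)
      qed (simp add: lmod.span_zero)
    qed
  next
    case (add a b)
    thus ?case by (simp add: distrib_right lmod.span_add)
  next
    case (mult a b)
    thus ?case by (simp add: mult.assoc)
  qed
  moreover have "1 \<in> lmod.span pbw" using words[of "[]" "[]"] by simp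
  ultimately have "a * 1 \<in> lmod.span pbw" by blast
  thus ?thesis by simp
qed

section \<open>Leading exponents and injectivity\<close>

lemma less_poly_mappingI:
  assumes "Poly_Mapping.lookup f k < Poly_Mapping.lookup g k"
    "\<And>j. j < k \<Longrightarrow> Poly_Mapping.lookup f j = Poly_Mapping.lookup g j"
  shows "f < (g :: 'a::linorder \<Rightarrow>\<^sub>0 'b::{zero,linorder})"
  using assms by transfer (auto simp: less_fun_def)

lemma lead_uminus [simp]: "lead (- f) = lead f"
  by (simp add: lead_def)

text \<open>The exponent of t_i^-2 ... t_(i+k-1)^-2 t_(i+k)^-1, the future leading monomial of
  coefficient k of the fraction starting at t_i; \<pi> lists the positions of its
  generators.\<close>

definition cf_exponent :: "(int \<Rightarrow> nat) \<Rightarrow> int \<Rightarrow> nat \<Rightarrow> nat \<Rightarrow>\<^sub>0 int" where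
  "cf_exponent \<pi> i k = (\<Sum>j<k. Poly_Mapping.single (\<pi> (i + int j)) (- 2)) + Poly_Mapping.single (\<pi> (i + int k)) (- 1)"

lemma cf_exponent_Suc:
  "cf_exponent \<pi> i (Suc k) = Poly_Mapping.single (\<pi> i) (- 2) + cf_exponent \<pi> (i + 1) k"
  by (simp add: cf_exponent_def sum.lessThan_Suc_shift add_ac del: sum.lessThan_Suc)

lemma lookup_cf_exponent:
  assumes "strict_mono_on {1..} \<pi>" "1 \<le> i" "1 \<le> m"
  shows "Poly_Mapping.lookup (cf_exponent \<pi> i k) (\<pi> m) =
    (if i \<le> m \<and> m < i + int k then - 2 else if m = i + int k then - 1 else 0)"
proof -
  have inj: "\<pi> (i + int j) = \<pi> m \<longleftrightarrow> i + int j = m" for j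
    using inj_onD[OF strict_mono_on_imp_inj_on[OF assms(1)], of "i + int j" m] assms(2,3) by auto
  have "(\<Sum>j<k. (- 2 :: int) when i + int j = m) = (if i \<le> m \<and> m < i + int k then - 2 else 0)"
  proof -
    have "(\<Sum>j<k. (- 2 :: int) when i + int j = m) = (\<Sum>j<k. if j = nat (m - i) then (if i \<le> m then - 2 else 0) else 0)"
      by (intro sum.cong) (auto simp: when_def)
    thus ?thesis by (auto simp: sum.delta nat_less_iff)
  qed
  thus ?thesis
    by (simp add: cf_exponent_def lookup_add lookup_sum lookup_single inj when_def)
qed

lemma lookup_cf_exponent_below:
  assumes "strict_mono_on {1..} \<pi>" "1 \<le> i" "n < \<pi> i"
  shows "Poly_Mapping.lookup (cf_exponent \<pi> i k) n = 0"
proof -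
  have "\<pi> i \<le> \<pi> (i + int j)" for j
    using assms(1,2) by (simp add: strict_mono_on_leD)
  hence "\<pi> (i + int j) \<noteq> n" for j using assms(3) by (metis leD)
  thus ?thesis by (simp add: cf_exponent_def lookup_add lookup_sum lookup_single)
qed

text \<open>Coefficient n + 1 of the equation expresses c_(i,n+1) t_i as minus the sum of all
  c_(i,l) c_(i+1,n-l). The summand l = 0 dominates, which gives the exponent recursively.\<close>

lemma lead_continued_fraction:
  fixes c :: "int \<Rightarrow> aq fps"
  assumes mono: "strict_mono_on {1..} (\<lambda>i. pos (\<iota> i))"
    and c: "\<And>i. c i * (fps_const (tA (\<iota> i)) + fps_X * c (i + 1)) = 1"
    and i: "1 \<le> i"
  shows "to_qt (c i $ k) \<noteq> 0 \<and> he (lead (to_qt (c i $ k))) = cf_exponent (\<lambda>i. pos (\<iota> i)) i k"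
  using i
proof (induction k arbitrary: i rule: less_induct)
  case (less k)
  let ?\<pi> = "\<lambda>i. pos (\<iota> i)"
  let ?t = "tA (\<iota> i)"
  have t: "to_qt (unit_inv ?t) = tq (\<iota> i) (- 1)"
    by (simp add: am_unit_inv[OF to_qt_hom is_unit_tA] to_qt_tA unit_inv_tq)
  have tq: "tq a z \<noteq> 0" "he (lead (tq a z)) = Poly_Mapping.single (pos a) z" for a z
  proof -
    show "tq a z \<noteq> 0" unfolding tq_def by (metis lookup_single_eq lookup_zero zero_neq_one)
    show "he (lead (tq a z)) = Poly_Mapping.single (pos a) z" by (simp add: tq_def lead_single)
  qed
  show ?case
  proof (cases k)
    case 0
    have "c i $ 0 * ?t = 1" using arg_cong[OF c[of i], of "\<lambda>A. A $ 0"] by simp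
    hence "c i $ 0 = unit_inv ?t"
      by (metis is_unit_tA mult.assoc mult_1 mult_1_right unit_inv_right)
    thus ?thesis by (simp add: 0 t tq cf_exponent_def)
  next
    case (Suc n)
    define F where "F = (\<lambda>l. to_qt (c i $ l * c (i + 1) $ (n - l) * unit_inv ?t))"
    have IH: "to_qt (c i $ l) \<noteq> 0" "he (lead (to_qt (c i $ l))) = cf_exponent ?\<pi> i l"
      "to_qt (c (i + 1) $ l) \<noteq> 0" "he (lead (to_qt (c (i + 1) $ l))) = cf_exponent ?\<pi> (i + 1) l"
      if "l \<le> n" for l
      using less.IH[of l i] less.IH[of l "i + 1"] less.prems that by (auto simp: Suc)
    have F: "F l \<noteq> 0" "he (lead (F l)) = cf_exponent ?\<pi> i l + cf_exponent ?\<pi> (i + 1) (n - l) + Poly_Mapping.single (?\<pi> i) (- 1)"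
      if "l \<le> n" for l
      using IH(1,2)[OF that] IH(3,4)[of "n - l"] tq[of "\<iota> i" "- 1"]
      by (simp_all add: F_def am_mult[OF to_qt_hom] t qtorus_mult_nonzero)
    have "(c i * (fps_const ?t + fps_X * c (i + 1))) $ Suc n = c i $ Suc n * ?t + (fps_X * (c i * c (i + 1))) $ Suc n"
      by (simp add: distrib_left mult.assoc[symmetric] flip: fps_X_central[of "c i"])
    hence "0 = c i $ Suc n * ?t + (\<Sum>l=0..n. c i $ l * c (i + 1) $ (n - l))"
      unfolding c by (simp add: fps_mult_nth[of "c i"])
    hence "c i $ Suc n * ?t = - (\<Sum>l=0..n. c i $ l * c (i + 1) $ (n - l))"
      by (simp add: eq_neg_iff_add_eq_0)
    hence "c i $ Suc n * ?t * unit_inv ?t = - (\<Sum>l=0..n. c i $ l * c (i + 1) $ (n - l)) * unit_inv ?t"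
      by simp
    hence "c i $ Suc n = - (\<Sum>l=0..n. c i $ l * c (i + 1) $ (n - l) * unit_inv ?t)"
      by (simp add: mult.assoc unit_inv_right is_unit_tA sum_distrib_right)
    hence sum: "to_qt (c i $ Suc n) = - (\<Sum>l=0..n. F l)"
      by (simp add: F_def am_uminus[OF to_qt_hom] am_sum[OF to_qt_hom])
    also have "(\<Sum>l=0..n. F l) = F 0 + (\<Sum>l=1..n. F l)"
      by (simp add: sum.atLeast_Suc_atMost)
    finally have sum: "to_qt (c i $ Suc n) = - (F 0 + (\<Sum>l=1..n. F l))" .
    have small: "m < lead (F 0)" if "m \<in> Poly_Mapping.keys (\<Sum>l=1..n. F l)" for m
    proof (rule keys_sum_less[OF _ that])
      fix l m assume l: "l \<in> {1..n}" and m: "m \<in> Poly_Mapping.keys (F l)"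
      \<comment> \<open>At the position of t_i the exponent is -2 for l = 0 and -3 for l > 0.
        Earlier positions do not occur, because later generators have larger positions.\<close>
      have "he (lead (F l)) < he (lead (F 0))"
      proof (rule less_poly_mappingI)
        show "Poly_Mapping.lookup (he (lead (F l))) (?\<pi> i) < Poly_Mapping.lookup (he (lead (F 0))) (?\<pi> i)"
          using l less.prems lookup_cf_exponent[OF mono, of _ i]
          by (simp add: F lookup_add lookup_single)
        show "Poly_Mapping.lookup (he (lead (F l))) j = Poly_Mapping.lookup (he (lead (F 0))) j" if j: "j < ?\<pi> i" for j
        proof -
          have "?\<pi> i < ?\<pi> (i + 1)" using less.prems by (intro strict_mono_onD[OF mono]) auto
          thus ?thesis
            using l j less.prems lookup_cf_exponent_below[OF mono, of _ j]
            by (simp add: F lookup_add lookup_single)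
        qed
      qed
      hence "lead (F l) < lead (F 0)" by (simp add: less_heis_def)
      thus "m < lead (F 0)" using lead_ge[OF m] by simp
    qed
    have "F 0 + (\<Sum>l=1..n. F l) \<noteq> 0" "lead (F 0 + (\<Sum>l=1..n. F l)) = lead (F 0)"
      using lead_add_less[of "F 0", OF F(1) small] by simp_all
    moreover have "he (lead (F 0)) = cf_exponent ?\<pi> i (Suc n)"
    proof -
      have "Poly_Mapping.single (?\<pi> i) (- 2) = Poly_Mapping.single (?\<pi> i) (- 1) + Poly_Mapping.single (?\<pi> i) (- 1 :: int)"
        by (simp flip: single_add)
      thus ?thesis by (simp only: F(2)[OF le0] cf_exponent_Suc) (simp add: cf_exponent_def add_ac)
    qed
    ultimately show ?thesis
      unfolding Suc sum lead_uminus neg_equal_0_iff_equal by metis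
  qed
qed

lemma pos_pos_mono: "strict_mono_on {1..} pos" and pos_neg_mono: "strict_mono_on {1..} (\<lambda>i. pos (1 - i))"
  by (auto simp: strict_mono_on_def pos_def)

lemma lead_word_val:
  fixes A :: "aq fps"
  assumes "\<And>k. to_qt (A $ k) \<noteq> 0 \<and> he (lead (to_qt (A $ k))) = E k"
  shows "to_qt (word_val A xs) \<noteq> 0 \<and> he (lead (to_qt (word_val A xs))) = sum_list (map E xs)"
proof (induction xs)
  case Nil
  show ?case using arg_cong[OF qtorus_mult_nonzero(2)[of 1 1], of he] by (simp add: am_1[OF to_qt_hom])
next
  case (Cons x xs)
  thus ?case using assms[of x] qtorus_mult_nonzero[of "to_qt (A $ x)" "to_qt (word_val A xs)"]
    by (simp add: am_mult[OF to_qt_hom])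
qed

lemma length_filter_split: "length (filter ((\<le>) k) xs) = length (filter ((\<le>) (Suc k)) xs) + count (mset xs) (k::nat)"
  by (induction xs) auto

lemma lookup_sum_cf_exponent:
  assumes "strict_mono_on {1..} \<pi>"
  shows "Poly_Mapping.lookup (sum_list (map (cf_exponent \<pi> 1) xs)) (\<pi> (1 + int k)) =
    - int (length (filter ((\<le>) k) xs) + length (filter ((\<le>) (Suc k)) xs))"
  by (induction xs) (auto simp: lookup_add lookup_cf_exponent[OF assms])

text \<open>The exponent at the generator with index 1 + k is -(S k + S (k + 1)), where S k counts
  the letters \<ge> k. Descending from large k, where S vanishes, these sums determine S; its
  differences are the multiplicities, and a sorted word is determined by them.\<close>

lemma cf_exponent_words_inj:
  assumes mono: "strict_mono_on {1..} \<pi>" and "sorted xs" "sorted ys"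
    and eq: "\<And>k. Poly_Mapping.lookup (sum_list (map (cf_exponent \<pi> 1) xs)) (\<pi> (1 + int k)) =
      Poly_Mapping.lookup (sum_list (map (cf_exponent \<pi> 1) ys)) (\<pi> (1 + int k))"
  shows "xs = ys"
proof -
  define S where "S = (\<lambda>xs k. length (filter ((\<le>) (k::nat)) xs))"
  have step: "S xs k + S xs (Suc k) = S ys k + S ys (Suc k)" for k
    using eq[of k] unfolding lookup_sum_cf_exponent[OF mono] S_def by linarith
  define N where "N = Suc (sum_list xs + sum_list ys)"
  have S_eq: "S xs k = S ys k" if "k \<le> N" for k
    using that
  proof (induction k rule: inc_induct)
    case base
    have "x < N" if "x \<in> set xs \<union> set ys" for x
      using that member_le_sum_list[of x xs] member_le_sum_list[of x ys] by (auto simp: N_def)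
    thus ?case by (auto simp: S_def filter_empty_conv[THEN iffD2] not_le)
  next
    case (step n)
    thus ?case using \<open>\<And>k. S xs k + S xs (Suc k) = S ys k + S ys (Suc k)\<close>[of n] by simp
  qed
  have 0: "S xs k = 0 \<and> S ys k = 0" if "N \<le> k" for k
  proof -
    have "x < N" if "x \<in> set xs \<union> set ys" for x
      using that member_le_sum_list[of x xs] member_le_sum_list[of x ys] by (auto simp: N_def)
    thus ?thesis using that by (force simp: S_def filter_empty_conv not_le)
  qed
  have "S xs k = S ys k" for k using S_eq[of k] 0[of k] by (cases "k \<le> N") auto
  hence "count (mset xs) k = count (mset ys) k" for k
    using length_filter_split[of k xs] length_filter_split[of k ys] by (simp add: S_def)
  hence "mset xs = mset ys" by (simp add: multiset_eq_iff)
  thus ?thesis using assms(2,3) by (metis properties_for_sort)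
qed

lemma DS_word_val:
  "DS (word_val u_series us) = word_val (uf.cser 1) us" "DS (word_val m_series ms) = word_val (mf.cser 1) ms"
  unfolding DS_u_series[symmetric] DS_m_series[symmetric]
  by (induction us, simp_all add: am_1[OF DS_hom] am_mult[OF DS_hom])
     (induction ms, simp_all add: am_1[OF DS_hom] am_mult[OF DS_hom])

text \<open>The u-part involves only t_i with i \<le> 0 and the m-part only those with i \<ge> 1, so
  the exponent of a product separates and both sorted words can be read off.\<close>

lemma inj_to_qt_DS: "inj (to_qt \<circ> DS)"
proof -
  let ?f = "to_qt \<circ> DS"
  have f: "additive_mult ?f"
    by (simp add: additive_mult_def am_add[OF to_qt_hom] am_add[OF DS_hom] am_mult[OF to_qt_hom] am_mult[OF DS_hom]
        am_1[OF to_qt_hom] am_1[OF DS_hom])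
  let ?E = "\<lambda>us ms. sum_list (map (cf_exponent (\<lambda>i. pos (1 - i)) 1) us) + sum_list (map (cf_exponent pos 1) ms)"
  have u: "to_qt (word_val (uf.cser 1) us) \<noteq> 0 \<and>
      he (lead (to_qt (word_val (uf.cser 1) us))) = sum_list (map (cf_exponent (\<lambda>i. pos (1 - i)) 1) us)" for us
    by (intro lead_word_val lead_continued_fraction uf.cser_mult pos_neg_mono) simp
  have m: "to_qt (word_val (mf.cser 1) ms) \<noteq> 0 \<and>
      he (lead (to_qt (word_val (mf.cser 1) ms))) = sum_list (map (cf_exponent pos 1) ms)" for ms
    by (intro lead_word_val lead_continued_fraction[where \<iota> = "\<lambda>i. i"] mf.cser_mult pos_pos_mono) simp
  have lead: "?f (word_val u_series us * word_val m_series ms) \<noteq> 0"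
    "he (lead (?f (word_val u_series us * word_val m_series ms))) = ?E us ms" for us ms
    using u[of us] m[of ms]
    by (simp_all add: am_mult[OF DS_hom] am_mult[OF to_qt_hom] DS_word_val qtorus_mult_nonzero)
  have other: "Poly_Mapping.lookup (sum_list (map (cf_exponent (\<lambda>i. pos (1 - i)) 1) us)) (pos (1 + int k)) = 0"
    "Poly_Mapping.lookup (sum_list (map (cf_exponent pos 1) us)) (pos (1 - (1 + int k))) = 0" for us k
  proof -
    have "1 - (1 + int j) \<noteq> 1 + int k" "1 + int j \<noteq> 1 - (1 + int k)" for j by auto
    thus "Poly_Mapping.lookup (sum_list (map (cf_exponent (\<lambda>i. pos (1 - i)) 1) us)) (pos (1 + int k)) = 0"
      "Poly_Mapping.lookup (sum_list (map (cf_exponent pos 1) us)) (pos (1 - (1 + int k))) = 0"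
      by (induction us; simp add: lookup_add cf_exponent_def lookup_sum lookup_single)+
  qed
  show ?thesis
  proof (rule am_inj[OF f], rule lin_indep_by_leads[OF f _ _ _ pbw_span])
    show "inj_on (\<lambda>b. he (lead (?f b))) pbw"
    proof (rule inj_onI)
      fix a b assume "a \<in> pbw" "b \<in> pbw" and eq: "he (lead (?f a)) = he (lead (?f b))"
      then obtain us ms us' ms' where
        a: "a = word_val u_series us * word_val m_series ms" "sorted us" "sorted ms" and
        b: "b = word_val u_series us' * word_val m_series ms'" "sorted us'" "sorted ms'"
        by (auto simp: pbw_def)
      have E: "?E us ms = ?E us' ms'" using eq unfolding a(1) b(1) lead by simp
      have "ms = ms'"
        by (rule cf_exponent_words_inj[OF pos_pos_mono a(3) b(3)])
           (use arg_cong[OF E, of "\<lambda>e. Poly_Mapping.lookup e (pos (1 + int _))"] in \<open>simp add: lookup_add other\<close>)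
      moreover have "us = us'"
      proof (rule cf_exponent_words_inj[OF pos_neg_mono a(2) b(2)])
        fix k
        show "Poly_Mapping.lookup (sum_list (map (cf_exponent (\<lambda>i. pos (1 - i)) 1) us)) (pos (1 - (1 + int k))) =
          Poly_Mapping.lookup (sum_list (map (cf_exponent (\<lambda>i. pos (1 - i)) 1) us')) (pos (1 - (1 + int k)))"
          using arg_cong[OF E, of "\<lambda>e. Poly_Mapping.lookup e (pos (1 - (1 + int k)))"]
          by (simp only: lookup_add other add_0_right)
      qed
      ultimately show "a = b" by (simp add: a(1) b(1))
    qed
  qed (use lead in \<open>auto simp: pbw_def DS_scalar to_qt_scalar\<close>)
qed

lemma inj_DS: "inj DS"
  using inj_to_qt_DS by (rule inj_on_imageI2)

section \<open>The Ore condition from polynomial growth\<close>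

text \<open>A region containing the support of products of k factors. The exponents of the t_i grow
  linearly in k and the power of q quadratically, since \<open>ecoc\<close> is bilinear; the number
  of elements is still polynomial in k.\<close>

definition box :: "nat \<Rightarrow> nat \<Rightarrow> nat \<Rightarrow> nat \<Rightarrow> heis set" where
  "box N C D k = {h. \<bar>hc h\<bar> \<le> int (D * k\<^sup>2) \<and> (\<forall>n. \<bar>Poly_Mapping.lookup (he h) n\<bar> \<le> int (C * k)) \<and>
     (\<forall>n\<ge>N. Poly_Mapping.lookup (he h) n = 0)}"

text \<open>The cross term 2 D j k of D (j + k)^2 absorbs the cocycle, which is at most N^2 C^2 j
  k.\<close>

lemma box_add:
  assumes "N\<^sup>2 * C\<^sup>2 \<le> D" "g \<in> box N C D j" "h \<in> box N C D k"
  shows "g + h \<in> box N C D (j + k)"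
proof -
  let ?e = "Poly_Mapping.lookup (he g)" and ?f = "Poly_Mapping.lookup (he h)"
  have e: "\<bar>?e n\<bar> \<le> int (C * j)" and f: "\<bar>?f n\<bar> \<le> int (C * k)" for n
    using assms(2,3) by (auto simp: box_def)
  have "ecoc (he g) (he h) = (\<Sum>m<N. \<Sum>n<N. ?e m * ?f n * (if n < m then eps (idx m) (idx n) else 0))"
    by (rule ecoc_superset) (use assms(2,3) in \<open>auto simp: box_def in_keys_iff not_less[symmetric]\<close>)
  also have "\<bar>\<dots>\<bar> \<le> (\<Sum>m<N. \<Sum>n<N. \<bar>?e m * ?f n * (if n < m then eps (idx m) (idx n) else 0)\<bar>)"
    by (rule order.trans[OF sum_abs]) (intro sum_mono sum_abs)
  also have "\<dots> \<le> (\<Sum>m<N. \<Sum>n<N. int (C * j) * int (C * k) * 1)"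
  proof (intro sum_mono)
    fix m n
    have "\<bar>if n < m then eps (idx m) (idx n) else 0\<bar> \<le> 1" by (auto simp: eps_def)
    thus "\<bar>?e m * ?f n * (if n < m then eps (idx m) (idx n) else 0)\<bar> \<le> int (C * j) * int (C * k) * 1"
      unfolding abs_mult by (intro mult_mono e f) auto
  qed
  also have "\<dots> = int (N\<^sup>2 * C\<^sup>2 * j * k)"
    by (simp add: power2_eq_square)
  also have "\<dots> \<le> int (2 * D * j * k)"
    using assms(1) by (intro iffD2[OF of_nat_le_iff] mult_right_mono) auto
  finally have "\<bar>ecoc (he g) (he h)\<bar> \<le> int (2 * D * j * k)" .
  moreover have "\<bar>hc g\<bar> \<le> int (D * j\<^sup>2)" "\<bar>hc h\<bar> \<le> int (D * k\<^sup>2)"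
    using assms(2,3) by (auto simp: box_def)
  moreover have "int (D * (j + k)\<^sup>2) = int (D * j\<^sup>2) + int (D * k\<^sup>2) + int (2 * D * j * k)"
    by (simp add: power2_eq_square algebra_simps)
  ultimately have "\<bar>hc (g + h)\<bar> \<le> int (D * (j + k)\<^sup>2)"
    by (simp add: plus_heis_def)
  moreover have "\<bar>Poly_Mapping.lookup (he (g + h)) n\<bar> \<le> int (C * (j + k))" for n
    using e[of n] f[of n] by (simp add: lookup_add algebra_simps)
  ultimately show ?thesis using assms(2,3) by (auto simp: box_def lookup_add)
qed

lemma card_box:
  shows "finite (box N C D k)" and "card (box N C D k) \<le> (2 * (D * k\<^sup>2) + 1) * (2 * (C * k) + 1) ^ N"
proof -
  let ?f = "\<lambda>h. (hc h, restrict (Poly_Mapping.lookup (he h)) {..<N})"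
  let ?B = "{- int (D * k\<^sup>2)..int (D * k\<^sup>2)} \<times> ({..<N} \<rightarrow>\<^sub>E {- int (C * k)..int (C * k)})"
  have inj: "inj_on ?f (box N C D k)"
  proof (rule inj_onI)
    fix g h assume gh: "g \<in> box N C D k" "h \<in> box N C D k" and eq: "?f g = ?f h"
    have "Poly_Mapping.lookup (he g) n = Poly_Mapping.lookup (he h) n" for n
    proof (cases "n < N")
      case True
      thus ?thesis using eq by (metis lessThan_iff prod.inject restrict_apply')
    qed (use gh in \<open>auto simp: box_def\<close>)
    hence "he g = he h" by (intro poly_mapping_eqI)
    thus "g = h" using eq by (simp add: heis.expand)
  qed
  have sub: "?f ` box N C D k \<subseteq> ?B"
  proof (rule image_subsetI)
    fix h assume "h \<in> box N C D k"
    thus "?f h \<in> ?B"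
      unfolding mem_Times_iff fst_conv snd_conv restrict_PiE_iff
      by (auto simp: box_def abs_le_iff minus_le_iff)
  qed
  have fin: "finite ?B" by (intro finite_cartesian_product finite_PiE) auto
  show "finite (box N C D k)" using inj sub fin by (rule inj_on_finite)
  have "card (box N C D k) \<le> card ?B" using inj sub fin by (rule card_inj_on_le)
  also have "card ?B = (2 * (D * k\<^sup>2) + 1) * (2 * (C * k) + 1) ^ N"
    by (simp add: card_cartesian_product card_PiE nat_add_distrib nat_mult_distrib nat_power_eq)
  finally show "card (box N C D k) \<le> (2 * (D * k\<^sup>2) + 1) * (2 * (C * k) + 1) ^ N" .
qed

lemma polynomial_less_exponential:
  fixes N C D :: nat
  shows "\<exists>k. (2 * (D * k\<^sup>2) + 1) * (2 * (C * k) + 1) ^ N < 2 ^ k"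
proof -
  \<comment> \<open>With this \<open>e\<close> the left side is at most (e k)^(N+2), which for k =
    4^j is at most 2 to the power (e + 2 j)(N + 2). The choice of j makes this exponent smaller than
    j^2 \<le> 4^j = k.\<close>
  define e where "e = 2 * D + 2 * C + 1"
  define j where "j = (e + 3) * (N + 2) + 1"
  define k where "k = (2::nat) ^ (2 * j)"
  have k1: "1 \<le> k" by (simp add: k_def)
  have "2 * (D * k\<^sup>2) + 1 \<le> (e * k)\<^sup>2"
  proof -
    have "2 * (D * k\<^sup>2) + 1 \<le> e * k\<^sup>2"
      using one_le_power[OF k1, of 2] by (simp add: e_def algebra_simps)
    also have "\<dots> \<le> e * e * k\<^sup>2" by (simp add: e_def)
    finally show ?thesis by (simp add: power2_eq_square mult_ac)
  qed
  moreover have "(2 * (C * k) + 1) ^ N \<le> (e * k) ^ N"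
    using k1 by (intro power_mono) (auto simp: e_def algebra_simps)
  ultimately have "(2 * (D * k\<^sup>2) + 1) * (2 * (C * k) + 1) ^ N \<le> (e * k) ^ (N + 2)"
    unfolding power_add mult.commute[of "(e * k) ^ N"] by (rule mult_mono) auto
  also have "\<dots> \<le> (2 ^ e * 2 ^ (2 * j)) ^ (N + 2)"
    unfolding k_def by (intro power_mono mult_right_mono) (auto intro: less_imp_le less_exp)
  also have "\<dots> = 2 ^ ((e + 2 * j) * (N + 2))"
    by (simp only: power_add[symmetric] power_mult[symmetric])
  also have "\<dots> < 2 ^ k"
  proof (rule power_strict_increasing)
    have "e * 1 \<le> e * j" by (intro mult_le_mono2) (simp add: j_def)
    hence "e + 2 * j \<le> (e + 3) * j" unfolding distrib_right by linarith
    hence "(e + 2 * j) * (N + 2) \<le> (e + 3) * j * (N + 2)" by (rule mult_le_mono1)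
    also have "\<dots> = ((e + 3) * (N + 2)) * j" by (simp only: mult_ac)
    also have "\<dots> < j * j" by (intro mult_strict_right_mono) (auto simp: j_def)
    also have "\<dots> \<le> 2 ^ j * 2 ^ j" by (intro mult_mono) (auto intro: less_imp_le less_exp)
    also have "\<dots> = k" by (simp add: k_def mult_2 power_add)
    finally show "(e + 2 * j) * (N + 2) < k" .
  qed simp
  finally show ?thesis by blast
qed

section \<open>Linear dependence of words in two elements\<close>

interpretation qt_vs: vector_space "\<lambda>(c::complex) (x::qtorus). Poly_Mapping.single 0 c * x"
  by unfold_locales (simp_all add: distrib_left distrib_right single_add mult_single flip: mult.assoc)

text \<open>The parameter m will be multiplication or its opposite, so that right and left common
  multiples come from one argument.\<close>

definition word_prod :: "('r::ring_1 \<Rightarrow> 'r \<Rightarrow> 'r) \<Rightarrow> 'r \<Rightarrow> 'r \<Rightarrow> bool list \<Rightarrow> 'r" where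
  "word_prod m a b w = foldr (\<lambda>x. m (if x then a else b)) w 1"

definition bool_words :: "nat \<Rightarrow> bool list set" where
  "bool_words k = {w. length w = k}"

lemma bool_words_Suc: "bool_words (Suc k) = Cons True ` bool_words k \<union> Cons False ` bool_words k"
proof -
  have "w \<in> Cons True ` bool_words k \<union> Cons False ` bool_words k" if "w \<in> bool_words (Suc k)" for w
    using that by (cases w; cases "hd w") (auto simp: bool_words_def)
  thus ?thesis by (auto simp: bool_words_def)
qed

lemma finite_bool_words [simp]: "finite (bool_words k)" and card_bool_words: "card (bool_words k) = 2 ^ k"
proof -
  have "bool_words k = {xs. set xs \<subseteq> UNIV \<and> length xs = k}" by (auto simp: bool_words_def)
  thus "finite (bool_words k)" "card (bool_words k) = 2 ^ k"
    using finite_lists_length_eq[of "UNIV :: bool set" k] card_lists_length_eq[of "UNIV :: bool set" k] by simp_all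
qed

locale embedded_in_qtorus =
  fixes f :: "'g::presentation presented \<Rightarrow> qtorus"
  assumes hom: "additive_mult f" and f_scalar: "f (scalar c) = qt_scalar c" and inj: "inj f"
begin

lemma f_eq_0_iff [simp]: "f a = 0 \<longleftrightarrow> a = 0"
  using inj am_0[OF hom] by (metis injD)

lemma no_zero_divisors: "a * b = 0 \<longleftrightarrow> a = 0 \<or> b = (0 :: 'g presented)"
  using qtorus_mult_nonzero(1)[of "f a" "f b"] by (metis am_mult[OF hom] f_eq_0_iff mult_zero_left mult_zero_right)

definition cs :: "complex \<Rightarrow> 'g presented" where
  "cs c = scalar (Poly_Mapping.single 0 c)"

lemma f_cs: "f (cs c * x) = Poly_Mapping.single 0 c * f x"
  by (simp add: cs_def am_mult[OF hom] f_scalar qt_scalar_single zero_heis_def)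

text \<open>Jategaonkar's argument: elements without a common multiple generate a free algebra, which
  has exponential growth, whereas the quantum torus has polynomial growth.\<close>

lemma relation_descent:
  assumes m: "m = (*) \<or> m = (\<lambda>x y. y * x)"
    and "\<exists>w\<in>bool_words k. c w \<noteq> 0" "(\<Sum>w\<in>bool_words k. cs (c w) * word_prod m a b w) = 0"
    and "a \<noteq> 0" "b \<noteq> 0"
  shows "\<exists>r s. m a r = m b s \<and> m a r \<noteq> 0"
  using assms(2,3)
proof (induction k arbitrary: c)
  case 0
  have "bool_words 0 = {[]}" by (auto simp: bool_words_def)
  hence "cs (c []) = 0" "c [] \<noteq> 0" using 0 by (auto simp: word_prod_def)
  hence "Poly_Mapping.single 0 (c []) * f 1 = 0" using f_cs[of "c []" 1] by (simp add: am_0[OF hom])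
  hence "Poly_Mapping.single (0::heis) (c []) = 0" by (simp add: am_1[OF hom])
  thus ?case using \<open>c [] \<noteq> 0\<close> by (metis lookup_single_eq lookup_zero)
next
  case (Suc k)
  define r where "r = (\<Sum>w\<in>bool_words k. cs (c (True # w)) * word_prod m a b w)"
  define s where "s = (\<Sum>w\<in>bool_words k. cs (c (False # w)) * word_prod m a b w)"
  have lin: "(\<Sum>w\<in>bool_words k. cs (d w) * m x (word_prod m a b w)) = m x (\<Sum>w\<in>bool_words k. cs (d w) * word_prod m a b w)" for d x
    using m by (auto simp: sum_distrib_left sum_distrib_right cs_def scalar_left_commute mult.assoc)
  have inj: "inj_on (Cons x) S" for x and S :: "bool list set" by (rule inj_onI) simp
  have "(\<Sum>w\<in>bool_words (Suc k). cs (c w) * word_prod m a b w) = m a r + m b s"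
    unfolding bool_words_Suc r_def s_def lin[symmetric]
    by (subst sum.union_disjoint) (auto simp: sum.reindex[OF inj] word_prod_def)
  hence sum0: "m a r + m b s = 0" using Suc.prems(2) by simp
  have mz: "m x y = 0 \<longleftrightarrow> x = 0 \<or> y = 0" for x y using m no_zero_divisors by auto
  \<comment> \<open>Split by the first letter, the relation reads m a r + m b s = 0. If r is
    nonzero, -s completes a common multiple; otherwise r and s both vanish, and one of them is a
    nontrivial relation among shorter words.\<close>
  show ?case
  proof (cases "r = 0")
    case False
    have *: "m b (- s) = - m b s" using m by auto
    have "m a r = m b (- s)" unfolding * using sum0 by (simp add: eq_neg_iff_add_eq_0)
    thus ?thesis using False mz assms(4) by blast
  next
    case True
    hence "m a r = 0" using mz by blast
    hence "m b s = 0" using sum0 by simp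
    hence "s = 0" using mz assms(5) by blast
    have "(\<exists>w\<in>bool_words k. c (True # w) \<noteq> 0) \<or> (\<exists>w\<in>bool_words k. c (False # w) \<noteq> 0)"
      using Suc.prems(1) unfolding bool_words_Suc by blast
    thus ?thesis
      using Suc.IH[of "\<lambda>w. c (True # w)"] Suc.IH[of "\<lambda>w. c (False # w)"] True \<open>s = 0\<close>
      by (auto simp: r_def s_def)
  qed
qed

lemma keys_word_prod:
  assumes m: "m = (*) \<or> m = (\<lambda>x y. y * x)" and D: "N\<^sup>2 * C\<^sup>2 \<le> D"
    and "Poly_Mapping.keys (f a) \<subseteq> box N C D 1" "Poly_Mapping.keys (f b) \<subseteq> box N C D 1"
  shows "Poly_Mapping.keys (f (word_prod m a b w)) \<subseteq> box N C D (length w)"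
proof (induction w)
  case Nil
  have "Poly_Mapping.keys (1 :: qtorus) = {0}" by (simp flip: single_one)
  thus ?case by (simp add: word_prod_def am_1[OF hom] box_def zero_heis_def)
next
  case (Cons x w)
  let ?x = "if x then a else b"
  have x: "Poly_Mapping.keys (f ?x) \<subseteq> box N C D 1" using assms(3,4) by simp
  have "Poly_Mapping.keys (f (word_prod m a b (x # w))) \<subseteq>
      {g + h | g h. g \<in> Poly_Mapping.keys (f ?x) \<and> h \<in> Poly_Mapping.keys (f (word_prod m a b w))} \<union>
      {g + h | g h. g \<in> Poly_Mapping.keys (f (word_prod m a b w)) \<and> h \<in> Poly_Mapping.keys (f ?x)}"
    using m keys_mult[of "f ?x" "f (word_prod m a b w)"] keys_mult[of "f (word_prod m a b w)" "f ?x"]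
    by (auto simp: word_prod_def am_mult[OF hom])
  moreover have "g + h \<in> box N C D (length (x # w))" "h + g \<in> box N C D (length (x # w))"
    if "g \<in> Poly_Mapping.keys (f ?x)" "h \<in> Poly_Mapping.keys (f (word_prod m a b w))" for g h
    using box_add[OF D, of g 1 h "length w"] box_add[OF D, of h "length w" g 1] that x Cons.IH
    by (simp_all add: subset_iff)
  ultimately show ?case by (blast dest: subsetD)
qed

lemma ex_box: "\<exists>N C D. N\<^sup>2 * C\<^sup>2 \<le> D \<and> S \<subseteq> box N C D 1" if "finite S"
proof -
  have "finite (\<Union>h\<in>S. Poly_Mapping.keys (he h))" using that by simp
  then obtain N where N: "(\<Union>h\<in>S. Poly_Mapping.keys (he h)) \<subseteq> {..<N}" using finite_nat_bounded by blast
  define C where "C = (\<Sum>h\<in>S. \<Sum>n<N. nat \<bar>Poly_Mapping.lookup (he h) n\<bar>)"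
  define D where "D = N\<^sup>2 * C\<^sup>2 + (\<Sum>h\<in>S. nat \<bar>hc h\<bar>)"
  have "h \<in> box N C D 1" if h: "h \<in> S" for h
  proof -
    have 0: "Poly_Mapping.lookup (he h) n = 0" if "N \<le> n" for n
      using N h that by (metis UN_I in_keys_iff lessThan_iff not_le subsetD)
    have "nat \<bar>Poly_Mapping.lookup (he h) n\<bar> \<le> C" for n
    proof (cases "n < N")
      case True
      have "nat \<bar>Poly_Mapping.lookup (he h) n\<bar> \<le> (\<Sum>n<N. nat \<bar>Poly_Mapping.lookup (he h) n\<bar>)"
        using True by (intro member_le_sum) auto
      also have "\<dots> \<le> C" unfolding C_def
        using member_le_sum[OF h, of "\<lambda>h. \<Sum>n<N. nat \<bar>Poly_Mapping.lookup (he h) n\<bar>"] \<open>finite S\<close> by simp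
      finally show ?thesis .
    qed (use 0 in auto)
    moreover have "nat \<bar>hc h\<bar> \<le> D"
      using member_le_sum[OF h, of "\<lambda>h. nat \<bar>hc h\<bar>"] \<open>finite S\<close> by (simp add: D_def)
    ultimately show ?thesis using 0 by (simp add: box_def nat_le_iff)
  qed
  thus ?thesis by (intro exI[of _ N] exI[of _ C] exI[of _ D]) (auto simp: D_def)
qed

text \<open>For suitable k the 2^k words of length k lie in a complex space of smaller dimension.
  The resulting relation gives a common multiple by \<open>relation_descent\<close>.\<close>

lemma common_multiple:
  fixes a b :: "'g presented"
  assumes m: "m = (*) \<or> m = (\<lambda>x y. y * x)" and "a \<noteq> 0" "b \<noteq> 0"
  shows "\<exists>r s. m a r = m b s \<and> m a r \<noteq> 0"
proof -
  obtain N C D where D: "N\<^sup>2 * C\<^sup>2 \<le> D" "Poly_Mapping.keys (f a) \<union> Poly_Mapping.keys (f b) \<subseteq> box N C D 1"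
    using ex_box[of "Poly_Mapping.keys (f a) \<union> Poly_Mapping.keys (f b)"] by auto
  obtain k where k: "(2 * (D * k\<^sup>2) + 1) * (2 * (C * k) + 1) ^ N < 2 ^ k"
    using polynomial_less_exponential by blast
  define W where "W = (\<lambda>w. f (word_prod m a b w))"
  define B where "B = (\<lambda>h. Poly_Mapping.single h (1::complex)) ` box N C D k"
  have span: "W ` bool_words k \<subseteq> qt_vs.span B"
  proof safe
    fix w assume "w \<in> bool_words k"
    hence keys: "Poly_Mapping.keys (W w) \<subseteq> box N C D k"
      using keys_word_prod[OF m D(1), of a b w] D(2) by (simp add: W_def bool_words_def)
    have "W w = (\<Sum>h\<in>Poly_Mapping.keys (W w). Poly_Mapping.single h (Poly_Mapping.lookup (W w) h))"
      by (rule poly_mapping_eqI) (simp add: lookup_sum lookup_single when_def in_keys_iff sum.delta)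
    also have "\<dots> = (\<Sum>h\<in>Poly_Mapping.keys (W w). Poly_Mapping.single 0 (Poly_Mapping.lookup (W w) h) * Poly_Mapping.single h 1)"
      by (simp add: mult_single)
    also have "\<dots> \<in> qt_vs.span B"
      using keys by (intro qt_vs.span_sum qt_vs.span_scale qt_vs.span_base) (auto simp: B_def)
    finally show "W w \<in> qt_vs.span B" .
  qed
  have "\<exists>c. (\<exists>w\<in>bool_words k. c w \<noteq> 0) \<and> (\<Sum>w\<in>bool_words k. Poly_Mapping.single 0 (c w) * W w) = 0"
  \<comment> \<open>Dependence of the set of values sees only distinct elements; two words with
    equal values give a relation with coefficients 1 and -1 directly.\<close>
  proof (cases "inj_on W (bool_words k)")
    case True
    have "card B \<le> card (box N C D k)" unfolding B_def by (rule card_image_le) (rule card_box(1))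
    hence "card B < card (W ` bool_words k)"
      using card_box(2)[of N C D k] k card_bool_words[of k] by (simp add: card_image[OF True])
    hence "qt_vs.dependent (W ` bool_words k)"
      using qt_vs.independent_span_bound[of B "W ` bool_words k"] span card_box(1)[of N C D k] by (auto simp: B_def)
    then obtain u where "\<exists>v\<in>W ` bool_words k. u v \<noteq> 0" "(\<Sum>v\<in>W ` bool_words k. Poly_Mapping.single 0 (u v) * v) = 0"
      using qt_vs.dependent_finite[of "W ` bool_words k"] by auto
    thus ?thesis
      by (intro exI[of _ "u \<circ> W"]) (auto simp: sum.reindex[OF True])
  next
    case False
    then obtain v w where vw: "v \<in> bool_words k" "w \<in> bool_words k" "v \<noteq> w" "W v = W w" by (auto simp: inj_on_def)
    let ?c = "\<lambda>x. if x = v then 1 else if x = w then - 1 else 0 :: complex"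
    have "(\<Sum>x\<in>bool_words k. Poly_Mapping.single 0 (?c x) * W x) = (\<Sum>x\<in>{v, w}. Poly_Mapping.single 0 (?c x) * W x)"
      by (rule sum.mono_neutral_right) (use vw in auto)
    also have "\<dots> = 0" using vw by (simp add: single_uminus single_one)
    finally show ?thesis using vw by (intro exI[of _ ?c]) auto
  qed
  then obtain c where c: "\<exists>w\<in>bool_words k. c w \<noteq> 0" "(\<Sum>w\<in>bool_words k. Poly_Mapping.single 0 (c w) * W w) = 0"
    by blast
  have "f (\<Sum>w\<in>bool_words k. cs (c w) * word_prod m a b w) = 0"
    using c(2) by (simp add: am_sum[OF hom] f_cs W_def)
  thus ?thesis using relation_descent[OF m c(1)] assms(2,3) by simp
qed

end

section \<open>Ore localisation\<close>

locale ore_domain =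
  fixes ty :: "'a::ring_1 itself"
  assumes no_zero_div: "a * b = (0::'a) \<longleftrightarrow> a = 0 \<or> b = 0"
    and right_ore: "a \<noteq> (0::'a) \<Longrightarrow> b \<noteq> 0 \<Longrightarrow> \<exists>r s. a * r = b * s \<and> a * r \<noteq> 0"
    and left_ore: "a \<noteq> (0::'a) \<Longrightarrow> b \<noteq> 0 \<Longrightarrow> \<exists>r s. r * a = s * b \<and> r * a \<noteq> 0"
begin

text \<open>The fraction $ab^{-1}$ is represented by the graph of the left multiplication by it.\<close>

definition fraction :: "'a \<Rightarrow> 'a \<Rightarrow> ('a \<times> 'a) set" where
  "fraction a b = {(r, s). \<exists>c d. c \<noteq> 0 \<and> r * c = b * d \<and> s * c = a * d}"

definition fractions :: "('a \<times> 'a) set set" where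
  "fractions = {fraction a b | a b. b \<noteq> 0}"

lemma cancel: "a \<noteq> 0 \<Longrightarrow> a * x = a * y \<longleftrightarrow> x = (y::'a)" "a \<noteq> 0 \<Longrightarrow> x * a = y * a \<longleftrightarrow> x = y"
  using no_zero_div[of a "x - y"] no_zero_div[of "x - y" a] by (auto simp: left_diff_distrib right_diff_distrib)

lemma fraction_self: "(b, a) \<in> fraction a b"
  unfolding fraction_def by (intro CollectI case_prodI exI[of _ 1]) simp

lemma fraction_in [simp]: "b \<noteq> 0 \<Longrightarrow> fraction a b \<in> fractions"
  by (auto simp: fractions_def)

context
  fixes G assumes G: "G \<in> fractions"
begin

lemma graph_obtain: obtains a b where "b \<noteq> 0" "G = fraction a b"
  using G by (auto simp: fractions_def)

lemma graph_unique: "(r, s) \<in> G \<Longrightarrow> (r, s') \<in> G \<Longrightarrow> s = s'"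
proof -
  assume "(r, s) \<in> G" "(r, s') \<in> G"
  then obtain a b c d c' d' where b: "b \<noteq> 0" and 1: "c \<noteq> 0" "r * c = b * d" "s * c = a * d"
    and 2: "c' \<noteq> 0" "r * c' = b * d'" "s' * c' = a * d'"
    using G by (auto simp: fractions_def fraction_def)
  obtain x y where xy: "c * x = c' * y" "c * x \<noteq> 0" using right_ore[OF 1(1) 2(1)] by blast
  have "b * (d * x) = b * (d' * y)" by (metis 1(2) 2(2) mult.assoc xy(1))
  hence "d * x = d' * y" using b cancel by blast
  hence "s * (c * x) = s' * (c * x)" by (metis 1(3) 2(3) mult.assoc xy(1))
  thus "s = s'" using xy(2) cancel by blast
qed

lemma graph_mult: "(r, s) \<in> G \<Longrightarrow> (r * t, s * t) \<in> G"
proof -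
  assume "(r, s) \<in> G"
  then obtain a b c d where Gab: "G = fraction a b" and 1: "c \<noteq> 0" "r * c = b * d" "s * c = a * d"
    using G by (auto simp: fractions_def fraction_def)
  show ?thesis
  proof (cases "t = 0")
    case True
    thus ?thesis unfolding Gab fraction_def
      by (intro CollectI case_prodI) (rule exI[of _ 1], rule exI[of _ 0], simp)
  next
    case False
    obtain x y where xy: "c * x = t * y" "c * x \<noteq> 0" using right_ore[OF 1(1) False] by blast
    have "y \<noteq> 0" using xy by auto
    moreover have "r * t * y = b * (d * x)" "s * t * y = a * (d * x)"
      by (metis 1(2,3) mult.assoc xy(1))+
    ultimately show ?thesis unfolding Gab fraction_def by blast
  qed
qed

lemma graph_cancel: "(r * t, s * t) \<in> G \<Longrightarrow> t \<noteq> 0 \<Longrightarrow> (r, s) \<in> G"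
proof -
  assume "(r * t, s * t) \<in> G" and t: "t \<noteq> 0"
  then obtain a b c d where Gab: "G = fraction a b" and 1: "c \<noteq> 0" "r * t * c = b * d" "s * t * c = a * d"
    using G by (auto simp: fractions_def fraction_def)
  have "t * c \<noteq> 0" using t 1(1) no_zero_div by blast
  thus ?thesis using 1(2,3) unfolding Gab fraction_def by (auto simp: mult.assoc)
qed

lemma graph_sum: "(r, s) \<in> G \<Longrightarrow> (r', s') \<in> G \<Longrightarrow> (r + r', s + s') \<in> G"
proof -
  assume "(r, s) \<in> G" "(r', s') \<in> G"
  then obtain a b c d c' d' where Gab: "G = fraction a b" and 1: "c \<noteq> 0" "r * c = b * d" "s * c = a * d"
    and 2: "c' \<noteq> 0" "r' * c' = b * d'" "s' * c' = a * d'"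
    using G unfolding fractions_def by (auto simp: fraction_def)
  obtain x y where xy: "c * x = c' * y" "c * x \<noteq> 0" using right_ore[OF 1(1) 2(1)] by blast
  have "r * (c * x) = b * (d * x)" "s * (c * x) = a * (d * x)"
    "r' * (c * x) = b * (d' * y)" "s' * (c * x) = a * (d' * y)"
    by (metis 1(2,3) mult.assoc) (metis 1(3) mult.assoc, metis 2(2) mult.assoc xy(1), metis 2(3) mult.assoc xy(1))
  hence "(r + r') * (c * x) = b * (d * x + d' * y)" "(s + s') * (c * x) = a * (d * x + d' * y)"
    by (simp_all add: distrib_left distrib_right)
  thus ?thesis using xy(2) unfolding Gab fraction_def by blast
qed

lemma graph_0: "(0, 0) \<in> G"
proof -
  obtain a b where "G = fraction a b" by (rule graph_obtain)
  thus ?thesis using graph_mult[of b a 0] fraction_self by simp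
qed

lemma graph_dense: "\<exists>t s. t \<noteq> 0 \<and> (r * t, s) \<in> G"
proof (cases "r = 0")
  case True
  thus ?thesis using graph_0 by (intro exI[of _ 1] exI[of _ 0]) simp
next
  case False
  obtain a b where ab: "b \<noteq> 0" "G = fraction a b" by (rule graph_obtain)
  obtain x y where "r * x = b * y" "r * x \<noteq> 0" using right_ore[OF False ab(1)] by blast
  moreover have "(b * y, a * y) \<in> G" using graph_mult fraction_self ab(2) by blast
  ultimately show ?thesis by (metis mult_zero_right)
qed

text \<open>A graph is determined by one point with nonzero first component. Equations between
  fractions, and with them the ring axioms, reduce to exhibiting one common point of both
  sides.\<close>

lemma fraction_eqI: "(r, s) \<in> G \<Longrightarrow> r \<noteq> 0 \<Longrightarrow> fraction s r = G"
proof -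
  assume rs: "(r, s) \<in> G" and r: "r \<noteq> 0"
  have "(x, y) \<in> G" if xy: "(x, y) \<in> fraction s r" for x y
  proof -
    obtain c d where "c \<noteq> 0" "x * c = r * d" "y * c = s * d" using xy by (auto simp: fraction_def)
    thus ?thesis using graph_mult[OF rs, of d] graph_cancel[of x c y] by simp
  qed
  moreover have "(x, y) \<in> fraction s r" if xy: "(x, y) \<in> G" for x y
  proof (cases "x = 0")
    case True
    hence "y = 0" using graph_unique[OF xy] graph_0 by simp
    thus ?thesis unfolding True fraction_def
      by (intro CollectI case_prodI) (rule exI[of _ 1], rule exI[of _ 0], simp)
  next
    case False
    obtain c d where cd: "x * c = r * d" "x * c \<noteq> 0" using right_ore[OF False r] by blast
    have "y * c = s * d"
      using graph_unique[of "x * c"] graph_mult[OF xy, of c] graph_mult[OF rs, of d] cd(1) by simp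
    moreover have "c \<noteq> 0" using cd(2) by auto
    ultimately show ?thesis using cd(1) by (auto simp: fraction_def)
  qed
  ultimately show ?thesis by auto
qed

end

lemma graph_eqI:
  "G \<in> fractions \<Longrightarrow> G' \<in> fractions \<Longrightarrow> (r, s) \<in> G \<Longrightarrow> (r, s) \<in> G' \<Longrightarrow> r \<noteq> 0 \<Longrightarrow> G = G'"
  by (metis fraction_eqI)

lemma graph_dense2:
  assumes "G \<in> fractions" "G' \<in> fractions"
  obtains t s s' where "t \<noteq> 0" "(r * t, s) \<in> G" "(r * t, s') \<in> G'"
proof -
  obtain t s where t: "t \<noteq> 0" "(r * t, s) \<in> G" using graph_dense[OF assms(1)] by blast
  obtain t' s' where t': "t' \<noteq> 0" "(r * t * t', s') \<in> G'" using graph_dense[OF assms(2)] by blast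
  show thesis
    by (rule that[of "t * t'" "s * t'" s'])
       (use t t' graph_mult[OF assms(1) t(2), of t'] no_zero_div in \<open>auto simp: mult.assoc\<close>)
qed

text \<open>Graphs are added pointwise and multiplied by composition. The single point chosen by
  \<open>SOME\<close> determines the result; \<open>fr_add_mem\<close> and
  \<open>fr_mult_mem\<close> show that all other points lie on the same graph.\<close>

definition fr_add :: "('a \<times> 'a) set \<Rightarrow> ('a \<times> 'a) set \<Rightarrow> ('a \<times> 'a) set" where
  "fr_add G F = (SOME K. \<exists>r s s'. r \<noteq> 0 \<and> (r, s) \<in> G \<and> (r, s') \<in> F \<and> K = fraction (s + s') r)"

definition fr_mult :: "('a \<times> 'a) set \<Rightarrow> ('a \<times> 'a) set \<Rightarrow> ('a \<times> 'a) set" where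
  "fr_mult G F = (SOME K. \<exists>r s u. r \<noteq> 0 \<and> (r, s) \<in> F \<and> (s, u) \<in> G \<and> K = fraction u r)"

context
  fixes G F assumes GH: "G \<in> fractions" "F \<in> fractions"
begin

lemma fr_add_ex: "\<exists>r s s'. r \<noteq> 0 \<and> (r, s) \<in> G \<and> (r, s') \<in> F \<and> fr_add G F = fraction (s + s') r"
proof -
  obtain t s s' where "t \<noteq> 0" "(1 * t, s) \<in> G" "(1 * t, s') \<in> F" using graph_dense2[OF GH] by blast
  hence "\<exists>K r s s'. r \<noteq> 0 \<and> (r, s) \<in> G \<and> (r, s') \<in> F \<and> K = fraction (s + s') r" by auto
  thus ?thesis unfolding fr_add_def by (rule someI_ex)
qed

lemma fr_mult_ex: "\<exists>r s u. r \<noteq> 0 \<and> (r, s) \<in> F \<and> (s, u) \<in> G \<and> fr_mult G F = fraction u r"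
proof -
  obtain t s where ts: "t \<noteq> 0" "(1 * t, s) \<in> F" using graph_dense[OF GH(2)] by blast
  obtain t' u where "t' \<noteq> 0" "(s * t', u) \<in> G" using graph_dense[OF GH(1)] by blast
  moreover have "(t * t', s * t') \<in> F" using graph_mult[OF GH(2)] ts by simp
  ultimately have "\<exists>K r s u. r \<noteq> 0 \<and> (r, s) \<in> F \<and> (s, u) \<in> G \<and> K = fraction u r"
    using ts(1) no_zero_div by blast
  thus ?thesis unfolding fr_mult_def by (rule someI_ex)
qed

lemma fr_add_closed: "fr_add G F \<in> fractions" and fr_mult_closed: "fr_mult G F \<in> fractions"
  using fr_add_ex fr_mult_ex by auto

lemma fr_add_mem: "(r, s) \<in> G \<Longrightarrow> (r, s') \<in> F \<Longrightarrow> (r, s + s') \<in> fr_add G F"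
proof -
  assume rs: "(r, s) \<in> G" "(r, s') \<in> F"
  obtain r0 s0 s0' where r0: "r0 \<noteq> 0" "(r0, s0) \<in> G" "(r0, s0') \<in> F" "fr_add G F = fraction (s0 + s0') r0"
    using fr_add_ex by blast
  have mem: "(r0, s0 + s0') \<in> fr_add G F" unfolding r0(4) by (rule fraction_self)
  show ?thesis
  proof (cases "r = 0")
    case True
    hence "s = 0" "s' = 0" using rs graph_unique graph_0 GH by blast+
    thus ?thesis using True graph_0[OF fr_add_closed] by simp
  next
    case False
    obtain x y where xy: "r * x = r0 * y" "r * x \<noteq> 0" using right_ore[OF False r0(1)] by blast
    have "s * x = s0 * y" "s' * x = s0' * y"
      by (metis graph_unique graph_mult GH rs r0 xy(1))+
    hence "(r * x, (s + s') * x) \<in> fr_add G F"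
      using graph_mult[OF fr_add_closed mem, of y] xy(1) by (simp add: distrib_right)
    thus ?thesis using graph_cancel[OF fr_add_closed, of r x] xy(2) by (metis mult_zero_right)
  qed
qed

lemma fr_mult_mem: "(r, s) \<in> F \<Longrightarrow> (s, u) \<in> G \<Longrightarrow> (r, u) \<in> fr_mult G F"
proof -
  assume rs: "(r, s) \<in> F" "(s, u) \<in> G"
  obtain r0 s0 u0 where r0: "r0 \<noteq> 0" "(r0, s0) \<in> F" "(s0, u0) \<in> G" "fr_mult G F = fraction u0 r0"
    using fr_mult_ex by blast
  have mem: "(r0, u0) \<in> fr_mult G F" unfolding r0(4) by (rule fraction_self)
  show ?thesis
  proof (cases "r = 0")
    case True
    hence "s = 0" using rs graph_unique graph_0 GH by blast
    hence "u = 0" using rs graph_unique graph_0 GH by blast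
    thus ?thesis using True graph_0[OF fr_mult_closed] by simp
  next
    case False
    obtain x y where xy: "r * x = r0 * y" "r * x \<noteq> 0" using right_ore[OF False r0(1)] by blast
    have "s * x = s0 * y" by (metis graph_unique graph_mult GH(2) rs(1) r0(2) xy(1))
    hence "u * x = u0 * y" by (metis graph_unique graph_mult GH(1) rs(2) r0(3))
    hence "(r * x, u * x) \<in> fr_mult G F"
      using graph_mult[OF fr_mult_closed mem, of y] xy(1) by simp
    thus ?thesis using graph_cancel[OF fr_mult_closed, of r x] xy(2) by (metis mult_zero_right)
  qed
qed

end

definition fr_ring :: "('a \<times> 'a) set ring" where
  "fr_ring = \<lparr>carrier = fractions, monoid.mult = fr_mult, one = fraction 1 1, ring.zero = fraction 0 1, add = fr_add\<rparr>"

lemma fr_ring_simps [simp]: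
  "carrier fr_ring = fractions" "monoid.mult fr_ring = fr_mult" "monoid.one fr_ring = fraction 1 1"
  "ring.zero fr_ring = fraction 0 1" "ring.add fr_ring = fr_add"
  by (simp_all add: fr_ring_def)

definition fr_emb :: "'a \<Rightarrow> ('a \<times> 'a) set" where
  "fr_emb a = fraction a 1"

lemma fr_emb_closed [simp]: "fr_emb a \<in> fractions"
  by (simp add: fr_emb_def)

lemma fr_emb_mem: "(r, a * r) \<in> fr_emb a"
proof -
  have "(1 * r, a * r) \<in> fraction a 1" by (rule graph_mult[OF fraction_in fraction_self]) simp
  thus ?thesis by (simp add: fr_emb_def)
qed

lemma fraction_1_mem: "(r, r) \<in> fraction 1 1" and fraction_0_mem: "(r, 0) \<in> fraction 0 1"
  using fr_emb_mem[of r 1] fr_emb_mem[of r 0] by (simp_all add: fr_emb_def)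

lemma fr_ring_ring: "Ring.ring fr_ring"
proof (rule ringI)
  show "abelian_group fr_ring"
  proof (rule abelian_groupI)
    fix x y z assume x: "x \<in> carrier fr_ring" and y: "y \<in> carrier fr_ring" and z: "z \<in> carrier fr_ring"
    note xyz = x y z
    have xyz: "x \<in> fractions" "y \<in> fractions" "z \<in> fractions" using xyz by simp_all
    note c = fr_add_closed
    obtain t s s' where t: "t \<noteq> 0" "(1 * t, s) \<in> x" "(1 * t, s') \<in> y" using graph_dense2[OF xyz(1,2)] by blast
    obtain t' u where t': "t' \<noteq> 0" "(t * t', u) \<in> z" using graph_dense[OF xyz(3)] by blast
    have m: "(t * t', s * t') \<in> x" "(t * t', s' * t') \<in> y" "t * t' \<noteq> 0"
      using t t' graph_mult xyz no_zero_div by fastforce+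
    have "fr_add (fr_add x y) z = fr_add x (fr_add y z)"
    proof (rule graph_eqI)
      show "(t * t', s * t' + s' * t' + u) \<in> fr_add (fr_add x y) z"
        using m t' xyz c by (intro fr_add_mem) auto
      show "(t * t', s * t' + s' * t' + u) \<in> fr_add x (fr_add y z)"
        unfolding add.assoc using m t' xyz c by (intro fr_add_mem) auto
    qed (use m xyz c in auto)
    thus "x \<oplus>\<^bsub>fr_ring\<^esub> y \<oplus>\<^bsub>fr_ring\<^esub> z = x \<oplus>\<^bsub>fr_ring\<^esub> (y \<oplus>\<^bsub>fr_ring\<^esub> z)" by simp
    have "fr_add x y = fr_add y x"
    proof (rule graph_eqI)
      show "(t, s + s') \<in> fr_add x y" using t xyz by (intro fr_add_mem) auto
      show "(t, s + s') \<in> fr_add y x" unfolding add.commute[of s] using t xyz by (intro fr_add_mem) auto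
    qed (use t xyz c in auto)
    thus "x \<oplus>\<^bsub>fr_ring\<^esub> y = y \<oplus>\<^bsub>fr_ring\<^esub> x" by simp
    have "fr_add (fraction 0 1) x = x"
    proof (rule graph_eqI)
      show "(t, 0 + s) \<in> fr_add (fraction 0 1) x" using t xyz fraction_0_mem by (intro fr_add_mem) auto
    qed (use t xyz c in auto)
    thus "\<zero>\<^bsub>fr_ring\<^esub> \<oplus>\<^bsub>fr_ring\<^esub> x = x" by simp
    have "fr_add (fraction (- s) t) x = fraction 0 1"
    proof (rule graph_eqI)
      show "(t, - s + s) \<in> fr_add (fraction (- s) t) x" using t xyz fraction_self by (intro fr_add_mem) auto
    qed (use t xyz c fraction_0_mem in auto)
    thus "\<exists>y\<in>carrier fr_ring. y \<oplus>\<^bsub>fr_ring\<^esub> x = \<zero>\<^bsub>fr_ring\<^esub>" using t(1) by auto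
    show "x \<oplus>\<^bsub>fr_ring\<^esub> y \<in> carrier fr_ring" using xyz c by simp
  qed simp
  show "Group.monoid fr_ring"
  proof (rule monoidI)
    fix x y z assume xyz: "x \<in> carrier fr_ring" "y \<in> carrier fr_ring" "z \<in> carrier fr_ring"
    hence xyz: "x \<in> fractions" "y \<in> fractions" "z \<in> fractions" by simp_all
    note c = fr_mult_closed
    obtain t s where t: "t \<noteq> 0" "(1 * t, s) \<in> z" using graph_dense[OF xyz(3)] by blast
    obtain t' u where t': "t' \<noteq> 0" "(s * t', u) \<in> y" using graph_dense[OF xyz(2)] by blast
    obtain t'' v where t'': "t'' \<noteq> 0" "(u * t'', v) \<in> x" using graph_dense[OF xyz(1)] by blast
    have m: "(t * t' * t'', s * t' * t'') \<in> z" "(s * t' * t'', u * t'') \<in> y" "t * t' * t'' \<noteq> 0"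
      using t t' t'' graph_mult xyz no_zero_div by fastforce+
    have "fr_mult (fr_mult x y) z = fr_mult x (fr_mult y z)"
    proof (rule graph_eqI)
      show "(t * t' * t'', v) \<in> fr_mult (fr_mult x y) z"
        by (rule fr_mult_mem[OF _ _ m(1)] fr_mult_mem[OF _ _ m(2) t''(2)] c xyz)+
      show "(t * t' * t'', v) \<in> fr_mult x (fr_mult y z)"
        by (rule fr_mult_mem[OF _ _ _ t''(2)] fr_mult_mem[OF _ _ m(1) m(2)] c xyz)+
    qed (use m xyz c in auto)
    thus "x \<otimes>\<^bsub>fr_ring\<^esub> y \<otimes>\<^bsub>fr_ring\<^esub> z = x \<otimes>\<^bsub>fr_ring\<^esub> (y \<otimes>\<^bsub>fr_ring\<^esub> z)" by simp
    show "x \<otimes>\<^bsub>fr_ring\<^esub> y \<in> carrier fr_ring" using xyz c by simp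
    obtain r w where r: "r \<noteq> 0" "(1 * r, w) \<in> x" using graph_dense[OF xyz(1)] by blast
    have "fr_mult (fraction 1 1) x = x"
    proof (rule graph_eqI)
      show "(r, w) \<in> fr_mult (fraction 1 1) x" using r xyz fraction_1_mem by (intro fr_mult_mem[of _ _ r w]) auto
    qed (use r xyz c in auto)
    thus "\<one>\<^bsub>fr_ring\<^esub> \<otimes>\<^bsub>fr_ring\<^esub> x = x" by simp
    have "fr_mult x (fraction 1 1) = x"
    proof (rule graph_eqI)
      show "(r, w) \<in> fr_mult x (fraction 1 1)" using r xyz fraction_1_mem by (intro fr_mult_mem[of _ _ r r]) auto
    qed (use r xyz c in auto)
    thus "x \<otimes>\<^bsub>fr_ring\<^esub> \<one>\<^bsub>fr_ring\<^esub> = x" by simp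
  qed simp
  fix x y z assume "x \<in> carrier fr_ring" "y \<in> carrier fr_ring" "z \<in> carrier fr_ring"
  hence xyz: "x \<in> fractions" "y \<in> fractions" "z \<in> fractions" by simp_all
  note c = fr_mult_closed fr_add_closed
  obtain t s where t: "t \<noteq> 0" "(1 * t, s) \<in> z" using graph_dense[OF xyz(3)] by blast
  obtain t' u v where t': "t' \<noteq> 0" "(s * t', u) \<in> x" "(s * t', v) \<in> y" using graph_dense2[OF xyz(1,2)] by blast
  have m: "(t * t', s * t') \<in> z" "t * t' \<noteq> 0" using t t' graph_mult xyz no_zero_div by fastforce+
  have "fr_mult (fr_add x y) z = fr_add (fr_mult x z) (fr_mult y z)"
  proof (rule graph_eqI)
    show "(t * t', u + v) \<in> fr_mult (fr_add x y) z"
      by (rule fr_mult_mem[OF _ _ m(1)] fr_add_mem[OF _ _ t'(2,3)] c xyz)+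
    show "(t * t', u + v) \<in> fr_add (fr_mult x z) (fr_mult y z)"
      by (rule fr_add_mem fr_mult_mem[OF _ _ m(1) t'(2)] fr_mult_mem[OF _ _ m(1) t'(3)] c xyz)+
  qed (use m xyz c in auto)
  thus "(x \<oplus>\<^bsub>fr_ring\<^esub> y) \<otimes>\<^bsub>fr_ring\<^esub> z = x \<otimes>\<^bsub>fr_ring\<^esub> z \<oplus>\<^bsub>fr_ring\<^esub> y \<otimes>\<^bsub>fr_ring\<^esub> z" by simp
  obtain r p p' where r: "r \<noteq> 0" "(1 * r, p) \<in> x" "(1 * r, p') \<in> y" using graph_dense2[OF xyz(1,2)] by blast
  obtain r1 w where r1: "r1 \<noteq> 0" "(p * r1, w) \<in> z" using graph_dense[OF xyz(3)] by blast
  obtain r2 w' where r2: "r2 \<noteq> 0" "(p' * r1 * r2, w') \<in> z" using graph_dense[OF xyz(3)] by blast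
  have m: "(r * r1 * r2, p * r1 * r2) \<in> x" "(r * r1 * r2, p' * r1 * r2) \<in> y" "r * r1 * r2 \<noteq> 0"
      "(p * r1 * r2, w * r2) \<in> z"
    using r r1 r2 graph_mult xyz no_zero_div by fastforce+
  have s: "((p + p') * r1 * r2, w * r2 + w') \<in> z"
    using graph_sum[OF xyz(3) m(4) r2(2)] by (simp add: distrib_right)
  have "fr_mult z (fr_add x y) = fr_add (fr_mult z x) (fr_mult z y)"
  proof (rule graph_eqI)
    have "(r * r1 * r2, (p + p') * r1 * r2) \<in> fr_add x y"
      using fr_add_mem[OF xyz(1,2) m(1,2)] by (simp add: distrib_right)
    thus "(r * r1 * r2, w * r2 + w') \<in> fr_mult z (fr_add x y)"
      by (rule fr_mult_mem[OF _ _ _ s, rotated 2]) (rule c xyz)+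
    show "(r * r1 * r2, w * r2 + w') \<in> fr_add (fr_mult z x) (fr_mult z y)"
      by (rule fr_add_mem fr_mult_mem[OF _ _ m(1) m(4)] fr_mult_mem[OF _ _ m(2) r2(2)] c xyz)+
  qed (use m xyz c in auto)
  thus "z \<otimes>\<^bsub>fr_ring\<^esub> (x \<oplus>\<^bsub>fr_ring\<^esub> y) = z \<otimes>\<^bsub>fr_ring\<^esub> x \<oplus>\<^bsub>fr_ring\<^esub> z \<otimes>\<^bsub>fr_ring\<^esub> y" by simp
qed

interpretation FR: ring fr_ring
  by (rule fr_ring_ring)

lemma fr_inverse:
  assumes "a \<noteq> 0" "b \<noteq> 0"
  shows "fr_mult (fraction a b) (fraction b a) = fraction 1 1"
  by (rule graph_eqI[OF fr_mult_closed _ fr_mult_mem[OF _ _ fraction_self fraction_self] fraction_1_mem])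
     (use assms in auto)

lemma fr_inv: "a \<noteq> 0 \<Longrightarrow> b \<noteq> 0 \<Longrightarrow> inv\<^bsub>fr_ring\<^esub> (fraction a b) = fraction b a"
  by (rule FR.inv_char) (auto simp: fr_inverse)

lemma fraction_eq_0: "b \<noteq> 0 \<Longrightarrow> fraction a b = fraction 0 1 \<longleftrightarrow> a = 0"
proof
  assume "b \<noteq> 0" "fraction a b = fraction 0 1"
  thus "a = 0" using fraction_self[of b a] fraction_0_mem[of b] graph_unique[of "fraction 0 1" b a 0] by simp
next
  assume "b \<noteq> 0" "a = 0"
  thus "fraction a b = fraction 0 1"
    using fraction_self[of b a] fraction_0_mem[of b] graph_eqI[of "fraction a b" "fraction 0 1" b 0] by simp
qed

lemma fr_emb_0_1: "fr_emb 1 = fraction 1 1" "fr_emb 0 = fraction 0 1"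
  by (simp_all add: fr_emb_def)

lemma fr_emb_mult: "fr_mult (fr_emb a) (fr_emb b) = fr_emb (a * b)"
proof (rule graph_eqI)
  show "(1, a * (b * 1)) \<in> fr_mult (fr_emb a) (fr_emb b)"
    by (rule fr_mult_mem[OF _ _ fr_emb_mem fr_emb_mem]) simp_all
  show "(1, a * (b * 1)) \<in> fr_emb (a * b)" using fr_emb_mem[of 1 "a * b"] by simp
qed (simp_all add: fr_mult_closed)

lemma fr_emb_add: "fr_add (fr_emb a) (fr_emb b) = fr_emb (a + b)"
proof (rule graph_eqI)
  show "(1, a * 1 + b * 1) \<in> fr_add (fr_emb a) (fr_emb b)"
    by (rule fr_add_mem[OF _ _ fr_emb_mem fr_emb_mem]) simp_all
  show "(1, a * 1 + b * 1) \<in> fr_emb (a + b)" using fr_emb_mem[of 1 "a + b"] by simp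
qed (simp_all add: fr_add_closed)

lemma is_fraction_field_fr_ring: "is_fraction_field fr_ring fr_emb"
  unfolding is_fraction_field_def skew_field_def
proof (intro conjI ballI)
  show "\<one>\<^bsub>fr_ring\<^esub> \<noteq> \<zero>\<^bsub>fr_ring\<^esub>" using fraction_eq_0[of 1 1] by simp
  show "Units fr_ring = carrier fr_ring - {\<zero>\<^bsub>fr_ring\<^esub>}"
  proof (intro equalityI subsetI)
    fix x assume x: "x \<in> Units fr_ring"
    have "x \<noteq> \<zero>\<^bsub>fr_ring\<^esub>"
    proof
      assume "x = \<zero>\<^bsub>fr_ring\<^esub>"
      then obtain y where "y \<in> carrier fr_ring" "\<zero>\<^bsub>fr_ring\<^esub> \<otimes>\<^bsub>fr_ring\<^esub> y = \<one>\<^bsub>fr_ring\<^esub>"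
        using x by (auto simp: Units_def)
      hence "\<zero>\<^bsub>fr_ring\<^esub> = \<one>\<^bsub>fr_ring\<^esub>" using FR.l_null by metis
      thus False using fraction_eq_0[of 1 1] by simp
    qed
    thus "x \<in> carrier fr_ring - {\<zero>\<^bsub>fr_ring\<^esub>}" using x FR.Units_closed by blast
  next
    fix x assume "x \<in> carrier fr_ring - {\<zero>\<^bsub>fr_ring\<^esub>}"
    hence x: "x \<in> fractions" "x \<noteq> fraction 0 1" by simp_all
    then obtain a b where ab: "x = fraction a b" "b \<noteq> 0" by (auto simp: fractions_def)
    moreover have "a \<noteq> 0" using x(2) ab fraction_eq_0 by metis
    ultimately have "x = fraction a b" "a \<noteq> 0" "b \<noteq> 0" by simp_all
    thus "x \<in> Units fr_ring"
      unfolding Units_def by (auto simp: fr_inverse intro!: bexI[of _ "fraction b a"])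
  qed
  show "fr_emb \<in> ring_hom ring_of_type_algebra fr_ring"
    by (rule ring_hom_memI) (simp_all add: ring_of_type_algebra_def fr_emb_mult fr_emb_add fr_emb_0_1)
  show "inj fr_emb"
  proof (rule injI)
    fix a b assume "fr_emb a = fr_emb b"
    thus "a = b" using fr_emb_mem[of 1 a] fr_emb_mem[of 1 b] graph_unique[of "fr_emb a" 1 a b] by simp
  qed
  fix k assume "k \<in> carrier fr_ring"
  then obtain a b where k: "k = fraction a b" "b \<noteq> 0" by (auto simp: fractions_def)
  have inv: "inv\<^bsub>fr_ring\<^esub> (fr_emb c) = fraction 1 c" if "c \<noteq> 0" for c
    unfolding fr_emb_def using that by (intro fr_inv) auto
  have "k = fr_mult (fr_emb a) (fraction 1 b)"
  proof (rule graph_eqI)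
    show "(b, a * 1) \<in> fr_mult (fr_emb a) (fraction 1 b)"
      by (rule fr_mult_mem[OF _ _ fraction_self fr_emb_mem]) (use k in simp_all)
  qed (use k fraction_self in \<open>auto simp: fr_mult_closed\<close>)
  thus "\<exists>a b. b \<noteq> 0 \<and> k = fr_emb a \<otimes>\<^bsub>fr_ring\<^esub> inv\<^bsub>fr_ring\<^esub> fr_emb b"
    using k(2) by (intro exI[of _ a] exI[of _ b]) (simp add: inv)
  \<comment> \<open>The left Ore condition turns the right fraction a b^-1 into the left fraction
    c^-1 d.\<close>
  obtain c d where cd: "c \<noteq> 0" "c * a = d * b"
  proof (cases "a = 0")
    case True
    thus thesis using that[of 1 0] by simp
  next
    case False
    then obtain r s where "r * a = s * b" "r * a \<noteq> 0" using left_ore[OF False k(2)] by blast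
    thus thesis using that[of r s] by (metis mult_zero_left)
  qed
  have "fr_mult (fraction 1 c) (fr_emb d) = k"
  proof (rule graph_eqI)
    have "(c * a, a) \<in> fraction 1 c"
    proof -
      have "(c * a, 1 * a) \<in> fraction 1 c" by (rule graph_mult[OF fraction_in fraction_self]) (rule cd(1))
      thus ?thesis by simp
    qed
    hence "(d * b, a) \<in> fraction 1 c" by (simp add: cd(2))
    thus "(b, a) \<in> fr_mult (fraction 1 c) (fr_emb d)"
      by (rule fr_mult_mem[OF _ _ fr_emb_mem, rotated 2]) (use cd in simp_all)
  qed (use k cd fraction_self in \<open>auto simp: fr_mult_closed\<close>)
  thus "\<exists>a b. b \<noteq> 0 \<and> k = inv\<^bsub>fr_ring\<^esub> fr_emb b \<otimes>\<^bsub>fr_ring\<^esub> fr_emb a"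
    using cd(1) by (intro exI[of _ d] exI[of _ c]) (simp add: inv)
qed (rule fr_ring_ring)

end

lemma (in embedded_in_qtorus) ore_domain: "ore_domain TYPE('g presented)"
proof
  fix a b :: "'g presented"
  show "a * b = 0 \<longleftrightarrow> a = 0 \<or> b = 0" by (rule no_zero_divisors)
  show "\<exists>r s. a * r = b * s \<and> a * r \<noteq> 0" if "a \<noteq> 0" "b \<noteq> 0"
    using common_multiple[of "(*)" a b] that by simp
  show "\<exists>r s. r * a = s * b \<and> r * a \<noteq> 0" if "a \<noteq> 0" "b \<noteq> 0"
    using common_multiple[of "\<lambda>x y. y * x" a b] that by simp
qed

interpretation aq_emb: embedded_in_qtorus to_qt
  by unfold_locales (rule to_qt_hom to_qt_scalar inj_to_qt)+

interpretation hb_emb: embedded_in_qtorus "to_qt \<circ> DS"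
proof
  show "additive_mult (to_qt \<circ> DS)"
    by (simp add: additive_mult_def am_add[OF to_qt_hom] am_add[OF DS_hom] am_mult[OF to_qt_hom] am_mult[OF DS_hom]
        am_1[OF to_qt_hom] am_1[OF DS_hom])
  show "(to_qt \<circ> DS) (scalar c) = qt_scalar c" for c by (simp add: DS_scalar to_qt_scalar)
qed (rule inj_to_qt_DS)

interpretation aq_ore: ore_domain "TYPE(aq)"
  by (rule aq_emb.ore_domain)

interpretation hb_ore: ore_domain "TYPE(hb)"
  by (rule hb_emb.ore_domain)

section \<open>Birationality\<close>

text \<open>This says b = f(s) f(r)^-1 within the target itself, before its fraction field
  enters.\<close>

definition frac_over :: "('a::ring_1 \<Rightarrow> 'b::ring_1) \<Rightarrow> 'b \<Rightarrow> bool" where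
  "frac_over f b \<longleftrightarrow> (\<exists>r s. r \<noteq> 0 \<and> b * f r = f s)"

context
  fixes f :: "'a::ring_1 \<Rightarrow> 'b::ring_1"
  assumes A: "ore_domain TYPE('a)" and B: "ore_domain TYPE('b)"
    and hom: "additive_mult f" and inj: "inj f"
begin

interpretation A: ore_domain "TYPE('a)" by (rule A)
interpretation B: ore_domain "TYPE('b)" by (rule B)

lemma f_0_iff: "f a = 0 \<longleftrightarrow> a = 0"
  using inj am_0[OF hom] by (metis injD)

lemma frac_over_image: "frac_over f (f a)"
  unfolding frac_over_def by (intro exI[of _ 1] exI[of _ a]) (use f_0_iff[of 1] am_1[OF hom] B.no_zero_div in \<open>auto simp: am_1[OF hom]\<close>)

lemma frac_over_add:
  assumes "frac_over f b" "frac_over f b'"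
  shows "frac_over f (b + b')"
proof -
  obtain r s r' s' where *: "r \<noteq> 0" "b * f r = f s" "r' \<noteq> 0" "b' * f r' = f s'"
    using assms by (auto simp: frac_over_def)
  obtain x y where xy: "r * x = r' * y" "r * x \<noteq> 0" using A.right_ore[OF *(1,3)] by blast
  have "b * f (r * x) = f (s * x)" by (metis *(2) am_mult[OF hom] mult.assoc)
  moreover have "b' * f (r * x) = f (s' * y)" by (metis *(4) am_mult[OF hom] mult.assoc xy(1))
  ultimately have "(b + b') * f (r * x) = f (s * x + s' * y)"
    by (simp add: distrib_right am_add[OF hom])
  thus ?thesis using xy(2) unfolding frac_over_def by blast
qed

lemma frac_over_mult:
  assumes "frac_over f b" "frac_over f b'"
  shows "frac_over f (b * b')"
proof -
  obtain r s r' s' where *: "r \<noteq> 0" "b * f r = f s" "r' \<noteq> 0" "b' * f r' = f s'"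
    using assms by (auto simp: frac_over_def)
  show ?thesis
  proof (cases "s' = 0")
    case True
    hence "b * b' * f r' = f 0" by (simp add: mult.assoc *(4) am_0[OF hom])
    thus ?thesis using *(3) unfolding frac_over_def by blast
  next
    case False
    obtain x y where xy: "s' * x = r * y" "s' * x \<noteq> 0" using A.right_ore[OF False *(1)] by blast
    have "b * b' * f (r' * x) = b * (b' * f r') * f x" by (simp add: am_mult[OF hom] mult.assoc)
    also have "\<dots> = b * f (r * y)" by (simp add: *(4) mult.assoc xy(1) flip: am_mult[OF hom])
    also have "\<dots> = f (s * y)" by (simp add: am_mult[OF hom] *(2) flip: mult.assoc)
    finally have "b * b' * f (r' * x) = f (s * y)" .
    moreover have "r' * x \<noteq> 0" using *(3) xy(2) A.no_zero_div by auto
    ultimately show ?thesis unfolding frac_over_def by blast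
  qed
qed

lemma frac_over_uminus: "frac_over f b \<Longrightarrow> frac_over f (- b)"
  by (metis am_uminus[OF hom] frac_over_def mult_minus_left)

lemma frac_over_unit_inv:
  assumes "frac_over f b" "is_unit_elt b"
  shows "frac_over f (unit_inv b)"
proof -
  obtain r s where *: "r \<noteq> 0" "b * f r = f s" using assms(1) by (auto simp: frac_over_def)
  have "unit_inv b * f s = f r" using unit_inv_left'[OF assms(2), of "f r"] *(2) by simp
  moreover have "s \<noteq> 0" using calculation *(1) f_0_iff am_0[OF hom] by (metis mult_zero_right)
  ultimately show ?thesis unfolding frac_over_def by blast
qed

lemma frac_over_sum: "(\<And>x. x \<in> S \<Longrightarrow> frac_over f (h x)) \<Longrightarrow> frac_over f (sum h S)"
  by (induction S rule: infinite_finite_induct)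
     (use frac_over_image[of 0] am_0[OF hom] in \<open>auto intro: frac_over_add\<close>)

text \<open>The induced map of fractions sends the graph of a fraction to the graph through the image of
  any of its points.\<close>

definition fr_map :: "('a \<times> 'a) set \<Rightarrow> ('b \<times> 'b) set" where
  "fr_map k = (SOME l. \<exists>r s. r \<noteq> 0 \<and> (r, s) \<in> k \<and> l = B.fraction (f s) (f r))"

lemma fr_map_ex:
  "k \<in> A.fractions \<Longrightarrow> \<exists>r s. r \<noteq> 0 \<and> (r, s) \<in> k \<and> fr_map k = B.fraction (f s) (f r)"
proof -
  assume "k \<in> A.fractions"
  then obtain a b where "b \<noteq> 0" "k = A.fraction a b" by (rule A.graph_obtain)
  hence "\<exists>l r s. r \<noteq> 0 \<and> (r, s) \<in> k \<and> l = B.fraction (f s) (f r)" using A.fraction_self by blast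
  thus ?thesis unfolding fr_map_def by (rule someI_ex)
qed

lemma fr_map_closed: "k \<in> A.fractions \<Longrightarrow> fr_map k \<in> B.fractions"
  using fr_map_ex f_0_iff by fastforce

lemma fr_map_mem:
  assumes k: "k \<in> A.fractions" and rs: "(r, s) \<in> k"
  shows "(f r, f s) \<in> fr_map k"
proof -
  obtain r0 s0 where *: "r0 \<noteq> 0" "(r0, s0) \<in> k" "fr_map k = B.fraction (f s0) (f r0)"
    using fr_map_ex[OF k] by blast
  have mem: "(f r0, f s0) \<in> fr_map k" unfolding *(3) by (rule B.fraction_self)
  show ?thesis
  proof (cases "r = 0")
    case True
    hence "s = 0" using A.graph_unique[OF k rs] A.graph_0[OF k] by simp
    thus ?thesis using True B.graph_0[OF fr_map_closed[OF k]] by (simp add: am_0[OF hom])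
  next
    case False
    obtain x y where xy: "r * x = r0 * y" "r * x \<noteq> 0" using A.right_ore[OF False *(1)] by blast
    have "s * x = s0 * y"
      using A.graph_unique[OF k A.graph_mult[OF k rs, of x]] A.graph_mult[OF k *(2), of y] xy(1) by simp
    hence "(f r * f x, f s * f x) \<in> fr_map k"
      using B.graph_mult[OF fr_map_closed[OF k] mem, of "f y"] xy(1) by (simp flip: am_mult[OF hom])
    moreover have "f x \<noteq> 0" using xy(2) f_0_iff[of x] by (metis mult_zero_right)
    ultimately show ?thesis by (rule B.graph_cancel[OF fr_map_closed[OF k]])
  qed
qed

lemma fr_map_iso:
  assumes gen: "\<And>b. frac_over f b"
  shows "fr_map \<in> ring_iso A.fr_ring B.fr_ring"
proof (rule ring_iso_memI)
  fix x y assume "x \<in> carrier A.fr_ring" "y \<in> carrier A.fr_ring"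
  hence xy: "x \<in> A.fractions" "y \<in> A.fractions" by simp_all
  show "fr_map x \<in> carrier B.fr_ring" using xy fr_map_closed by simp
  obtain r s u where r: "r \<noteq> 0" "(r, s) \<in> y" "(s, u) \<in> x"
    using A.fr_mult_ex[OF xy] by blast
  show "fr_map (x \<otimes>\<^bsub>A.fr_ring\<^esub> y) = fr_map x \<otimes>\<^bsub>B.fr_ring\<^esub> fr_map y"
    unfolding A.fr_ring_simps B.fr_ring_simps
  proof (rule B.graph_eqI)
    show "(f r, f u) \<in> fr_map (A.fr_mult x y)"
      by (intro fr_map_mem A.fr_mult_closed A.fr_mult_mem xy) (rule r)+
    show "(f r, f u) \<in> B.fr_mult (fr_map x) (fr_map y)"
      by (rule B.fr_mult_mem[OF _ _ fr_map_mem[OF xy(2) r(2)] fr_map_mem[OF xy(1) r(3)]])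
         (rule fr_map_closed xy)+
  qed (use r(1) f_0_iff xy in \<open>auto intro: fr_map_closed A.fr_mult_closed B.fr_mult_closed\<close>)
  obtain t p p' where t: "t \<noteq> 0" "(t, p) \<in> x" "(t, p') \<in> y"
    using A.fr_add_ex[OF xy] by blast
  show "fr_map (x \<oplus>\<^bsub>A.fr_ring\<^esub> y) = fr_map x \<oplus>\<^bsub>B.fr_ring\<^esub> fr_map y"
    unfolding A.fr_ring_simps B.fr_ring_simps
  proof (rule B.graph_eqI)
    show "(f t, f (p + p')) \<in> fr_map (A.fr_add x y)"
      by (intro fr_map_mem A.fr_add_closed A.fr_add_mem xy) (rule t)+
    show "(f t, f (p + p')) \<in> B.fr_add (fr_map x) (fr_map y)"
      unfolding am_add[OF hom]
      by (rule B.fr_add_mem[OF _ _ fr_map_mem[OF xy(1) t(2)] fr_map_mem[OF xy(2) t(3)]])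
         (rule fr_map_closed xy)+
  qed (use t(1) f_0_iff xy in \<open>auto intro: fr_map_closed A.fr_add_closed B.fr_add_closed\<close>)
next
  have one: "f 1 = 1" by (rule am_1[OF hom])
  have ne: "(1 :: 'b) \<noteq> 0" "(1 :: 'a) \<noteq> 0" by simp_all
  show "fr_map \<one>\<^bsub>A.fr_ring\<^esub> = \<one>\<^bsub>B.fr_ring\<^esub>"
    unfolding A.fr_ring_simps B.fr_ring_simps
  proof (rule B.graph_eqI)
    show "(1, 1) \<in> fr_map (A.fraction 1 1)"
      using fr_map_mem[OF A.fraction_in A.fraction_self, of 1 1] one by simp
  qed (auto intro: fr_map_closed B.fraction_self)
next
  show "bij_betw fr_map (carrier A.fr_ring) (carrier B.fr_ring)"
    unfolding A.fr_ring_simps B.fr_ring_simps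
  proof (intro bij_betwI')
    fix x y assume xy: "x \<in> A.fractions" "y \<in> A.fractions"
    show "fr_map x = fr_map y \<longleftrightarrow> x = y"
    proof
      assume eq: "fr_map x = fr_map y"
      obtain t s s' where t: "t \<noteq> 0" "(t, s) \<in> x" "(t, s') \<in> y"
        using A.fr_add_ex[OF xy] by blast
      have "f s = f s'"
        using B.graph_unique[OF fr_map_closed[OF xy(2)], of "f t" "f s" "f s'"]
          fr_map_mem[OF xy(1) t(2)] fr_map_mem[OF xy(2) t(3)] eq by simp
      hence "s = s'" using inj by (rule injD[rotated])
      thus "x = y" using A.graph_eqI[OF xy t(2)] t by simp
    qed simp
  next
    fix l assume l: "l \<in> B.fractions"
    then obtain a b where ab: "b \<noteq> 0" "l = B.fraction a b" by (rule B.graph_obtain)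
    \<comment> \<open>Clearing denominators gives a point of l with both coordinates in the image of
      f: b f(r) f(r') = f(s r') and a f(r) f(r') = f(s').\<close>
    obtain r s where rs: "r \<noteq> 0" "b * f r = f s" using gen[of b] by (auto simp: frac_over_def)
    obtain r' s' where rs': "r' \<noteq> 0" "a * f r * f r' = f s'" using gen[of "a * f r"] by (auto simp: frac_over_def)
    have "(b * (f r * f r'), a * (f r * f r')) \<in> l"
      unfolding ab(2) by (rule B.graph_mult[OF B.fraction_in[OF ab(1)] B.fraction_self])
    hence mem: "(f (s * r'), f s') \<in> l"
      using rs(2) rs'(2) by (simp add: am_mult[OF hom] flip: mult.assoc)
    have "f s \<noteq> 0" unfolding rs(2)[symmetric] using ab(1) rs(1) f_0_iff B.no_zero_div by simp
    hence nz: "s * r' \<noteq> 0" using rs'(1) A.no_zero_div f_0_iff by simp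
    have k: "A.fraction s' (s * r') \<in> A.fractions" using nz by (rule A.fraction_in)
    have "l = fr_map (A.fraction s' (s * r'))"
      by (rule B.graph_eqI[OF l fr_map_closed[OF k] mem fr_map_mem[OF k A.fraction_self]])
         (use nz f_0_iff[of "s * r'"] in simp)
    thus "\<exists>x\<in>A.fractions. l = fr_map x" using nz by auto
  qed (rule fr_map_closed)
qed

lemma birationalI:
  assumes gen: "\<And>b. frac_over f b"
  shows "birational f"
  unfolding birational_def
proof (intro exI conjI bexI allI)
  show "fr_map (A.fr_emb a) = B.fr_emb (f a)" for a
  proof (rule B.graph_eqI)
    show "(f 1, f (a * 1)) \<in> fr_map (A.fr_emb a)"
      by (rule fr_map_mem[OF _ A.fr_emb_mem]) simp
    show "(f 1, f (a * 1)) \<in> B.fr_emb (f a)"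
      unfolding am_mult[OF hom] by (rule B.fr_emb_mem)
  qed (use f_0_iff[of 1] in \<open>auto intro: fr_map_closed\<close>)
qed (rule A.is_fraction_field_fr_ring B.is_fraction_field_fr_ring fr_map_iso[OF gen])+

end

lemma left_inverse_eq_unit_inv:
  assumes "is_unit_elt t" "x * t = 1"
  shows "x = unit_inv t"
proof -
  have "x * t * unit_inv t = x" using assms(1) by (simp add: mult.assoc unit_inv_right)
  thus ?thesis using assms(2) by simp
qed

lemma eq_neg_if_sum_0:
  assumes "0 = x + (y + z)"
  shows "y = - (x + z :: 'a::ab_group_add)"
proof -
  have "y + (x + z) = 0" using assms by (simp add: add.left_commute)
  thus ?thesis by (simp only: eq_neg_iff_add_eq_0)
qed

text \<open>The recursion is solved in the other direction: the constant coefficient of c_i gives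
  t_i, and coefficient n + 1 of the equation gives c_(i+1,n) in terms of c_i and earlier
  coefficients of c_(i+1).\<close>

lemma frac_over_continued_fraction:
  fixes c :: "int \<Rightarrow> aq fps"
  assumes c: "\<And>i. c i * (fps_const (tA (\<iota> i)) + fps_X * c (i + 1)) = 1"
    and start: "\<And>n. frac_over DS (c 1 $ n)" and "1 \<le> i"
  shows "(\<forall>n. frac_over DS (c i $ n)) \<and> frac_over DS (tA (\<iota> i))"
proof -
  note D = hb_ore.ore_domain_axioms aq_ore.ore_domain_axioms DS_hom inj_DS
  have t: "frac_over DS (tA (\<iota> i))" if "\<And>n. frac_over DS (c i $ n)" for i
  proof -
    have "c i $ 0 * tA (\<iota> i) = 1" using arg_cong[OF c[of i], of "\<lambda>A. A $ 0"] by simp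
    hence "c i $ 0 = unit_inv (tA (\<iota> i))"
      by (rule left_inverse_eq_unit_inv[OF is_unit_tA])
    hence "tA (\<iota> i) = unit_inv (c i $ 0)" by (simp add: unit_inv_unit_inv is_unit_tA)
    moreover have "is_unit_elt (c i $ 0)"
      using \<open>c i $ 0 = _\<close> is_unit_unit_inv[OF is_unit_tA] by simp
    ultimately show ?thesis using frac_over_unit_inv[OF D that] by simp
  qed
  have "\<forall>n. frac_over DS (c i $ n)" if "1 \<le> i"
    using that
  proof (induction i rule: int_ge_induct)
    case (step i)
    have "frac_over DS (c (i + 1) $ n)" for n
    proof (induction n rule: less_induct)
      case (less n)
      have "(c i * (fps_const (tA (\<iota> i)) + fps_X * c (i + 1))) $ Suc n =
          c i $ Suc n * tA (\<iota> i) + (fps_X * (c i * c (i + 1))) $ Suc n"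
        by (simp add: distrib_left mult.assoc[symmetric] flip: fps_X_central[of "c i"])
      hence "0 = c i $ Suc n * tA (\<iota> i) + (\<Sum>l=0..n. c i $ l * c (i + 1) $ (n - l))"
        unfolding c by (simp add: fps_mult_nth[of "c i"])
      also have "(\<Sum>l=0..n. c i $ l * c (i + 1) $ (n - l)) =
          c i $ 0 * c (i + 1) $ n + (\<Sum>l=1..n. c i $ l * c (i + 1) $ (n - l))"
        by (simp add: sum.atLeast_Suc_atMost)
      finally have "c i $ 0 * c (i + 1) $ n =
          - (c i $ Suc n * tA (\<iota> i) + (\<Sum>l=1..n. c i $ l * c (i + 1) $ (n - l)))"
        by (rule eq_neg_if_sum_0)
      moreover have "tA (\<iota> i) * c i $ 0 = 1"
      proof -
        have "c i $ 0 * tA (\<iota> i) = 1" using arg_cong[OF c[of i], of "\<lambda>A. A $ 0"] by simp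
        hence "c i $ 0 = unit_inv (tA (\<iota> i))" by (rule left_inverse_eq_unit_inv[OF is_unit_tA])
        thus ?thesis by (simp add: unit_inv_right is_unit_tA)
      qed
      ultimately have "c (i + 1) $ n =
          tA (\<iota> i) * - (c i $ Suc n * tA (\<iota> i) + (\<Sum>l=1..n. c i $ l * c (i + 1) $ (n - l)))"
        by (metis (no_types) mult.assoc mult_1)
      also have "frac_over DS \<dots>"
      proof (intro frac_over_mult[OF D] frac_over_uminus[OF D] frac_over_add[OF D] frac_over_sum[OF D])
        show "frac_over DS (tA (\<iota> i))" using t step.IH by blast
        thus "frac_over DS (tA (\<iota> i))" .
        show "frac_over DS (c i $ Suc n)" using step.IH by blast
        fix l assume "l \<in> {1..n}"
        thus "frac_over DS (c i $ l)" "frac_over DS (c (i + 1) $ (n - l))" using step.IH less by auto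
      qed
      finally show ?case .
    qed
    thus ?case by blast
  qed (use start in simp)
  thus ?thesis using t assms(3) by blast
qed

lemma frac_over_aq: "frac_over DS a"
proof (induction a rule: aq_induct)
  note D = hb_ore.ore_domain_axioms aq_ore.ore_domain_axioms DS_hom inj_DS
  show "frac_over DS (scalar c)" for c
    using frac_over_image[OF D, of "scalar c"] by (simp add: DS_scalar)
  have u: "frac_over DS (uf.cser 1 $ n)" and m: "frac_over DS (mf.cser 1 $ n)" for n
    using frac_over_image[OF D] unfolding DS_u_series[symmetric] DS_m_series[symmetric] coeffwise_nth by blast+
  show t: "frac_over DS (tA i)" for i
  proof (cases "1 \<le> i")
    case True
    thus ?thesis using frac_over_continued_fraction[of mf.cser "\<lambda>i. i", OF mf.cser_mult m] by blast
  next
    case False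
    hence "1 \<le> 1 - i" by simp
    from frac_over_continued_fraction[of uf.cser "\<lambda>i. 1 - i", OF uf.cser_mult u this]
    show ?thesis by simp
  qed
  show "frac_over DS (unit_inv (tA i))" for i
    by (rule frac_over_unit_inv[OF D t is_unit_tA])
  show "frac_over DS (a + b)" "frac_over DS (a * b)" if "frac_over DS a" "frac_over DS b" for a b
    using that frac_over_add[OF D] frac_over_mult[OF D] by blast+
qed

lemma birational_DS: "birational DS"
  by (rule birationalI[OF hb_ore.ore_domain_axioms aq_ore.ore_domain_axioms DS_hom inj_DS frac_over_aq])

section \<open>Gaussian binomial coefficients\<close>

lemma qvar_power: "qvar ^ n = qpow (int n)"
  by (induction n) (auto simp: qvar_eq_qpow qpow_add)

lemma qpow_eq_1_iff [simp]: "qpow a = 1 \<longleftrightarrow> a = 0"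
proof
  assume "qpow a = 1"
  hence "Poly_Mapping.lookup (Poly_Mapping.single a (1::complex)) 0 = Poly_Mapping.lookup (Poly_Mapping.single 0 1) 0"
    by (simp add: qpow_def single_one)
  thus "a = 0" by (simp add: lookup_single when_def split: if_splits)
qed simp

lemma qvar_minus_1_nonzero [simp]: "qvar - 1 \<noteq> 0" "qvar \<noteq> 1"
  by (simp_all add: qvar_eq_qpow)

lemma qint_eq: "(qvar - 1) * qint n = qvar ^ n - 1"
proof -
  have *: "(qvar - 1) * (\<Sum>i<n. qvar ^ i) = qvar ^ n - 1"
    by (simp add: power_diff_1_eq)
  show ?thesis unfolding qint_def using exact_quot_eqI'[OF *] * by simp
qed

lemma qint_simps [simp]: "qint 0 = 0" "qint (Suc 0) = 1"
  using qint_eq[of 0] qint_eq[of 1] by (simp_all del: qvar_minus_1_nonzero) (use qvar_minus_1_nonzero in auto)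

lemma qint_add: "qint (a + b) = qint a + qvar ^ a * qint b"
proof -
  have "(qvar - 1) * qint (a + b) = (qvar - 1) * (qint a + qvar ^ a * qint b)"
    by (simp add: qint_eq distrib_left mult.left_commute[of "qvar - 1"] power_add) (simp add: algebra_simps)
  thus ?thesis by simp
qed

lemma qint_eq_0_iff [simp]: "qint n = 0 \<longleftrightarrow> n = 0"
  using qint_eq[of n] by (auto simp: qvar_power)

text \<open>The Gaussian binomial by the q-Pascal rule, which avoids division;
  \<open>gbin_qfact\<close> identifies it with the quotient of factorials.\<close>

fun gbin :: "nat \<Rightarrow> nat \<Rightarrow> laurent" where
  "gbin n 0 = 1"
| "gbin 0 (Suc k) = 0"
| "gbin (Suc n) (Suc k) = gbin n k + qvar ^ Suc k * gbin n (Suc k)"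

lemma qfact_Suc: "qfact (Suc n) = qfact n * qint (Suc n)"
  by (simp add: qfact_def prod.nat_ivl_Suc' mult.commute)

lemma qfact_0 [simp]: "qfact 0 = 1"
  by (simp add: qfact_def)

lemma qfact_nonzero [simp]: "qfact n \<noteq> 0"
  by (induction n) (auto simp: qfact_Suc)

lemma gbin_eq_0: "n < k \<Longrightarrow> gbin n k = 0"
  by (induction n k rule: gbin.induct) auto

lemma gbin_same [simp]: "gbin n n = 1"
  by (induction n) (auto simp: gbin_eq_0)

lemma gbin_qfact: "gbin (k + j) k * (qfact k * qfact j) = qfact (k + j)"
proof (induction "k + j" arbitrary: k j)
  case (Suc n)
  show ?case
  proof (cases k; cases j)
    fix k' j' assume k: "k = Suc k'" and j: "j = Suc j'"
    have 1: "gbin (k' + j) k' * (qfact k' * qfact j) = qfact (k' + j)"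
      and 2: "gbin (k + j') k * (qfact k * qfact j') = qfact (k + j')"
      using Suc.hyps(1)[of k' j] Suc.hyps(1)[of k j'] Suc.hyps(2) k j by simp_all
    have "gbin (k + j) k * (qfact k * qfact j) =
        gbin (k' + j) k' * (qfact k' * qfact j) * qint k + qvar ^ k * (gbin (k + j') k * (qfact k * qfact j')) * qint j"
      by (simp add: k j qfact_Suc algebra_simps)
    also have "\<dots> = qfact (k' + j) * (qint k + qvar ^ k * qint j)"
      unfolding 1 2 by (simp add: k j algebra_simps)
    also have "\<dots> = qfact (k + j)"
      unfolding qint_add[symmetric] by (simp add: k qfact_Suc)
    finally show ?thesis .
  qed (use Suc in auto)
qed simp

lemma gbin_sym: "gbin (k + l) k = gbin (k + l) l"
proof -
  have "gbin (k + l) k * (qfact k * qfact l) = gbin (k + l) l * (qfact k * qfact l)"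
    using gbin_qfact[of k l] gbin_qfact[of l k] by (simp add: add.commute mult.commute)
  thus ?thesis by simp
qed

lemma gbin_absorb: "gbin (Suc (k + l)) (Suc k) * qint (Suc k) = gbin (k + l) k * qint (Suc (k + l))"
proof -
  have "gbin (Suc (k + l)) (Suc k) * qint (Suc k) * (qfact k * qfact l) = gbin (k + l) k * qint (Suc (k + l)) * (qfact k * qfact l)"
    using gbin_qfact[of k l] gbin_qfact[of "Suc k" l] by (simp add: qfact_Suc mult_ac)
  thus ?thesis by simp
qed

lemma gbin_shift: "gbin (Suc (k + l)) (Suc k) * qint (Suc k) = gbin (Suc (k + l)) k * qint (Suc l)"
proof -
  have "gbin (Suc (k + l)) (Suc k) * qint (Suc k) * (qfact k * qfact l) = gbin (Suc (k + l)) k * qint (Suc l) * (qfact k * qfact l)"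
    using gbin_qfact[of k "Suc l"] gbin_qfact[of "Suc k" l] by (simp add: qfact_Suc mult_ac)
  thus ?thesis by simp
qed

text \<open>A factor of F_q. It is the complete symmetric polynomial of degree b in 1, q, ...,
  q^(a-1), whence the recursion \<open>cbin_Suc\<close>.\<close>

definition cbin :: "nat \<Rightarrow> nat \<Rightarrow> laurent" where
  "cbin a b = (if b = 0 then 1 else gbin (a + b - 1) b)"

lemma qbinom_eq_cbin: "qbinom (int a + int b - 1) (int b) = cbin a b"
proof (cases "a = 0 \<or> b = 0")
  case False
  then obtain a' b' where ab: "a = Suc a'" "b = Suc b'" by (metis not0_implies_Suc)
  have "exact_quot (qfact (b + a')) (qfact b * qfact a') = gbin (b + a') b"
    by (rule exact_quot_eqI') (use gbin_qfact[of b a'] in \<open>simp_all add: mult.commute\<close>)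
  moreover have n: "nat (int a + int b - 1) = b + a'" "nat (int a + int b - 1 - int b) = a'"
    using ab by auto
  moreover have "a + b - 1 = b + a'" "int b \<noteq> 0" "\<not> (int b < 0 \<or> max 0 (int a + int b - 1) < int b)" "b \<noteq> 0"
    using ab by auto
  ultimately show ?thesis
    unfolding qbinom_def cbin_def n nat_int by (simp only: if_False simp_thms)
qed (auto simp: qbinom_def cbin_def gbin_eq_0)

lemma cbin_0 [simp]: "cbin a 0 = 1" "cbin 0 (Suc b) = 0"
  by (simp_all add: cbin_def gbin_eq_0)

lemma cbin_Suc: "cbin (Suc a) (Suc b) = cbin (Suc a) b + qvar ^ Suc b * cbin a (Suc b)"
  by (cases b) (simp_all add: cbin_def)

lemma cbin_gbin: "1 \<le> b \<Longrightarrow> gbin (b + j - 1) (b - 1) = cbin b j"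
  using gbin_sym[of "b - 1" j] by (auto simp: cbin_def)

section \<open>Power series in $q$-commuting elements\<close>

lemma fps_power_nth_0: "x $ 0 = 0 \<Longrightarrow> n < j \<Longrightarrow> (x :: 'a::ring_1 fps) ^ j $ n = 0"
proof (induction j arbitrary: n)
  case (Suc j)
  have "(x * x ^ j) $ n = (\<Sum>i=0..n. x $ i * x ^ j $ (n - i))" by (simp add: fps_mult_nth)
  also have "\<dots> = 0"
  proof (rule sum.neutral, rule ballI)
    fix i assume "i \<in> {0..n}"
    thus "x $ i * x ^ j $ (n - i) = 0" using Suc by (cases "i = 0") auto
  qed
  finally show ?case by simp
qed simp

lemma fps_mult_low:
  "(\<And>i. i < a \<Longrightarrow> A $ i = 0) \<Longrightarrow> (\<And>i. i < b \<Longrightarrow> B $ i = (0::'a::ring_1)) \<Longrightarrow> n < a + b \<Longrightarrow> (A * B) $ n = 0"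
  unfolding fps_mult_nth
proof (intro sum.neutral ballI)
  fix i assume "\<And>i. i < a \<Longrightarrow> A $ i = 0" "\<And>i. i < b \<Longrightarrow> B $ i = 0" "n < a + b" "i \<in> {0..n}"
  thus "A $ i * B $ (n - i) = 0" by (cases "i < a") auto
qed

context central_scalars
begin

interpretation F: central_scalars "\<lambda>c. fps_const (sc c)"
  by (rule central_scalars_fps)

text \<open>The series with terms c_j x^j. If x has no constant term, x^j starts in degree j, so the
  cut at j \<le> n loses nothing.\<close>

definition psum :: "(nat \<Rightarrow> laurent) \<Rightarrow> 'r fps \<Rightarrow> 'r fps" where
  "psum c x = Abs_fps (\<lambda>n. \<Sum>j\<le>n. sc (c j) * (x ^ j) $ n)"

lemma psum_mult_right:
  assumes "x $ 0 = 0"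
  shows "(psum c x * A) $ n = (\<Sum>j\<le>n. sc (c j) * (x ^ j * A) $ n)"
proof -
  have "(psum c x * A) $ n = (\<Sum>i\<in>{0..n}. \<Sum>j\<le>n. sc (c j) * (x ^ j $ i * A $ (n - i)))"
    unfolding fps_mult_nth psum_def fps_nth_Abs_fps sum_distrib_right mult.assoc
    by (intro sum.cong refl sum.mono_neutral_left) (auto simp: fps_power_nth_0[OF assms])
  also have "\<dots> = (\<Sum>j\<le>n. sc (c j) * (x ^ j * A) $ n)"
    unfolding fps_mult_nth sum_distrib_left by (rule sum.swap)
  finally show ?thesis .
qed

lemma psum_mult_left:
  assumes "x $ 0 = 0"
  shows "(A * psum c x) $ n = (\<Sum>j\<le>n. sc (c j) * (A * x ^ j) $ n)"
proof -
  have "(A * psum c x) $ n = (\<Sum>i\<in>{0..n}. \<Sum>j\<le>n. A $ i * (sc (c j) * x ^ j $ (n - i)))"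
    unfolding fps_mult_nth psum_def fps_nth_Abs_fps sum_distrib_left
    by (intro sum.cong refl sum.mono_neutral_left) (auto simp: fps_power_nth_0[OF assms])
  also have "\<dots> = (\<Sum>j\<le>n. sc (c j) * (A * x ^ j) $ n)"
    unfolding fps_mult_nth sum_distrib_left sc_left_commute by (rule sum.swap)
  finally show ?thesis .
qed

lemma psum_twist:
  assumes "x $ 0 = 0" "x * \<zeta> = fps_const (sc qvar) * (\<zeta> * x)"
  shows "psum c x * \<zeta> = \<zeta> * psum (\<lambda>j. qvar ^ j * c j) x"
proof (rule fps_ext)
  have "x ^ j * \<zeta> = fps_const (sc (qvar ^ j)) * (\<zeta> * x ^ j)" for j
  proof (induction j)
    case (Suc j)
    have "x ^ Suc j * \<zeta> = x * (x ^ j * \<zeta>)" by (simp add: mult.assoc)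
    also have "\<dots> = fps_const (sc (qvar ^ j)) * (x * \<zeta> * x ^ j)"
      unfolding Suc by (simp only: F.sc_left_commute[of x] mult.assoc)
    also have "\<dots> = fps_const (sc (qvar ^ Suc j)) * (\<zeta> * x ^ Suc j)"
      unfolding assms(2) by (simp add: mult.assoc sc_mult sc_central[of qvar] flip: fps_const_mult)
    finally show ?case .
  qed simp
  thus "(psum c x * \<zeta>) $ n = (\<zeta> * psum (\<lambda>j. qvar ^ j * c j) x) $ n" for n
    unfolding psum_mult_right[OF assms(1)] psum_mult_left[OF assms(1)]
    by (simp add: sc_mult mult.assoc sc_central[of "c _"])
qed

text \<open>\<open>psum (cbin a) x\<close> is the product of the geometric series 1/(1 - q^i x) over
  i < a. For a + 1 factors, multiplication by 1 - x removes i = 0 and leaves the product for a with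
  x replaced by q x.\<close>

lemma psum_cbin_Suc:
  assumes "x $ 0 = 0"
  shows "psum (cbin (Suc a)) x * (1 - x) = psum (\<lambda>j. qvar ^ j * cbin a j) x"
    and "(1 - x) * psum (cbin (Suc a)) x = psum (\<lambda>j. qvar ^ j * cbin a j) x"
proof -
  have comm: "x * psum c x = psum c x * x" for c
    by (rule fps_ext) (simp add: psum_mult_left[OF assms] psum_mult_right[OF assms] power_commutes)
  have "(psum (cbin (Suc a)) x * (1 - x)) $ n = psum (\<lambda>j. qvar ^ j * cbin a j) x $ n" for n
  proof -
    have "(psum (cbin (Suc a)) x * x) $ n = (\<Sum>j\<le>n. sc (cbin (Suc a) j) * x ^ Suc j $ n)"
      by (simp add: psum_mult_right[OF assms] power_commutes)
    also have "\<dots> = (\<Sum>j<n. sc (cbin (Suc a) j) * x ^ Suc j $ n)"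
      by (simp add: fps_power_nth_0[OF assms, of n "Suc n", simplified] flip: lessThan_Suc_atMost)
    finally have 1: "(psum (cbin (Suc a)) x * x) $ n = (\<Sum>j<n. sc (cbin (Suc a) j) * x ^ Suc j $ n)" .
    have 2: "psum d x $ n = sc (d 0) * (x ^ 0) $ n + (\<Sum>j<n. sc (d (Suc j)) * x ^ Suc j $ n)" for d
    proof (cases n)
      case (Suc m)
      show ?thesis unfolding Suc psum_def fps_nth_Abs_fps
        by (subst sum.atMost_Suc_shift) (simp only: lessThan_Suc_atMost)
    qed (simp add: psum_def)
    show ?thesis
      unfolding right_diff_distrib mult_1_right fps_sub_nth 1
      unfolding 2[of "cbin (Suc a)"] 2[of "\<lambda>j. qvar ^ j * cbin a j"]
      by (simp add: cbin_Suc sc_add distrib_right sum.distrib del: power_Suc)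
  qed
  thus 1: "psum (cbin (Suc a)) x * (1 - x) = psum (\<lambda>j. qvar ^ j * cbin a j) x" by (rule fps_ext)
  show "(1 - x) * psum (cbin (Suc a)) x = psum (\<lambda>j. qvar ^ j * cbin a j) x"
    unfolding 1[symmetric] by (simp add: left_diff_distrib right_diff_distrib comm)
qed

lemma psum_cbin_0: "psum (cbin 0) x = 1"
proof (rule fps_ext)
  fix n
  have "(\<Sum>j\<le>n. sc (cbin 0 j) * x ^ j $ n) = (\<Sum>j\<in>{0}. sc (cbin 0 j) * x ^ j $ n)"
  proof (rule sum.mono_neutral_right)
    show "\<forall>j\<in>{..n} - {0}. sc (cbin 0 j) * x ^ j $ n = 0"
      by (metis DiffD2 cbin_0(2) insertI1 mult_zero_left not0_implies_Suc sc_0)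
  qed auto
  thus "psum (cbin 0) x $ n = 1 $ n" by (simp add: psum_def)
qed

text \<open>Here Q is \<zeta> (1 - x)^-1. Moving all \<zeta> to the left turns the inverse factors
  into (1 - q^i x)^-1 with i < a, whose product has the coefficients \<open>cbin a\<close>.\<close>

lemma power_right_geometric:
  assumes "x $ 0 = 0" "x * \<zeta> = fps_const (sc qvar) * (\<zeta> * x)" "Q * (1 - x) = \<zeta>"
  shows "Q ^ a = \<zeta> ^ a * psum (cbin a) x"
proof (induction a)
  case (Suc a)
  have u: "is_unit_elt (1 - x)" using assms(1) by (intro is_unit_fps_1) simp
  have "Q ^ Suc a * (1 - x) = \<zeta> ^ a * (psum (cbin a) x * \<zeta>)"
    unfolding power_Suc2 Suc by (simp add: mult.assoc assms(3))
  also have "\<dots> = \<zeta> ^ Suc a * psum (cbin (Suc a)) x * (1 - x)"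
    unfolding psum_twist[OF assms(1,2)] psum_cbin_Suc(1)[OF assms(1), symmetric] power_Suc2 mult.assoc ..
  finally show ?case by (rule unit_cancel_right[OF u])
qed (simp add: psum_cbin_0)

lemma psum_twist':
  assumes "Y $ 0 = 0" "\<zeta> * Y = fps_const (sc qvar) * (Y * \<zeta>)"
  shows "\<zeta> * psum c Y = psum (\<lambda>j. qvar ^ j * c j) Y * \<zeta>"
proof (rule fps_ext)
  have "\<zeta> * Y ^ j = fps_const (sc (qvar ^ j)) * (Y ^ j * \<zeta>)" for j
  proof (induction j)
    case (Suc j)
    have "\<zeta> * Y ^ Suc j = (\<zeta> * Y ^ j) * Y" by (simp only: power_Suc2 mult.assoc)
    also have "\<dots> = fps_const (sc (qvar ^ j)) * (Y ^ j * (\<zeta> * Y))"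
      unfolding Suc by (simp only: mult.assoc)
    also have "\<dots> = fps_const (sc (qvar ^ j)) * (fps_const (sc qvar) * (Y ^ j * (Y * \<zeta>)))"
      unfolding assms(2) by (simp only: F.sc_left_commute[of "Y ^ j"])
    also have "\<dots> = fps_const (sc (qvar ^ Suc j)) * (Y ^ Suc j * \<zeta>)"
      by (simp only: power_Suc2 sc_mult mult.assoc flip: fps_const_mult)
    finally show ?case .
  qed simp
  thus "(\<zeta> * psum c Y) $ n = (psum (\<lambda>j. qvar ^ j * c j) Y * \<zeta>) $ n" for n
    unfolding psum_mult_right[OF assms(1)] psum_mult_left[OF assms(1)]
    by (simp add: sc_mult mult.assoc sc_central[of "c _"])
qed

lemma power_left_geometric:
  assumes "Y $ 0 = 0" "\<zeta> * Y = fps_const (sc qvar) * (Y * \<zeta>)" "(1 - Y) * P = \<zeta>"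
  shows "P ^ a = psum (cbin a) Y * \<zeta> ^ a"
proof (induction a)
  case (Suc a)
  have u: "is_unit_elt (1 - Y)" using assms(1) by (intro is_unit_fps_1) simp
  have "(1 - Y) * P ^ Suc a = (\<zeta> * psum (cbin a) Y) * \<zeta> ^ a"
    unfolding power_Suc Suc by (simp add: assms(3) flip: mult.assoc)
  also have "\<dots> = (1 - Y) * (psum (cbin (Suc a)) Y * \<zeta> ^ Suc a)"
    unfolding psum_twist'[OF assms(1,2)] psum_cbin_Suc(2)[OF assms(1), symmetric] power_Suc mult.assoc ..
  finally show ?case by (rule unit_cancel_left[OF u])
qed (simp add: psum_cbin_0)

lemma q_binomial_theorem:
  fixes P x :: 'r
  assumes "x * P = sc qvar * (P * x)"
  shows "(P + x) ^ m = (\<Sum>b\<le>m. sc (gbin m b) * (P ^ b * x ^ (m - b)))"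
proof (induction m)
  case (Suc m)
  have XP: "x * P ^ b = sc (qvar ^ b) * (P ^ b * x)" for b
  proof (induction b)
    case (Suc b)
    have "x * P ^ Suc b = (x * P ^ b) * P" by (simp only: power_Suc2 mult.assoc)
    also have "\<dots> = sc (qvar ^ b) * (P ^ b * (x * P))" unfolding Suc by (simp only: mult.assoc)
    also have "\<dots> = sc (qvar ^ Suc b) * (P ^ Suc b * x)"
      unfolding assms by (simp only: sc_left_commute[of "P ^ b"] power_Suc2 sc_mult mult.assoc)
    finally show ?case .
  qed simp
  have "(P + x) ^ Suc m = (\<Sum>b\<le>m. sc (gbin m b) * (P ^ Suc b * x ^ (m - b))) +
      (\<Sum>b\<le>m. sc (qvar ^ b * gbin m b) * (P ^ b * x ^ (Suc m - b)))"
  proof -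
    have "x * (P ^ b * x ^ (m - b)) = sc (qvar ^ b) * (P ^ b * x ^ (Suc m - b))" if "b \<le> m" for b
    proof -
      have "x * (P ^ b * x ^ (m - b)) = (x * P ^ b) * x ^ (m - b)" by (simp only: mult.assoc)
      thus ?thesis unfolding XP using that by (simp add: mult.assoc Suc_diff_le)
    qed
    hence "x * (P + x) ^ m = (\<Sum>b\<le>m. sc (qvar ^ b * gbin m b) * (P ^ b * x ^ (Suc m - b)))"
      unfolding Suc sum_distrib_left
      by (intro sum.cong refl) (simp add: sc_left_commute[of x] sc_mult mult.assoc sc_left_commute[of "sc _"])
    moreover have "P * (P + x) ^ m = (\<Sum>b\<le>m. sc (gbin m b) * (P ^ Suc b * x ^ (m - b)))"
      unfolding Suc sum_distrib_left
      by (intro sum.cong refl) (simp add: sc_left_commute[of P] mult.assoc)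
    ultimately show ?thesis by (simp add: distrib_right)
  qed
  also have "(\<Sum>b\<le>m. sc (qvar ^ b * gbin m b) * (P ^ b * x ^ (Suc m - b))) =
      x ^ Suc m + (\<Sum>b\<le>m. sc (qvar ^ Suc b * gbin m (Suc b)) * (P ^ Suc b * x ^ (m - b)))"
  proof -
    have "(\<Sum>b\<le>Suc m. sc (qvar ^ b * gbin m b) * (P ^ b * x ^ (Suc m - b))) =
        x ^ Suc m + (\<Sum>b\<le>m. sc (qvar ^ Suc b * gbin m (Suc b)) * (P ^ Suc b * x ^ (m - b)))"
      by (subst sum.atMost_Suc_shift) simp
    thus ?thesis by (simp add: gbin_eq_0 del: power_Suc)
  qed
  also have "(\<Sum>b\<le>m. sc (gbin m b) * (P ^ Suc b * x ^ (m - b))) +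
      (x ^ Suc m + (\<Sum>b\<le>m. sc (qvar ^ Suc b * gbin m (Suc b)) * (P ^ Suc b * x ^ (m - b)))) =
      (\<Sum>b\<le>Suc m. sc (gbin (Suc m) b) * (P ^ b * x ^ (Suc m - b)))"
  proof -
    have "(\<Sum>b\<le>Suc m. sc (gbin (Suc m) b) * (P ^ b * x ^ (Suc m - b))) =
        x ^ Suc m + (\<Sum>b\<le>m. sc (gbin (Suc m) (Suc b)) * (P ^ Suc b * x ^ (m - b)))"
      by (subst sum.atMost_Suc_shift) simp
    thus ?thesis by (simp add: sc_add distrib_right sum.distrib del: power_Suc)
  qed
  finally show ?case .
qed simp

text \<open>Let V = x + Y. In the induction the relation V Y = q Y V + (1 - q) Y^2, or its analogue
  for x, produces quadratic terms that cancel. For m = 0 the factor q^m - 1 vanishes, so the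
  truncated \<open>m - 1\<close> is harmless.\<close>

lemma q_shift_powers:
  fixes x Y :: 'r
  assumes "x * Y = sc qvar * (Y * x)"
  shows "(x + sc qvar * Y) ^ m = (x + Y) ^ m + sc (qvar ^ m - 1) * (Y * (x + Y) ^ (m - 1))"
    and "(sc qvar * x + Y) ^ m = (x + Y) ^ m + sc (qvar ^ m - 1) * ((x + Y) ^ (m - 1) * x)"
proof -
  define V where "V = x + Y"
  let ?q = "sc qvar"
  have VY: "V * Y = ?q * (Y * V) + sc (1 - qvar) * (Y * Y)"
    by (simp add: V_def assms distrib_left distrib_right sc_diff left_diff_distrib)
  have XV: "x * V = ?q * (V * x) + sc (1 - qvar) * (x * x)"
    by (simp add: V_def assms distrib_left distrib_right sc_diff left_diff_distrib)
  show "(x + ?q * Y) ^ m = V ^ m + sc (qvar ^ m - 1) * (Y * V ^ (m - 1))"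
  proof (induction m)
    case (Suc m)
    show ?case
    proof (cases m)
      case 0
      thus ?thesis by (simp add: V_def sc_diff left_diff_distrib)
    next
      case (Suc l)
      let ?c = "qvar ^ m - 1"
      have "(x + ?q * Y) ^ Suc m = (V + sc (qvar - 1) * Y) * (V ^ m + sc ?c * (Y * V ^ l))"
        unfolding power_Suc Suc.IH by (simp add: Suc V_def sc_diff left_diff_distrib)
      also have "\<dots> = V ^ Suc m + sc ?c * (V * Y * V ^ l) + sc (qvar - 1) * (Y * V ^ m) + sc ((qvar - 1) * ?c) * (Y * Y * V ^ l)"
        by (simp add: distrib_left distrib_right sc_left_commute[of V] sc_left_commute[of Y] sc_mult mult.assoc)
      also have "sc ?c * (V * Y * V ^ l) = sc (?c * qvar) * (Y * V ^ m) + sc (?c * (1 - qvar)) * (Y * Y * V ^ l)"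
        unfolding VY by (simp add: Suc distrib_left distrib_right sc_mult mult.assoc)
      also have "V ^ Suc m + (sc (?c * qvar) * (Y * V ^ m) + sc (?c * (1 - qvar)) * (Y * Y * V ^ l)) + sc (qvar - 1) * (Y * V ^ m) + sc ((qvar - 1) * ?c) * (Y * Y * V ^ l)
        = V ^ Suc m + sc (?c * qvar + (qvar - 1)) * (Y * V ^ m) + sc (?c * (1 - qvar) + (qvar - 1) * ?c) * (Y * Y * V ^ l)"
        by (simp add: sc_add distrib_right add_ac)
      also have "?c * qvar + (qvar - 1) = qvar ^ Suc m - 1" by (simp add: algebra_simps)
      also have "?c * (1 - qvar) + (qvar - 1) * ?c = 0" by (simp add: algebra_simps)
      finally show ?thesis by simp
    qed
  qed simp
  show "(?q * x + Y) ^ m = V ^ m + sc (qvar ^ m - 1) * (V ^ (m - 1) * x)"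
  proof (induction m)
    case (Suc m)
    show ?case
    proof (cases m)
      case 0
      thus ?thesis by (simp add: V_def sc_diff left_diff_distrib)
    next
      case (Suc l)
      let ?c = "qvar ^ m - 1"
      have "(?q * x + Y) ^ Suc m = (V ^ m + sc ?c * (V ^ l * x)) * (V + sc (qvar - 1) * x)"
      proof -
        have "?q * x + Y = V + sc (qvar - 1) * x" by (simp add: V_def sc_diff left_diff_distrib)
        thus ?thesis unfolding power_Suc2 Suc.IH by (simp add: Suc)
      qed
      also have "\<dots> = V ^ Suc m + sc ?c * (V ^ l * (x * V)) + sc (qvar - 1) * (V ^ m * x) + sc ((qvar - 1) * ?c) * (V ^ l * (x * x))"
        by (simp add: distrib_left distrib_right sc_left_commute[of x] sc_left_commute[of "V ^ l"] sc_left_commute[of "V ^ m"]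
            sc_mult mult.assoc power_commutes) (simp add: Suc mult.assoc power_commutes sc_left_commute[of V]
              sc_left_commute[of "sc (qvar * qvar ^ l - 1)" "qvar - 1"])
      also have "sc ?c * (V ^ l * (x * V)) = sc (?c * qvar) * (V ^ m * x) + sc (?c * (1 - qvar)) * (V ^ l * (x * x))"
        unfolding XV by (simp add: Suc distrib_left sc_left_commute[of "V ^ l"] sc_mult mult.assoc power_Suc2 del: power_Suc)
      also have "V ^ Suc m + (sc (?c * qvar) * (V ^ m * x) + sc (?c * (1 - qvar)) * (V ^ l * (x * x))) + sc (qvar - 1) * (V ^ m * x) + sc ((qvar - 1) * ?c) * (V ^ l * (x * x))
        = V ^ Suc m + sc (?c * qvar + (qvar - 1)) * (V ^ m * x) + sc (?c * (1 - qvar) + (qvar - 1) * ?c) * (V ^ l * (x * x))"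
        by (simp add: sc_add distrib_right add_ac)
      also have "?c * qvar + (qvar - 1) = qvar ^ Suc m - 1" by (simp add: algebra_simps)
      also have "?c * (1 - qvar) + (qvar - 1) * ?c = 0" by (simp add: algebra_simps)
      finally show ?thesis by simp
    qed
  qed simp
qed

end

section \<open>Truncated quantum logarithms\<close>

text \<open>The quantum logarithm $\sum_m x^m / [m]$, truncated at order \<open>n\<close> and multiplied by $[n]!$ to
  clear the denominators.\<close>

definition gam :: "nat \<Rightarrow> nat \<Rightarrow> laurent" where
  "gam n m = (\<Prod>j\<in>{1..n} - {m}. qint j)"

lemma gam_qint: "m \<in> {1..n} \<Longrightarrow> gam n m * qint m = qfact n"
  unfolding gam_def qfact_def by (subst (2) prod.remove[of _ m]) (auto simp: mult.commute)

text \<open>With \<open>gam n m\<close> = [n]!/[m] this is the absorption rule that replaces the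
  binomial (m over b) divided by [m] with (m-1 over b-1) divided by [b]. It turns expanded
  logarithms into powers of geometric series.\<close>

lemma gam_gbin:
  assumes "1 \<le> b" "b \<le> m" "m \<le> n"
  shows "gam n m * gbin m b = gam n b * cbin b (m - b)"
proof -
  obtain k l where k: "b = Suc k" and m: "m = Suc (k + l)"
    using assms by (metis Suc_le_D add_Suc le_Suc_ex One_nat_def)
  have c: "gbin (k + l) k = cbin b l" using cbin_gbin[of b l] by (simp add: k)
  have "gam n m * gbin m b * (qint m * qint b) = (gam n m * qint m) * (gbin m b * qint b)" by (simp add: mult_ac)
  also have "\<dots> = (gam n b * qint b) * (cbin b l * qint m)"
    using assms gbin_absorb[of k l] by (simp add: gam_qint k[symmetric] m[symmetric] c)
  finally have "gam n m * gbin m b * (qint m * qint b) = gam n b * cbin b l * (qint m * qint b)" by (simp add: mult_ac)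
  moreover have "qint m * qint b \<noteq> 0" using assms by simp
  moreover have "m - b = l" by (simp add: k m)
  ultimately show ?thesis by simp
qed

lemma gbin_diff: "k \<le> n \<Longrightarrow> gbin n (n - k) = gbin n k"
  using gbin_sym[of k "n - k"] by simp

lemma sum_triangle:
  fixes f :: "nat \<Rightarrow> nat \<Rightarrow> 'a::comm_monoid_add"
  shows "(\<Sum>m=1..n. \<Sum>b=1..m. f m b) = (\<Sum>b=1..n. \<Sum>j=0..n-b. f (b + j) b)"
  unfolding sum.Sigma[OF finite_atLeastAtMost ballI[OF finite_atLeastAtMost]]
  by (rule sum.reindex_bij_witness[where i = "\<lambda>(b, j). (b + j, b)" and j = "\<lambda>(m, b). (b, m - b)"]) auto

context central_scalars
begin

interpretation F: central_scalars "\<lambda>c. fps_const (sc c)"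
  by (rule central_scalars_fps)

definition qlog :: "nat \<Rightarrow> 'r fps \<Rightarrow> 'r fps" where
  "qlog n x = (\<Sum>m=1..n. fps_const (sc (gam n m)) * x ^ m)"

lemma qlog_nth: "qlog n x $ k = (\<Sum>m=1..n. sc (gam n m) * (x ^ m) $ k)"
  by (simp add: qlog_def fps_sum_nth)

text \<open>Both sides equal coefficient n of the sum over b of gam n b times psum (cbin b) Y,
  \<zeta>^b and psum (cbin b) x. The q-binomial theorem with \<open>gam_gbin\<close> expands each
  difference, and the geometric power lemmas rewrite P^b and Q^b.\<close>

lemma qlog_telescope:
  assumes x0: "x $ 0 = 0" and Y0: "Y $ 0 = 0" and \<zeta>0: "\<zeta> $ 0 = 0"
    and x\<zeta>: "x * \<zeta> = fps_const (sc qvar) * (\<zeta> * x)"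
    and \<zeta>Y: "\<zeta> * Y = fps_const (sc qvar) * (Y * \<zeta>)" and xY: "x * Y = Y * x"
    and P: "(1 - Y) * P = \<zeta>" and Q: "Q * (1 - x) = \<zeta>"
  shows "(qlog n (P + x) - qlog n x) $ n = (qlog n (Y + Q) - qlog n Y) $ n"
proof -
  have uY: "is_unit_elt (1 - Y)" and ux: "is_unit_elt (1 - x)"
    using x0 Y0 by (auto intro: is_unit_fps_1)
  have P0: "P $ 0 = 0" and Q0: "Q $ 0 = 0"
    using arg_cong[OF P, of "\<lambda>A. A $ 0"] arg_cong[OF Q, of "\<lambda>A. A $ 0"] x0 Y0 \<zeta>0 by simp_all
  have xP: "x * P = fps_const (sc qvar) * (P * x)"
  proof (rule unit_cancel_left[OF uY])
    have "(1 - Y) * (x * P) = x * ((1 - Y) * P)"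
      by (simp add: left_diff_distrib right_diff_distrib xY flip: mult.assoc)
    also have "\<dots> = fps_const (sc qvar) * ((1 - Y) * P * x)" unfolding P x\<zeta> ..
    finally show "(1 - Y) * (x * P) = (1 - Y) * (fps_const (sc qvar) * (P * x))"
      by (simp only: F.sc_left_commute[of "1 - Y"] mult.assoc)
  qed
  have QY: "Q * Y = fps_const (sc qvar) * (Y * Q)"
  proof (rule unit_cancel_right[OF ux])
    have "Q * Y * (1 - x) = (Q * (1 - x)) * Y"
      by (simp add: left_diff_distrib right_diff_distrib xY mult.assoc)
    also have "\<dots> = fps_const (sc qvar) * (Y * Q) * (1 - x)" unfolding Q \<zeta>Y by (simp only: mult.assoc Q)
    finally show "Q * Y * (1 - x) = fps_const (sc qvar) * (Y * Q) * (1 - x)" .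
  qed
  \<comment> \<open>Terms of total degree above n do not reach coefficient n, so sums over j \<le> n
    - b may be extended to j \<le> n.\<close>
  have low: "(A ^ b * B ^ j) $ n = 0" if "A $ 0 = 0" "B $ 0 = 0" "n < b + j" for A B :: "'r fps" and b j
    by (rule fps_mult_low[of b _ j]) (use that in \<open>auto simp: fps_power_nth_0\<close>)
  have "(qlog n (P + x) - qlog n x) $ n = (\<Sum>m=1..n. \<Sum>b=1..m. sc (gam n m * gbin m b) * (P ^ b * x ^ (m - b)) $ n)"
  proof -
    have "sc (gam n m) * ((P + x) ^ m) $ n - sc (gam n m) * (x ^ m) $ n =
        (\<Sum>b=1..m. sc (gam n m * gbin m b) * (P ^ b * x ^ (m - b)) $ n)" for m
    proof -
      have "((P + x) ^ m) $ n = (\<Sum>b\<le>m. sc (gbin m b) * (P ^ b * x ^ (m - b)) $ n)"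
        unfolding F.q_binomial_theorem[OF xP] by (simp add: fps_sum_nth)
      also have "\<dots> = (x ^ m) $ n + (\<Sum>b=1..m. sc (gbin m b) * (P ^ b * x ^ (m - b)) $ n)"
        unfolding atMost_atLeast0 by (simp add: sum.atLeast_Suc_atMost)
      finally show ?thesis by (simp add: distrib_left sum_distrib_left sc_mult mult.assoc)
    qed
    thus ?thesis by (simp add: qlog_nth flip: sum_subtractf)
  qed
  also have "\<dots> = (\<Sum>b=1..n. \<Sum>j=0..n-b. sc (gam n (b + j) * gbin (b + j) b) * (P ^ b * x ^ j) $ n)"
    by (subst sum_triangle) simp
  also have "\<dots> = (\<Sum>b=1..n. sc (gam n b) * (psum (cbin b) Y * \<zeta> ^ b * psum (cbin b) x) $ n)"
  proof (intro sum.cong refl)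
    fix b assume b: "b \<in> {1..n}"
    have "(\<Sum>j=0..n-b. sc (gam n (b + j) * gbin (b + j) b) * (P ^ b * x ^ j) $ n) =
        (\<Sum>j=0..n-b. sc (gam n b) * (sc (cbin b j) * (P ^ b * x ^ j) $ n))"
    proof (intro sum.cong refl)
      fix j assume "j \<in> {0..n-b}"
      hence g: "gam n (b + j) * gbin (b + j) b = gam n b * cbin b j"
        using gam_gbin[of b "b + j" n] b by auto
      show "sc (gam n (b + j) * gbin (b + j) b) * (P ^ b * x ^ j) $ n = sc (gam n b) * (sc (cbin b j) * (P ^ b * x ^ j) $ n)"
        by (simp only: g sc_mult mult.assoc)
    qed
    also have "\<dots> = (\<Sum>j\<le>n. sc (gam n b) * (sc (cbin b j) * (P ^ b * x ^ j) $ n))"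
      by (rule sum.mono_neutral_left) (auto simp: low[OF P0 x0])
    also have "\<dots> = sc (gam n b) * (P ^ b * psum (cbin b) x) $ n"
      by (simp add: psum_mult_left[OF x0] sum_distrib_left)
    finally show "(\<Sum>j=0..n-b. sc (gam n (b + j) * gbin (b + j) b) * (P ^ b * x ^ j) $ n) =
        sc (gam n b) * (psum (cbin b) Y * \<zeta> ^ b * psum (cbin b) x) $ n"
      by (simp only: power_left_geometric[OF Y0 \<zeta>Y P])
  qed
  also have "\<dots> = (\<Sum>b=1..n. \<Sum>j=0..n-b. sc (gam n (b + j) * gbin (b + j) b) * (Y ^ j * Q ^ b) $ n)"
  proof (intro sum.cong refl)
    fix b assume b: "b \<in> {1..n}"
    have "(\<Sum>j=0..n-b. sc (gam n (b + j) * gbin (b + j) b) * (Y ^ j * Q ^ b) $ n) =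
        (\<Sum>j=0..n-b. sc (gam n b) * (sc (cbin b j) * (Y ^ j * Q ^ b) $ n))"
    proof (intro sum.cong refl)
      fix j assume "j \<in> {0..n-b}"
      hence g: "gam n (b + j) * gbin (b + j) b = gam n b * cbin b j"
        using gam_gbin[of b "b + j" n] b by auto
      show "sc (gam n (b + j) * gbin (b + j) b) * (Y ^ j * Q ^ b) $ n = sc (gam n b) * (sc (cbin b j) * (Y ^ j * Q ^ b) $ n)"
        by (simp only: g sc_mult mult.assoc)
    qed
    also have "\<dots> = (\<Sum>j\<le>n. sc (gam n b) * (sc (cbin b j) * (Y ^ j * Q ^ b) $ n))"
      by (rule sum.mono_neutral_left) (auto simp: low[OF Y0 Q0])
    also have "\<dots> = sc (gam n b) * (psum (cbin b) Y * Q ^ b) $ n"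
      by (simp add: psum_mult_right[OF Y0] sum_distrib_left)
    finally show "sc (gam n b) * (psum (cbin b) Y * \<zeta> ^ b * psum (cbin b) x) $ n =
        (\<Sum>j=0..n-b. sc (gam n (b + j) * gbin (b + j) b) * (Y ^ j * Q ^ b) $ n)"
      by (simp only: power_right_geometric[OF x0 x\<zeta> Q] mult.assoc)
  qed
  also have "\<dots> = (\<Sum>m=1..n. \<Sum>b=1..m. sc (gam n m * gbin m b) * (Y ^ (m - b) * Q ^ b) $ n)"
    by (subst sum_triangle) simp
  also have "\<dots> = (qlog n (Y + Q) - qlog n Y) $ n"
  proof -
    have "sc (gam n m) * ((Y + Q) ^ m) $ n - sc (gam n m) * (Y ^ m) $ n =
        (\<Sum>b=1..m. sc (gam n m * gbin m b) * (Y ^ (m - b) * Q ^ b) $ n)" for m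
    proof -
      have "((Y + Q) ^ m) $ n = (\<Sum>b\<le>m. sc (gbin m b) * (Y ^ b * Q ^ (m - b)) $ n)"
        unfolding F.q_binomial_theorem[OF QY] by (simp add: fps_sum_nth)
      also have "\<dots> = (\<Sum>b\<in>{0..m}. sc (gbin m b) * (Y ^ (m - b) * Q ^ b) $ n)"
        by (rule sum.reindex_bij_witness[of _ "\<lambda>b. m - b" "\<lambda>b. m - b"])
           (auto simp: gbin_diff)
      also have "\<dots> = (Y ^ m) $ n + (\<Sum>b=1..m. sc (gbin m b) * (Y ^ (m - b) * Q ^ b) $ n)"
        by (simp add: sum.atLeast_Suc_atMost)
      finally show ?thesis by (simp add: distrib_left sum_distrib_left sc_mult mult.assoc)
    qed
    thus ?thesis by (simp add: qlog_nth flip: sum_subtractf)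
  qed
  finally show ?thesis .
qed

text \<open>Moving t to the left gives powers of x' + q Y and of q x' + Y, each being V = x' + Y
  with one variable rescaled. By \<open>q_shift_powers\<close> the m-th commutator has the factor
  q^m - 1 = (q - 1)[m], which cancels the denominator of the logarithm and leaves a geometric series
  with sum \<open>J\<close>.\<close>

lemma qlog_commutator:
  assumes x0: "x $ 0 = 0" and Y0: "Y $ 0 = 0"
    and tx: "x * t = t * x'" and qx: "x = fps_const (sc qvar) * x'"
    and Yt: "Y * t = fps_const (sc qvar) * (t * Y)" and xY: "x' * Y = fps_const (sc qvar) * (Y * x')"
    and J: "J * (1 - (x' + Y)) = 1" "(1 - (x' + Y)) * J = 1"
  shows "(qlog n (x + Y) * t - t * qlog n (x + Y)) $ n =
    sc ((qvar - 1) * qfact n) * (t * Y * J - t * J * x') $ n"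
proof -
  define V where "V = x' + Y"
  have x'0: "x' $ 0 = 0"
  proof -
    have "sc (qpow 1) * x' $ 0 = 0" using arg_cong[OF qx, of "\<lambda>A. A $ 0"] x0 by (simp add: qvar_eq_qpow)
    hence "sc (qpow (- 1)) * (sc (qpow 1) * x' $ 0) = 0" by simp
    thus ?thesis by simp
  qed
  have V0: "V $ 0 = 0" using x'0 Y0 by (simp add: V_def)
  have step: "(x + Y) * t = t * (x' + fps_const (sc qvar) * Y)"
    by (simp add: distrib_left distrib_right tx Yt F.sc_left_commute)
  have pow: "(x + Y) ^ m * t = t * (x' + fps_const (sc qvar) * Y) ^ m" for m
  proof (induction m)
    case (Suc m)
    have "(x + Y) ^ Suc m * t = (x + Y) ^ m * ((x + Y) * t)" by (simp only: power_Suc2 mult.assoc)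
    also have "\<dots> = t * (x' + fps_const (sc qvar) * Y) ^ Suc m"
      unfolding step by (simp only: Suc power_Suc2 flip: mult.assoc)
    finally show ?case .
  qed simp
  have comm: "(x + Y) ^ m * t - t * (x + Y) ^ m =
      fps_const (sc (qvar ^ m - 1)) * (t * Y * V ^ (m - 1) - t * V ^ (m - 1) * x')" for m
  proof -
    have "(x + Y) ^ m = V ^ m + fps_const (sc (qvar ^ m - 1)) * (V ^ (m - 1) * x')"
      unfolding qx V_def by (rule F.q_shift_powers(2)[OF xY])
    moreover have "(x' + fps_const (sc qvar) * Y) ^ m = V ^ m + fps_const (sc (qvar ^ m - 1)) * (Y * V ^ (m - 1))"
      unfolding V_def by (rule F.q_shift_powers(1)[OF xY])
    ultimately show ?thesis
      unfolding pow
      by (simp add: distrib_left right_diff_distrib F.sc_left_commute[of t] mult.assoc)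
  qed
  \<comment> \<open>The remainder V^n J of the geometric series starts in degree n and is multiplied
    by Y or x', which have no constant term.\<close>
  have geo: "(A * Y * J) $ n = (\<Sum>m=1..n. (A * Y * V ^ (m - 1)) $ n)"
       "(A * J * x') $ n = (\<Sum>m=1..n. (A * V ^ (m - 1) * x') $ n)" for A
  proof -
    have "(\<Sum>m<n. V ^ m) * (1 - V) = 1 - V ^ n"
      by (induction n) (auto simp: distrib_right right_diff_distrib[of "V ^ _"] power_commutes)
    hence "(\<Sum>m<n. V ^ m) * (1 - V) * J = (1 - V ^ n) * J" by simp
    hence sumV: "(\<Sum>m<n. V ^ m) = J - V ^ n * J"
      using J unfolding V_def[symmetric] by (simp add: mult.assoc left_diff_distrib)
    have low0: "(V ^ n * J) $ k = 0" if "k < n" for k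
      by (rule fps_mult_low[of n _ 0]) (use that V0 in \<open>auto simp: fps_power_nth_0\<close>)
    have lowV: "(B * (V ^ n * J)) $ k = 0" if "k < Suc n" "B $ 0 = 0" for B k
    proof (rule fps_mult_low[of 1 _ n])
      show "(V ^ n * J) $ i = 0" if "i < n" for i using that by (rule low0)
    qed (use that in simp_all)
    have lowV': "(A * ((V ^ n * J) * x')) $ n = 0"
    proof (rule fps_mult_low[of 0 _ "Suc n"])
      show "((V ^ n * J) * x') $ i = 0" if "i < Suc n" for i
        by (rule fps_mult_low[of n _ 1]) (use low0 x'0 that in simp_all)
    qed simp_all
    have "(\<Sum>m=1..n. V ^ (m - 1)) = (\<Sum>m<n. V ^ m)"
      by (rule sum.reindex_bij_witness[of _ Suc "\<lambda>m. m - 1"]) auto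
    hence sumV: "J = (\<Sum>m=1..n. V ^ (m - 1)) + V ^ n * J" using sumV by simp
    have "A * Y * J = (\<Sum>m=1..n. A * Y * V ^ (m - 1)) + A * (Y * (V ^ n * J))"
      by (subst sumV) (simp add: distrib_left sum_distrib_left mult.assoc)
    moreover have "(A * (Y * (V ^ n * J))) $ n = 0"
      by (rule fps_mult_low[of 0 _ "Suc n"]) (use lowV Y0 in auto)
    ultimately show "(A * Y * J) $ n = (\<Sum>m=1..n. (A * Y * V ^ (m - 1)) $ n)" by (simp add: fps_sum_nth)
    have "A * J * x' = (\<Sum>m=1..n. A * V ^ (m - 1) * x') + A * ((V ^ n * J) * x')"
      by (subst sumV) (simp add: distrib_left distrib_right sum_distrib_left sum_distrib_right mult.assoc)
    thus "(A * J * x') $ n = (\<Sum>m=1..n. (A * V ^ (m - 1) * x') $ n)" using lowV' by (simp add: fps_sum_nth)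
  qed
  have "qlog n (x + Y) * t - t * qlog n (x + Y) =
      (\<Sum>m=1..n. fps_const (sc (gam n m)) * ((x + Y) ^ m * t - t * (x + Y) ^ m))"
    by (simp add: qlog_def sum_distrib_left sum_distrib_right right_diff_distrib mult.assoc
        F.sc_left_commute[of t] sum_subtractf)
  also have "\<dots> = (\<Sum>m=1..n. fps_const (sc ((qvar - 1) * qfact n)) * (t * Y * V ^ (m - 1) - t * V ^ (m - 1) * x'))"
  proof (intro sum.cong refl)
    fix m assume m: "m \<in> {1..n}"
    have "gam n m * (qvar ^ m - 1) = (qvar - 1) * qfact n"
      using gam_qint[OF m] by (simp flip: qint_eq)
    hence "fps_const (sc (gam n m)) * fps_const (sc (qvar ^ m - 1)) = fps_const (sc ((qvar - 1) * qfact n))"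
      by (simp only: fps_const_mult flip: sc_mult)
    thus "fps_const (sc (gam n m)) * ((x + Y) ^ m * t - t * (x + Y) ^ m) =
        fps_const (sc ((qvar - 1) * qfact n)) * (t * Y * V ^ (m - 1) - t * V ^ (m - 1) * x')"
      unfolding comm by (simp only: mult.assoc[symmetric])
  qed
  finally show ?thesis
    by (simp add: fps_sum_nth geo sum_distrib_left right_diff_distrib sum_subtractf)
qed

end

section \<open>The local densities as quantum logarithms\<close>

interpretation FS: central_scalars "\<lambda>c. fps_const (scalar c) :: aq fps"
  by (rule scalar.central_scalars_fps)

abbreviation tF :: "int \<Rightarrow> aq fps" where "tF i \<equiv> fps_const (tA i)"
abbreviation mA :: "int \<Rightarrow> aq fps" where "mA i \<equiv> mf.cser i"
abbreviation uA :: "int \<Rightarrow> aq fps" where "uA i \<equiv> uf.cser (1 - i)"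

definition qc :: "aq fps \<Rightarrow> aq fps \<Rightarrow> int \<Rightarrow> bool" where
  "qc a b k \<longleftrightarrow> a * b = fps_const (scalar (qpow k)) * (b * a)"

lemma qc_mult: "qc a b k \<Longrightarrow> qc a c l \<Longrightarrow> qc a (b * c) (k + l)"
  unfolding qc_def by (rule FS.qcomm_mult)

lemma qc_swap: "qc a b k \<Longrightarrow> qc b a (- k)"
  unfolding qc_def by (rule FS.qcomm_swap)

lemma qc_unit_inv: "is_unit_elt b \<Longrightarrow> qc a b k \<Longrightarrow> qc a (unit_inv b) (- k)"
  unfolding qc_def by (rule FS.qcomm_unit_inv)

lemma qc_unit_inv': "is_unit_elt b \<Longrightarrow> qc b a k \<Longrightarrow> qc (unit_inv b) a (- k)"
  unfolding qc_def by (rule FS.qcomm_unit_inv')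

lemma qc_uminus: "qc a b k \<Longrightarrow> qc a (- b) k" "qc a b k \<Longrightarrow> qc (- a) b k"
  by (simp_all add: qc_def)

lemma qc_X: "qc a fps_X 0" "qc fps_X a 0"
  by (simp_all add: qc_def fps_X_central)

lemma qc_0: "qc a b 0 \<longleftrightarrow> a * b = b * a"
  by (simp add: qc_def)

lemma qc_t_t: "qc (tF i) (tF j) (eps i j)"
  using tA_comm[of i j] by (simp add: qc_def)

lemma qc_t_m: "j < i \<Longrightarrow> qc (tF j) (mA i) (- eps j i)"
  using mf.cser_comm[of j i] by (simp add: qc_def)

lemma qc_t_u: "i < j \<Longrightarrow> qc (tF j) (uA i) (- eps j i)"
proof -
  assume "i < j"
  moreover have "eps (1 - j) (1 - i) = - eps j i" by (auto simp: eps_def)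
  ultimately show ?thesis using uf.cser_comm[of "1 - j" "1 - i"] by (simp add: qc_def)
qed

lemma qc_u_m:
  assumes "i < k"
  shows "qc (uA i) (mA k) (eps i k)"
proof -
  have *: "mA k $ b * uA i $ a = scalar (qpow (- eps i k)) * (uA i $ a * mA k $ b)" for a b
  proof -
    have 1: "mA k $ b * tA (1 - l) = scalar (qpow (eps (1 - l) k)) * (tA (1 - l) * mA k $ b)" if "1 - i \<le> l" for l
    proof (rule scalar.qcomm_swap[where c = "- eps (1 - l) k", simplified])
      show "tA (1 - l) * mA k $ b = scalar (qpow (- eps (1 - l) k)) * (mA k $ b * tA (1 - l))"
        using arg_cong[OF mf.cser_comm[of "1 - l" k], of "\<lambda>A. A $ b"] that assms by simp
    qed
    have 2: "eps (1 - (l + 1)) k = - eps (1 - l) k" if "1 - i \<le> l" for l :: int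
      using that assms by (auto simp: eps_def)
    show ?thesis
      using uf.cser_comm_elt[of "1 - i" "mA k $ b" "\<lambda>l. eps (1 - l) k" "1 - i" a, OF 1 2] by simp
  qed
  have "mA k * uA i = fps_const (scalar (qpow (- eps i k))) * (uA i * mA k)"
  proof (rule fps_ext)
    fix n
    have "(mA k * uA i) $ n = (\<Sum>b=0..n. scalar (qpow (- eps i k)) * (uA i $ (n - b) * mA k $ b))"
      by (simp add: fps_mult_nth *)
    also have "\<dots> = (\<Sum>b=0..n. scalar (qpow (- eps i k)) * (uA i $ b * mA k $ (n - b)))"
      by (rule sum.reindex_bij_witness[of _ "\<lambda>b. n - b" "\<lambda>b. n - b"]) auto
    also have "\<dots> = scalar (qpow (- eps i k)) * (uA i * mA k) $ n"
      by (simp only: fps_mult_nth sum_distrib_left)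
    finally show "(mA k * uA i) $ n = (fps_const (scalar (qpow (- eps i k))) * (uA i * mA k)) $ n"
      by (simp only: fps_mult_left_const_nth)
  qed
  hence "qc (mA k) (uA i) (- eps i k)" by (simp add: qc_def)
  from qc_swap[OF this] show ?thesis by simp
qed

definition tI :: "int \<Rightarrow> aq fps" where "tI i = fps_const (unit_inv (tA i))"

lemma tI_eq: "tI i = unit_inv (tF i)"
  by (simp add: tI_def unit_inv_fps_const is_unit_tA)

lemma is_unit_tF: "is_unit_elt (tF i)"
  by (intro is_unit_fps_const is_unit_tA)

lemma tI_tF: "tI i * tF i = 1" "tF i * tI i = 1" "tI i * (tF i * z) = z" "tF i * (tI i * z) = z"
  by (simp_all add: tI_eq is_unit_tF unit_inv_left unit_inv_right unit_inv_left' unit_inv_right')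

lemmas qc_tI = qc_unit_inv[OF is_unit_tF, folded tI_eq]
lemmas qc_tI' = qc_unit_inv'[OF is_unit_tF, folded tI_eq]

text \<open>The series \<open>xs j\<close> and \<open>ys j\<close> solve $x_j (1 - x_{j+1}) = z_j$ and $(1 - y_{j-1}) y_j = z_j$. The
  density $T^{(j-1)/2} A_n$ is, up to a factor, the coefficient of $\lambda^{-n}$ in the quantum logarithm
  of \<open>xs j\<close>.\<close>

definition xs :: "int \<Rightarrow> aq fps" where "xs j = - (fps_X * (mA (j + 1) * tI j))"
definition ys :: "int \<Rightarrow> aq fps" where "ys j = - (fps_X * (tI (j + 1) * uA j))"
definition zs :: "int \<Rightarrow> aq fps" where "zs j = - (fps_X * (tI (j + 1) * tI j))"

lemma xs_ys_zs_0: "xs j $ 0 = 0" "ys j $ 0 = 0" "zs j $ 0 = 0"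
  by (simp_all add: xs_def ys_def zs_def)

lemma qc_xs: "qc a (mA (j + 1)) k \<Longrightarrow> qc a (tF j) l \<Longrightarrow> qc a (xs j) (k - l)"
  unfolding xs_def using qc_uminus(1)[OF qc_mult[OF qc_X(1) qc_mult[OF _ qc_tI]]] by force

lemma qc_ys: "qc a (tF (j + 1)) k \<Longrightarrow> qc a (uA j) l \<Longrightarrow> qc a (ys j) (l - k)"
  unfolding ys_def using qc_uminus(1)[OF qc_mult[OF qc_X(1) qc_mult[OF qc_tI]]] by force

lemma qc_zs: "qc a (tF (j + 1)) k \<Longrightarrow> qc a (tF j) l \<Longrightarrow> qc a (zs j) (- k - l)"
  unfolding zs_def using qc_uminus(1)[OF qc_mult[OF qc_X(1) qc_mult[OF qc_tI qc_tI]]] by force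

lemma t_xs_far: "i < j \<Longrightarrow> qc (tF i) (xs j) 0"
  using qc_xs[OF qc_t_m[of i "j + 1"] qc_t_t[of i j]] mf.eps_Suc[of i j] by simp

lemma t_xs: "qc (tF i) (xs i) 1"
  using qc_xs[OF qc_t_m[of i "i + 1"] qc_t_t[of i i]] by (simp add: eps_def)

lemma t_ys_far: "j + 1 < i \<Longrightarrow> qc (tF i) (ys j) 0"
proof -
  assume "j + 1 < i"
  moreover from this have "eps i (j + 1) = - eps i j" by (auto simp: eps_def)
  ultimately show ?thesis using qc_ys[OF qc_t_t[of i "j + 1"] qc_t_u[of j i]] by simp
qed

lemma t_ys: "qc (tF (j + 1)) (ys j) (- 1)"
  using qc_ys[OF qc_t_t[of "j + 1" "j + 1"] qc_t_u[of j "j + 1"]] by (simp add: eps_def)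

lemma t_zs_far: "i < j \<or> j + 1 < i \<Longrightarrow> qc (tF i) (zs j) 0"
proof -
  assume "i < j \<or> j + 1 < i"
  hence "eps i (j + 1) = - eps i j" by (auto simp: eps_def)
  thus ?thesis using qc_zs[OF qc_t_t[of i "j + 1"] qc_t_t[of i j]] by simp
qed

lemma xs_ys: "qc (xs (j + 1)) (ys j) 1"
proof -
  have "qc (uA j) (mA (j + 1 + 1)) 1" using qc_u_m[of j "j + 1 + 1"] by (simp add: eps_def)
  moreover have "qc (uA j) (tF (j + 1)) 1" using qc_swap[OF qc_t_u[of j "j + 1"]] by (simp add: eps_def)
  ultimately have "qc (uA j) (xs (j + 1)) (1 - 1)" by (rule qc_xs)
  from qc_ys[OF qc_swap[OF t_xs] qc_swap[OF this]] show ?thesis by simp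
qed

lemma xs_ys_far: "xs (j + 1) * ys (j - 1) = ys (j - 1) * xs (j + 1)"
proof -
  have "qc (uA (j - 1)) (mA (j + 1 + 1)) (- 1)" using qc_u_m[of "j - 1" "j + 1 + 1"] by (simp add: eps_def)
  moreover have "qc (uA (j - 1)) (tF (j + 1)) (- 1)" using qc_swap[OF qc_t_u[of "j - 1" "j + 1"]] by (simp add: eps_def)
  ultimately have "qc (uA (j - 1)) (xs (j + 1)) (- 1 - - 1)" by (rule qc_xs)
  moreover have "qc (xs (j + 1)) (tF (j - 1 + 1)) 0" using qc_swap[OF t_xs_far[of j "j + 1"]] by simp
  ultimately have "qc (xs (j + 1)) (ys (j - 1)) (- (- 1 - - 1) - 0)" using qc_ys[OF _ qc_swap] by blast
  thus ?thesis by (simp add: qc_0)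
qed

lemma xs_zs: "qc (xs (j + 1)) (zs j) 1"
  using qc_zs[OF qc_swap[OF t_xs[of "j + 1"]] qc_swap[OF t_xs_far[of j "j + 1"]]] by simp

lemma zs_ys: "qc (zs j) (ys (j - 1)) 1"
  using qc_swap[OF qc_zs[OF qc_swap[OF t_ys_far[of "j - 1" "j + 1"]] qc_swap[OF t_ys[of "j - 1", simplified]]]] by simp

lemma mA_mult: "mA i * (tF i + fps_X * mA (i + 1)) = 1" "(tF i + fps_X * mA (i + 1)) * mA i = 1"
  by (rule mf.cser_mult mf.mult_cser)+

lemma uA_mult: "uA i * (tF i + fps_X * uA (i - 1)) = 1" "(tF i + fps_X * uA (i - 1)) * uA i = 1"
  using uf.cser_mult[of "1 - i"] uf.mult_cser[of "1 - i"] by (simp_all add: algebra_simps)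

text \<open>The factor 1 - x_(j+1) equals m_(j+1)^-1 t_(j+1)^-1 and commutes with t_j, so it can be
  moved next to m_(j+1) and cancels it.\<close>

lemma xs_rec: "xs j * (1 - xs (j + 1)) = zs j"
proof -
  have "tI j * (1 - xs (j + 1)) = (1 - xs (j + 1)) * tI j"
    using qc_tI'[OF t_xs_far[of j "j + 1"]] by (simp add: qc_0 left_diff_distrib right_diff_distrib)
  hence "xs j * (1 - xs (j + 1)) = - (fps_X * (mA (j + 1) * ((1 - xs (j + 1)) * tI j)))"
    unfolding xs_def[of j] by (simp only: mult.assoc mult_minus_left)
  also have x: "1 - xs (j + 1) = (tF (j + 1) + fps_X * mA (j + 1 + 1)) * tI (j + 1)"
    by (simp only: xs_def distrib_right tI_tF mult.assoc diff_minus_eq_add)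
  also have "mA (j + 1) * ((tF (j + 1) + fps_X * mA (j + 1 + 1)) * tI (j + 1) * tI j) = tI (j + 1) * tI j"
    by (simp only: mult.assoc[symmetric] mA_mult mult_1)
  finally show ?thesis by (simp only: zs_def x)
qed

lemma ys_rec: "(1 - ys (j - 1)) * ys j = zs j"
proof -
  have comm: "(1 - ys (j - 1)) * tI (j + 1) = tI (j + 1) * (1 - ys (j - 1))"
    using qc_tI'[OF t_ys_far[of "j - 1" "j + 1"]] by (simp add: qc_0 left_diff_distrib right_diff_distrib)
  from comm have "(1 - ys (j - 1)) * (tI (j + 1) * uA j) = tI (j + 1) * ((1 - ys (j - 1)) * uA j)"
    by (simp only: mult.assoc[symmetric])
  hence "(1 - ys (j - 1)) * ys j = - (fps_X * (tI (j + 1) * ((1 - ys (j - 1)) * uA j)))"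
    unfolding ys_def[of j] mult_minus_right by (simp only: fps_X_left_commute[of "1 - ys (j - 1)"])
  also have y: "1 - ys (j - 1) = tI j * (tF j + fps_X * uA (j - 1))"
  proof -
    have "fps_X * (tI j * uA (j - 1)) = tI j * (fps_X * uA (j - 1))" by (rule fps_X_left_commute[symmetric])
    thus ?thesis by (simp add: ys_def distrib_left tI_tF)
  qed
  also have "tI (j + 1) * (tI j * (tF j + fps_X * uA (j - 1)) * uA j) = tI (j + 1) * tI j"
    by (simp only: mult.assoc uA_mult mult_1_right)
  finally show ?thesis by (simp only: zs_def y)
qed

abbreviation "qlogA \<equiv> scalar.qlog :: nat \<Rightarrow> aq fps \<Rightarrow> aq fps"

text \<open>The quantum logarithms of \<open>xs (j + 1)\<close> form a telescoping sum up to terms that involve only $t_i$ with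
  \<open>i \<le> j\<close>. This leaves a single term \<open>ys (i - 1) + xs i\<close> in the action on $t_i$.\<close>

lemma density_telescope:
  "qlogA n (xs (j + 1)) $ n =
     qlogA n (ys j + xs (j + 1)) $ n - qlogA n (ys (j - 1) + xs j) $ n + qlogA n (ys (j - 1)) $ n"
proof -
  have "(qlogA n (ys j + xs (j + 1)) - qlogA n (xs (j + 1))) $ n = (qlogA n (ys (j - 1) + xs j) - qlogA n (ys (j - 1))) $ n"
    by (rule scalar.qlog_telescope[OF xs_ys_zs_0(1,2,3) _ _ xs_ys_far ys_rec xs_rec])
       (use xs_zs zs_ys in \<open>simp_all add: qc_def qvar_eq_qpow\<close>)
  thus ?thesis by (simp add: algebra_simps)
qed

definition KA :: "int \<Rightarrow> aq fps" where
  "KA i = unit_inv (tF i + fps_X * mA (i + 1) + fps_X * uA (i - 1))"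

lemma KA_mult:
  "(tF i + fps_X * mA (i + 1) + fps_X * uA (i - 1)) * KA i = 1"
  "KA i * (tF i + fps_X * mA (i + 1) + fps_X * uA (i - 1)) = 1"
proof -
  have "is_unit_elt (tF i + fps_X * mA (i + 1) + fps_X * uA (i - 1))"
    by (rule is_unit_fps) (simp add: is_unit_tA)
  thus "(tF i + fps_X * mA (i + 1) + fps_X * uA (i - 1)) * KA i = 1"
    "KA i * (tF i + fps_X * mA (i + 1) + fps_X * uA (i - 1)) = 1"
    by (simp_all add: KA_def unit_inv_left unit_inv_right)
qed

definition flow :: "int \<Rightarrow> aq fps" where
  "flow i = fps_X * (tF i * KA i * mA (i + 1) - uA (i - 1) * KA i * tF i)"

text \<open>\<open>qlog_commutator\<close> applies with J = K_i t_i, because t_i (1 - x' - y_(i-1))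
  is the inverse of K_i.\<close>

lemma density_commutator:
  "(qlogA n (ys (i - 1) + xs i) * tF i - tF i * qlogA n (ys (i - 1) + xs i)) $ n =
     scalar ((qvar - 1) * qfact n) * flow i $ n"
proof -
  \<comment> \<open>Conjugation of x_i by t_i multiplies it by q^-1.\<close>
  define x' where "x' = fps_const (scalar (qpow (- 1))) * xs i"
  have qx: "xs i = fps_const (scalar qvar) * x'"
    by (simp add: x'_def qvar_eq_qpow flip: mult.assoc)
  have tx: "xs i * tF i = tF i * x'"
    using qc_swap[OF t_xs[of i]] by (simp add: qc_def x'_def FS.sc_left_commute)
  have Yt: "ys (i - 1) * tF i = fps_const (scalar qvar) * (tF i * ys (i - 1))"
    using qc_swap[OF t_ys[of "i - 1"]] by (simp add: qc_def qvar_eq_qpow)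
  have xY: "x' * ys (i - 1) = fps_const (scalar qvar) * (ys (i - 1) * x')"
    using xs_ys[of "i - 1"] by (simp add: x'_def qc_def qvar_eq_qpow FS.sc_left_commute[of "ys (i - 1)"] mult.assoc)
  have xt: "tF i * x' = - (fps_X * mA (i + 1))"
    unfolding tx[symmetric] by (simp add: xs_def mult.assoc tI_tF)
  have tY: "tF i * ys (i - 1) = - (fps_X * uA (i - 1))"
  proof -
    have "tF i * (fps_X * (tI i * uA (i - 1))) = fps_X * (tF i * (tI i * uA (i - 1)))"
      by (rule fps_X_left_commute)
    thus ?thesis by (simp add: ys_def tI_tF)
  qed
  have K: "tF i * (1 - (x' + ys (i - 1))) = tF i + fps_X * mA (i + 1) + fps_X * uA (i - 1)"
    by (simp add: right_diff_distrib distrib_left xt tY)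
  have J1: "KA i * tF i * (1 - (x' + ys (i - 1))) = 1"
    unfolding mult.assoc K by (rule KA_mult)
  have J2: "(1 - (x' + ys (i - 1))) * (KA i * tF i) = 1"
  proof -
    have "1 - (x' + ys (i - 1)) = tI i * (tF i + fps_X * mA (i + 1) + fps_X * uA (i - 1))"
      unfolding K[symmetric] by (simp add: tI_tF)
    hence "(1 - (x' + ys (i - 1))) * (KA i * tF i) = tI i * ((tF i + fps_X * mA (i + 1) + fps_X * uA (i - 1)) * KA i) * tF i"
      by (simp only: mult.assoc)
    thus ?thesis by (simp only: KA_mult tI_tF mult_1_right)
  qed
  have "tF i * ys (i - 1) * (KA i * tF i) - tF i * (KA i * tF i) * x' =
      tF i * (KA i * (fps_X * mA (i + 1))) - fps_X * (uA (i - 1) * (KA i * tF i))"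
    by (simp add: tY xt mult.assoc)
  also have "tF i * (KA i * (fps_X * mA (i + 1))) = fps_X * (tF i * (KA i * mA (i + 1)))"
    by (simp only: fps_X_left_commute)
  finally have "tF i * ys (i - 1) * (KA i * tF i) - tF i * (KA i * tF i) * x' = flow i"
    by (simp add: flow_def right_diff_distrib mult.assoc)
  with scalar.qlog_commutator[OF xs_ys_zs_0(1,2) tx qx Yt xY J1 J2, of n] show ?thesis
    by (simp only: add.commute[of "ys (i - 1)"])
qed

section \<open>Locality\<close>

text \<open>Locality to the right holds only to finite order: coefficient n of \<open>xs L\<close>
  involves t_L, ..., t_(L+n).\<close>

definition commutes_upto :: "nat \<Rightarrow> aq \<Rightarrow> aq fps \<Rightarrow> bool" where
  "commutes_upto n z A \<longleftrightarrow> (\<forall>m\<le>n. A $ m * z = z * A $ m)"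

lemma commutes_upto_mult: "commutes_upto n z A \<Longrightarrow> commutes_upto n z B \<Longrightarrow> commutes_upto n z (A * B)"
proof -
  assume AB: "commutes_upto n z A" "commutes_upto n z B"
  have "A $ i * B $ j * z = z * (A $ i * B $ j)" if "i \<le> n" "j \<le> n" for i j
    using AB that unfolding commutes_upto_def by (metis mult.assoc)
  thus ?thesis
    by (auto simp: commutes_upto_def fps_mult_nth sum_distrib_left sum_distrib_right intro!: sum.cong)
qed

lemma commutes_upto_add: "commutes_upto n z A \<Longrightarrow> commutes_upto n z B \<Longrightarrow> commutes_upto n z (A + B)"
  by (simp add: commutes_upto_def distrib_left distrib_right)

lemma commutes_upto_power: "commutes_upto n z A \<Longrightarrow> commutes_upto n z (A ^ k)"
proof (induction k)
  case (Suc k)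
  thus ?case unfolding power_Suc by (intro commutes_upto_mult)
qed (simp add: commutes_upto_def)

lemma commutes_upto_qlog:
  assumes "commutes_upto n z A"
  shows "qlogA l A $ n * z = z * qlogA l A $ n"
proof -
  have "(A ^ k) $ n * z = z * (A ^ k) $ n" for k
    using commutes_upto_power[OF assms, of k] by (simp add: commutes_upto_def)
  thus ?thesis
    by (simp add: scalar.qlog_nth sum_distrib_left sum_distrib_right mult.assoc scalar_left_commute)
qed

lemma commutes_upto_qc: "qc (tF i) A 0 \<Longrightarrow> commutes_upto n (tA i) A"
  unfolding commutes_upto_def qc_0 fps_eq_iff by simp

text \<open>In x_L = z_L + x_L x_(L+1) both factors of the product start in degree 1, so the shift
  from L to L + 1 is paid for by a lower degree.\<close>

lemma xs_commutes_upto: "L + int n < i \<Longrightarrow> commutes_upto n (tA i) (xs L)"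
proof -
  have "xs L $ m * tA i = tA i * xs L $ m" if "L + int m < i" for m L
    using that
  proof (induction m arbitrary: L rule: less_induct)
    case (less m)
    show ?case
    proof (cases "m = 0")
      case False
      have "xs L = zs L + xs L * xs (L + 1)" using xs_rec[of L] by (simp add: right_diff_distrib diff_eq_eq)
      hence x: "xs L $ m = zs L $ m + (\<Sum>a=0..m. xs L $ a * xs (L + 1) $ (m - a))"
        by (metis fps_add_nth fps_mult_nth)
      have "zs L $ m * tA i = tA i * zs L $ m"
        using commutes_upto_qc[OF t_zs_far[of i L], of m] less.prems False by (auto simp: commutes_upto_def)
      moreover have "xs L $ a * xs (L + 1) $ (m - a) * tA i = tA i * (xs L $ a * xs (L + 1) $ (m - a))"
        if "a \<in> {0..m}" for a
      proof (cases "a = 0 \<or> a = m")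
        case False
        have "xs L $ a * tA i = tA i * xs L $ a" "xs (L + 1) $ (m - a) * tA i = tA i * xs (L + 1) $ (m - a)"
          using less.IH[of a L] less.IH[of "m - a" "L + 1"] less.prems that False by auto
        thus ?thesis by (metis mult.assoc)
      qed (auto simp: xs_ys_zs_0)
      ultimately show ?thesis
        unfolding x by (simp add: distrib_left distrib_right sum_distrib_left sum_distrib_right)
    qed (simp add: xs_ys_zs_0)
  qed
  thus "L + int n < i \<Longrightarrow> commutes_upto n (tA i) (xs L)" by (simp add: commutes_upto_def)
qed

section \<open>Expansion of the densities\<close>

fun zmon :: "int \<Rightarrow> nat list \<Rightarrow> aq" where
  "zmon j [] = 1"
| "zmon j (a # \<alpha>) = unit_inv (zA j) ^ a * zmon (j + 1) \<alpha>"

lemma Fq_single: "Fq [a] = 1"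
  by (simp add: Fq_def)

lemma Fq_Cons: "Fq (a # b # \<alpha>) = cbin a b * Fq (b # \<alpha>)"
proof -
  have "length (a # b # \<alpha>) - 1 = Suc (length (b # \<alpha>) - 1)" by simp
  thus ?thesis unfolding Fq_def prod.lessThan_Suc_shift
    by (simp add: prod.lessThan_Suc_shift qbinom_eq_cbin del: prod.lessThan_Suc)
qed

definition comps :: "nat \<Rightarrow> nat \<Rightarrow> nat list set" where
  "comps L n = {\<alpha>. length \<alpha> = L \<and> sum_list \<alpha> = n}"

lemma finite_comps: "finite (comps L n)"
proof (rule finite_subset)
  show "comps L n \<subseteq> {\<alpha>. set \<alpha> \<subseteq> {..n} \<and> length \<alpha> = L}"
    using member_le_sum_list by (fastforce simp: comps_def)
qed (simp add: finite_lists_length_eq)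

lemma comps_0: "comps 0 n = (if n = 0 then {[]} else {})"
  by (auto simp: comps_def)

lemma sum_comps_Suc: "(\<Sum>\<alpha>\<in>comps (Suc L) n. f \<alpha>) = (\<Sum>a\<le>n. \<Sum>\<beta>\<in>comps L (n - a). f (a # \<beta>))"
proof -
  have "(\<Sum>a\<le>n. \<Sum>\<beta>\<in>comps L (n - a). f (a # \<beta>)) = (\<Sum>(a, \<beta>)\<in>(SIGMA a:{..n}. comps L (n - a)). f (a # \<beta>))"
    by (rule sum.Sigma) (auto simp: finite_comps)
  also have "\<dots> = (\<Sum>\<alpha>\<in>comps (Suc L) n. f \<alpha>)"
    by (rule sum.reindex_bij_witness[of _ "\<lambda>\<alpha>. (hd \<alpha>, tl \<alpha>)" "\<lambda>(a, \<beta>). a # \<beta>"])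
       (auto simp: comps_def length_Suc_conv)
  finally show ?thesis by simp
qed

text \<open>The part of a density behind the first exponent a; its recursion on the length mirrors
  the recursion of the series x_j.\<close>

definition tail_sum :: "nat \<Rightarrow> nat \<Rightarrow> int \<Rightarrow> nat \<Rightarrow> aq" where
  "tail_sum L a j n = (\<Sum>\<beta>\<in>comps L n. scalar (Fq (a # \<beta>)) * zmon (j + 1) \<beta>)"

lemma tail_sum_Suc:
  "tail_sum (Suc L) a j n = (\<Sum>b\<le>n. scalar (cbin a b) * (unit_inv (zA (j + 1)) ^ b * tail_sum L b (j + 1) (n - b)))"
proof -
  have "scalar (Fq (a # b # \<beta>)) * zmon (j + 1) (b # \<beta>) =
      scalar (cbin a b) * (unit_inv (zA (j + 1)) ^ b * (scalar (Fq (b # \<beta>)) * zmon (j + 1 + 1) \<beta>))" for b \<beta>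
    by (simp only: Fq_Cons scalar_mult mult.assoc zmon.simps scalar_left_commute[of "unit_inv (zA (j + 1)) ^ b"])
  thus ?thesis
    unfolding tail_sum_def sum_comps_Suc sum_distrib_left by (simp only:)
qed

text \<open>F_q vanishes when a zero exponent is followed by a positive one, so only the zero tail
  survives.\<close>

lemma tail_sum_0: "tail_sum L 0 j n = (if n = 0 then 1 else 0)"
proof (induction L arbitrary: j)
  case 0
  show ?case by (simp add: tail_sum_def comps_0 Fq_single)
next
  case (Suc L)
  have "tail_sum (Suc L) 0 j n = (\<Sum>b\<in>{0}. scalar (cbin 0 b) * (unit_inv (zA (j + 1)) ^ b * tail_sum L b (j + 1) (n - b)))"
    unfolding tail_sum_Suc
  proof (rule sum.mono_neutral_right)
    show "\<forall>b\<in>{..n} - {0}. scalar (cbin 0 b) * (unit_inv (zA (j + 1)) ^ b * tail_sum L b (j + 1) (n - b)) = 0"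
      by (metis DiffD2 cbin_0(2) insertI1 mult_zero_left not0_implies_Suc scalar_0)
  qed auto
  thus ?case by (simp add: Suc)
qed

lemma zs_power_nth: "a \<le> n \<Longrightarrow> (zs j ^ a * B) $ n = (- 1) ^ a * (unit_inv (zA j) ^ a * B $ (n - a))"
proof -
  assume "a \<le> n"
  have z: "zs j = fps_X * fps_const (- unit_inv (zA j))"
    by (simp add: zs_def tI_def unit_inv_zA fps_const_neg[symmetric] del: fps_const_neg)
  have "zs j ^ a = fps_X ^ a * fps_const (- unit_inv (zA j)) ^ a"
  proof (induction a)
    case (Suc a)
    have "zs j ^ Suc a = fps_X * fps_const (- unit_inv (zA j)) * (fps_X ^ a * fps_const (- unit_inv (zA j)) ^ a)"
      unfolding power_Suc Suc unfolding z ..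
    moreover have "c * (fps_X ^ a * B) = fps_X ^ a * (c * B)" for c B :: "aq fps"
      by (simp only: mult.assoc[symmetric] fps_mult_fps_X_power_commute[of a c])
    ultimately show ?case by (simp only: power_Suc mult.assoc)
  qed simp
  also have "fps_const (- unit_inv (zA j)) ^ a = fps_const ((- 1) ^ a * unit_inv (zA j) ^ a)"
    by (simp add: power_minus[of "unit_inv (zA j)"])
  finally show ?thesis
    using \<open>a \<le> n\<close> by (simp add: mult.assoc fps_X_power_mult_nth)
qed

lemma xs_power: "xs j ^ a = zs j ^ a * scalar.psum (cbin a) (xs (j + 1))"
  by (rule scalar.power_right_geometric[OF xs_ys_zs_0(1) _ xs_rec])
     (use xs_zs[of j] in \<open>simp add: qc_def qvar_eq_qpow\<close>)

text \<open>Unfolding F_q by one entry matches x_(j+1)^b = z_(j+1)^b psum (cbin b) x_(j+2). In a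
  nonzero term no positive entry follows a zero one, if the total is n then n entries
  suffice.\<close>

lemma tail_sum_psum: "n \<le> L \<Longrightarrow> tail_sum L a j n = (- 1) ^ n * scalar.psum (cbin a) (xs (j + 1)) $ n"
proof (induction L arbitrary: a j n)
  case 0
  thus ?case by (simp add: tail_sum_def comps_0 Fq_single scalar.psum_def)
next
  case (Suc L)
  have "tail_sum (Suc L) a j n = (\<Sum>b\<le>n. (- 1) ^ n * (scalar (cbin a b) * (xs (j + 1) ^ b) $ n))"
    unfolding tail_sum_Suc
  proof (intro sum.cong refl)
    fix b assume b: "b \<in> {..n}"
    have ts: "tail_sum L b (j + 1) (n - b) = (- 1) ^ (n - b) * scalar.psum (cbin b) (xs (j + 1 + 1)) $ (n - b)"
    proof (cases "b = 0")
      \<comment> \<open>For b = 0 the total does not drop, so the induction hypothesis may not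
        apply; the tail is constant instead.\<close>
      case True
      thus ?thesis by (simp add: tail_sum_0 scalar.psum_cbin_0)
    next
      case False
      thus ?thesis using Suc.prems b by (intro Suc.IH) auto
    qed
    have "(- 1 :: aq) ^ (n - b) = (- 1) ^ n * (- 1) ^ b"
      using b by (simp add: minus_one_power_iff)
    hence "unit_inv (zA (j + 1)) ^ b * tail_sum L b (j + 1) (n - b) =
        (- 1) ^ n * ((- 1) ^ b * (unit_inv (zA (j + 1)) ^ b * scalar.psum (cbin b) (xs (j + 1 + 1)) $ (n - b)))"
      unfolding ts by (simp only: mult.assoc minus_one_power_left_commute[of "unit_inv _ ^ _"])
    also have "\<dots> = (- 1) ^ n * (xs (j + 1) ^ b) $ n"
      using b by (simp add: xs_power zs_power_nth)
    finally show "scalar (cbin a b) * (unit_inv (zA (j + 1)) ^ b * tail_sum L b (j + 1) (n - b)) =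
        (- 1) ^ n * (scalar (cbin a b) * (xs (j + 1) ^ b) $ n)"
      by (simp add: scalar_left_commute[of "(- 1) ^ n"])
  qed
  thus ?case by (simp add: scalar.psum_def sum_distrib_left)
qed

text \<open>This makes the \<open>exact_quot\<close> in the coefficients of A_n a genuine quotient.
  A factor [a] is extracted along the list from [a + r] = [a] + q^a [r] and cbin a b [b] = gbin (a +
  b - 1) (b - 1) [a]; after a zero entry F_q vanishes unless all later entries are zero.\<close>

lemma qint_dvd_Fq: "1 \<le> a \<Longrightarrow> \<exists>d. qint a * d = qint (a + sum_list \<beta>) * Fq (a # \<beta>)"
proof (induction \<beta> arbitrary: a)
  case Nil
  show ?case by (auto simp: Fq_single)
next
  case (Cons b \<gamma>)
  show ?case
  proof (cases "b = 0")
    case True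
    have F0: "Fq (0 # \<gamma>) = 0" if "sum_list \<gamma> \<noteq> 0" for \<gamma>
      using that
    proof (induction \<gamma>)
      case (Cons c \<gamma>)
      thus ?case by (cases c) (auto simp: Fq_Cons)
    qed simp
    have "qint a * Fq (0 # \<gamma>) = qint (a + sum_list \<gamma>) * Fq (0 # \<gamma>)"
      using F0[of \<gamma>] by (metis add_0_right mult_zero_right)
    thus ?thesis using True by (auto simp: Fq_Cons)
  next
    case False
    then obtain d where d: "qint b * d = qint (b + sum_list \<gamma>) * Fq (b # \<gamma>)"
      using Cons.IH[of b] by auto
    obtain k l where k: "b = Suc k" "a = Suc l" using False Cons.prems by (metis not0_implies_Suc not_one_le_zero)
    have c: "cbin a b * qint b = gbin (Suc (k + l)) k * qint a"
      using gbin_shift[of k l] by (simp add: cbin_def k add.commute)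
    have "qint (a + sum_list (b # \<gamma>)) * Fq (a # b # \<gamma>) =
        (qint a + qvar ^ a * qint (b + sum_list \<gamma>)) * (cbin a b * Fq (b # \<gamma>))"
      by (simp add: Fq_Cons qint_add)
    also have "\<dots> = qint a * (cbin a b * Fq (b # \<gamma>)) + qvar ^ a * cbin a b * (qint (b + sum_list \<gamma>) * Fq (b # \<gamma>))"
      by (simp add: algebra_simps)
    also have "\<dots> = qint a * (cbin a b * Fq (b # \<gamma>)) + qvar ^ a * d * (cbin a b * qint b)"
      unfolding d[symmetric] by (simp add: algebra_simps)
    also have "\<dots> = qint a * (cbin a b * Fq (b # \<gamma>) + qvar ^ a * d * gbin (Suc (k + l)) k)"
      unfolding c by (simp add: algebra_simps)
    finally show ?thesis by metis
  qed
qed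

text \<open>The image of A_n under j - 1 half shifts, see \<open>A_sum_density\<close> and
  \<open>shA_density\<close>.\<close>

definition density :: "int \<Rightarrow> nat \<Rightarrow> nat \<Rightarrow> aq" where
  "density j N n = (\<Sum>\<alpha> | length \<alpha> = 2 * N - 2 \<and> 1 \<le> \<alpha> ! 0 \<and> sum_list \<alpha> = n.
     scalar (exact_quot (qint n * Fq \<alpha>) (qint (\<alpha> ! 0))) * zmon j \<alpha>)"

lemma zmon_prod_list:
  "zmon j \<alpha> = (\<Prod>i\<leftarrow>[0..<length \<alpha>]. unit_inv (zA (j + int i)) ^ (\<alpha> ! i))"
proof (induction \<alpha> arbitrary: j)
  case (Cons a \<alpha>)
  have "[0..<length (a # \<alpha>)] = 0 # map Suc [0..<length \<alpha>]"
    by (simp add: upt_conv_Cons map_Suc_upt del: upt_Suc)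
  thus ?case by (simp add: Cons comp_def add.assoc del: upt_Suc)
qed simp

lemma A_sum_density: "A_sum N n = density 1 N n"
  unfolding A_sum_def density_def
  by (intro sum.cong refl) (auto simp: zmon_prod_list add.commute)

text \<open>The terms with first exponent a assemble to ([n]!/[a]) x_j^a, because x_j^a = z_j^a psum
  (cbin a) x_(j+1).\<close>

lemma density_qlog:
  assumes "1 \<le> n" "n \<le> 2 * (N - 1)"
  shows "scalar (qfact n) * density j N n = (- 1) ^ n * (scalar (qint n) * qlogA n (xs j) $ n)"
proof -
  \<comment> \<open>Behind the first exponent there are L entries. As a \<ge> 1, the total n - a of
    the tail is at most L, which \<open>tail_sum_psum\<close> requires.\<close>
  obtain L where L: "2 * N - 2 = Suc L" using assms by (metis Suc_le_D diff_mult_distrib2 mult.right_neutral le_trans One_nat_def)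
  have nL: "n \<le> Suc L" using assms L by simp
  let ?g = "\<lambda>\<alpha>. scalar (exact_quot (qint n * Fq \<alpha>) (qint (\<alpha> ! 0))) * zmon j \<alpha>"
  have "density j N n = (\<Sum>\<alpha>\<in>comps (Suc L) n. if 1 \<le> \<alpha> ! 0 then ?g \<alpha> else 0)"
    unfolding density_def L
    by (rule sum.mono_neutral_cong_left) (auto simp: comps_def finite_comps[unfolded comps_def])
  also have "\<dots> = (\<Sum>a\<le>n. \<Sum>\<beta>\<in>comps L (n - a). if 1 \<le> a then ?g (a # \<beta>) else 0)"
    unfolding sum_comps_Suc by simp
  also have "\<dots> = (\<Sum>a\<in>{1..n}. \<Sum>\<beta>\<in>comps L (n - a). if 1 \<le> a then ?g (a # \<beta>) else 0)"
    by (rule sum.mono_neutral_right) auto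
  finally have "scalar (qfact n) * density j N n =
      (\<Sum>a\<in>{1..n}. \<Sum>\<beta>\<in>comps L (n - a). scalar (qfact n) * ?g (a # \<beta>))"
    by (simp add: sum_distrib_left)
  also have "\<dots> = (\<Sum>a\<in>{1..n}. (- 1) ^ n * (scalar (qint n) * (scalar (gam n a) * (xs j ^ a) $ n)))"
  proof (intro sum.cong refl)
    fix a assume a: "a \<in> {1..n}"
    have "scalar (qfact n) * ?g (a # \<beta>) =
        scalar (qint n * gam n a) * (unit_inv (zA j) ^ a * (scalar (Fq (a # \<beta>)) * zmon (j + 1) \<beta>))"
      if \<beta>: "\<beta> \<in> comps L (n - a)" for \<beta>
    proof -
      have "n = a + sum_list \<beta>" using \<beta> a by (auto simp: comps_def)
      then obtain d where d: "qint a * d = qint n * Fq (a # \<beta>)" using qint_dvd_Fq[of a \<beta>] a by auto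
      have "exact_quot (qint n * Fq (a # \<beta>)) (qint a) = d"
        by (rule exact_quot_eqI'[OF d]) (use a in simp)
      moreover have "qfact n * d = qint n * gam n a * Fq (a # \<beta>)"
        using gam_qint[OF a] d by (metis mult.assoc mult.commute)
      ultimately have "scalar (qfact n) * (scalar (exact_quot (qint n * Fq (a # \<beta>)) (qint a)) * z) =
          scalar (qint n * gam n a) * (scalar (Fq (a # \<beta>)) * z)" for z :: aq
        by (simp only: mult.assoc[symmetric] scalar_mult[symmetric])
      thus ?thesis
        by (simp only: nth_Cons_0 zmon.simps scalar_left_commute[of "unit_inv (zA j) ^ a"])
    qed
    hence "(\<Sum>\<beta>\<in>comps L (n - a). scalar (qfact n) * ?g (a # \<beta>)) =
        scalar (qint n * gam n a) * (unit_inv (zA j) ^ a * tail_sum L a j (n - a))"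
      by (simp add: tail_sum_def sum_distrib_left)
    also have "tail_sum L a j (n - a) = (- 1) ^ (n - a) * scalar.psum (cbin a) (xs (j + 1)) $ (n - a)"
      by (rule tail_sum_psum) (use a nL in auto)
    also have "(- 1 :: aq) ^ (n - a) = (- 1) ^ n * (- 1) ^ a"
      using a by (simp add: minus_one_power_iff)
    also have "unit_inv (zA j) ^ a * ((- 1) ^ n * (- 1) ^ a * scalar.psum (cbin a) (xs (j + 1)) $ (n - a)) =
        (- 1) ^ n * (xs j ^ a) $ n"
      using a by (simp only: xs_power zs_power_nth mult.assoc minus_one_power_left_commute[of "unit_inv _ ^ _"] atLeastAtMost_iff)
    finally show "(\<Sum>\<beta>\<in>comps L (n - a). scalar (qfact n) * ?g (a # \<beta>)) =
        (- 1) ^ n * (scalar (qint n) * (scalar (gam n a) * (xs j ^ a) $ n))"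
      by (simp only: scalar_mult mult.assoc scalar_left_commute[of "(- 1) ^ n"])
  qed
  also have "\<dots> = (- 1) ^ n * (scalar (qint n) * qlogA n (xs j) $ n)"
    by (simp add: scalar.qlog_nth sum_distrib_left)
  finally show ?thesis .
qed

lemma density_commutes:
  assumes "1 \<le> n" "n \<le> 2 * (N - 1)" "i < j \<or> j + int n < i"
  shows "density j N n * tA i = tA i * density j N n"
proof -
  have "commutes_upto n (tA i) (xs j)"
    using assms(3) commutes_upto_qc[OF t_xs_far] xs_commutes_upto by blast
  from commutes_upto_qlog[OF this, of n]
  have "scalar (qfact n) * (density j N n * tA i) = scalar (qfact n) * (tA i * density j N n)"
    unfolding scalar_left_commute[of "tA i", symmetric]
    by (simp only: mult.assoc[symmetric] density_qlog[OF assms(1,2)])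
       (simp add: mult.assoc scalar_left_commute[of "tA i"] minus_one_power_iff)
  thus ?thesis by (rule aq_scalar_cancel) simp
qed

text \<open>Only densities with i - n \<le> j \<le> i can act on t_i. By
  \<open>density_telescope\<close>, whose last term commutes with t_i in this range, their
  logarithms collapse to the single term at j = i.\<close>

lemma density_sum_commutator:
  assumes n: "1 \<le> n" "n \<le> 2 * (N - 1)"
  shows "(\<Sum>j=i-int n..i. density j N n * tA i - tA i * density j N n) =
    (- 1) ^ n * (scalar ((qvar - 1) * qint n) * flow i $ n)"
proof -
  define cm where "cm = (\<lambda>A :: aq fps. A $ n * tA i - tA i * A $ n)"
  define C where "C = (\<lambda>j. cm (qlogA n (ys (j - 1) + xs j)))"
  have x: "cm (qlogA n (xs (j + 1))) = C (j + 1) - C j" if "j + 1 \<le> i" for j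
  proof -
    have "commutes_upto n (tA i) (ys (j - 1))"
      by (rule commutes_upto_qc[OF t_ys_far]) (use that in simp)
    from commutes_upto_qlog[OF this, of n] have "cm (qlogA n (ys (j - 1))) = 0" by (simp add: cm_def)
    thus ?thesis unfolding C_def cm_def density_telescope by (simp add: algebra_simps)
  qed
  \<comment> \<open>At the lower end of the telescope y_(i-n-2) commutes with t_i, and x_(i-n-1)
    does so up to order n.\<close>
  have C0: "C (i - int n - 1) = 0"
  proof -
    have "commutes_upto n (tA i) (ys (i - int n - 1 - 1) + xs (i - int n - 1))"
      by (intro commutes_upto_add commutes_upto_qc t_ys_far xs_commutes_upto) auto
    from commutes_upto_qlog[OF this, of n] show ?thesis by (simp add: C_def cm_def)
  qed
  have tel: "(\<Sum>j=i-int k..i. cm (qlogA n (xs j))) = C i - C (i - int k - 1)" for k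
  proof (induction k)
    case 0
    show ?case using x[of "i - 1"] by simp
  next
    case (Suc k)
    have "{i - int (Suc k)..i} = insert (i - int k - 1) {i - int k..i}" by auto
    hence "(\<Sum>j=i-int (Suc k)..i. cm (qlogA n (xs j))) = cm (qlogA n (xs (i - int k - 2 + 1))) + (C i - C (i - int k - 1))"
      using Suc by simp
    moreover have "cm (qlogA n (xs (i - int k - 2 + 1))) = C (i - int k - 2 + 1) - C (i - int k - 2)"
      by (rule x) simp
    ultimately show ?case by (simp only:) (simp add: algebra_simps)
  qed
  have "scalar (qfact n) * (\<Sum>j=i-int n..i. density j N n * tA i - tA i * density j N n) =
      (\<Sum>j=i-int n..i. (- 1) ^ n * (scalar (qint n) * cm (qlogA n (xs j))))"
    unfolding sum_distrib_left
  proof (intro sum.cong refl)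
    fix j
    have "scalar (qfact n) * (density j N n * tA i - tA i * density j N n) =
        (scalar (qfact n) * density j N n) * tA i - tA i * (scalar (qfact n) * density j N n)"
      by (simp add: right_diff_distrib mult.assoc scalar_left_commute[of "tA i"])
    also have "\<dots> = (- 1) ^ n * (scalar (qint n) * cm (qlogA n (xs j)))"
      unfolding density_qlog[OF n] cm_def
      by (simp add: right_diff_distrib mult.assoc scalar_left_commute[of "tA i"] minus_one_power_iff)
    finally show "scalar (qfact n) * (density j N n * tA i - tA i * density j N n) =
        (- 1) ^ n * (scalar (qint n) * cm (qlogA n (xs j)))" .
  qed
  also have "\<dots> = (- 1) ^ n * (scalar (qint n) * C i)"
    by (simp add: tel C0 flip: sum_distrib_left)
  also have "C i = scalar ((qvar - 1) * qfact n) * flow i $ n"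
    using density_commutator[of n i] by (simp add: C_def cm_def)
  finally have "scalar (qfact n) * (\<Sum>j=i-int n..i. density j N n * tA i - tA i * density j N n) =
      (- 1) ^ n * (scalar (qint n) * (scalar ((qvar - 1) * qfact n) * flow i $ n))" .
  also have "\<dots> = scalar (qfact n) * ((- 1) ^ n * (scalar ((qvar - 1) * qint n) * flow i $ n))"
  proof -
    have "scalar (qint n) * (scalar ((qvar - 1) * qfact n) * z) = scalar (qfact n) * (scalar ((qvar - 1) * qint n) * z)"
      for z :: aq
      by (simp only: mult.assoc[symmetric] scalar_mult[symmetric]) (simp only: mult_ac)
    thus ?thesis by (simp only: scalar_left_commute[of "(- 1) ^ n"])
  qed
  finally show ?thesis by (rule aq_scalar_cancel) simp
qed

section \<open>The shift automorphism\<close>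

definition shA :: "int \<Rightarrow> aq \<Rightarrow> aq" where
  "shA d = scalar.presented_lift (scalar.aq_assign (\<lambda>i. tA (i + d)))"

lemma shA_hom: "additive_mult (shA d)"
  and shA_scalar: "shA d (scalar c) = scalar c"
  and shA_tA: "shA d (tA i) = tA (i + d)"
proof -
  have "tA (a + d) * tA (b + d) = scalar (qpow (eps a b)) * (tA (b + d) * tA (a + d))" for a b
    using tA_comm[of "a + d" "b + d"] by (simp add: eps_def)
  note * = scalar.aq_lift_hom[OF is_unit_tA this] scalar.aq_lift_scalar[OF is_unit_tA this]
    scalar.aq_lift_tA[OF is_unit_tA this]
  show "additive_mult (shA d)" "shA d (scalar c) = scalar c" "shA d (tA i) = tA (i + d)"
    unfolding shA_def by (rule *)+
qed

lemma shA_shA: "shA d (shA e z) = shA (d + e) z"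
proof -
  have "shA d \<circ> shA e = shA (d + e)"
    by (rule aq_hom_eqI)
       (simp_all add: additive_mult_def am_add[OF shA_hom] am_mult[OF shA_hom] am_1[OF shA_hom]
         shA_scalar shA_tA add_ac)
  thus ?thesis by (metis comp_apply)
qed

lemma shA_0: "shA 0 z = z"
proof -
  have "shA 0 = id"
    by (rule aq_hom_eqI) (use shA_hom in \<open>simp_all add: additive_mult_def shA_scalar shA_tA\<close>)
  thus ?thesis by simp
qed

lemma T_half_eq: "T_half = shA 1"
  unfolding T_half_def
proof (rule the_equality)
  show "alg_hom (shA 1) \<and> (\<forall>i. shA 1 (xA i) = yA i) \<and> (\<forall>i. shA 1 (yA i) = xA (i + 1))"
  proof -
    have "shA 1 (xA i) = yA i" "shA 1 (yA i) = xA (i + 1)" for i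
      using shA_tA[of 1 "2 * i - 1"] shA_tA[of 1 "2 * i"] tA_odd[of "i + 1"]
      by (simp_all add: tA_odd tA_even add.commute)
    thus ?thesis
      by (simp add: alg_hom_def am_add[OF shA_hom] am_mult[OF shA_hom] am_1[OF shA_hom] shA_scalar)
  qed
next
  fix f assume f: "alg_hom f \<and> (\<forall>i. f (xA i) = yA i) \<and> (\<forall>i. f (yA i) = xA (i + 1))"
  show "f = shA 1"
  proof (rule aq_hom_eqI[OF _ shA_hom])
    show "f (tA i) = shA 1 (tA i)" for i
    proof (cases "even i")
      case True
      then obtain k where "i = 2 * k" by blast
      thus ?thesis using f tA_odd[of "k + 1"] by (simp add: shA_tA) (simp add: tA_even add.commute)
    next
      case False
      then obtain k where "i = 2 * k - 1" by (metis oddE add_diff_cancel_right' even_add even_plus_one_iff odd_one dvd_def)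
      thus ?thesis using f by (simp add: shA_tA) (simp add: tA_odd tA_even)
    qed
  qed (use f in \<open>auto simp: alg_hom_additive_mult alg_hom_def shA_scalar\<close>)
qed

lemma T_eq: "T = shA 2"
  by (auto simp: T_def T_half_eq shA_shA)

lemma shA_funpow: "(shA d ^^ n) z = shA (int n * d) z"
  by (induction n) (simp_all add: shA_0 shA_shA algebra_simps)

lemma T_pow_eq: "T_pow k = shA (2 * k)"
proof
  fix z
  have "inv_into UNIV (shA 2) = shA (- 2)"
    by (rule inv_equality) (simp_all add: shA_shA shA_0)
  thus "T_pow k z = shA (2 * k) z"
    by (simp add: T_pow_def T_eq shA_funpow mult.commute)
qed

lemma shA_zmon: "shA d (zmon j \<alpha>) = zmon (j + d) \<alpha>"
proof (induction \<alpha> arbitrary: j)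
  case (Cons a \<alpha>)
  have "shA d (zA j) = zA (j + d)"
    by (simp add: zA_eq am_mult[OF shA_hom] shA_tA add_ac)
  moreover have "is_unit_elt (zA j)"
    unfolding zA_eq by (intro is_unit_mult is_unit_tA)
  moreover have "j + d + 1 = j + 1 + d" by simp
  ultimately show ?case
    by (simp only: zmon.simps am_mult[OF shA_hom] am_power[OF shA_hom] am_unit_inv[OF shA_hom] Cons)
qed (simp add: am_1[OF shA_hom])

lemma shA_density: "shA d (density j N n) = density (j + d) N n"
  by (simp add: density_def am_sum[OF shA_hom] am_mult[OF shA_hom] shA_scalar shA_zmon)

lemma psi_density: "psi N n = density 1 N n + density 2 N n"
  by (simp add: psi_def A_sum_density T_half_eq shA_density)

section \<open>Commutation at infinity\<close>

text \<open>Under this condition \<open>Sum_any\<close> is a sum over a finite support; for infinite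
  support its value would be 0.\<close>

definition eventually_central :: "aq \<Rightarrow> aq \<Rightarrow> bool" where
  "eventually_central P z \<longleftrightarrow> finite {k. T_pow k P * z - z * T_pow k P \<noteq> 0}"

lemma eventually_central_combine:
  assumes "eventually_central P x" "eventually_central Q y"
    "\<And>k. T_pow k P * x - x * T_pow k P = 0 \<Longrightarrow> T_pow k Q * y - y * T_pow k Q = 0 \<Longrightarrow>
       T_pow k R * z - z * T_pow k R = 0"
  shows "eventually_central R z"
  using assms(1,2) unfolding eventually_central_def
  by (rule finite_subset[rotated, OF finite_UnI]) (use assms(3) in blast)

lemma eventually_central_scalar: "eventually_central P (scalar c)"
  by (simp add: eventually_central_def scalar_central)

lemma eventually_central_add: "eventually_central P x \<Longrightarrow> eventually_central Q x \<Longrightarrow> eventually_central (P + Q) x"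
  by (erule (1) eventually_central_combine)
     (simp add: T_pow_eq am_add[OF shA_hom] distrib_left distrib_right)

lemma eventually_central_add_right: "eventually_central P x \<Longrightarrow> eventually_central P y \<Longrightarrow> eventually_central P (x + y)"
  by (erule (1) eventually_central_combine) (simp add: distrib_left distrib_right)

lemma eventually_central_mult_right: "eventually_central P x \<Longrightarrow> eventually_central P y \<Longrightarrow> eventually_central P (x * y)"
  by (erule (1) eventually_central_combine) (simp, metis mult.assoc)

lemma eventually_central_if_tA:
  assumes "\<And>i. eventually_central P (tA i)"
  shows "eventually_central P z"
proof (induction z rule: aq_induct)
  case (tA_inv i)
  have "T_pow k P * unit_inv (tA i) = unit_inv (tA i) * T_pow k P"
    if "T_pow k P * tA i - tA i * T_pow k P = 0" for k
    using mf.comm_unit_inv[OF is_unit_tA] that by simp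
  thus ?case by (intro eventually_central_combine[OF assms[of i] assms[of i]]) simp
qed (auto intro: assms eventually_central_scalar eventually_central_add_right eventually_central_mult_right)

text \<open>A shift of an element of degree \<open>d\<close> that is far enough to the right or to the left
  (\<open>\<sigma> = 1\<close> or \<open>\<sigma> = - 1\<close>) commutes with $t_i$ up to $q^{\pm d}$.\<close>

definition q_asymptotic :: "int \<Rightarrow> int \<Rightarrow> aq \<Rightarrow> bool" where
  "q_asymptotic i d P \<longleftrightarrow> (\<exists>K\<ge>0. \<forall>k\<ge>K. \<forall>\<sigma>\<in>{1, - 1}.
     shA (2 * \<sigma> * k) P * tA i = scalar (qpow (d * (\<sigma> * (if odd i then - 1 else 1)))) * (tA i * shA (2 * \<sigma> * k) P))"

lemma q_asymptotic_mult:
  assumes "q_asymptotic i d P" "q_asymptotic i e Q"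
  shows "q_asymptotic i (d + e) (P * Q)"
proof -
  from assms obtain K L where "K \<ge> 0" "L \<ge> 0"
    and K: "\<And>k \<sigma>. k \<ge> K \<Longrightarrow> \<sigma> \<in> {1, - 1} \<Longrightarrow> shA (2 * \<sigma> * k) P * tA i =
      scalar (qpow (d * (\<sigma> * (if odd i then - 1 else 1)))) * (tA i * shA (2 * \<sigma> * k) P)"
    and L: "\<And>k \<sigma>. k \<ge> L \<Longrightarrow> \<sigma> \<in> {1, - 1} \<Longrightarrow> shA (2 * \<sigma> * k) Q * tA i =
      scalar (qpow (e * (\<sigma> * (if odd i then - 1 else 1)))) * (tA i * shA (2 * \<sigma> * k) Q)"
    unfolding q_asymptotic_def by blast
  show ?thesis
    unfolding q_asymptotic_def
  proof (intro exI[of _ "max K L"] conjI allI impI ballI)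
    fix k \<sigma> :: int assume "k \<ge> max K L" "\<sigma> \<in> {1, - 1}"
    from scalar.qcomm_mult'[OF K[OF _ this(2)] L[OF _ this(2)]] this(1)
    show "shA (2 * \<sigma> * k) (P * Q) * tA i =
        scalar (qpow ((d + e) * (\<sigma> * (if odd i then - 1 else 1)))) * (tA i * shA (2 * \<sigma> * k) (P * Q))"
      by (simp only: am_mult[OF shA_hom] distrib_right max.bounded_iff)
  qed (use \<open>K \<ge> 0\<close> in simp)
qed

lemma q_asymptotic_tA: "q_asymptotic i (if odd j then 1 else - 1) (tA j)"
proof -
  have e: "eps (j + 2 * \<sigma> * k) i = (if odd j then 1 else - 1) * (\<sigma> * (if odd i then - 1 else 1))"
    if "k \<ge> \<bar>i - j\<bar> + 1" "\<sigma> \<in> {1, - 1}" for k \<sigma>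
    using that by (auto simp: eps_def)
  show ?thesis
    unfolding q_asymptotic_def
  proof (intro exI[of _ "\<bar>i - j\<bar> + 1"] conjI allI impI ballI)
    fix k \<sigma> :: int assume "k \<ge> \<bar>i - j\<bar> + 1" "\<sigma> \<in> {1, - 1}"
    from e[OF this] tA_comm[of "j + 2 * \<sigma> * k" i]
    show "shA (2 * \<sigma> * k) (tA j) * tA i =
        scalar (qpow ((if odd j then 1 else - 1) * (\<sigma> * (if odd i then - 1 else 1)))) * (tA i * shA (2 * \<sigma> * k) (tA j))"
      by (simp only: shA_tA)
  qed simp
qed

lemma q_asymptotic_unit_inv:
  assumes "q_asymptotic i d P" "is_unit_elt P"
  shows "q_asymptotic i (- d) (unit_inv P)"
proof -
  have u: "shA l (unit_inv P) = unit_inv (shA l P)" "is_unit_elt (shA l P)" for l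
    using am_unit_inv[OF shA_hom] am_unit[OF shA_hom] assms(2) by blast+
  show ?thesis
    using assms(1) scalar.qcomm_unit_inv'[OF u(2)]
    unfolding q_asymptotic_def u(1) by (metis mult_minus_left)
qed

lemma q_asymptotic_word:
  "q_asymptotic i (sum_list (map gen_degree ws)) (prod_list (map gen ws))"
proof (induction ws)
  case Nil
  show ?case unfolding q_asymptotic_def by (intro exI[of _ 0]) (simp add: am_1[OF shA_hom])
next
  case (Cons g ws)
  have "q_asymptotic i 1 (xA j)" "q_asymptotic i (- 1) (yA j)"
    "q_asymptotic i (- 1) (gen (GX_inv j))" "q_asymptotic i 1 (gen (GY_inv j))" for j
    using q_asymptotic_tA[of i "2 * j - 1"] q_asymptotic_tA[of i "2 * j"]
      q_asymptotic_unit_inv[OF q_asymptotic_tA is_unit_tA, of i "2 * j - 1"]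
      q_asymptotic_unit_inv[OF q_asymptotic_tA is_unit_tA, of i "2 * j"]
    by (simp_all add: tA_odd tA_even unit_inv_tA)
  hence "q_asymptotic i (gen_degree g) (gen g)" by (cases g) auto
  from q_asymptotic_mult[OF this Cons] show ?case by simp
qed

lemma eventually_central_if_q_asymptotic: "q_asymptotic i 0 P \<Longrightarrow> eventually_central P (tA i)"
proof -
  assume "q_asymptotic i 0 P"
  then obtain K where K: "\<forall>k\<ge>K. \<forall>\<sigma>\<in>{1, - 1}. shA (2 * \<sigma> * k) P * tA i =
      scalar (qpow (0 * (\<sigma> * (if odd i then - 1 else 1)))) * (tA i * shA (2 * \<sigma> * k) P)"
    unfolding q_asymptotic_def by blast
  have "{k. T_pow k P * tA i - tA i * T_pow k P \<noteq> 0} \<subseteq> {- K..K}"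
  proof (rule subsetI, rule ccontr)
    fix k assume k: "k \<in> {k. T_pow k P * tA i - tA i * T_pow k P \<noteq> 0}" "k \<notin> {- K..K}"
    thus False using K[rule_format, of k 1] K[rule_format, of "- k" "- 1"] by (auto simp: T_pow_eq)
  qed
  thus ?thesis unfolding eventually_central_def by (rule finite_subset) simp
qed

text \<open>Far from t_i the powers of q contributed by the letters of a word add up to plus or
  minus its degree, here 0. This is what makes \<open>ad\<close> independent of the
  representative.\<close>

lemma eventually_central_degree_0:
  assumes "R \<in> aq_degree_0"
  shows "eventually_central R z"
proof (rule eventually_central_if_tA)
  fix i
  obtain f where R: "R = abs_presented f"
    and f: "\<And>w. w \<in> Poly_Mapping.keys f \<Longrightarrow> sum_list (map gen_degree (letters w)) = 0"
    using assms unfolding aq_degree_0_def by blast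
  have abs_prod: "abs_presented (prod_list (map free_gen ws)) = prod_list (map gen ws)" for ws :: "aq_gen list"
    by (induction ws) (simp_all add: abs_presented_hom)
  have f_eq: "f = (\<Sum>w\<in>Poly_Mapping.keys f. Poly_Mapping.single w (Poly_Mapping.lookup f w))"
    by (rule poly_mapping_eqI) (simp add: lookup_sum lookup_single when_def in_keys_iff)
  have "eventually_central (abs_presented (\<Sum>w\<in>S. Poly_Mapping.single w (Poly_Mapping.lookup f w))) (tA i)"
    if "S \<subseteq> Poly_Mapping.keys f" "finite S" for S
    using that(2,1)
  proof (induction S)
    case empty
    show ?case by (simp add: abs_presented_hom eventually_central_def T_pow_eq am_0[OF shA_hom])
  next
    case (insert w S)
    have "eventually_central (prod_list (map gen (letters w))) (tA i)"
      using q_asymptotic_word[of i "letters w"] f[of w] insert.prems by (intro eventually_central_if_q_asymptotic) simp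
    hence "eventually_central (scalar (Poly_Mapping.lookup f w) * prod_list (map gen (letters w))) (tA i)"
      by (rule eventually_central_combine[OF _ eventually_central_scalar])
         (simp add: T_pow_eq am_mult[OF shA_hom] shA_scalar scalar_left_commute[of "tA i"] mult.assoc)
    thus ?case using insert
      by (simp add: abs_presented_hom free_word[of w] abs_prod eventually_central_add)
  qed
  from this[of "Poly_Mapping.keys f"] show "eventually_central R (tA i)" unfolding R by (simp flip: f_eq)
qed

section \<open>The action of the local integrals of motion\<close>

definition ad_sum :: "aq \<Rightarrow> aq \<Rightarrow> aq" where
  "ad_sum P z = Sum_any (\<lambda>k. T_pow k P * z - z * T_pow k P)"

lemma ad_sum_add_right: "eventually_central P x \<Longrightarrow> eventually_central P y \<Longrightarrow> ad_sum P (x + y) = ad_sum P x + ad_sum P y"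
  unfolding ad_sum_def eventually_central_def
  by (subst Sum_any.distrib[symmetric]) (auto simp: distrib_left distrib_right algebra_simps)

lemma ad_sum_mult_right: "eventually_central P x \<Longrightarrow> eventually_central P y \<Longrightarrow> ad_sum P (x * y) = ad_sum P x * y + x * ad_sum P y"
proof -
  assume xy: "eventually_central P x" "eventually_central P y"
  let ?g = "\<lambda>z k. T_pow k P * z - z * T_pow k P"
  have "finite {k. ?g x k * y \<noteq> 0}" "finite {k. x * ?g y k \<noteq> 0}"
    by (rule finite_subset[of _ "{k. ?g x k \<noteq> 0}"] finite_subset[of _ "{k. ?g y k \<noteq> 0}"];
        use xy in \<open>auto simp: eventually_central_def\<close>)+
  hence "Sum_any (\<lambda>k. ?g x k * y + x * ?g y k) = Sum_any (\<lambda>k. ?g x k * y) + Sum_any (\<lambda>k. x * ?g y k)"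
    by (rule Sum_any.distrib)
  also have "\<dots> = ad_sum P x * y + x * ad_sum P y"
    using xy unfolding ad_sum_def eventually_central_def
    by (simp only: Sum_any_left_distrib Sum_any_right_distrib)
  also have "(\<lambda>k. ?g x k * y + x * ?g y k) = ?g (x * y)"
    by (auto simp: algebra_simps)
  finally show ?thesis by (simp add: ad_sum_def)
qed

lemma ad_sum_scalar: "ad_sum P (scalar c) = 0"
  by (simp add: ad_sum_def scalar_central)

text \<open>The commutator sums of T R and R agree by the substitution k -> k + 1; finiteness of all
  supports allows the sums to be separated.\<close>

lemma ad_sum_class:
  assumes "eventually_central P z" "R \<in> aq_degree_0"
  shows "ad_sum (P + (T R - R)) z = ad_sum P z"
proof -
  let ?g = "\<lambda>P k. T_pow k P * z - z * T_pow k P"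
  have "eventually_central R z" by (rule eventually_central_degree_0[OF assms(2)])
  moreover have shift: "T_pow k (T R) = T_pow (k + 1) R" for k
    by (simp add: T_pow_eq T_eq shA_shA)
  ultimately have "eventually_central (T R) z"
  proof -
    assume "eventually_central R z"
    have "{k. ?g (T R) k \<noteq> 0} = (\<lambda>k. k - 1) ` {k. ?g R k \<noteq> 0}"
      unfolding shift by (auto simp: image_iff intro!: exI[of _ "_ + 1"])
    thus ?thesis using \<open>eventually_central R z\<close> unfolding eventually_central_def by simp
  qed
  have "eventually_central (- R) z"
    using \<open>eventually_central R z\<close> by (rule eventually_central_combine[OF _ eventually_central_scalar]) (simp add: T_pow_eq am_uminus[OF shA_hom])
  have "eventually_central (P + (T R - R)) z"
    using eventually_central_add[OF assms(1) eventually_central_add[OF \<open>eventually_central (T R) z\<close> \<open>eventually_central (- R) z\<close>]] by simp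
  have "ad_sum (P + (T R - R)) z + ad_sum R z = Sum_any (\<lambda>k. ?g (P + (T R - R)) k + ?g R k)"
    unfolding ad_sum_def using \<open>eventually_central (P + (T R - R)) z\<close> \<open>eventually_central R z\<close>
    by (intro Sum_any.distrib[symmetric]) (simp_all add: eventually_central_def)
  also have "(\<lambda>k. ?g (P + (T R - R)) k + ?g R k) = (\<lambda>k. ?g P k + ?g (T R) k)"
    by (simp add: fun_eq_iff T_pow_eq am_add[OF shA_hom] am_diff[OF shA_hom] algebra_simps)
  also have "Sum_any \<dots> = ad_sum P z + ad_sum (T R) z"
    unfolding ad_sum_def using assms(1) \<open>eventually_central (T R) z\<close>
    by (intro Sum_any.distrib) (simp_all add: eventually_central_def)
  also have "ad_sum (T R) z = ad_sum R z"
    unfolding ad_sum_def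
    by (rule Sum_any.reindex_cong[of "\<lambda>k. k + 1", symmetric])
       (auto simp: shift bij_def inj_def surj_def intro: exI[of _ "_ - 1"])
  finally show ?thesis by simp
qed

text \<open>T^k sends \<psi>_n to the sum of the densities with indices 2k + 1 and 2k + 2, so the
  sum over k meets every density exactly once.\<close>

lemma ad_sum_psi:
  assumes n: "1 \<le> n" "n \<le> 2 * (N - 1)"
  shows "eventually_central (psi N n) z"
    and "ad_sum (psi N n) (tA i) = scalar ((qvar - 1) * qint n) * ((- 1) ^ n * flow i $ n)"
proof -
  define cm where "cm = (\<lambda>i j. density j N n * tA i - tA i * density j N n)"
  have cm0: "cm i j = 0" if "j \<notin> {i - int n..i}" for i j
    using density_commutes[OF n, of i j] that by (auto simp: cm_def)
  have g: "T_pow k (psi N n) * tA i - tA i * T_pow k (psi N n) = cm i (2 * k + 1) + cm i (2 * k + 2)" for i k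
    by (simp add: T_pow_eq psi_density am_add[OF shA_hom] shA_density cm_def algebra_simps)
  \<comment> \<open>These are the k for which 2k + 1 or 2k + 2 lies in the range of densities acting
    on t_i.\<close>
  define Ks where "Ks = (\<lambda>i. (\<lambda>j. (j - 1) div 2) ` {i - int n..i})"
  have Ks: "cm i (2 * k + 1) + cm i (2 * k + 2) = 0" if "k \<notin> Ks i" for i k
  proof -
    have "2 * k + 1 \<notin> {i - int n..i}" "2 * k + 2 \<notin> {i - int n..i}"
      using that unfolding Ks_def by (auto simp: image_iff dest: bspec[of _ _ "2 * k + 1"] bspec[of _ _ "2 * k + 2"])
    thus ?thesis by (simp add: cm0)
  qed
  have sub: "{k. cm i (2 * k + 1) + cm i (2 * k + 2) \<noteq> 0} \<subseteq> Ks i" for i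
    using Ks by blast
  have fin: "finite (Ks i)" for i by (simp add: Ks_def)
  show "eventually_central (psi N n) z"
    by (rule eventually_central_if_tA) (unfold eventually_central_def g, rule finite_subset[OF sub fin])
  have "ad_sum (psi N n) (tA i) = (\<Sum>k\<in>Ks i. cm i (2 * k + 1) + cm i (2 * k + 2))"
    unfolding ad_sum_def g by (rule Sum_any.expand_superset[OF fin sub])
  also have "\<dots> = (\<Sum>k\<in>Ks i. \<Sum>j\<in>{j\<in>{i - int n..i}. (j - 1) div 2 = k}. cm i j)"
  proof (intro sum.cong refl)
    fix k
    have "(\<Sum>j\<in>{j\<in>{i - int n..i}. (j - 1) div 2 = k}. cm i j) = (\<Sum>j\<in>{2 * k + 1, 2 * k + 2}. cm i j)"
      by (rule sum.mono_neutral_left) (insert cm0[of "2 * k + 1" i] cm0[of "2 * k + 2" i], auto)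
    thus "cm i (2 * k + 1) + cm i (2 * k + 2) = (\<Sum>j\<in>{j\<in>{i - int n..i}. (j - 1) div 2 = k}. cm i j)"
      by simp
  qed
  also have "\<dots> = (\<Sum>j=i-int n..i. cm i j)"
    by (rule sum.group) (auto simp: Ks_def)
  also have "\<dots> = (- 1) ^ n * (scalar ((qvar - 1) * qint n) * flow i $ n)"
    unfolding cm_def by (rule density_sum_commutator[OF n])
  finally show "ad_sum (psi N n) (tA i) = scalar ((qvar - 1) * qint n) * ((- 1) ^ n * flow i $ n)"
    by (simp only: scalar_left_commute[of "(- 1) ^ n"])
qed

text \<open>The quotient of the derivation \<open>ad (I_class (psi N n))\<close> by $[n]$.\<close>

definition current :: "nat \<Rightarrow> aq \<Rightarrow> aq" where
  "current n z = (SOME d. \<forall>N. n \<le> 2 * (N - 1) \<longrightarrow> scalar ((qvar - 1) * qint n) * d = ad_sum (psi N n) z)"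

text \<open>On generators (q - 1)[n] divides the commutator sum by \<open>ad_sum_psi\<close>. The
  Leibniz rule propagates this to all elements, with one quotient for all admissible N.\<close>

lemma current:
  assumes "1 \<le> n" "n \<le> 2 * (N - 1)"
  shows "scalar ((qvar - 1) * qint n) * current n z = ad_sum (psi N n) z"
proof -
  let ?c = "scalar ((qvar - 1) * qint n) :: aq"
  have "\<exists>d. \<forall>N. n \<le> 2 * (N - 1) \<longrightarrow> ?c * d = ad_sum (psi N n) z"
  proof (induction z rule: aq_induct)
    case (scalar c)
    show ?case by (intro exI[of _ 0]) (simp add: ad_sum_scalar)
  next
    case (tA i)
    show ?case using ad_sum_psi(2)[OF assms(1)] by metis
  next
    case (tA_inv i)
    let ?t' = "unit_inv (tA i)"
    have "?c * - (?t' * ((- 1) ^ n * flow i $ n) * ?t') = ad_sum (psi N n) ?t'" if N: "n \<le> 2 * (N - 1)" for N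
    proof -
      have "ad_sum (psi N n) (?t' * tA i) = 0"
        using ad_sum_scalar[of "psi N n" 1] by (simp add: unit_inv_left is_unit_tA)
      hence "ad_sum (psi N n) ?t' * tA i = - (?t' * ad_sum (psi N n) (tA i))"
        unfolding ad_sum_mult_right[OF ad_sum_psi(1)[OF assms(1) N] ad_sum_psi(1)[OF assms(1) N]]
        by (simp add: eq_neg_iff_add_eq_0)
      hence "ad_sum (psi N n) ?t' * (tA i * ?t') = - (?t' * ad_sum (psi N n) (tA i)) * ?t'"
        by (simp only: mult.assoc[symmetric])
      thus ?thesis
        by (simp add: unit_inv_right is_unit_tA ad_sum_psi(2)[OF assms(1) N] scalar_left_commute[of "?t'"] mult.assoc)
    qed
    thus ?case by metis
  next
    case (add a b)
    then obtain d e where "\<And>N. n \<le> 2 * (N - 1) \<Longrightarrow> ?c * d = ad_sum (psi N n) a"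
      "\<And>N. n \<le> 2 * (N - 1) \<Longrightarrow> ?c * e = ad_sum (psi N n) b" by metis
    thus ?case
      by (intro exI[of _ "d + e"]) (simp add: ad_sum_add_right ad_sum_psi(1)[OF assms(1)] distrib_left)
  next
    case (mult a b)
    then obtain d e where "\<And>N. n \<le> 2 * (N - 1) \<Longrightarrow> ?c * d = ad_sum (psi N n) a"
      "\<And>N. n \<le> 2 * (N - 1) \<Longrightarrow> ?c * e = ad_sum (psi N n) b" by metis
    note de = this[symmetric]
    show ?case
      by (intro exI[of _ "d * b + a * e"])
         (simp add: ad_sum_mult_right ad_sum_psi(1)[OF assms(1)] distrib_left de mult.assoc scalar_left_commute[of a])
  qed
  from someI_ex[OF this] show ?thesis using assms(2) unfolding current_def by blast
qed

lemma current_simps: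
  assumes n: "1 \<le> n"
  shows "current n (a + b) = current n a + current n b"
    and "current n (a * b) = current n a * b + a * current n b"
    and "current n (scalar c) = 0"
    and "current n (tA i) = (- 1) ^ n * flow i $ n"
proof -
  have N: "n \<le> 2 * (Suc n - 1)" by simp
  note s = current[OF n N]
  note l = ad_sum_psi(1)[OF n N]
  have c: "x = y" if "scalar ((qvar - 1) * qint n) * x = scalar ((qvar - 1) * qint n) * y" for x y :: aq
    using that by (rule aq_scalar_cancel) (use n qvar_minus_1_nonzero in simp)
  show "current n (a + b) = current n a + current n b"
    by (rule c) (simp only: s distrib_left ad_sum_add_right[OF l l])
  show "current n (a * b) = current n a * b + a * current n b"
  proof (rule c)
    have "scalar e * (x * b + a * y) = scalar e * x * b + a * (scalar e * y)" for e x y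
      by (simp only: distrib_left scalar_left_commute[of a] mult.assoc)
    thus "scalar ((qvar - 1) * qint n) * current n (a * b) =
        scalar ((qvar - 1) * qint n) * (current n a * b + a * current n b)"
      by (simp only: s ad_sum_mult_right[OF l l])
  qed
  show "current n (scalar c) = 0"
    by (rule c) (simp add: s ad_sum_scalar)
  show "current n (tA i) = (- 1) ^ n * flow i $ n"
    by (rule c) (simp only: s ad_sum_psi(2)[OF n N])
qed

text \<open>After division by q - 1 a factor [n] remains. It stems from the numerator [n] in A_n and
  is the factor that stands before \<open>DS (H n a)\<close> in the final statement.\<close>

lemma ad_psi:
  assumes n: "1 \<le> n" "n \<le> 2 * (N - 1)"
  shows "ad (I_class (psi N n)) z = scalar (qint n) * current n z"
proof -
  have "exact_quot (ad_sum (psi N n) z) (scalar (qvar - 1)) = scalar (qint n) * current n z"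
  proof (rule exact_quot_eqI)
    show "scalar (qvar - 1) * (scalar (qint n) * current n z) = ad_sum (psi N n) z"
      using current[OF n, of z] by (simp only: scalar_mult mult.assoc)
    show "x = y" if "scalar (qvar - 1) * x = scalar (qvar - 1) * y" for x y :: aq
      using that qvar_minus_1_nonzero(1) by (rule aq_scalar_cancel)
  qed
  moreover have "ad_sum P z = ad_sum (psi N n) z" if "P \<in> I_class (psi N n)" for P
    using that ad_sum_class[OF ad_sum_psi(1)[OF n]] unfolding I_class_def by blast
  moreover have "0 \<in> aq_degree_0"
    unfolding aq_degree_0_def using abs_presented_hom(5) by (intro image_eqI[of _ _ 0]) simp_all
  hence "I_class (psi N n) \<noteq> {}" unfolding I_class_def by blast
  ultimately show ?thesis
    unfolding ad_def ad_sum_def[symmetric] by (intro the_equality) auto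
qed

section \<open>The Hamiltonian flows\<close>

text \<open>The signs and the zero constant term follow H_\<mu>, the sum of (-1)^k H_k \<mu>^-k over
  k \<ge> 1.\<close>

definition current_series :: "aq \<Rightarrow> aq fps" where
  "current_series z = Abs_fps (\<lambda>n. if n = 0 then 0 else (- 1) ^ n * current n z)"

lemma current_series_derivation: "derivation_along fps_const current_series"
  unfolding derivation_along_def fps_eq_iff current_series_def
  by (auto simp: current_simps Suc_le_eq distrib_left mult.assoc minus_one_power_left_commute)

lemma current_series_tA: "current_series (tA i) = flow i"
  by (auto simp: fps_eq_iff current_series_def current_simps alt_signs flow_def)

interpretation m_flow: riccati tA mA uA current_series KA
proof
  show "(tF i + fps_X * mA (i + 1)) * mA i = 1" "mA i * (tF i + fps_X * mA (i + 1)) = 1"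
    "(tF i + fps_X * uA (i - 1)) * uA i = 1" "uA i * (tF i + fps_X * uA (i - 1)) = 1" for i
    by (rule mA_mult uA_mult)+
  show "current_series (tA i) = fps_X * (tF i * KA i * mA (i + 1) - uA (i - 1) * KA i * tF i)" for i
    by (simp only: current_series_tA flow_def)
qed (rule KA_mult current_series_derivation)+

text \<open>With G = K_i^-1 - t_i, both t_i K_i G and G K_i t_i equal t_i - t_i K_i t_i. Exchanging
  m and u thus changes the sign of the flow, which is why the mirrored instance takes
  \<open>- current_series\<close>.\<close>

lemma flow_mirror: "flow i = fps_X * (mA (i + 1) * KA i * tF i - tF i * KA i * uA (i - 1))"
proof -
  define G where "G = fps_X * mA (i + 1) + fps_X * uA (i - 1)"
  have "(tF i + G) * KA i = 1" "KA i * (tF i + G) = 1"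
    using KA_mult[of i] by (simp_all only: G_def add.assoc)
  hence g: "G * KA i = 1 - tF i * KA i" "KA i * G = 1 - KA i * tF i"
    by (simp_all add: distrib_left distrib_right algebra_simps)
  have "tF i * (KA i * G) = G * KA i * tF i"
    unfolding g by (simp add: right_diff_distrib left_diff_distrib mult.assoc)
  thus ?thesis
    by (simp add: flow_def G_def algebra_simps fps_X_left_commute[of "tF i"] fps_X_left_commute[of "KA i"])
qed

interpretation u_flow: riccati "\<lambda>i. tA (1 - i)" uf.cser "\<lambda>i. mA (1 - i)" "\<lambda>z. - current_series z" "\<lambda>i. KA (1 - i)"
proof
  fix i :: int
  have i: "1 - i + 1 = 1 - (i - 1)" "1 - (1 - i - 1) = i + 1" by simp_all
  show "(fps_const (tA (1 - i)) + fps_X * uf.cser (i + 1)) * uf.cser i = 1"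
    "uf.cser i * (fps_const (tA (1 - i)) + fps_X * uf.cser (i + 1)) = 1"
    by (rule uf.cser_mult uf.mult_cser)+
  show "(fps_const (tA (1 - i)) + fps_X * mA (1 - (i - 1))) * mA (1 - i) = 1"
    "mA (1 - i) * (fps_const (tA (1 - i)) + fps_X * mA (1 - (i - 1))) = 1"
    using mA_mult[of "1 - i"] unfolding i by simp_all
  have "tF (1 - i) + fps_X * uf.cser (i + 1) + fps_X * mA (1 - (i - 1)) =
      tF (1 - i) + fps_X * mA (1 - i + 1) + fps_X * uA (1 - i - 1)"
    unfolding i by (simp add: add_ac)
  thus "(tF (1 - i) + fps_X * uf.cser (i + 1) + fps_X * mA (1 - (i - 1))) * KA (1 - i) = 1"
    "KA (1 - i) * (tF (1 - i) + fps_X * uf.cser (i + 1) + fps_X * mA (1 - (i - 1))) = 1"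
    using KA_mult[of "1 - i"] by (simp_all only:)
  show "- current_series (tA (1 - i)) = fps_X * (tF (1 - i) * KA (1 - i) * uf.cser (i + 1) - mA (1 - (i - 1)) * KA (1 - i) * tF (1 - i))"
    unfolding current_series_tA flow_mirror i by (simp add: right_diff_distrib)
next
  show "derivation_along fps_const (\<lambda>z. - current_series z)"
    using current_series_derivation by (simp add: derivation_along_def)
qed

section \<open>Comparison of the Hamiltonians with the currents\<close>

lemma lambda_minus_mu_left_commute:
  "A * ((lambda_inv - mu_inv) * B) = (lambda_inv - mu_inv) * (A * (B :: 'a::ring_1 fps fps))"
proof -
  have "A * (lambda_inv - mu_inv) = (lambda_inv - mu_inv) * A"
    by (simp only: right_diff_distrib left_diff_distrib lambda_inv_central[of A] mu_inv_central[of A])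
  thus ?thesis by (simp only: mult.assoc[symmetric])
qed

lemma exact_quot_diff:
  "(lambda_inv - mu_inv) * exact_quot (at_lambda A - at_mu A) (lambda_inv - mu_inv) = at_lambda A - at_mu (A :: 'a::ring_1 fps)"
  using exact_quot_lambda_minus_mu[OF divided_diff] divided_diff by metis

lemma exact_quot_diff':
  "(lambda_inv - mu_inv) * exact_quot (lambda_inv * at_lambda A - mu_inv * at_mu A) (lambda_inv - mu_inv) =
     lambda_inv * at_lambda A - mu_inv * at_mu (A :: 'a::ring_1 fps)"
  using exact_quot_diff[of "fps_X * A"]
  by (simp add: am_mult[OF additive_mult_at_lambda] am_mult[OF additive_mult_at_mu] at_lambda_X at_mu_X)

lemma H_mu_m:
  "(lambda_inv - mu_inv) * H_mu_m =
     (let a = at_lambda m_series; b = at_mu m_series; w = at_mu w_series in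
        mu_inv * (1 + b * w) * (a - b) - a * w * (lambda_inv * a - mu_inv * b))"
  unfolding H_mu_m_def Let_def right_diff_distrib[of "lambda_inv - mu_inv"]
  by (simp only: lambda_minus_mu_left_commute[symmetric] exact_quot_diff exact_quot_diff')

lemma H_mu_u:
  "(lambda_inv - mu_inv) * H_mu_u =
     (let a = at_lambda u_series; b = at_mu u_series; v = at_mu v_series in
        (lambda_inv * a - mu_inv * b) * v * a - mu_inv * (a - b) * (1 + v * b))"
proof -
  define c where "c = (lambda_inv - mu_inv :: hb fps fps)"
  define P where "P = exact_quot (lambda_inv * at_lambda u_series - mu_inv * at_mu u_series) c"
  define Q where "Q = exact_quot (at_lambda u_series - at_mu u_series) c"
  have "c * (P * v * a - mu_inv * Q * z) = c * P * v * a - mu_inv * (c * Q) * z" for v a z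
    using lambda_minus_mu_left_commute[of mu_inv Q] by (simp add: right_diff_distrib c_def mult.assoc)
  moreover have "c * P = lambda_inv * at_lambda u_series - mu_inv * at_mu u_series"
    unfolding P_def c_def by (rule exact_quot_diff')
  moreover have "c * Q = at_lambda u_series - at_mu u_series"
    unfolding Q_def c_def by (rule exact_quot_diff)
  ultimately show ?thesis
    unfolding H_mu_u_def Let_def c_def[symmetric] P_def[symmetric] Q_def[symmetric] by simp
qed

lemma DS_w: "coeffwise DS w_series = m_flow.w 1"
  and DS_v: "coeffwise DS v_series = u_flow.w 1"
proof -
  note h = additive_mult_coeffwise[OF DS_hom]
  have X: "coeffwise DS fps_X = fps_X"
    using am_0[OF DS_hom] am_1[OF DS_hom] by (rule coeffwise_fps_X)
  have u: "is_unit_elt (1 + fps_X * A * B)" for A B :: "hb fps"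
    by (rule is_unit_fps_1) (simp add: mult.assoc)
  show "coeffwise DS w_series = m_flow.w 1" "coeffwise DS v_series = u_flow.w 1"
    by (simp_all add: w_series_def v_series_def m_flow.w_def u_flow.w_def am_uminus[OF h] am_mult[OF h] am_unit_inv[OF h u]
       am_add[OF h] am_1[OF h] X DS_u_series DS_m_series)
qed

lemma DS_H_mu_m: "coeffwise (coeffwise DS) H_mu_m = coeffwise current_series (coeffwise DS m_series)"
proof -
  let ?d = "coeffwise (coeffwise DS)"
  note h = additive_mult_coeffwise[OF additive_mult_coeffwise[OF DS_hom]]
  note 01 = am_0[OF DS_hom] am_1[OF DS_hom]
  note hs = am_mult[OF h] am_diff[OF h] am_add[OF h] am_1[OF h] coeffwise_at_lambda[of DS, OF 01(1)]
    coeffwise_at_mu[of DS, OF 01(1)] coeffwise_lambda_inv[of DS, OF 01] coeffwise_mu_inv[of DS, OF 01]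
    DS_m_series DS_w
  have "(lambda_inv - mu_inv) * ?d H_mu_m = ?d ((lambda_inv - mu_inv) * H_mu_m)"
    by (simp only: hs)
  also have "\<dots> = m_flow.riccati_rhs 1"
    unfolding H_mu_m Let_def m_flow.riccati_rhs_def by (simp only: hs)
  also have "\<dots> = (lambda_inv - mu_inv) * coeffwise current_series (coeffwise DS m_series)"
    unfolding DS_m_series by (rule m_flow.riccati[symmetric])
  finally show ?thesis by (rule lambda_minus_mu_cancel)
qed

lemma DS_H_mu_u: "coeffwise (coeffwise DS) H_mu_u = coeffwise current_series (coeffwise DS u_series)"
proof -
  let ?d = "coeffwise (coeffwise DS)"
  note h = additive_mult_coeffwise[OF additive_mult_coeffwise[OF DS_hom]]
  note 01 = am_0[OF DS_hom] am_1[OF DS_hom]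
  note hs = am_mult[OF h] am_diff[OF h] am_add[OF h] am_1[OF h] coeffwise_at_lambda[of DS, OF 01(1)]
    coeffwise_at_mu[of DS, OF 01(1)] coeffwise_lambda_inv[of DS, OF 01] coeffwise_mu_inv[of DS, OF 01]
    DS_u_series DS_v
  have left: "z * (lambda_inv * x) = lambda_inv * (z * x)" "z * (mu_inv * x) = mu_inv * (z * x)"
    for z x :: "aq fps fps"
    by (metis lambda_inv_central mult.assoc) (metis mu_inv_central mult.assoc)
  \<comment> \<open>The formula for u is minus the one for m without any commutation among a, b and
    v; the sign meets the negated derivation of \<open>u_flow\<close>.\<close>
  have mirror: "(lambda_inv * a - mu_inv * b) * v * a - mu_inv * (a - b) * (1 + v * b) =
      - (mu_inv * (1 + b * v) * (a - b) - a * v * (lambda_inv * a - mu_inv * b))" for a b v :: "aq fps fps"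
    by (simp add: algebra_simps left[of a] left[of v])
  have "(lambda_inv - mu_inv) * ?d H_mu_u = ?d ((lambda_inv - mu_inv) * H_mu_u)"
    by (simp only: hs)
  also have "\<dots> = - u_flow.riccati_rhs 1"
    unfolding H_mu_u Let_def u_flow.riccati_rhs_def by (simp only: hs mirror)
  also have "\<dots> = (lambda_inv - mu_inv) * coeffwise current_series (coeffwise DS u_series)"
  proof -
    have "coeffwise (\<lambda>z. - current_series z) (uf.cser 1) = - coeffwise current_series (uf.cser 1)"
      by (rule fps_ext) simp
    thus ?thesis unfolding DS_u_series u_flow.riccati[symmetric] by simp
  qed
  finally show ?thesis by (rule lambda_minus_mu_cancel)
qed

lemma minus_one_power_current: "1 \<le> n \<Longrightarrow> current n ((- 1) ^ k * z) = (- 1) ^ k * current n z"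
proof -
  assume n: "1 \<le> n"
  have "current n (- z) + current n z = 0"
    using current_simps(1)[OF n, of "- z" z] current_simps(3)[OF n, of 0] by simp
  thus ?thesis by (cases "even k") (simp_all add: eq_neg_iff_add_eq_0)
qed

lemma current_DS_series:
  assumes "1 \<le> n"
  shows "current n (DS (m_series $ i)) = (- 1) ^ n * DS (H_mu_m $ i $ n)"
    and "current n (DS (u_series $ i)) = (- 1) ^ n * DS (H_mu_u $ i $ n)"
  using arg_cong[OF DS_H_mu_m, of "\<lambda>A. A $ i $ n"] arg_cong[OF DS_H_mu_u, of "\<lambda>A. A $ i $ n"] assms
  by (simp_all add: current_series_def alt_signs)

text \<open>On generators this is \<open>current_DS_series\<close>, elsewhere the Leibniz rule. It
  allows the current to be pulled back along the injective map \<open>DS\<close>.\<close>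

lemma current_DS_range:
  assumes n: "1 \<le> n"
  shows "current n (DS a) \<in> range DS"
proof (induction a rule: presented_induct)
  case (scalar c)
  have "current n (DS (scalar c)) = DS 0"
    by (simp only: DS_scalar current_simps(3)[OF n] am_0[OF DS_hom])
  thus ?case by simp
next
  case (gen g)
  show ?case
  proof (cases g)
    case (U i)
    have "current n (DS (gen g)) = DS ((- 1) ^ i * ((- 1) ^ n * H_mu_u $ i $ n))"
      by (simp only: U gen_u minus_one_power_hom[OF DS_hom] minus_one_power_current[OF n] current_DS_series[OF n])
    thus ?thesis by simp
  next
    case (M i)
    have "current n (DS (gen g)) = DS ((- 1) ^ i * ((- 1) ^ n * H_mu_m $ i $ n))"
      by (simp only: M gen_m minus_one_power_hom[OF DS_hom] minus_one_power_current[OF n] current_DS_series[OF n])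
    thus ?thesis by simp
  qed
next
  case (add a b)
  then obtain d e where "current n (DS a) = DS d" "current n (DS b) = DS e" by blast
  hence "current n (DS (a + b)) = DS (d + e)"
    by (simp only: am_add[OF DS_hom] current_simps(1)[OF n])
  thus ?case by simp
next
  case (mult a b)
  then obtain d e where "current n (DS a) = DS d" "current n (DS b) = DS e" by blast
  hence "current n (DS (a * b)) = DS (d * b + a * e)"
    by (simp only: am_mult[OF DS_hom] am_add[OF DS_hom] current_simps(2)[OF n])
  thus ?case by simp
qed

lemma derivation_uminus_power:
  assumes "derivation D"
  shows "D ((- 1) ^ k * a) = (- 1) ^ k * D a"
proof -
  have "D 0 = 0" using assms scalar_0 unfolding derivation_def by metis
  hence "D (- a) + D a = 0"
    using assms unfolding derivation_def by (metis add.left_inverse)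
  thus ?thesis by (cases "even k") (simp_all add: eq_neg_iff_add_eq_0)
qed

lemma hb_derivation_eqI:
  assumes "derivation D" "derivation D'" "coeffwise D u_series = coeffwise D' u_series"
    "coeffwise D m_series = coeffwise D' m_series"
  shows "D = D'"
proof
  fix a show "D a = D' a"
  proof (induction a rule: presented_induct)
    case (gen g)
    have "D (u_series $ i) = D' (u_series $ i)" "D (m_series $ i) = D' (m_series $ i)" for i
      using assms(3,4) by (metis coeffwise_nth)+
    thus ?case
      by (cases g) (simp_all only: gen_u gen_m derivation_uminus_power[OF assms(1)] derivation_uminus_power[OF assms(2)])
  qed (use assms(1,2) in \<open>simp_all add: derivation_def\<close>)
qed

lemma minus_one_power_nth: "((- 1) ^ n * A) $ i = (- 1) ^ n * A $ i" for A :: "'a::ring_1 fps"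
  by (cases "even n") simp_all

text \<open>\<open>H n\<close> is a description, so a derivation with the prescribed values has to
  be exhibited: the pullback of the current. Injectivity of \<open>DS\<close> transfers the
  derivation rules and the values, and the values on generators give uniqueness.\<close>

lemma DS_H:
  assumes n: "1 \<le> n"
  shows "DS (H n a) = current n (DS a)"
proof -
  define D where "D = (\<lambda>a. inv_into UNIV DS (current n (DS a)))"
  have D: "DS (D a) = current n (DS a)" for a
    unfolding D_def by (rule f_inv_into_f[OF current_DS_range[OF n]])
  have inj: "DS x = DS y \<Longrightarrow> x = y" for x y by (rule injD[OF inj_DS])
  have der: "derivation D"
    unfolding derivation_def
    by (intro conjI allI; rule inj)
       (simp_all only: D am_add[OF DS_hom] am_mult[OF DS_hom] current_simps[OF n] DS_scalar am_0[OF DS_hom])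
  have u: "(- 1) ^ n * coeffwise D u_series = mu_coeff n H_mu_u"
    and m: "(- 1) ^ n * coeffwise D m_series = mu_coeff n H_mu_m"
    unfolding fps_eq_iff
    by (intro allI; rule inj; simp only: minus_one_power_nth minus_one_power_hom[OF DS_hom] coeffwise_nth D
        current_DS_series[OF n] alt_signs mu_coeff_def fps_nth_Abs_fps)+
  have "H n = D"
    unfolding H_def
  proof (rule the_equality)
    fix D' assume D': "derivation D' \<and> (- 1) ^ n * coeffwise D' u_series = mu_coeff n H_mu_u \<and>
      (- 1) ^ n * coeffwise D' m_series = mu_coeff n H_mu_m"
    have sign: "A = B" if "(- 1) ^ n * A = (- 1) ^ n * B" for A B :: "hb fps"
      using arg_cong[OF that, of "\<lambda>A. (- 1) ^ n * A"] by (simp only: alt_signs)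
    show "D' = D"
      by (rule hb_derivation_eqI; (rule der conjunct1[OF D'])?) (rule sign; use D' u m in simp)+
  qed (use der u m in simp)
  thus ?thesis by (simp add: D)
qed

theorem theorem1:
  shows "\<exists>DS :: hb \<Rightarrow> aq.
    alg_hom DS \<and>
    DS_u_approx \<longlonglongrightarrow> coeffwise DS u_series \<and>
    DS_m_approx \<longlonglongrightarrow> coeffwise DS m_series \<and>
    inj DS \<and>
    birational DS \<and>
    (\<forall>n\<ge>1. \<forall>N. n \<le> 2 * (N - 1) \<longrightarrow>
      (\<forall>a. scalar (qint n) * DS (H n a) = ad (I_class (psi N n)) (DS a)))"
  using alg_hom_DS DS_u_limit DS_m_limit inj_DS birational_DS DS_H ad_psi by metis

end
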